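(* Let $X$ be a Grothendieck site, $\Gamma$ a group over $X$, and $\mathbb{G}=[\partial:G_1\to G_0]$ a $\Gamma$-crossed-module over $X$. There is a natural bifunctor $$\Psi:\mathfrak{Z}(\Gamma,\mathbb{G})\to\mathfrak{Z}'(\Gamma,\mathbb{G})$$ which is the identity on objects and is fully faithful on hom groupoids. If $H^1(X,G_1)$ is trivial (that is, every right $G_1$-torsor on $X$ is trivial), then $\Psi$ is a biequivalence. In particular, in the case where everything is discrete (i.e. $X$ is a point), $\Psi$ is a biequivalence.
   Context: Groups over $X$ are sheaves of groups on $X$; elements are local sections unless stated otherwise. A crossed-module $[\partial:G_1\to G_0]$ has a right action of $G_0$ on $G_1$ by automorphisms with $\partial(\alpha^g)=g^{-1}\partial(\alpha)g$, $\alpha^{\partial\beta}=\beta^{-1}\alpha\beta$. In a $\Gamma$-crossed-module, $\Gamma$ acts on the left on $G_0,G_1$ by automorphisms, $\partial$ is $\Gamma$-equivariant and ${}^{\sigma}(\alpha^g)=({}^{\sigma}\alpha)^{({}^{\sigma}g)}$. Objects of both $\mathfrak{Z}(\Gamma,\mathbb{G})$ and $\mathfrak{Z}'(\Gamma,\mathbb{G})$: pairs $(E,\rho)$ (with $\iota,\pi$ part of the data), where $1\to G_1\xrightarrow{\iota}E\xrightarrow{\pi}\Gamma\to1$ is an extension of groups over $X$ and $\rho:E\to G_0$ is a map with $\rho\iota=\partial$, $\rho(xy)=\rho(x)\cdot{}^{\pi(x)}\rho(y)$ and $\iota\big({}^{\pi(x)^{-1}}(\alpha^{\rho(x)})\big)=x^{-1}\iota(\alpha)x$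 for $x,y\in E$, $\alpha\in G_1$. The 2-groupoid $\mathfrak{Z}(\Gamma,\mathbb{G})$. An arrow $(E,\rho)\to(E',\rho')$ is a pair $(t,g)$, with $g$ a global section of $G_0$ and $t:E\to E'$ an isomorphism of groups such that $\pi=\pi't$, $g^{-1}\rho(x)\,{}^{\pi(x)}g=\rho'(t(x))$ and $\iota'(\alpha^g)=t\iota(\alpha)$. The composite of $(t,g)$ followed by $(t',g')$ is $(t'\circ t,gg')$. A 2-arrow $(t,g)\Rightarrow(t',g')$ is a global section $\mu$ of $G_1$ with $g\,\partial(\mu)=g'$ and $t'(x)=\iota'(\mu)^{-1}t(x)\iota'(\mu)$; composition of 2-arrows $\mu,\mu'$ is $\mu\mu'$. The bigroupoid $\mathfrak{Z}'(\Gamma,\mathbb{G})$. An arrow $(E,\rho)\to(E',\rho')$ is a pair $(t,g)$, where $g=(P,\varphi)$ consists of a right $G_1$-torsor $P$ on $X$ and a $G_1$-equivariant map $\varphi:P\to G_0$ ($G_1$ acting on $G_0$ by right multiplication via $\partial$), and $t:E\to{}^gE'$ is an isomorphism of groups with ${}^g\pi'\,t=\pi$, ${}^g\rho'\,t=\rho$, $t\iota={}^g\iota'$. Here ${}^gE':=P\times^{G_1}E'$ is the contracted product, with $G_1$ acting on $E'$ by right conjugation (so $(u\alpha,x)\sim(u,\iota'(\alpha)x\iota'(\alpha)^{-1})$), ${}^g\pi'(u,x)=\pi'(x)$, ${}^g\rho'(u,x)=\varphi(u)\,\rho'(x)\,{}^{\pi'(x)}\varphi(u)^{-1}$, and ${}^g\iota'(\alpha)=(u,\iota'(\alpha^{\varphi(u)}))$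 for any local $u\in P$. The composite of $(t,(P,\varphi)):(E,\rho)\to(E',\rho')$ followed by $(t',(P',\varphi')):(E',\rho')\to(E'',\rho'')$ has torsor part $(P\times^{G_1}P',\,(u,v)\mapsto\varphi(u)\varphi'(v))$, where $P'$ carries the left action ${}^{\alpha}v:=v\cdot\alpha^{\varphi'(v)}$, and homomorphism $(P\times^{G_1}t')\circ t$, using $P\times^{G_1}(P'\times^{G_1}E'')\cong(P\times^{G_1}P')\times^{G_1}E''$. A 2-arrow $(t,(P,\varphi))\Rightarrow(t',(P',\varphi'))$ between arrows $(E,\rho)\to(E',\rho')$ is an isomorphism of $G_1$-torsors $\mu:P\to P'$ with $\varphi'\mu=\varphi$ and $(\mu\times^{G_1}E')\circ t=t'$. The bifunctor $\Psi$ sends an arrow $(t,g)$ to the arrow $(\hat t,\hat g)$ whose $\hat g$ is the pair $(G_1,\varphi)$, with $G_1$ the trivial torsor and $\varphi(\alpha)=g\,\partial(\alpha)$, and whose $\hat t$ is $x\mapsto(1,t(x))$. *)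

theory Defs
  imports "HOL-Algebra.Group" "HOL-Library.FuncSet"
begin

section \<open>Sites, sheaves and sheafification\<close>

text \<open>
  A Grothendieck site is a category with, for each object, a set of covering sieves.
  \<open>cmp X f g\<close> is the composite \<open>f \<circ> g\<close> (first \<open>g\<close>, then \<open>f\<close>).
\<close>

record ('o, 'm) site =
  obs :: "'o set"
  ars :: "'m set"
  dm :: "'m \<Rightarrow> 'o"
  cd :: "'m \<Rightarrow> 'o"
  idn :: "'o \<Rightarrow> 'm"
  cmp :: "'m \<Rightarrow> 'm \<Rightarrow> 'm"
  cov :: "'o \<Rightarrow> 'm set set"

definition into :: "('o, 'm) site \<Rightarrow> 'o \<Rightarrow> 'm set" where
  "into X U = {f \<in> ars X. cd X f = U}"

definition sieve :: "('o, 'm) site \<Rightarrow> 'o \<Rightarrow> 'm set \<Rightarrow> bool" where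
  "sieve X U S \<longleftrightarrow> S \<subseteq> into X U \<and> (\<forall>f\<in>S. \<forall>h\<in>into X (dm X f). cmp X f h \<in> S)"

definition pull :: "('o, 'm) site \<Rightarrow> 'm \<Rightarrow> 'm set \<Rightarrow> 'm set" where
  "pull X f S = {h \<in> into X (dm X f). cmp X f h \<in> S}"

locale grothendieck_site =
  fixes X :: "('o, 'm) site"
  assumes dm_obs: "f \<in> ars X \<Longrightarrow> dm X f \<in> obs X"
    and cd_obs: "f \<in> ars X \<Longrightarrow> cd X f \<in> obs X"
    and idn_ars: "U \<in> obs X \<Longrightarrow> idn X U \<in> ars X"
    and dm_idn: "U \<in> obs X \<Longrightarrow> dm X (idn X U) = U"
    and cd_idn: "U \<in> obs X \<Longrightarrow> cd X (idn X U) = U"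
    and cmp_ars: "\<lbrakk>f \<in> ars X; g \<in> ars X; dm X f = cd X g\<rbrakk> \<Longrightarrow> cmp X f g \<in> ars X"
    and dm_cmp: "\<lbrakk>f \<in> ars X; g \<in> ars X; dm X f = cd X g\<rbrakk> \<Longrightarrow> dm X (cmp X f g) = dm X g"
    and cd_cmp: "\<lbrakk>f \<in> ars X; g \<in> ars X; dm X f = cd X g\<rbrakk> \<Longrightarrow> cd X (cmp X f g) = cd X f"
    and cmp_idn_right: "f \<in> ars X \<Longrightarrow> cmp X f (idn X (dm X f)) = f"
    and cmp_idn_left: "f \<in> ars X \<Longrightarrow> cmp X (idn X (cd X f)) f = f"
    and cmp_assoc: "\<lbrakk>f \<in> ars X; g \<in> ars X; h \<in> ars X; dm X f = cd X g; dm X g = cd X h\<rbrakk>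
        \<Longrightarrow> cmp X (cmp X f g) h = cmp X f (cmp X g h)"
    and cov_sieve: "\<lbrakk>U \<in> obs X; S \<in> cov X U\<rbrakk> \<Longrightarrow> sieve X U S"
    and cov_max: "U \<in> obs X \<Longrightarrow> into X U \<in> cov X U"
    and cov_stable: "\<lbrakk>U \<in> obs X; S \<in> cov X U; f \<in> into X U\<rbrakk> \<Longrightarrow> pull X f S \<in> cov X (dm X f)"
    and cov_local: "\<lbrakk>U \<in> obs X; S \<in> cov X U; sieve X U R; \<And>f. f \<in> S \<Longrightarrow> pull X f R \<in> cov X (dm X f)\<rbrakk>
        \<Longrightarrow> R \<in> cov X U"

text \<open>The point: one object, only the identity arrow, and only the maximal sieve is covering
  (so that sheaves are sets).\<close>

definition point_site :: "('o, 'm) site \<Rightarrow> bool" where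
  "point_site X \<longleftrightarrow> grothendieck_site X \<and> (\<exists>p i. obs X = {p} \<and> ars X = {i} \<and> cov X p = {{i}})"

record ('o, 'm, 'x) presheaf =
  sec :: "'o \<Rightarrow> 'x set"
  res :: "'m \<Rightarrow> 'x \<Rightarrow> 'x"

definition is_presheaf :: "('o, 'm) site \<Rightarrow> ('o, 'm, 'x, 'z) presheaf_scheme \<Rightarrow> bool" where
  "is_presheaf X F \<longleftrightarrow>
    (\<forall>f\<in>ars X. res F f \<in> sec F (cd X f) \<rightarrow> sec F (dm X f)) \<and>
    (\<forall>U\<in>obs X. \<forall>x\<in>sec F U. res F (idn X U) x = x) \<and>
    (\<forall>f\<in>ars X. \<forall>g\<in>into X (dm X f). \<forall>x\<in>sec F (cd X f).
      res F (cmp X f g) x = res F g (res F f x))"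

definition is_sheaf :: "('o, 'm) site \<Rightarrow> ('o, 'm, 'x, 'z) presheaf_scheme \<Rightarrow> bool" where
  "is_sheaf X F \<longleftrightarrow> is_presheaf X F \<and>
    (\<forall>U\<in>obs X. \<forall>S\<in>cov X U. \<forall>x.
      (\<forall>f\<in>S. x f \<in> sec F (dm X f)) \<and>
      (\<forall>f\<in>S. \<forall>h\<in>into X (dm X f). x (cmp X f h) = res F h (x f))
      \<longrightarrow> (\<exists>!s. s \<in> sec F U \<and> (\<forall>f\<in>S. res F f s = x f)))"

text \<open>Maps of sheaves and global sections are extensional functions, so that HOL equality of maps
  is equality of maps of sheaves. The site need not have a final object: a global section is a
  compatible family of sections over all objects.\<close>

definition maps :: "('o, 'm) site \<Rightarrow> ('o, 'm, 'x, 'z) presheaf_scheme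
    \<Rightarrow> ('o, 'm, 'y, 'w) presheaf_scheme \<Rightarrow> ('o \<Rightarrow> 'x \<Rightarrow> 'y) set" where
  "maps X F H = {t \<in> (\<Pi>\<^sub>E U\<in>obs X. sec F U \<rightarrow>\<^sub>E sec H U).
     \<forall>f\<in>ars X. \<forall>x\<in>sec F (cd X f). t (dm X f) (res F f x) = res H f (t (cd X f) x)}"

definition gsec :: "('o, 'm) site \<Rightarrow> ('o, 'm, 'x, 'z) presheaf_scheme \<Rightarrow> ('o \<Rightarrow> 'x) set" where
  "gsec X F = {s \<in> (\<Pi>\<^sub>E U\<in>obs X. sec F U). \<forall>f\<in>ars X. res F f (s (cd X f)) = s (dm X f)}"

definition mk_map :: "('o, 'm) site \<Rightarrow> ('o, 'm, 'x, 'z) presheaf_scheme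
    \<Rightarrow> ('o \<Rightarrow> 'x \<Rightarrow> 'y) \<Rightarrow> ('o \<Rightarrow> 'x \<Rightarrow> 'y)" where
  "mk_map X F t = (\<lambda>U\<in>obs X. \<lambda>x\<in>sec F U. t U x)"

definition loc_eq :: "('o, 'm) site \<Rightarrow> ('o, 'm, 'x, 'z) presheaf_scheme \<Rightarrow> 'o \<Rightarrow> 'x \<Rightarrow> 'x \<Rightarrow> bool" where
  "loc_eq X Q U q q' \<longleftrightarrow> {h \<in> into X U. res Q h q = res Q h q'} \<in> cov X U"

text \<open>
  Associated sheaf of a presheaf \<open>Q\<close>. A section over \<open>U\<close> is represented by the set of all pairs
  \<open>(f, q)\<close>, with \<open>f : V \<rightarrow> U\<close> and \<open>q \<in> Q V\<close>, such that the section restricts along \<open>f\<close> to the image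
  of \<open>q\<close>. The sets arising in this way are those closed under restriction, single valued up to
  local equality, defined on a covering sieve, and closed under gluing.
\<close>

definition sheafify :: "('o, 'm) site \<Rightarrow> ('o, 'm, 'q) presheaf \<Rightarrow> ('o, 'm, ('m \<times> 'q) set) presheaf" where
  "sheafify X Q = \<lparr>
     sec = (\<lambda>U. {s. s \<subseteq> {(f, q). f \<in> into X U \<and> q \<in> sec Q (dm X f)} \<and>
        (\<forall>(f, q)\<in>s. \<forall>h\<in>into X (dm X f). (cmp X f h, res Q h q) \<in> s) \<and>
        (\<forall>f q q'. (f, q) \<in> s \<and> (f, q') \<in> s \<longrightarrow> loc_eq X Q (dm X f) q q') \<and>
        fst ` s \<in> cov X U \<and>
        (\<forall>f\<in>into X U. \<forall>q\<in>sec Q (dm X f).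
           {h \<in> into X (dm X f). (cmp X f h, res Q h q) \<in> s} \<in> cov X (dm X f) \<longrightarrow> (f, q) \<in> s)}),
     res = (\<lambda>g s. {(f, q). f \<in> into X (dm X g) \<and> (cmp X g f, q) \<in> s}) \<rparr>"

definition to_sheaf :: "('o, 'm) site \<Rightarrow> ('o, 'm, 'q) presheaf \<Rightarrow> 'o \<Rightarrow> 'q \<Rightarrow> ('m \<times> 'q) set" where
  "to_sheaf X Q U q =
     {(f, q'). f \<in> into X U \<and> q' \<in> sec Q (dm X f) \<and> loc_eq X Q (dm X f) q' (res Q f q)}"


section \<open>Groups over a site and crossed modules\<close>

record ('o, 'm, 'x) gsheaf = "('o, 'm, 'x) presheaf" +
  gmul :: "'o \<Rightarrow> 'x \<Rightarrow> 'x \<Rightarrow> 'x"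
  gone :: "'o \<Rightarrow> 'x"

definition grp :: "('o, 'm, 'x) gsheaf \<Rightarrow> 'o \<Rightarrow> 'x monoid" where
  "grp G U = \<lparr>carrier = sec G U, monoid.mult = gmul G U, one = gone G U\<rparr>"

definition group_over :: "('o, 'm) site \<Rightarrow> ('o, 'm, 'x) gsheaf \<Rightarrow> bool" where
  "group_over X G \<longleftrightarrow> is_sheaf X G \<and> (\<forall>U\<in>obs X. group (grp G U)) \<and>
     (\<forall>f\<in>ars X. res G f \<in> hom (grp G (cd X f)) (grp G (dm X f)))"

definition ghoms :: "('o, 'm) site \<Rightarrow> ('o, 'm, 'x) gsheaf \<Rightarrow> ('o, 'm, 'y) gsheaf \<Rightarrow> ('o \<Rightarrow> 'x \<Rightarrow> 'y) set" where
  "ghoms X G H = {t \<in> maps X G H. \<forall>U\<in>obs X. t U \<in> hom (grp G U) (grp H U)}"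

definition gisos :: "('o, 'm) site \<Rightarrow> ('o, 'm, 'x) gsheaf \<Rightarrow> ('o, 'm, 'y) gsheaf \<Rightarrow> ('o \<Rightarrow> 'x \<Rightarrow> 'y) set" where
  "gisos X G H = {t \<in> maps X G H. \<forall>U\<in>obs X. t U \<in> iso (grp G U) (grp H U)}"

text \<open>
  \<open>bd\<close> is \<open>\<partial>\<close>, \<open>ract G U \<alpha> g\<close> is \<open>\<alpha>\<^sup>g\<close>, and \<open>lact1 G U \<sigma> \<alpha>\<close>, \<open>lact0 G U \<sigma> g\<close> are the left actions
  of \<open>\<Gamma>\<close> on \<open>G\<^sub>1\<close> and on \<open>G\<^sub>0\<close>.
\<close>

record ('o, 'm, 'a, 'b, 'g) xmod =
  G1 :: "('o, 'm, 'a) gsheaf"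
  G0 :: "('o, 'm, 'b) gsheaf"
  bd :: "'o \<Rightarrow> 'a \<Rightarrow> 'b"
  ract :: "'o \<Rightarrow> 'a \<Rightarrow> 'b \<Rightarrow> 'a"
  lact1 :: "'o \<Rightarrow> 'g \<Rightarrow> 'a \<Rightarrow> 'a"
  lact0 :: "'o \<Rightarrow> 'g \<Rightarrow> 'b \<Rightarrow> 'b"

definition crossed_module :: "('o, 'm) site \<Rightarrow> ('o, 'm, 'a, 'b, 'g) xmod \<Rightarrow> bool" where
  "crossed_module X G \<longleftrightarrow>
     group_over X (G1 G) \<and> group_over X (G0 G) \<and> bd G \<in> ghoms X (G1 G) (G0 G) \<and>
     (\<forall>f\<in>ars X. \<forall>a\<in>sec (G1 G) (cd X f). \<forall>g\<in>sec (G0 G) (cd X f).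
        res (G1 G) f (ract G (cd X f) a g) = ract G (dm X f) (res (G1 G) f a) (res (G0 G) f g)) \<and>
     (\<forall>U\<in>obs X. \<forall>g\<in>sec (G0 G) U. (\<lambda>a. ract G U a g) \<in> hom (grp (G1 G) U) (grp (G1 G) U)) \<and>
     (\<forall>U\<in>obs X. \<forall>a\<in>sec (G1 G) U. ract G U a \<one>\<^bsub>grp (G0 G) U\<^esub> = a) \<and>
     (\<forall>U\<in>obs X. \<forall>a\<in>sec (G1 G) U. \<forall>g\<in>sec (G0 G) U. \<forall>h\<in>sec (G0 G) U.
        ract G U a (g \<otimes>\<^bsub>grp (G0 G) U\<^esub> h) = ract G U (ract G U a g) h) \<and>
     (\<forall>U\<in>obs X. \<forall>a\<in>sec (G1 G) U. \<forall>g\<in>sec (G0 G) U.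
        bd G U (ract G U a g) = inv\<^bsub>grp (G0 G) U\<^esub> g \<otimes>\<^bsub>grp (G0 G) U\<^esub> bd G U a \<otimes>\<^bsub>grp (G0 G) U\<^esub> g) \<and>
     (\<forall>U\<in>obs X. \<forall>a\<in>sec (G1 G) U. \<forall>b\<in>sec (G1 G) U.
        ract G U a (bd G U b) = inv\<^bsub>grp (G1 G) U\<^esub> b \<otimes>\<^bsub>grp (G1 G) U\<^esub> a \<otimes>\<^bsub>grp (G1 G) U\<^esub> b)"

definition left_action :: "('o, 'm) site \<Rightarrow> ('o, 'm, 'g) gsheaf \<Rightarrow> ('o, 'm, 'x) gsheaf
    \<Rightarrow> ('o \<Rightarrow> 'g \<Rightarrow> 'x \<Rightarrow> 'x) \<Rightarrow> bool" where
  "left_action X \<Gamma> H l \<longleftrightarrow>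
     (\<forall>f\<in>ars X. \<forall>s\<in>sec \<Gamma> (cd X f). \<forall>x\<in>sec H (cd X f).
        res H f (l (cd X f) s x) = l (dm X f) (res \<Gamma> f s) (res H f x)) \<and>
     (\<forall>U\<in>obs X. \<forall>s\<in>sec \<Gamma> U. l U s \<in> hom (grp H U) (grp H U)) \<and>
     (\<forall>U\<in>obs X. \<forall>x\<in>sec H U. l U \<one>\<^bsub>grp \<Gamma> U\<^esub> x = x) \<and>
     (\<forall>U\<in>obs X. \<forall>s\<in>sec \<Gamma> U. \<forall>s'\<in>sec \<Gamma> U. \<forall>x\<in>sec H U.
        l U (s \<otimes>\<^bsub>grp \<Gamma> U\<^esub> s') x = l U s (l U s' x))"

definition gamma_crossed_module :: "('o, 'm) site \<Rightarrow> ('o, 'm, 'g) gsheaf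
    \<Rightarrow> ('o, 'm, 'a, 'b, 'g) xmod \<Rightarrow> bool" where
  "gamma_crossed_module X \<Gamma> G \<longleftrightarrow>
     crossed_module X G \<and>
     left_action X \<Gamma> (G1 G) (lact1 G) \<and> left_action X \<Gamma> (G0 G) (lact0 G) \<and>
     (\<forall>U\<in>obs X. \<forall>s\<in>sec \<Gamma> U. \<forall>a\<in>sec (G1 G) U. bd G U (lact1 G U s a) = lact0 G U s (bd G U a)) \<and>
     (\<forall>U\<in>obs X. \<forall>s\<in>sec \<Gamma> U. \<forall>a\<in>sec (G1 G) U. \<forall>g\<in>sec (G0 G) U.
        lact1 G U s (ract G U a g) = ract G U (lact1 G U s a) (lact0 G U s g))"


section \<open>Torsors and contracted products\<close>

record ('o, 'm, 'p, 'a) rtorsor = "('o, 'm, 'p) presheaf" +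
  tact :: "'o \<Rightarrow> 'p \<Rightarrow> 'a \<Rightarrow> 'p"

definition is_torsor :: "('o, 'm) site \<Rightarrow> ('o, 'm, 'a) gsheaf \<Rightarrow> ('o, 'm, 'p, 'a) rtorsor \<Rightarrow> bool" where
  "is_torsor X A P \<longleftrightarrow> is_sheaf X P \<and>
     (\<forall>U\<in>obs X. \<forall>u\<in>sec P U. \<forall>a\<in>sec A U. tact P U u a \<in> sec P U) \<and>
     (\<forall>f\<in>ars X. \<forall>u\<in>sec P (cd X f). \<forall>a\<in>sec A (cd X f).
        res P f (tact P (cd X f) u a) = tact P (dm X f) (res P f u) (res A f a)) \<and>
     (\<forall>U\<in>obs X. \<forall>u\<in>sec P U. tact P U u \<one>\<^bsub>grp A U\<^esub> = u) \<and>
     (\<forall>U\<in>obs X. \<forall>u\<in>sec P U. \<forall>a\<in>sec A U. \<forall>b\<in>sec A U.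
        tact P U u (a \<otimes>\<^bsub>grp A U\<^esub> b) = tact P U (tact P U u a) b) \<and>
     (\<forall>U\<in>obs X. \<forall>u\<in>sec P U. \<forall>v\<in>sec P U. \<exists>!a. a \<in> sec A U \<and> tact P U u a = v) \<and>
     (\<forall>U\<in>obs X. {f \<in> into X U. sec P (dm X f) \<noteq> {}} \<in> cov X U)"

definition torsor_isos :: "('o, 'm) site \<Rightarrow> ('o, 'm, 'a) gsheaf \<Rightarrow> ('o, 'm, 'p, 'a) rtorsor
    \<Rightarrow> ('o, 'm, 'q, 'a) rtorsor \<Rightarrow> ('o \<Rightarrow> 'p \<Rightarrow> 'q) set" where
  "torsor_isos X A P Q = {m \<in> maps X P Q.
     (\<forall>U\<in>obs X. bij_betw (m U) (sec P U) (sec Q U)) \<and>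
     (\<forall>U\<in>obs X. \<forall>u\<in>sec P U. \<forall>a\<in>sec A U. m U (tact P U u a) = tact Q U (m U u) a)}"

definition triv_torsor :: "('o, 'm, 'a) gsheaf \<Rightarrow> ('o, 'm, 'a, 'a) rtorsor" where
  "triv_torsor A = \<lparr>sec = sec A, res = res A, tact = gmul A\<rparr>"

text \<open>Torsors may be taken with sections in the type \<open>'a\<close> in which the structure group takes its
  values: the sections of a torsor over \<open>U\<close> are empty or in bijection with those of the group,
  so every torsor is isomorphic to one of this kind.\<close>

definition H1_trivial :: "('o, 'm) site \<Rightarrow> ('o, 'm, 'a) gsheaf \<Rightarrow> bool" where
  "H1_trivial X A \<longleftrightarrow>
     (\<forall>P :: ('o, 'm, 'a, 'a) rtorsor. is_torsor X A P \<longrightarrow> torsor_isos X A (triv_torsor A) P \<noteq> {})"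

text \<open>
  Contracted product of a right \<open>A\<close>-torsor \<open>P\<close> with a sheaf \<open>F\<close> carrying a left action \<open>l\<close> of \<open>A\<close>:
  the sheaf associated with the quotient of \<open>P \<times> F\<close> by \<open>(u a, x) \<sim> (u, l a x)\<close>.
\<close>

definition ctr_rel :: "('o, 'm, 'a) gsheaf \<Rightarrow> ('o, 'm, 'p, 'a) rtorsor \<Rightarrow> ('o, 'm, 'x, 'z) presheaf_scheme
    \<Rightarrow> ('o \<Rightarrow> 'a \<Rightarrow> 'x \<Rightarrow> 'x) \<Rightarrow> 'o \<Rightarrow> (('p \<times> 'x) \<times> ('p \<times> 'x)) set" where
  "ctr_rel A P F l U =
     {((tact P U u a, x), (u, l U a x)) | u a x. u \<in> sec P U \<and> a \<in> sec A U \<and> x \<in> sec F U}"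

definition ctr_pre :: "('o, 'm) site \<Rightarrow> ('o, 'm, 'a) gsheaf \<Rightarrow> ('o, 'm, 'p, 'a) rtorsor
    \<Rightarrow> ('o, 'm, 'x, 'z) presheaf_scheme \<Rightarrow> ('o \<Rightarrow> 'a \<Rightarrow> 'x \<Rightarrow> 'x) \<Rightarrow> ('o, 'm, ('p \<times> 'x) set) presheaf" where
  "ctr_pre X A P F l = \<lparr>
     sec = (\<lambda>U. (sec P U \<times> sec F U) // ctr_rel A P F l U),
     res = (\<lambda>f c. \<Union>(u, x)\<in>c. ctr_rel A P F l (dm X f) `` {(res P f u, res F f x)}) \<rparr>"

type_synonym ('m, 'p, 'x) ctr = "('m \<times> ('p \<times> 'x) set) set"

definition ctr :: "('o, 'm) site \<Rightarrow> ('o, 'm, 'a) gsheaf \<Rightarrow> ('o, 'm, 'p, 'a) rtorsor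
    \<Rightarrow> ('o, 'm, 'x, 'z) presheaf_scheme \<Rightarrow> ('o \<Rightarrow> 'a \<Rightarrow> 'x \<Rightarrow> 'x) \<Rightarrow> ('o, 'm, ('m, 'p, 'x) ctr) presheaf" where
  "ctr X A P F l = sheafify X (ctr_pre X A P F l)"

text \<open>The section of the contracted product over \<open>U\<close> denoted by the pair \<open>(u, x)\<close>.\<close>

definition ctr_pt :: "('o, 'm) site \<Rightarrow> ('o, 'm, 'a) gsheaf \<Rightarrow> ('o, 'm, 'p, 'a) rtorsor
    \<Rightarrow> ('o, 'm, 'x, 'z) presheaf_scheme \<Rightarrow> ('o \<Rightarrow> 'a \<Rightarrow> 'x \<Rightarrow> 'x) \<Rightarrow> 'o \<Rightarrow> 'p \<Rightarrow> 'x \<Rightarrow> ('m, 'p, 'x) ctr" where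
  "ctr_pt X A P F l U u x = to_sheaf X (ctr_pre X A P F l) U (ctr_rel A P F l U `` {(u, x)})"

text \<open>
  Value at \<open>s\<close>, a section over \<open>U\<close> of a contracted product, of the map to the sheaf \<open>T\<close> which is given
  on local representatives by \<open>(u, x) \<mapsto> k f u x\<close>, where \<open>(u, x)\<close> represents the restriction of \<open>s\<close>
  along \<open>f\<close>.
\<close>

definition descend :: "('o, 'm, 'y, 'w) presheaf_scheme \<Rightarrow> 'o \<Rightarrow> ('m \<Rightarrow> 'p \<Rightarrow> 'x \<Rightarrow> 'y)
    \<Rightarrow> ('m, 'p, 'x) ctr \<Rightarrow> 'y" where
  "descend T U k s = (THE y. y \<in> sec T U \<and> (\<forall>(f, c)\<in>s. \<forall>(u, x)\<in>c. res T f y = k f u x))"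


section \<open>The objects\<close>

text \<open>The sections of the group \<open>E\<close> lie in an arbitrary type \<open>'e\<close>.\<close>

record ('o, 'm, 'e, 'a, 'b, 'g) zobj =
  tot :: "('o, 'm, 'e) gsheaf"
  inc :: "'o \<Rightarrow> 'a \<Rightarrow> 'e"
  prj :: "'o \<Rightarrow> 'e \<Rightarrow> 'g"
  rho :: "'o \<Rightarrow> 'e \<Rightarrow> 'b"

definition is_extension :: "('o, 'm) site \<Rightarrow> ('o, 'm, 'a) gsheaf \<Rightarrow> ('o, 'm, 'e) gsheaf \<Rightarrow> ('o, 'm, 'g) gsheaf
    \<Rightarrow> ('o \<Rightarrow> 'a \<Rightarrow> 'e) \<Rightarrow> ('o \<Rightarrow> 'e \<Rightarrow> 'g) \<Rightarrow> bool" where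
  "is_extension X A E \<Gamma> i p \<longleftrightarrow>
     group_over X E \<and> i \<in> ghoms X A E \<and> p \<in> ghoms X E \<Gamma> \<and>
     (\<forall>U\<in>obs X. inj_on (i U) (sec A U)) \<and>
     (\<forall>U\<in>obs X. i U ` sec A U = {x \<in> sec E U. p U x = \<one>\<^bsub>grp \<Gamma> U\<^esub>}) \<and>
     (\<forall>U\<in>obs X. \<forall>s\<in>sec \<Gamma> U. {f \<in> into X U. res \<Gamma> f s \<in> p (dm X f) ` sec E (dm X f)} \<in> cov X U)"

definition z_objects :: "('o, 'm) site \<Rightarrow> ('o, 'm, 'g) gsheaf \<Rightarrow> ('o, 'm, 'a, 'b, 'g) xmod
    \<Rightarrow> ('o, 'm, 'e, 'a, 'b, 'g) zobj set" where
  "z_objects X \<Gamma> G = {E. is_extension X (G1 G) (tot E) \<Gamma> (inc E) (prj E) \<and>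
     rho E \<in> maps X (tot E) (G0 G) \<and>
     (\<forall>U\<in>obs X. \<forall>a\<in>sec (G1 G) U. rho E U (inc E U a) = bd G U a) \<and>
     (\<forall>U\<in>obs X. \<forall>x\<in>sec (tot E) U. \<forall>y\<in>sec (tot E) U.
        rho E U (x \<otimes>\<^bsub>grp (tot E) U\<^esub> y) = rho E U x \<otimes>\<^bsub>grp (G0 G) U\<^esub> lact0 G U (prj E U x) (rho E U y)) \<and>
     (\<forall>U\<in>obs X. \<forall>x\<in>sec (tot E) U. \<forall>a\<in>sec (G1 G) U.
        inc E U (lact1 G U (inv\<^bsub>grp \<Gamma> U\<^esub> (prj E U x)) (ract G U a (rho E U x)))
          = inv\<^bsub>grp (tot E) U\<^esub> x \<otimes>\<^bsub>grp (tot E) U\<^esub> inc E U a \<otimes>\<^bsub>grp (tot E) U\<^esub> x)}"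


section \<open>Bicategories and bifunctors\<close>

text \<open>Composition is in diagrammatic order: \<open>comp1 C f g\<close> is \<open>f\<close> followed by \<open>g\<close>, and likewise for the
  vertical composite \<open>vcomp\<close> and the horizontal composite \<open>hcomp\<close> of 2-arrows.\<close>

record ('ob, 'ar, 'ce) bicat =
  Ob :: "'ob set"
  Ar :: "'ar set"
  Ce :: "'ce set"
  src :: "'ar \<Rightarrow> 'ob"
  trg :: "'ar \<Rightarrow> 'ob"
  vdom :: "'ce \<Rightarrow> 'ar"
  vcod :: "'ce \<Rightarrow> 'ar"
  one1 :: "'ob \<Rightarrow> 'ar"
  comp1 :: "'ar \<Rightarrow> 'ar \<Rightarrow> 'ar"
  one2 :: "'ar \<Rightarrow> 'ce"
  vcomp :: "'ce \<Rightarrow> 'ce \<Rightarrow> 'ce"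
  hcomp :: "'ce \<Rightarrow> 'ce \<Rightarrow> 'ce"
  assoc :: "'ar \<Rightarrow> 'ar \<Rightarrow> 'ar \<Rightarrow> 'ce"
  lunit :: "'ar \<Rightarrow> 'ce"
  runit :: "'ar \<Rightarrow> 'ce"

definition hom1 :: "('ob, 'ar, 'ce) bicat \<Rightarrow> 'ob \<Rightarrow> 'ob \<Rightarrow> 'ar set" where
  "hom1 C A B = {f \<in> Ar C. src C f = A \<and> trg C f = B}"

definition hom2 :: "('ob, 'ar, 'ce) bicat \<Rightarrow> 'ar \<Rightarrow> 'ar \<Rightarrow> 'ce set" where
  "hom2 C f g = {c \<in> Ce C. vdom C c = f \<and> vcod C c = g}"

definition iso2 :: "('ob, 'ar, 'ce) bicat \<Rightarrow> 'ar \<Rightarrow> 'ar \<Rightarrow> 'ce set" where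
  "iso2 C f g = {c \<in> hom2 C f g. \<exists>d\<in>hom2 C g f. vcomp C c d = one2 C f \<and> vcomp C d c = one2 C g}"

locale bicategory =
  fixes C :: "('ob, 'ar, 'ce) bicat"
  assumes src_Ob: "f \<in> Ar C \<Longrightarrow> src C f \<in> Ob C"
    and trg_Ob: "f \<in> Ar C \<Longrightarrow> trg C f \<in> Ob C"
    and vdom_Ar: "c \<in> Ce C \<Longrightarrow> vdom C c \<in> Ar C"
    and vcod_Ar: "c \<in> Ce C \<Longrightarrow> vcod C c \<in> Ar C"
    and src_parallel: "c \<in> Ce C \<Longrightarrow> src C (vdom C c) = src C (vcod C c)"
    and trg_parallel: "c \<in> Ce C \<Longrightarrow> trg C (vdom C c) = trg C (vcod C c)"
    and one1_hom: "A \<in> Ob C \<Longrightarrow> one1 C A \<in> hom1 C A A"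
    and comp1_hom: "\<lbrakk>f \<in> Ar C; g \<in> Ar C; trg C f = src C g\<rbrakk> \<Longrightarrow> comp1 C f g \<in> hom1 C (src C f) (trg C g)"
    and one2_hom: "f \<in> Ar C \<Longrightarrow> one2 C f \<in> hom2 C f f"
    and vcomp_hom: "\<lbrakk>c \<in> Ce C; d \<in> Ce C; vcod C c = vdom C d\<rbrakk> \<Longrightarrow> vcomp C c d \<in> hom2 C (vdom C c) (vcod C d)"
    and vcomp_one_left: "c \<in> Ce C \<Longrightarrow> vcomp C (one2 C (vdom C c)) c = c"
    and vcomp_one_right: "c \<in> Ce C \<Longrightarrow> vcomp C c (one2 C (vcod C c)) = c"
    and vcomp_assoc: "\<lbrakk>c \<in> Ce C; d \<in> Ce C; e \<in> Ce C; vcod C c = vdom C d; vcod C d = vdom C e\<rbrakk>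
        \<Longrightarrow> vcomp C (vcomp C c d) e = vcomp C c (vcomp C d e)"
    and hcomp_hom: "\<lbrakk>c \<in> Ce C; d \<in> Ce C; trg C (vdom C c) = src C (vdom C d)\<rbrakk>
        \<Longrightarrow> hcomp C c d \<in> hom2 C (comp1 C (vdom C c) (vdom C d)) (comp1 C (vcod C c) (vcod C d))"
    and hcomp_one: "\<lbrakk>f \<in> Ar C; g \<in> Ar C; trg C f = src C g\<rbrakk>
        \<Longrightarrow> hcomp C (one2 C f) (one2 C g) = one2 C (comp1 C f g)"
    and interchange: "\<lbrakk>c \<in> Ce C; c' \<in> Ce C; d \<in> Ce C; d' \<in> Ce C; vcod C c = vdom C c'; vcod C d = vdom C d';
          trg C (vdom C c) = src C (vdom C d)\<rbrakk>
        \<Longrightarrow> hcomp C (vcomp C c c') (vcomp C d d') = vcomp C (hcomp C c d) (hcomp C c' d')"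
    and assoc_iso: "\<lbrakk>f \<in> Ar C; g \<in> Ar C; h \<in> Ar C; trg C f = src C g; trg C g = src C h\<rbrakk>
        \<Longrightarrow> assoc C f g h \<in> iso2 C (comp1 C (comp1 C f g) h) (comp1 C f (comp1 C g h))"
    and assoc_natural: "\<lbrakk>c \<in> Ce C; d \<in> Ce C; e \<in> Ce C;
          trg C (vdom C c) = src C (vdom C d); trg C (vdom C d) = src C (vdom C e)\<rbrakk>
        \<Longrightarrow> vcomp C (hcomp C (hcomp C c d) e) (assoc C (vcod C c) (vcod C d) (vcod C e))
            = vcomp C (assoc C (vdom C c) (vdom C d) (vdom C e)) (hcomp C c (hcomp C d e))"
    and lunit_iso: "f \<in> Ar C \<Longrightarrow> lunit C f \<in> iso2 C (comp1 C (one1 C (src C f)) f) f"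
    and lunit_natural: "c \<in> Ce C \<Longrightarrow>
          vcomp C (hcomp C (one2 C (one1 C (src C (vdom C c)))) c) (lunit C (vcod C c))
            = vcomp C (lunit C (vdom C c)) c"
    and runit_iso: "f \<in> Ar C \<Longrightarrow> runit C f \<in> iso2 C (comp1 C f (one1 C (trg C f))) f"
    and runit_natural: "c \<in> Ce C \<Longrightarrow>
          vcomp C (hcomp C c (one2 C (one1 C (trg C (vdom C c))))) (runit C (vcod C c))
            = vcomp C (runit C (vdom C c)) c"
    and pentagon: "\<lbrakk>f \<in> Ar C; g \<in> Ar C; h \<in> Ar C; k \<in> Ar C;
          trg C f = src C g; trg C g = src C h; trg C h = src C k\<rbrakk>
        \<Longrightarrow> vcomp C (assoc C (comp1 C f g) h k) (assoc C f g (comp1 C h k))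
            = vcomp C (hcomp C (assoc C f g h) (one2 C k))
                (vcomp C (assoc C f (comp1 C g h) k) (hcomp C (one2 C f) (assoc C g h k)))"
    and triangle: "\<lbrakk>f \<in> Ar C; g \<in> Ar C; trg C f = src C g\<rbrakk>
        \<Longrightarrow> vcomp C (assoc C f (one1 C (trg C f)) g) (hcomp C (one2 C f) (lunit C g))
            = hcomp C (runit C f) (one2 C g)"

text \<open>Bifunctors are homomorphisms of bicategories (pseudofunctors):
  \<open>fcomp F f g : F f \<cdot> F g \<Rightarrow> F (f \<cdot> g)\<close> and \<open>funit F A : 1 \<Rightarrow> F 1\<close> are invertible.\<close>

record ('ob, 'ar, 'ce, 'ob2, 'ar2, 'ce2) bifun =
  fob :: "'ob \<Rightarrow> 'ob2"
  far :: "'ar \<Rightarrow> 'ar2"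
  fce :: "'ce \<Rightarrow> 'ce2"
  fcomp :: "'ar \<Rightarrow> 'ar \<Rightarrow> 'ce2"
  funit :: "'ob \<Rightarrow> 'ce2"

locale bifunctor = C: bicategory C + D: bicategory D
  for C :: "('ob, 'ar, 'ce) bicat" and D :: "('ob2, 'ar2, 'ce2) bicat" +
  fixes F :: "('ob, 'ar, 'ce, 'ob2, 'ar2, 'ce2) bifun"
  assumes fob_Ob: "A \<in> Ob C \<Longrightarrow> fob F A \<in> Ob D"
    and far_hom: "f \<in> Ar C \<Longrightarrow> far F f \<in> hom1 D (fob F (src C f)) (fob F (trg C f))"
    and fce_hom: "c \<in> Ce C \<Longrightarrow> fce F c \<in> hom2 D (far F (vdom C c)) (far F (vcod C c))"
    and fce_one2: "f \<in> Ar C \<Longrightarrow> fce F (one2 C f) = one2 D (far F f)"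
    and fce_vcomp: "\<lbrakk>c \<in> Ce C; d \<in> Ce C; vcod C c = vdom C d\<rbrakk>
        \<Longrightarrow> fce F (vcomp C c d) = vcomp D (fce F c) (fce F d)"
    and fcomp_iso: "\<lbrakk>f \<in> Ar C; g \<in> Ar C; trg C f = src C g\<rbrakk>
        \<Longrightarrow> fcomp F f g \<in> iso2 D (comp1 D (far F f) (far F g)) (far F (comp1 C f g))"
    and fcomp_natural: "\<lbrakk>c \<in> Ce C; d \<in> Ce C; trg C (vdom C c) = src C (vdom C d)\<rbrakk>
        \<Longrightarrow> vcomp D (hcomp D (fce F c) (fce F d)) (fcomp F (vcod C c) (vcod C d))
            = vcomp D (fcomp F (vdom C c) (vdom C d)) (fce F (hcomp C c d))"
    and funit_iso: "A \<in> Ob C \<Longrightarrow> funit F A \<in> iso2 D (one1 D (fob F A)) (far F (one1 C A))"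
    and fcomp_assoc: "\<lbrakk>f \<in> Ar C; g \<in> Ar C; h \<in> Ar C; trg C f = src C g; trg C g = src C h\<rbrakk>
        \<Longrightarrow> vcomp D (hcomp D (fcomp F f g) (one2 D (far F h)))
              (vcomp D (fcomp F (comp1 C f g) h) (fce F (assoc C f g h)))
            = vcomp D (assoc D (far F f) (far F g) (far F h))
              (vcomp D (hcomp D (one2 D (far F f)) (fcomp F g h)) (fcomp F f (comp1 C g h)))"
    and fcomp_lunit: "f \<in> Ar C \<Longrightarrow>
          vcomp D (hcomp D (funit F (src C f)) (one2 D (far F f)))
            (vcomp D (fcomp F (one1 C (src C f)) f) (fce F (lunit C f)))
          = lunit D (far F f)"
    and fcomp_runit: "f \<in> Ar C \<Longrightarrow>
          vcomp D (hcomp D (one2 D (far F f)) (funit F (trg C f)))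
            (vcomp D (fcomp F f (one1 C (trg C f))) (fce F (runit C f)))
          = runit D (far F f)"

definition locally_fully_faithful :: "('ob, 'ar, 'ce) bicat \<Rightarrow> ('ob2, 'ar2, 'ce2) bicat
    \<Rightarrow> ('ob, 'ar, 'ce, 'ob2, 'ar2, 'ce2) bifun \<Rightarrow> bool" where
  "locally_fully_faithful C D F \<longleftrightarrow>
     (\<forall>A\<in>Ob C. \<forall>B\<in>Ob C. \<forall>f\<in>hom1 C A B. \<forall>g\<in>hom1 C A B.
        bij_betw (fce F) (hom2 C f g) (hom2 D (far F f) (far F g)))"

definition locally_groupoidal :: "('ob, 'ar, 'ce) bicat \<Rightarrow> bool" where
  "locally_groupoidal C \<longleftrightarrow> (\<forall>c\<in>Ce C. c \<in> iso2 C (vdom C c) (vcod C c))"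

definition locally_ess_surj :: "('ob, 'ar, 'ce) bicat \<Rightarrow> ('ob2, 'ar2, 'ce2) bicat
    \<Rightarrow> ('ob, 'ar, 'ce, 'ob2, 'ar2, 'ce2) bifun \<Rightarrow> bool" where
  "locally_ess_surj C D F \<longleftrightarrow>
     (\<forall>A\<in>Ob C. \<forall>B\<in>Ob C. \<forall>h\<in>hom1 D (fob F A) (fob F B). \<exists>f\<in>hom1 C A B. iso2 D (far F f) h \<noteq> {})"

definition equivalent_objects :: "('ob, 'ar, 'ce) bicat \<Rightarrow> 'ob \<Rightarrow> 'ob \<Rightarrow> bool" where
  "equivalent_objects C A B \<longleftrightarrow> (\<exists>f\<in>hom1 C A B. \<exists>g\<in>hom1 C B A.
     iso2 C (comp1 C f g) (one1 C A) \<noteq> {} \<and> iso2 C (comp1 C g f) (one1 C B) \<noteq> {})"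

text \<open>A biequivalence is a bifunctor inducing equivalences of hom categories and surjective on
  objects up to equivalence (Street, Fibrations in bicategories).\<close>

definition biequivalence :: "('ob, 'ar, 'ce) bicat \<Rightarrow> ('ob2, 'ar2, 'ce2) bicat
    \<Rightarrow> ('ob, 'ar, 'ce, 'ob2, 'ar2, 'ce2) bifun \<Rightarrow> bool" where
  "biequivalence C D F \<longleftrightarrow> bifunctor C D F \<and>
     locally_fully_faithful C D F \<and> locally_ess_surj C D F \<and>
     (\<forall>B\<in>Ob D. \<exists>A\<in>Ob C. equivalent_objects D (fob F A) B)"


section \<open>The 2-groupoid with global sections as arrows\<close>

text \<open>Arrows and 2-arrows carry their source and target: an arrow is \<open>(A, B, t, g)\<close> and a 2-arrow
  is \<open>(f, f', \<mu>)\<close>.\<close>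

type_synonym ('o, 'm, 'e, 'a, 'b, 'g) zarr =
  "('o, 'm, 'e, 'a, 'b, 'g) zobj \<times> ('o, 'm, 'e, 'a, 'b, 'g) zobj \<times> ('o \<Rightarrow> 'e \<Rightarrow> 'e) \<times> ('o \<Rightarrow> 'b)"

type_synonym ('o, 'm, 'e, 'a, 'b, 'g) zcell =
  "('o, 'm, 'e, 'a, 'b, 'g) zarr \<times> ('o, 'm, 'e, 'a, 'b, 'g) zarr \<times> ('o \<Rightarrow> 'a)"

definition z_arrows :: "('o, 'm) site \<Rightarrow> ('o, 'm, 'g) gsheaf \<Rightarrow> ('o, 'm, 'a, 'b, 'g) xmod
    \<Rightarrow> ('o, 'm, 'e, 'a, 'b, 'g) zarr set" where
  "z_arrows X \<Gamma> G = {(A, B, t, g). A \<in> z_objects X \<Gamma> G \<and> B \<in> z_objects X \<Gamma> G \<and>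
     g \<in> gsec X (G0 G) \<and> t \<in> gisos X (tot A) (tot B) \<and>
     (\<forall>U\<in>obs X. \<forall>x\<in>sec (tot A) U. prj A U x = prj B U (t U x)) \<and>
     (\<forall>U\<in>obs X. \<forall>x\<in>sec (tot A) U.
        inv\<^bsub>grp (G0 G) U\<^esub> (g U) \<otimes>\<^bsub>grp (G0 G) U\<^esub> rho A U x \<otimes>\<^bsub>grp (G0 G) U\<^esub> lact0 G U (prj A U x) (g U)
          = rho B U (t U x)) \<and>
     (\<forall>U\<in>obs X. \<forall>a\<in>sec (G1 G) U. inc B U (ract G U a (g U)) = t U (inc A U a))}"

definition z_cells :: "('o, 'm) site \<Rightarrow> ('o, 'm, 'g) gsheaf \<Rightarrow> ('o, 'm, 'a, 'b, 'g) xmod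
    \<Rightarrow> ('o, 'm, 'e, 'a, 'b, 'g) zcell set" where
  "z_cells X \<Gamma> G = {((A, B, t, g), (A', B', t', g'), m).
     (A, B, t, g) \<in> z_arrows X \<Gamma> G \<and> (A', B', t', g') \<in> z_arrows X \<Gamma> G \<and> A' = A \<and> B' = B \<and>
     m \<in> gsec X (G1 G) \<and>
     (\<forall>U\<in>obs X. g U \<otimes>\<^bsub>grp (G0 G) U\<^esub> bd G U (m U) = g' U) \<and>
     (\<forall>U\<in>obs X. \<forall>x\<in>sec (tot A) U.
        t' U x = inv\<^bsub>grp (tot B) U\<^esub> (inc B U (m U)) \<otimes>\<^bsub>grp (tot B) U\<^esub> t U x \<otimes>\<^bsub>grp (tot B) U\<^esub> inc B U (m U))}"

definition z_one1 :: "('o, 'm) site \<Rightarrow> ('o, 'm, 'a, 'b, 'g) xmod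
    \<Rightarrow> ('o, 'm, 'e, 'a, 'b, 'g) zobj \<Rightarrow> ('o, 'm, 'e, 'a, 'b, 'g) zarr" where
  "z_one1 X G A = (A, A, mk_map X (tot A) (\<lambda>U x. x), \<lambda>U\<in>obs X. \<one>\<^bsub>grp (G0 G) U\<^esub>)"

definition z_comp1 :: "('o, 'm) site \<Rightarrow> ('o, 'm, 'a, 'b, 'g) xmod
    \<Rightarrow> ('o, 'm, 'e, 'a, 'b, 'g) zarr \<Rightarrow> ('o, 'm, 'e, 'a, 'b, 'g) zarr \<Rightarrow> ('o, 'm, 'e, 'a, 'b, 'g) zarr" where
  "z_comp1 X G = (\<lambda>(A, B, t, g) (B', C, t', g').
     (A, C, mk_map X (tot A) (\<lambda>U x. t' U (t U x)), \<lambda>U\<in>obs X. g U \<otimes>\<^bsub>grp (G0 G) U\<^esub> g' U))"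

text \<open>Identity 2-arrow data; also used between the two sides of the (strict) associativity and unit laws.\<close>

definition z_triv :: "('o, 'm) site \<Rightarrow> ('o, 'm, 'a, 'b, 'g) xmod
    \<Rightarrow> ('o, 'm, 'e, 'a, 'b, 'g) zarr \<Rightarrow> ('o, 'm, 'e, 'a, 'b, 'g) zarr \<Rightarrow> ('o, 'm, 'e, 'a, 'b, 'g) zcell" where
  "z_triv X G f f' = (f, f', \<lambda>U\<in>obs X. \<one>\<^bsub>grp (G1 G) U\<^esub>)"

definition z_vcomp :: "('o, 'm) site \<Rightarrow> ('o, 'm, 'a, 'b, 'g) xmod
    \<Rightarrow> ('o, 'm, 'e, 'a, 'b, 'g) zcell \<Rightarrow> ('o, 'm, 'e, 'a, 'b, 'g) zcell \<Rightarrow> ('o, 'm, 'e, 'a, 'b, 'g) zcell" where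
  "z_vcomp X G = (\<lambda>(f, f', m) (h, h', m'). (f, h', \<lambda>U\<in>obs X. m U \<otimes>\<^bsub>grp (G1 G) U\<^esub> m' U))"

text \<open>The horizontal composite of \<open>\<mu> : (t, g) \<Rightarrow> (s, h)\<close> and \<open>\<mu>' : (t', g') \<Rightarrow> (s', h')\<close> is
  \<open>\<mu>\<^sup>g\<^sup>' \<mu>'\<close>, since \<open>h h' = g \<partial>(\<mu>) g' \<partial>(\<mu>') = g g' \<partial>(\<mu>\<^sup>g\<^sup>' \<mu>')\<close>.\<close>

definition z_hcomp :: "('o, 'm) site \<Rightarrow> ('o, 'm, 'a, 'b, 'g) xmod
    \<Rightarrow> ('o, 'm, 'e, 'a, 'b, 'g) zcell \<Rightarrow> ('o, 'm, 'e, 'a, 'b, 'g) zcell \<Rightarrow> ('o, 'm, 'e, 'a, 'b, 'g) zcell" where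
  "z_hcomp X G = (\<lambda>(f, h, m) ((B, C, t', g'), h', m').
     (z_comp1 X G f (B, C, t', g'), z_comp1 X G h h',
      \<lambda>U\<in>obs X. ract G U (m U) (g' U) \<otimes>\<^bsub>grp (G1 G) U\<^esub> m' U))"

definition Z_cat :: "('o, 'm) site \<Rightarrow> ('o, 'm, 'g) gsheaf \<Rightarrow> ('o, 'm, 'a, 'b, 'g) xmod
    \<Rightarrow> (('o, 'm, 'e, 'a, 'b, 'g) zobj, ('o, 'm, 'e, 'a, 'b, 'g) zarr, ('o, 'm, 'e, 'a, 'b, 'g) zcell) bicat" where
  "Z_cat X \<Gamma> G = \<lparr>
     Ob = z_objects X \<Gamma> G, Ar = z_arrows X \<Gamma> G, Ce = z_cells X \<Gamma> G,
     src = (\<lambda>(A, B, t, g). A), trg = (\<lambda>(A, B, t, g). B),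
     vdom = (\<lambda>(f, f', m). f), vcod = (\<lambda>(f, f', m). f'),
     one1 = z_one1 X G, comp1 = z_comp1 X G,
     one2 = (\<lambda>f. z_triv X G f f), vcomp = z_vcomp X G, hcomp = z_hcomp X G,
     assoc = (\<lambda>f g h. z_triv X G (z_comp1 X G (z_comp1 X G f g) h) (z_comp1 X G f (z_comp1 X G g h))),
     lunit = (\<lambda>f. z_triv X G (z_comp1 X G (z_one1 X G (fst f)) f) f),
     runit = (\<lambda>f. z_triv X G (z_comp1 X G f (z_one1 X G (fst (snd f)))) f) \<rparr>"


section \<open>Twisting by a torsor\<close>

definition conj_act :: "('o, 'm, 'e, 'a, 'b, 'g) zobj \<Rightarrow> 'o \<Rightarrow> 'a \<Rightarrow> 'e \<Rightarrow> 'e" where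
  "conj_act E U a x =
     inc E U a \<otimes>\<^bsub>grp (tot E) U\<^esub> x \<otimes>\<^bsub>grp (tot E) U\<^esub> inv\<^bsub>grp (tot E) U\<^esub> (inc E U a)"

definition tw_sheaf :: "('o, 'm) site \<Rightarrow> ('o, 'm, 'a, 'b, 'g) xmod \<Rightarrow> ('o, 'm, 'p, 'a) rtorsor
    \<Rightarrow> ('o, 'm, 'e, 'a, 'b, 'g) zobj \<Rightarrow> ('o, 'm, ('m, 'p, 'e) ctr) presheaf" where
  "tw_sheaf X G P E = ctr X (G1 G) P (tot E) (conj_act E)"

definition tw_pt :: "('o, 'm) site \<Rightarrow> ('o, 'm, 'a, 'b, 'g) xmod \<Rightarrow> ('o, 'm, 'p, 'a) rtorsor
    \<Rightarrow> ('o, 'm, 'e, 'a, 'b, 'g) zobj \<Rightarrow> 'o \<Rightarrow> 'p \<Rightarrow> 'e \<Rightarrow> ('m, 'p, 'e) ctr" where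
  "tw_pt X G P E = ctr_pt X (G1 G) P (tot E) (conj_act E)"

text \<open>
  The twist of \<open>E\<close> by \<open>(P, \<phi>)\<close>, with its group structure \<open>(u, x) (u, y) = (u, x y)\<close> and its structure maps.
  It takes values in a larger type than \<open>E\<close>, and is only used as the target of the first component of
  an arrow.
\<close>

definition tw_group :: "('o, 'm) site \<Rightarrow> ('o, 'm, 'a, 'b, 'g) xmod \<Rightarrow> ('o, 'm, 'p, 'a) rtorsor
    \<Rightarrow> ('o, 'm, 'e, 'a, 'b, 'g) zobj \<Rightarrow> ('o, 'm, ('m, 'p, 'e) ctr) gsheaf" where
  "tw_group X G P E = (let T = tw_sheaf X G P E in \<lparr>
     sec = sec T, res = res T,
     gmul = (\<lambda>U s s'. THE z. z \<in> sec T U \<and>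
        (\<forall>f c c' u x y. (f, c) \<in> s \<and> (f, c') \<in> s' \<and> (u, x) \<in> c \<and> (u, y) \<in> c' \<longrightarrow>
           res T f z = tw_pt X G P E (dm X f) u (x \<otimes>\<^bsub>grp (tot E) (dm X f)\<^esub> y))),
     gone = (\<lambda>U. THE z. z \<in> sec T U \<and>
        (\<forall>f\<in>into X U. \<forall>u\<in>sec P (dm X f). res T f z = tw_pt X G P E (dm X f) u \<one>\<^bsub>grp (tot E) (dm X f)\<^esub>)) \<rparr>)"

definition twist :: "('o, 'm) site \<Rightarrow> ('o, 'm, 'g) gsheaf \<Rightarrow> ('o, 'm, 'a, 'b, 'g) xmod
    \<Rightarrow> ('o, 'm, 'p, 'a) rtorsor \<Rightarrow> ('o \<Rightarrow> 'p \<Rightarrow> 'b) \<Rightarrow> ('o, 'm, 'e, 'a, 'b, 'g) zobj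
    \<Rightarrow> ('o, 'm, ('m, 'p, 'e) ctr, 'a, 'b, 'g) zobj" where
  "twist X \<Gamma> G P \<phi> E = (let T = tw_sheaf X G P E in \<lparr>
     tot = tw_group X G P E,
     inc = mk_map X (G1 G) (\<lambda>U a. THE z. z \<in> sec T U \<and>
        (\<forall>f\<in>into X U. \<forall>u\<in>sec P (dm X f). res T f z =
           tw_pt X G P E (dm X f) u (inc E (dm X f) (ract G (dm X f) (res (G1 G) f a) (\<phi> (dm X f) u))))),
     prj = mk_map X T (\<lambda>U. descend \<Gamma> U (\<lambda>f u x. prj E (dm X f) x)),
     rho = mk_map X T (\<lambda>U. descend (G0 G) U (\<lambda>f u x. let V = dm X f in
        \<phi> V u \<otimes>\<^bsub>grp (G0 G) V\<^esub> rho E V x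
          \<otimes>\<^bsub>grp (G0 G) V\<^esub> lact0 G V (prj E V x) (inv\<^bsub>grp (G0 G) V\<^esub> (\<phi> V u)))) \<rparr>)"


section \<open>Products of torsors\<close>

definition bitorsor_act :: "('o, 'm, 'a, 'b, 'g) xmod \<Rightarrow> ('o, 'm, 'p, 'a) rtorsor \<Rightarrow> ('o \<Rightarrow> 'p \<Rightarrow> 'b)
    \<Rightarrow> 'o \<Rightarrow> 'a \<Rightarrow> 'p \<Rightarrow> 'p" where
  "bitorsor_act G P \<phi> U a v = tact P U v (ract G U a (\<phi> U v))"

definition ctr_torsor :: "('o, 'm) site \<Rightarrow> ('o, 'm, 'a, 'b, 'g) xmod \<Rightarrow> ('o, 'm, 'p, 'a) rtorsor
    \<Rightarrow> ('o, 'm, 'q, 'a) rtorsor \<Rightarrow> ('o \<Rightarrow> 'q \<Rightarrow> 'b) \<Rightarrow> ('o, 'm, ('m, 'p, 'q) ctr, 'a) rtorsor" where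
  "ctr_torsor X G P P' \<phi>' = (let T = ctr X (G1 G) P P' (bitorsor_act G P' \<phi>') in \<lparr>
     sec = sec T, res = res T,
     tact = (\<lambda>U s b. descend T U (\<lambda>f u v.
        ctr_pt X (G1 G) P P' (bitorsor_act G P' \<phi>') (dm X f) u (tact P' (dm X f) v (res (G1 G) f b))) s) \<rparr>)"

text \<open>
  The contracted product of two torsors has sections in a larger type. As it is a \<open>G\<^sub>1\<close>-torsor, its sets
  of sections inject into the type \<open>'a\<close> of sections of \<open>G\<^sub>1\<close>; the composite arrow uses its copy along
  chosen injections. \<open>tprod\<close> is this copy, \<open>tpair\<close> the class of a pair in it, and \<open>tdescend\<close> is
  \<open>descend\<close> transported to it.
\<close>

definition code :: "'x set \<Rightarrow> 'x \<Rightarrow> 'a" where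
  "code S = (SOME c. inj_on c S)"

definition decode :: "'x set \<Rightarrow> 'a \<Rightarrow> 'x" where
  "decode S = inv_into S (code S)"

definition tprod :: "('o, 'm) site \<Rightarrow> ('o, 'm, 'a, 'b, 'g) xmod \<Rightarrow> ('o, 'm, 'a, 'a) rtorsor
    \<Rightarrow> ('o, 'm, 'a, 'a) rtorsor \<Rightarrow> ('o \<Rightarrow> 'a \<Rightarrow> 'b) \<Rightarrow> ('o, 'm, 'a, 'a) rtorsor" where
  "tprod X G P P' \<phi>' = (let T = ctr_torsor X G P P' \<phi>' in \<lparr>
     sec = (\<lambda>U. code (sec T U) ` sec T U),
     res = (\<lambda>f p. code (sec T (dm X f)) (res T f (decode (sec T (cd X f)) p))),
     tact = (\<lambda>U p b. code (sec T U) (tact T U (decode (sec T U) p) b)) \<rparr>)"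

definition tpair :: "('o, 'm) site \<Rightarrow> ('o, 'm, 'a, 'b, 'g) xmod \<Rightarrow> ('o, 'm, 'a, 'a) rtorsor
    \<Rightarrow> ('o, 'm, 'a, 'a) rtorsor \<Rightarrow> ('o \<Rightarrow> 'a \<Rightarrow> 'b) \<Rightarrow> 'o \<Rightarrow> 'a \<Rightarrow> 'a \<Rightarrow> 'a" where
  "tpair X G P P' \<phi>' U u v = code (sec (ctr_torsor X G P P' \<phi>') U)
     (ctr_pt X (G1 G) P P' (bitorsor_act G P' \<phi>') U u v)"

definition tdescend :: "('o, 'm) site \<Rightarrow> ('o, 'm, 'a, 'b, 'g) xmod \<Rightarrow> ('o, 'm, 'a, 'a) rtorsor
    \<Rightarrow> ('o, 'm, 'a, 'a) rtorsor \<Rightarrow> ('o \<Rightarrow> 'a \<Rightarrow> 'b)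
    \<Rightarrow> ('o, 'm, 'y, 'w) presheaf_scheme \<Rightarrow> 'o \<Rightarrow> ('m \<Rightarrow> 'a \<Rightarrow> 'a \<Rightarrow> 'y) \<Rightarrow> 'a \<Rightarrow> 'y" where
  "tdescend X G P P' \<phi>' T U k p = descend T U k (decode (sec (ctr_torsor X G P P' \<phi>') U) p)"

definition tprod_map :: "('o, 'm) site \<Rightarrow> ('o, 'm, 'a, 'b, 'g) xmod \<Rightarrow> ('o, 'm, 'a, 'a) rtorsor
    \<Rightarrow> ('o \<Rightarrow> 'a \<Rightarrow> 'b) \<Rightarrow> ('o, 'm, 'a, 'a) rtorsor \<Rightarrow> ('o \<Rightarrow> 'a \<Rightarrow> 'b) \<Rightarrow> ('o \<Rightarrow> 'a \<Rightarrow> 'b)" where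
  "tprod_map X G P \<phi> P' \<phi>' = mk_map X (tprod X G P P' \<phi>') (\<lambda>U. tdescend X G P P' \<phi>' (G0 G) U
     (\<lambda>f u v. \<phi> (dm X f) u \<otimes>\<^bsub>grp (G0 G) (dm X f)\<^esub> \<phi>' (dm X f) v))"


section \<open>The bigroupoid with torsors as arrows\<close>

text \<open>Arrows are \<open>(A, B, t, P, \<phi>)\<close>, 2-arrows \<open>(f, f', \<mu>)\<close>.\<close>

type_synonym ('o, 'm, 'e, 'a, 'b, 'g) warr =
  "('o, 'm, 'e, 'a, 'b, 'g) zobj \<times> ('o, 'm, 'e, 'a, 'b, 'g) zobj \<times> ('o \<Rightarrow> 'e \<Rightarrow> ('m, 'a, 'e) ctr)
     \<times> ('o, 'm, 'a, 'a) rtorsor \<times> ('o \<Rightarrow> 'a \<Rightarrow> 'b)"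

type_synonym ('o, 'm, 'e, 'a, 'b, 'g) wcell =
  "('o, 'm, 'e, 'a, 'b, 'g) warr \<times> ('o, 'm, 'e, 'a, 'b, 'g) warr \<times> ('o \<Rightarrow> 'a \<Rightarrow> 'a)"

definition w_arrows :: "('o, 'm) site \<Rightarrow> ('o, 'm, 'g) gsheaf \<Rightarrow> ('o, 'm, 'a, 'b, 'g) xmod
    \<Rightarrow> ('o, 'm, 'e, 'a, 'b, 'g) warr set" where
  "w_arrows X \<Gamma> G = {(A, B, t, P, \<phi>). A \<in> z_objects X \<Gamma> G \<and> B \<in> z_objects X \<Gamma> G \<and>
     is_torsor X (G1 G) P \<and> \<phi> \<in> maps X P (G0 G) \<and>
     (\<forall>U\<in>obs X. \<forall>u\<in>sec P U. \<forall>a\<in>sec (G1 G) U.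
        \<phi> U (tact P U u a) = \<phi> U u \<otimes>\<^bsub>grp (G0 G) U\<^esub> bd G U a) \<and>
     t \<in> gisos X (tot A) (tot (twist X \<Gamma> G P \<phi> B)) \<and>
     (\<forall>U\<in>obs X. \<forall>x\<in>sec (tot A) U. prj (twist X \<Gamma> G P \<phi> B) U (t U x) = prj A U x) \<and>
     (\<forall>U\<in>obs X. \<forall>x\<in>sec (tot A) U. rho (twist X \<Gamma> G P \<phi> B) U (t U x) = rho A U x) \<and>
     (\<forall>U\<in>obs X. \<forall>a\<in>sec (G1 G) U. t U (inc A U a) = inc (twist X \<Gamma> G P \<phi> B) U a)}"

text \<open>\<open>\<mu> \<times> E\<close>, for a map of torsors \<open>\<mu> : P \<rightarrow> Q\<close>, and \<open>P \<times> t\<close>, for an equivariant map of groups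
  \<open>t : E \<rightarrow> E'\<close>.\<close>

definition ctr_map_fst :: "('o, 'm) site \<Rightarrow> ('o, 'm, 'a, 'b, 'g) xmod \<Rightarrow> ('o, 'm, 'p, 'a) rtorsor
    \<Rightarrow> ('o, 'm, 'q, 'a) rtorsor \<Rightarrow> ('o, 'm, 'e, 'a, 'b, 'g) zobj \<Rightarrow> ('o \<Rightarrow> 'p \<Rightarrow> 'q)
    \<Rightarrow> 'o \<Rightarrow> ('m, 'p, 'e) ctr \<Rightarrow> ('m, 'q, 'e) ctr" where
  "ctr_map_fst X G P Q E m = mk_map X (tw_sheaf X G P E) (\<lambda>U. descend (tw_sheaf X G Q E) U
     (\<lambda>f u x. tw_pt X G Q E (dm X f) (m (dm X f) u) x))"

definition ctr_map_snd :: "('o, 'm) site \<Rightarrow> ('o, 'm, 'a, 'b, 'g) xmod \<Rightarrow> ('o, 'm, 'p, 'a) rtorsor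
    \<Rightarrow> ('o, 'm, 'e, 'a, 'b, 'g) zobj \<Rightarrow> ('o, 'm, 'd, 'a, 'b, 'g) zobj \<Rightarrow> ('o \<Rightarrow> 'e \<Rightarrow> 'd)
    \<Rightarrow> 'o \<Rightarrow> ('m, 'p, 'e) ctr \<Rightarrow> ('m, 'p, 'd) ctr" where
  "ctr_map_snd X G P E E' t = mk_map X (tw_sheaf X G P E) (\<lambda>U. descend (tw_sheaf X G P E') U
     (\<lambda>f u x. tw_pt X G P E' (dm X f) u (t (dm X f) x)))"

text \<open>The isomorphism \<open>P \<times> (P' \<times> E) \<cong> (P \<times> P') \<times> E\<close>, \<open>(u, (v, x)) \<mapsto> ((u, v), x)\<close>.\<close>

definition ctr_assoc :: "('o, 'm) site \<Rightarrow> ('o, 'm, 'g) gsheaf \<Rightarrow> ('o, 'm, 'a, 'b, 'g) xmod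
    \<Rightarrow> ('o, 'm, 'a, 'a) rtorsor \<Rightarrow> ('o, 'm, 'a, 'a) rtorsor \<Rightarrow> ('o \<Rightarrow> 'a \<Rightarrow> 'b)
    \<Rightarrow> ('o, 'm, 'e, 'a, 'b, 'g) zobj \<Rightarrow> 'o \<Rightarrow> ('m, 'a, ('m, 'a, 'e) ctr) ctr \<Rightarrow> ('m, 'a, 'e) ctr" where
  "ctr_assoc X \<Gamma> G P P' \<phi>' E = (let R = tprod X G P P' \<phi>'; T = tw_sheaf X G R E in
     mk_map X (tw_sheaf X G P (twist X \<Gamma> G P' \<phi>' E)) (\<lambda>U. descend T U
       (\<lambda>f u w. descend T (dm X f)
         (\<lambda>h v x. tw_pt X G R E (dm X h) (tpair X G P P' \<phi>' (dm X h) (res P h u) v) x) w)))"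

definition w_cells :: "('o, 'm) site \<Rightarrow> ('o, 'm, 'g) gsheaf \<Rightarrow> ('o, 'm, 'a, 'b, 'g) xmod
    \<Rightarrow> ('o, 'm, 'e, 'a, 'b, 'g) wcell set" where
  "w_cells X \<Gamma> G = {((A, B, t, P, \<phi>), (A', B', t', P', \<phi>'), m).
     (A, B, t, P, \<phi>) \<in> w_arrows X \<Gamma> G \<and> (A', B', t', P', \<phi>') \<in> w_arrows X \<Gamma> G \<and> A' = A \<and> B' = B \<and>
     m \<in> torsor_isos X (G1 G) P P' \<and>
     (\<forall>U\<in>obs X. \<forall>u\<in>sec P U. \<phi>' U (m U u) = \<phi> U u) \<and>
     (\<forall>U\<in>obs X. \<forall>x\<in>sec (tot A) U. ctr_map_fst X G P P' B m U (t U x) = t' U x)}"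

definition w_one1 :: "('o, 'm) site \<Rightarrow> ('o, 'm, 'a, 'b, 'g) xmod
    \<Rightarrow> ('o, 'm, 'e, 'a, 'b, 'g) zobj \<Rightarrow> ('o, 'm, 'e, 'a, 'b, 'g) warr" where
  "w_one1 X G A = (A, A,
     mk_map X (tot A) (\<lambda>U x. tw_pt X G (triv_torsor (G1 G)) A U \<one>\<^bsub>grp (G1 G) U\<^esub> x),
     triv_torsor (G1 G), bd G)"

definition w_comp1 :: "('o, 'm) site \<Rightarrow> ('o, 'm, 'g) gsheaf \<Rightarrow> ('o, 'm, 'a, 'b, 'g) xmod
    \<Rightarrow> ('o, 'm, 'e, 'a, 'b, 'g) warr \<Rightarrow> ('o, 'm, 'e, 'a, 'b, 'g) warr \<Rightarrow> ('o, 'm, 'e, 'a, 'b, 'g) warr" where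
  "w_comp1 X \<Gamma> G = (\<lambda>(A, B, t, P, \<phi>) (B', C, t', P', \<phi>'). (A, C,
     mk_map X (tot A) (\<lambda>U x. ctr_assoc X \<Gamma> G P P' \<phi>' C U
       (ctr_map_snd X G P B (twist X \<Gamma> G P' \<phi>' C) t' U (t U x))),
     tprod X G P P' \<phi>', tprod_map X G P \<phi> P' \<phi>'))"

definition w_tor :: "('o, 'm, 'e, 'a, 'b, 'g) warr \<Rightarrow> ('o, 'm, 'a, 'a) rtorsor" where
  "w_tor = (\<lambda>(A, B, t, P, \<phi>). P)"

definition w_phi :: "('o, 'm, 'e, 'a, 'b, 'g) warr \<Rightarrow> 'o \<Rightarrow> 'a \<Rightarrow> 'b" where
  "w_phi = (\<lambda>(A, B, t, P, \<phi>). \<phi>)"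

definition w_one2 :: "('o, 'm) site \<Rightarrow> ('o, 'm, 'e, 'a, 'b, 'g) warr \<Rightarrow> ('o, 'm, 'e, 'a, 'b, 'g) wcell" where
  "w_one2 X f = (f, f, mk_map X (w_tor f) (\<lambda>U u. u))"

definition w_vcomp :: "('o, 'm) site \<Rightarrow> ('o, 'm, 'e, 'a, 'b, 'g) wcell \<Rightarrow> ('o, 'm, 'e, 'a, 'b, 'g) wcell
    \<Rightarrow> ('o, 'm, 'e, 'a, 'b, 'g) wcell" where
  "w_vcomp X = (\<lambda>(f, f', m) (h, h', m'). (f, h', mk_map X (w_tor f) (\<lambda>U u. m' U (m U u))))"

text \<open>On local sections, the horizontal composite is \<open>(u, v) \<mapsto> (\<mu> u, \<mu>' v)\<close>, the associativity isomorphism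
  is \<open>((u, v), w) \<mapsto> (u, (v, w))\<close>, and the unit isomorphisms \<open>G\<^sub>1 \<times> P \<rightarrow> P\<close> and \<open>P \<times> G\<^sub>1 \<rightarrow> P\<close> are
  given by the left and right actions of \<open>G\<^sub>1\<close> on \<open>P\<close>.\<close>

definition w_hcomp :: "('o, 'm) site \<Rightarrow> ('o, 'm, 'g) gsheaf \<Rightarrow> ('o, 'm, 'a, 'b, 'g) xmod
    \<Rightarrow> ('o, 'm, 'e, 'a, 'b, 'g) wcell \<Rightarrow> ('o, 'm, 'e, 'a, 'b, 'g) wcell \<Rightarrow> ('o, 'm, 'e, 'a, 'b, 'g) wcell" where
  "w_hcomp X \<Gamma> G = (\<lambda>(f, h, m) (f', h', m').
     (w_comp1 X \<Gamma> G f f', w_comp1 X \<Gamma> G h h',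
      mk_map X (tprod X G (w_tor f) (w_tor f') (w_phi f')) (\<lambda>U.
        tdescend X G (w_tor f) (w_tor f') (w_phi f') (tprod X G (w_tor h) (w_tor h') (w_phi h')) U
          (\<lambda>k u v. tpair X G (w_tor h) (w_tor h') (w_phi h') (dm X k) (m (dm X k) u) (m' (dm X k) v)))))"

definition w_assoc :: "('o, 'm) site \<Rightarrow> ('o, 'm, 'g) gsheaf \<Rightarrow> ('o, 'm, 'a, 'b, 'g) xmod
    \<Rightarrow> ('o, 'm, 'e, 'a, 'b, 'g) warr \<Rightarrow> ('o, 'm, 'e, 'a, 'b, 'g) warr \<Rightarrow> ('o, 'm, 'e, 'a, 'b, 'g) warr
    \<Rightarrow> ('o, 'm, 'e, 'a, 'b, 'g) wcell" where
  "w_assoc X \<Gamma> G f g h = (let P = w_tor f; Q = w_tor g; R = w_tor h; \<psi> = w_phi g; \<chi> = w_phi h;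
       PQ = tprod X G P Q \<psi>; QR = tprod X G Q R \<chi>; \<psi>\<chi> = tprod_map X G Q \<psi> R \<chi>; T = tprod X G P QR \<psi>\<chi> in
     (w_comp1 X \<Gamma> G (w_comp1 X \<Gamma> G f g) h, w_comp1 X \<Gamma> G f (w_comp1 X \<Gamma> G g h),
      mk_map X (tprod X G PQ R \<chi>) (\<lambda>U. tdescend X G PQ R \<chi> T U
        (\<lambda>k p w. tdescend X G P Q \<psi> T (dm X k)
          (\<lambda>l u v. tpair X G P QR \<psi>\<chi> (dm X l) u (tpair X G Q R \<chi> (dm X l) v (res R l w))) p))))"

definition w_lunit :: "('o, 'm) site \<Rightarrow> ('o, 'm, 'g) gsheaf \<Rightarrow> ('o, 'm, 'a, 'b, 'g) xmod
    \<Rightarrow> ('o, 'm, 'e, 'a, 'b, 'g) warr \<Rightarrow> ('o, 'm, 'e, 'a, 'b, 'g) wcell" where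
  "w_lunit X \<Gamma> G f = (let I = triv_torsor (G1 G); P = w_tor f; \<phi> = w_phi f in
     (w_comp1 X \<Gamma> G (w_one1 X G (fst f)) f, f,
      mk_map X (tprod X G I P \<phi>) (\<lambda>U. tdescend X G I P \<phi> P U
        (\<lambda>k a v. bitorsor_act G P \<phi> (dm X k) a v))))"

definition w_runit :: "('o, 'm) site \<Rightarrow> ('o, 'm, 'g) gsheaf \<Rightarrow> ('o, 'm, 'a, 'b, 'g) xmod
    \<Rightarrow> ('o, 'm, 'e, 'a, 'b, 'g) warr \<Rightarrow> ('o, 'm, 'e, 'a, 'b, 'g) wcell" where
  "w_runit X \<Gamma> G f = (let I = triv_torsor (G1 G); P = w_tor f in
     (w_comp1 X \<Gamma> G f (w_one1 X G (fst (snd f))), f,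
      mk_map X (tprod X G P I (bd G)) (\<lambda>U. tdescend X G P I (bd G) P U
        (\<lambda>k u b. tact P (dm X k) u b))))"

definition W_cat :: "('o, 'm) site \<Rightarrow> ('o, 'm, 'g) gsheaf \<Rightarrow> ('o, 'm, 'a, 'b, 'g) xmod
    \<Rightarrow> (('o, 'm, 'e, 'a, 'b, 'g) zobj, ('o, 'm, 'e, 'a, 'b, 'g) warr, ('o, 'm, 'e, 'a, 'b, 'g) wcell) bicat" where
  "W_cat X \<Gamma> G = \<lparr>
     Ob = z_objects X \<Gamma> G, Ar = w_arrows X \<Gamma> G, Ce = w_cells X \<Gamma> G,
     src = (\<lambda>(A, B, t, P, \<phi>). A), trg = (\<lambda>(A, B, t, P, \<phi>). B),
     vdom = (\<lambda>(f, f', m). f), vcod = (\<lambda>(f, f', m). f'),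
     one1 = w_one1 X G, comp1 = w_comp1 X \<Gamma> G,
     one2 = w_one2 X, vcomp = w_vcomp X, hcomp = w_hcomp X \<Gamma> G,
     assoc = w_assoc X \<Gamma> G, lunit = w_lunit X \<Gamma> G, runit = w_runit X \<Gamma> G \<rparr>"


section \<open>The comparison bifunctor\<close>

definition psi_arr :: "('o, 'm) site \<Rightarrow> ('o, 'm, 'a, 'b, 'g) xmod
    \<Rightarrow> ('o, 'm, 'e, 'a, 'b, 'g) zarr \<Rightarrow> ('o, 'm, 'e, 'a, 'b, 'g) warr" where
  "psi_arr X G = (\<lambda>(A, B, t, g). (A, B,
     mk_map X (tot A) (\<lambda>U x. tw_pt X G (triv_torsor (G1 G)) B U \<one>\<^bsub>grp (G1 G) U\<^esub> (t U x)),
     triv_torsor (G1 G),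
     mk_map X (G1 G) (\<lambda>U a. g U \<otimes>\<^bsub>grp (G0 G) U\<^esub> bd G U a)))"

text \<open>
  A 2-arrow \<open>\<mu> : (t, g) \<Rightarrow> (t', g')\<close> goes to \<open>\<alpha> \<mapsto> \<mu>\<^sup>-\<^sup>1 \<alpha>\<close>, as \<open>g' \<partial>(\<mu>\<^sup>-\<^sup>1 \<alpha>) = g \<partial>(\<alpha>)\<close>. The comparison
  2-arrow for the composite of \<open>(t, g)\<close> and \<open>(t', g')\<close> is \<open>(\<alpha>, \<beta>) \<mapsto> \<alpha>\<^sup>g\<^sup>' \<beta>\<close>, as
  \<open>g \<partial>(\<alpha>) g' \<partial>(\<beta>) = g g' \<partial>(\<alpha>\<^sup>g\<^sup>' \<beta>)\<close>.
\<close>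

definition psi_comp :: "('o, 'm) site \<Rightarrow> ('o, 'm, 'g) gsheaf \<Rightarrow> ('o, 'm, 'a, 'b, 'g) xmod
    \<Rightarrow> ('o, 'm, 'e, 'a, 'b, 'g) zarr \<Rightarrow> ('o, 'm, 'e, 'a, 'b, 'g) zarr \<Rightarrow> ('o, 'm, 'e, 'a, 'b, 'g) wcell" where
  "psi_comp X \<Gamma> G f f' = (let I = triv_torsor (G1 G); \<phi>' = w_phi (psi_arr X G f'); g' = snd (snd (snd f')) in
     (w_comp1 X \<Gamma> G (psi_arr X G f) (psi_arr X G f'), psi_arr X G (z_comp1 X G f f'),
      mk_map X (tprod X G I I \<phi>') (\<lambda>U. tdescend X G I I \<phi>' I U
        (\<lambda>k a b. ract G (dm X k) a (g' (dm X k)) \<otimes>\<^bsub>grp (G1 G) (dm X k)\<^esub> b))))"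

definition Psi :: "('o, 'm) site \<Rightarrow> ('o, 'm, 'g) gsheaf \<Rightarrow> ('o, 'm, 'a, 'b, 'g) xmod
    \<Rightarrow> (('o, 'm, 'e, 'a, 'b, 'g) zobj, ('o, 'm, 'e, 'a, 'b, 'g) zarr, ('o, 'm, 'e, 'a, 'b, 'g) zcell,
        ('o, 'm, 'e, 'a, 'b, 'g) zobj, ('o, 'm, 'e, 'a, 'b, 'g) warr, ('o, 'm, 'e, 'a, 'b, 'g) wcell) bifun" where
  "Psi X \<Gamma> G = \<lparr>
     fob = (\<lambda>A. A),
     far = psi_arr X G,
     fce = (\<lambda>(f, f', m). (psi_arr X G f, psi_arr X G f',
        mk_map X (G1 G) (\<lambda>U a. inv\<^bsub>grp (G1 G) U\<^esub> (m U) \<otimes>\<^bsub>grp (G1 G) U\<^esub> a))),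
     fcomp = psi_comp X \<Gamma> G,
     funit = (\<lambda>A. (w_one1 X G A, psi_arr X G (z_one1 X G A), mk_map X (G1 G) (\<lambda>U a. a))) \<rparr>"

end

theory Submission
  imports Defs
begin

text \<open>
  Let \<open>(t, (P, \<phi>))\<close> be an arrow of the bigroupoid of torsor arrows, from \<open>E\<close> to \<open>E'\<close>. Where \<open>P\<close> has a section
  \<open>u\<close>, the map \<open>x \<mapsto> (u, x)\<close> identifies \<open>E'\<close> with its twist by \<open>P\<close>, so that \<open>t\<close> becomes \<open>x \<mapsto> (u, s x)\<close> with
  \<open>s : E \<rightarrow> E'\<close>, and the conditions on \<open>t\<close> say exactly that \<open>(s, \<phi>(u))\<close> is, over that object, an arrow of the
  2-groupoid. Call \<open>s\<close> the germ of the arrow at \<open>u\<close>. The germ at \<open>u a\<close> is the germ at \<open>u\<close> conjugated by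
  \<open>a\<close>, and \<open>\<phi>(u a) = \<phi>(u) \<partial>(a)\<close>: this is the way in which a 2-arrow changes an arrow of the 2-groupoid. An
  arrow of the bigroupoid is thus an arrow of the 2-groupoid that is given only locally, and only up to
  2-arrows recorded by \<open>P\<close>. Up to a 2-arrow it comes from the 2-groupoid as soon as \<open>P\<close> has a global section.

  This makes the bigroupoid computable. Sections of a sheaf are equal once they are equal over a
  covering, and a torsor has sections over a covering, so every assertion about contracted products may
  be checked on pairs \<open>(u, x)\<close> (\<open>eq_densely\<close>, \<open>glue_over\<close>, \<open>contracted.pt_bij\<close>). In these terms an arrow is
  recognised by possessing germs (\<open>w_arrowD\<close>, \<open>w_arrowI\<close>), a 2-arrow is an equivariant map of torsors
  that preserves germs and the maps to \<open>G\<^sub>0\<close> (\<open>w_cell\<close>, \<open>w_cell_germI\<close>), and the germ of a composite at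
  \<open>(u, v)\<close> is the composite of the germs at \<open>u\<close> and \<open>v\<close> (\<open>w_comp\<close>). The structural 2-arrows are the evident
  ones on tuples: \<open>((u, v), w) \<mapsto> (u, (v, w))\<close>, and the left and right actions of \<open>G\<^sub>1\<close> for the units. A
  2-arrow is determined by its values on tuples, so each coherence law is an equality of tuples
  (\<open>W_bicategory\<close>). All 2-arrows are invertible because an equivariant map of torsors is an isomorphism
  (\<open>torsor_map_bij\<close>). For the 2-groupoid the laws are identities in \<open>G\<^sub>1\<close>; the decisive one is
  interchange, which rests on the Peiffer identity \<open>a\<^sup>\<partial>\<^sup>b = b\<^sup>-\<^sup>1 a b\<close> (\<open>Z_bicategory\<close>).

  The image of \<open>(t, g)\<close> under \<open>\<Psi>\<close> is the arrow on the trivial torsor with germ \<open>t\<close> at the section \<open>1\<close>. A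
  2-arrow \<open>\<mu>\<close> goes to \<open>\<alpha> \<mapsto> \<mu>\<^sup>-\<^sup>1 \<alpha>\<close>, and composition is compared by \<open>(\<alpha>, \<beta>) \<mapsto> \<alpha>\<^sup>g\<^sup>' \<beta>\<close>. On tuples the axioms
  of a bifunctor become identities such as \<open>(\<alpha>\<^sup>g\<^sup>' \<beta>)\<^sup>h \<gamma> = \<alpha>\<^sup>g\<^sup>'\<^sup>h (\<beta>\<^sup>h \<gamma>)\<close> (\<open>Psi_bifunctor\<close>). An equivariant
  endomorphism of the trivial torsor is left multiplication by a global section of \<open>G\<^sub>1\<close>, which gives
  full faithfulness (\<open>psi2_surj\<close>, \<open>psi2_inj\<close>). If the torsor of an arrow is trivial, the germs of the arrow
  at a global section of the torsor form an arrow of the 2-groupoid, and the trivialisation is a 2-arrow from its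
  image (\<open>psi_ess_surj\<close>). Hence \<open>\<Psi>\<close> is a biequivalence when \<open>H\<^sup>1(X, G\<^sub>1)\<close> is trivial; over the point it is,
  because a torsor with local sections then has a section (\<open>point_H1_trivial\<close>).
\<close>

section \<open>Local arguments on a site\<close>

text \<open>On a topological space: every open set is covered by open sets with the property \<open>D\<close>.
  As the members of \<open>cov X U\<close> are sieves, the property is also inherited along arrows.\<close>

definition densely :: "('o, 'm) site \<Rightarrow> ('o \<Rightarrow> bool) \<Rightarrow> bool" where
  "densely X D \<longleftrightarrow> (\<forall>U\<in>obs X. {f \<in> into X U. D (dm X f)} \<in> cov X U)"

context grothendieck_site
begin

lemma into_ars: "f \<in> into X U \<Longrightarrow> f \<in> ars X" "f \<in> into X U \<Longrightarrow> cd X f = U"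
  and intoI: "f \<in> ars X \<Longrightarrow> f \<in> into X (cd X f)"
  by (auto simp: into_def)

lemma dm_into [simp]: "f \<in> into X U \<Longrightarrow> dm X f \<in> obs X"
  by (auto simp: into_def dm_obs)

lemma idn_into [simp]: "U \<in> obs X \<Longrightarrow> idn X U \<in> into X U"
  by (auto simp: into_def idn_ars cd_idn)

lemma cmp_into [simp]: "\<lbrakk>f \<in> into X U; g \<in> into X (dm X f)\<rbrakk> \<Longrightarrow> cmp X f g \<in> into X U"
  by (auto simp: into_def cmp_ars cd_cmp)

lemma dm_cmp_into [simp]: "\<lbrakk>f \<in> into X U; g \<in> into X (dm X f)\<rbrakk> \<Longrightarrow> dm X (cmp X f g) = dm X g"
  by (auto simp: into_def dm_cmp)

lemma cmp_assoc_into: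
  "\<lbrakk>f \<in> into X U; g \<in> into X (dm X f); h \<in> into X (dm X g)\<rbrakk>
     \<Longrightarrow> cmp X (cmp X f g) h = cmp X f (cmp X g h)"
  by (auto simp: into_def cmp_assoc)

lemma cmp_idn_into [simp]: "f \<in> into X U \<Longrightarrow> cmp X f (idn X (dm X f)) = f"
    "f \<in> into X U \<Longrightarrow> cmp X (idn X U) f = f"
  by (auto simp: into_def cmp_idn_right cmp_idn_left)

lemma dm_idn' [simp]: "U \<in> obs X \<Longrightarrow> dm X (idn X U) = U"
  by (rule dm_idn)

lemma sieve_into: "\<lbrakk>U \<in> obs X; S \<in> cov X U; f \<in> S\<rbrakk> \<Longrightarrow> f \<in> into X U"
  using cov_sieve unfolding sieve_def by blast

lemma sieve_cmp: "\<lbrakk>U \<in> obs X; S \<in> cov X U; f \<in> S; h \<in> into X (dm X f)\<rbrakk> \<Longrightarrow> cmp X f h \<in> S"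
  using cov_sieve unfolding sieve_def by blast

text \<open>Pulled back along a member of \<open>S\<close>, the larger sieve is maximal, hence covering; the
  local character of coverings then applies.\<close>

lemma cov_mono:
  assumes "U \<in> obs X" "S \<in> cov X U" "S \<subseteq> R" "sieve X U R"
  shows "R \<in> cov X U"
proof (rule cov_local[OF assms(1,2,4)])
  fix f assume f: "f \<in> S"
  have "pull X f R = into X (dm X f)"
    using assms f sieve_cmp[OF assms(1,2) f] unfolding pull_def by blast
  thus "pull X f R \<in> cov X (dm X f)"
    using cov_max sieve_into[OF assms(1,2) f] by simp
qed

text \<open>Pulled back along a member of \<open>S\<close>, the intersection is the pullback of
  \<open>R\<close>.\<close>

lemma cov_inter:
  assumes "U \<in> obs X" "S \<in> cov X U" "R \<in> cov X U"
  shows "S \<inter> R \<in> cov X U"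
proof (rule cov_local[OF assms(1,2)])
  show "sieve X U (S \<inter> R)"
    using cov_sieve[OF assms(1,2)] cov_sieve[OF assms(1,3)] unfolding sieve_def by blast
next
  fix f assume f: "f \<in> S"
  have "pull X f (S \<inter> R) = pull X f R"
    using sieve_cmp[OF assms(1,2) f] unfolding pull_def by blast
  thus "pull X f (S \<inter> R) \<in> cov X (dm X f)"
    using cov_stable[OF assms(1,3)] sieve_into[OF assms(1,2) f] by simp
qed

lemma densely_conj:
  assumes "densely X D" "densely X D'"
  shows "densely X (\<lambda>U. D U \<and> D' U)"
  unfolding densely_def
proof
  fix U assume U: "U \<in> obs X"
  have "{f \<in> into X U. D (dm X f)} \<inter> {f \<in> into X U. D' (dm X f)} \<in> cov X U"
    using assms U cov_inter unfolding densely_def by blast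
  also have "{f \<in> into X U. D (dm X f)} \<inter> {f \<in> into X U. D' (dm X f)}
      = {f \<in> into X U. D (dm X f) \<and> D' (dm X f)}" by blast
  finally show "{f \<in> into X U. D (dm X f) \<and> D' (dm X f)} \<in> cov X U" .
qed

lemma densely_True [simp]: "densely X (\<lambda>U. True)"
  unfolding densely_def using cov_max by simp

lemma presheafD:
  assumes "is_presheaf X F" "f \<in> into X U"
  shows res_sec: "x \<in> sec F U \<Longrightarrow> res F f x \<in> sec F (dm X f)"
    and res_cmp: "\<lbrakk>x \<in> sec F U; h \<in> into X (dm X f)\<rbrakk> \<Longrightarrow> res F (cmp X f h) x = res F h (res F f x)"
  using assms unfolding is_presheaf_def by (auto simp: into_def)

lemma res_idn: "\<lbrakk>is_presheaf X F; U \<in> obs X; x \<in> sec F U\<rbrakk> \<Longrightarrow> res F (idn X U) x = x"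
  unfolding is_presheaf_def by blast

lemma presheafI:
  assumes "\<And>U f x. \<lbrakk>f \<in> into X U; x \<in> sec F U\<rbrakk> \<Longrightarrow> res F f x \<in> sec F (dm X f)"
    and "\<And>U x. \<lbrakk>U \<in> obs X; x \<in> sec F U\<rbrakk> \<Longrightarrow> res F (idn X U) x = x"
    and "\<And>U f h x. \<lbrakk>f \<in> into X U; h \<in> into X (dm X f); x \<in> sec F U\<rbrakk>
       \<Longrightarrow> res F (cmp X f h) x = res F h (res F f x)"
  shows "is_presheaf X F"
  using assms(1)[OF intoI] assms(2) assms(3)[OF intoI] unfolding is_presheaf_def by blast

lemma sheaf_presheaf: "is_sheaf X F \<Longrightarrow> is_presheaf X F"
  unfolding is_sheaf_def by blast

lemma sheaf_glue:
  assumes "is_sheaf X F" "U \<in> obs X" "S \<in> cov X U"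
    and "\<And>f. f \<in> S \<Longrightarrow> x f \<in> sec F (dm X f)"
    and "\<And>f h. \<lbrakk>f \<in> S; h \<in> into X (dm X f)\<rbrakk> \<Longrightarrow> x (cmp X f h) = res F h (x f)"
  shows "\<exists>!s. s \<in> sec F U \<and> (\<forall>f\<in>S. res F f s = x f)"
  using assms(1)[unfolded is_sheaf_def] assms(2-5) by simp

lemma sheaf_eqI:
  assumes F: "is_sheaf X F" "U \<in> obs X" "S \<in> cov X U" and s: "s \<in> sec F U" "s' \<in> sec F U"
    and eq: "\<And>f. f \<in> S \<Longrightarrow> res F f s = res F f s'"
  shows "s = s'"
proof -
  have "\<exists>!r. r \<in> sec F U \<and> (\<forall>f\<in>S. res F f r = res F f s)"
    using s presheafD[OF sheaf_presheaf[OF F(1)] sieve_into[OF F(2,3)]]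
    by (intro sheaf_glue F) auto
  with s eq show ?thesis by metis
qed

text \<open>The principle behind most equations below: identities between sections need to be proved only where
  the torsors that are involved have sections.\<close>

lemma eq_densely:
  assumes "is_sheaf X F" "densely X D" "U \<in> obs X" "s \<in> sec F U" "s' \<in> sec F U"
    and "\<And>f. \<lbrakk>f \<in> into X U; D (dm X f)\<rbrakk> \<Longrightarrow> res F f s = res F f s'"
  shows "s = s'"
proof (rule sheaf_eqI[OF assms(1,3) _ assms(4,5)])
  show "{f \<in> into X U. D (dm X f)} \<in> cov X U" using assms(2,3) unfolding densely_def by blast
qed (use assms(6) in blast)

lemma mapsI:
  assumes "\<And>U x. \<lbrakk>U \<in> obs X; x \<in> sec F U\<rbrakk> \<Longrightarrow> t U x \<in> sec H U"
    and "\<And>U f x. \<lbrakk>U \<in> obs X; f \<in> into X U; x \<in> sec F U\<rbrakk> \<Longrightarrow> res H f (t U x) = t (dm X f) (res F f x)"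
    and "is_presheaf X F"
  shows "mk_map X F t \<in> maps X F H"
proof -
  have "res F f x \<in> sec F (dm X f)" if "f \<in> ars X" "x \<in> sec F (cd X f)" for f x
    using res_sec[OF assms(3) intoI] that by blast
  thus ?thesis using assms(1) assms(2)[OF _ intoI] cd_obs dm_obs
    unfolding maps_def mk_map_def by auto
qed

lemma mk_map_apply [simp]: "\<lbrakk>U \<in> obs X; x \<in> sec F U\<rbrakk> \<Longrightarrow> mk_map X F t U x = t U x"
  unfolding mk_map_def by simp

lemma maps_sec: "\<lbrakk>t \<in> maps X F H; U \<in> obs X; x \<in> sec F U\<rbrakk> \<Longrightarrow> t U x \<in> sec H U"
  unfolding maps_def by blast

lemma maps_res: "\<lbrakk>t \<in> maps X F H; f \<in> into X U; x \<in> sec F U\<rbrakk>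
    \<Longrightarrow> res H f (t U x) = t (dm X f) (res F f x)"
  unfolding maps_def by (auto simp: into_def)

lemma maps_eqI:
  assumes "t \<in> maps X F H" "t' \<in> maps X F H'"
    and "\<And>U x. \<lbrakk>U \<in> obs X; x \<in> sec F U\<rbrakk> \<Longrightarrow> t U x = t' U x"
  shows "t = t'"
proof -
  have "t \<in> (\<Pi>\<^sub>E U\<in>obs X. sec F U \<rightarrow>\<^sub>E sec H U)" "t' \<in> (\<Pi>\<^sub>E U\<in>obs X. sec F U \<rightarrow>\<^sub>E sec H' U)"
    using assms unfolding maps_def by auto
  hence "t U x = t' U x" for U x
    using assms(3) unfolding PiE_def Pi_def extensional_def
    by (cases "U \<in> obs X"; cases "x \<in> sec F U") auto
  thus ?thesis by blast
qed

lemma maps_eq_densely: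
  assumes t: "t \<in> maps X F H" "t' \<in> maps X F H" and H: "is_sheaf X H" and F: "is_presheaf X F"
    and D: "densely X D" and eq: "\<And>U x. \<lbrakk>U \<in> obs X; D U; x \<in> sec F U\<rbrakk> \<Longrightarrow> t U x = t' U x"
  shows "t = t'"
proof (rule maps_eqI[OF t])
  fix U x assume U: "U \<in> obs X" and x: "x \<in> sec F U"
  show "t U x = t' U x"
  proof (rule eq_densely[OF H D U maps_sec[OF t(1) U x] maps_sec[OF t(2) U x]])
    fix f assume f: "f \<in> into X U" "D (dm X f)"
    show "res H f (t U x) = res H f (t' U x)"
      using eq[OF _ f(2) res_sec[OF F f(1) x]] maps_res[OF t(1) f(1) x] maps_res[OF t(2) f(1) x] f(1)
      by simp
  qed
qed

text \<open>Injectivity is a statement about equality, hence local; granted injectivity, the local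
  preimages of a section agree on overlaps and glue.\<close>

lemma bij_densely:
  assumes t: "t \<in> maps X F H" and F: "is_sheaf X F" and H: "is_sheaf X H" and D: "densely X D"
    and bij: "\<And>U. \<lbrakk>U \<in> obs X; D U\<rbrakk> \<Longrightarrow> bij_betw (t U) (sec F U) (sec H U)"
    and U: "U \<in> obs X"
  shows "bij_betw (t U) (sec F U) (sec H U)"
proof -
  note PF = sheaf_presheaf[OF F] and PH = sheaf_presheaf[OF H]
  have inj: "inj_on (t V) (sec F V)" if V: "V \<in> obs X" for V
  proof (rule inj_onI)
    fix x y assume xy: "x \<in> sec F V" "y \<in> sec F V" "t V x = t V y"
    show "x = y"
    proof (rule eq_densely[OF F D V xy(1,2)])
      fix f assume f: "f \<in> into X V" "D (dm X f)"
      have "t (dm X f) (res F f x) = t (dm X f) (res F f y)"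
        using xy f maps_res[OF t] by metis
      thus "res F f x = res F f y"
        using inj_onD[OF bij_betw_imp_inj_on[OF bij[OF _ f(2)]]] f res_sec[OF PF f(1)] xy by simp
    qed
  qed
  have "t U ` sec F U = sec H U"
  proof safe
    fix x assume "x \<in> sec F U" thus "t U x \<in> sec H U" using maps_sec[OF t U] by blast
  next
    fix y assume y: "y \<in> sec H U"
    let ?S = "{f \<in> into X U. D (dm X f)}"
    let ?x = "\<lambda>f. inv_into (sec F (dm X f)) (t (dm X f)) (res H f y)"
    have S: "?S \<in> cov X U" using D U unfolding densely_def by blast
    have x: "?x f \<in> sec F (dm X f)" "t (dm X f) (?x f) = res H f y" if "f \<in> ?S" for f
    proof -
      have "res H f y \<in> t (dm X f) ` sec F (dm X f)"
        using that bij[of "dm X f"] res_sec[OF PH, of f U y] y unfolding bij_betw_def by auto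
      thus "?x f \<in> sec F (dm X f)" "t (dm X f) (?x f) = res H f y"
        by (auto intro: inv_into_into f_inv_into_f)
    qed
    have "\<exists>!s. s \<in> sec F U \<and> (\<forall>f\<in>?S. res F f s = ?x f)"
    proof (rule sheaf_glue[OF F U S])
      fix f h assume f: "f \<in> ?S" and h: "h \<in> into X (dm X f)"
      have f': "f \<in> into X U" using f by simp
      have fh: "cmp X f h \<in> ?S" using sieve_cmp[OF U S f h] .
      have dm: "dm X (cmp X f h) = dm X h" using f' h by simp
      have "t (dm X h) (?x (cmp X f h)) = res H h (res H f y)"
        using x(2)[OF fh] res_cmp[OF PH f' y h] dm by simp
      also have "\<dots> = t (dm X h) (res F h (?x f))"
        using x[OF f] maps_res[OF t h x(1)[OF f]] by simp
      finally show "?x (cmp X f h) = res F h (?x f)"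
        using inj_onD[OF inj[OF dm_into[OF h]]] x(1)[OF fh] res_sec[OF PF h x(1)[OF f]]
        unfolding dm by blast
    qed (use x in auto)
    then obtain s where s: "s \<in> sec F U" "\<And>f. f \<in> ?S \<Longrightarrow> res F f s = ?x f" by blast
    have "t U s = y"
    proof (rule sheaf_eqI[OF H U S maps_sec[OF t U s(1)] y])
      fix f assume f: "f \<in> ?S"
      hence "res H f (t U s) = t (dm X f) (?x f)" using maps_res[OF t _ s(1), of f] s(2)[OF f] by simp
      also have "\<dots> = res H f y" by (rule x(2)[OF f])
      finally show "res H f (t U s) = res H f y" .
    qed
    thus "y \<in> t U ` sec F U" using s by blast
  qed
  thus ?thesis using inj[OF U] unfolding bij_betw_def by blast
qed

text \<open>A section is prescribed by a formula in a variable \<open>u\<close> that ranges over the local sections of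
  \<open>P\<close>, provided that the formula does not depend on the choice of \<open>u\<close>. All constructions on
  contracted products are instances.\<close>

lemma glue_over:
  assumes F: "is_sheaf X F" and P: "is_presheaf X P" and D: "densely X (\<lambda>U. sec P U \<noteq> {})"
    and U: "U \<in> obs X"
    and k_sec: "\<And>f u. \<lbrakk>f \<in> into X U; u \<in> sec P (dm X f)\<rbrakk> \<Longrightarrow> k f u \<in> sec F (dm X f)"
    and k_res: "\<And>f u h. \<lbrakk>f \<in> into X U; u \<in> sec P (dm X f); h \<in> into X (dm X f)\<rbrakk>
        \<Longrightarrow> res F h (k f u) = k (cmp X f h) (res P h u)"
    and k_indep: "\<And>f u v. \<lbrakk>f \<in> into X U; u \<in> sec P (dm X f); v \<in> sec P (dm X f)\<rbrakk> \<Longrightarrow> k f u = k f v"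
  shows "\<exists>!z. z \<in> sec F U \<and> (\<forall>f\<in>into X U. \<forall>u\<in>sec P (dm X f). res F f z = k f u)"
proof -
  let ?S = "{f \<in> into X U. sec P (dm X f) \<noteq> {}}"
  let ?k = "\<lambda>f. k f (SOME u. u \<in> sec P (dm X f))"
  have S: "?S \<in> cov X U" using D U unfolding densely_def by blast
  have k: "?k f = k f u" if "f \<in> into X U" "u \<in> sec P (dm X f)" for f u
    using k_indep[OF that(1) someI[of "\<lambda>u. u \<in> sec P (dm X f)", OF that(2)] that(2)] .
  have "\<exists>!z. z \<in> sec F U \<and> (\<forall>f\<in>?S. res F f z = ?k f)"
  proof (rule sheaf_glue[OF F U S])
    fix f assume "f \<in> ?S"
    thus "?k f \<in> sec F (dm X f)" using k k_sec by fastforce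
  next
    fix f h assume f: "f \<in> ?S" and h: "h \<in> into X (dm X f)"
    then obtain u where u: "f \<in> into X U" "u \<in> sec P (dm X f)" by blast
    show "?k (cmp X f h) = res F h (?k f)"
      using k[OF u] k[of "cmp X f h" "res P h u"] k_res[OF u h] u h res_sec[OF P h u(2)] by simp
  qed
  moreover have "(\<forall>f\<in>?S. res F f z = ?k f) \<longleftrightarrow>
      (\<forall>f\<in>into X U. \<forall>u\<in>sec P (dm X f). res F f z = k f u)" for z
    using k by auto
  ultimately show ?thesis by simp
qed

end

section \<open>Sheafification\<close>

context grothendieck_site
begin

context
  fixes Q :: "('o, 'm, 'q) presheaf"
  assumes Q: "is_presheaf X Q"
begin

lemma sieve_loc_eq: "\<lbrakk>q \<in> sec Q U; q' \<in> sec Q U\<rbrakk>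
    \<Longrightarrow> sieve X U {h \<in> into X U. res Q h q = res Q h q'}"
  unfolding sieve_def by (auto simp: res_cmp[OF Q])

lemma loc_eq_refl: "U \<in> obs X \<Longrightarrow> loc_eq X Q U q q"
  unfolding loc_eq_def using cov_max by simp

lemma loc_eq_sym: "loc_eq X Q U q q' \<Longrightarrow> loc_eq X Q U q' q"
  unfolding loc_eq_def by (simp add: eq_commute)

lemma loc_eq_trans:
  assumes "U \<in> obs X" "q \<in> sec Q U" "q'' \<in> sec Q U" "loc_eq X Q U q q'" "loc_eq X Q U q' q''"
  shows "loc_eq X Q U q q''"
  unfolding loc_eq_def
  by (rule cov_mono[OF assms(1) cov_inter[OF assms(1) assms(4,5)[unfolded loc_eq_def]]])
    (use assms sieve_loc_eq in auto)

lemma loc_eq_res: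
  assumes "U \<in> obs X" "q \<in> sec Q U" "q' \<in> sec Q U" "loc_eq X Q U q q'" "f \<in> into X U"
  shows "loc_eq X Q (dm X f) (res Q f q) (res Q f q')"
proof -
  have "pull X f {h \<in> into X U. res Q h q = res Q h q'}
      = {h \<in> into X (dm X f). res Q h (res Q f q) = res Q h (res Q f q')}"
    using assms by (auto simp: pull_def res_cmp[OF Q])
  thus ?thesis using cov_stable[OF assms(1) assms(4)[unfolded loc_eq_def] assms(5)]
    unfolding loc_eq_def by simp
qed

text \<open>Local equality is local: this is the transitivity of coverings, and it makes the set representing
  \<open>to_sheaf X Q U q\<close> closed under gluing.\<close>

lemma loc_eq_local:
  assumes "U \<in> obs X" "q \<in> sec Q U" "q' \<in> sec Q U" "S \<in> cov X U"
    and "\<And>h. h \<in> S \<Longrightarrow> loc_eq X Q (dm X h) (res Q h q) (res Q h q')"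
  shows "loc_eq X Q U q q'"
  unfolding loc_eq_def
proof (rule cov_local[OF assms(1,4) sieve_loc_eq[OF assms(2,3)]])
  fix f assume f: "f \<in> S"
  have "pull X f {h \<in> into X U. res Q h q = res Q h q'}
      = {h \<in> into X (dm X f). res Q h (res Q f q) = res Q h (res Q f q')}"
    using assms sieve_into[OF assms(1,4) f] by (auto simp: pull_def res_cmp[OF Q])
  thus "pull X f {h \<in> into X U. res Q h q = res Q h q'} \<in> cov X (dm X f)"
    using assms(5)[OF f] unfolding loc_eq_def by simp
qed

lemma sheafify_sec_iff:
  "s \<in> sec (sheafify X Q) U \<longleftrightarrow>
     s \<subseteq> {(f, q). f \<in> into X U \<and> q \<in> sec Q (dm X f)} \<and>
     (\<forall>(f, q)\<in>s. \<forall>h\<in>into X (dm X f). (cmp X f h, res Q h q) \<in> s) \<and>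
     (\<forall>f q q'. (f, q) \<in> s \<and> (f, q') \<in> s \<longrightarrow> loc_eq X Q (dm X f) q q') \<and>
     fst ` s \<in> cov X U \<and>
     (\<forall>f\<in>into X U. \<forall>q\<in>sec Q (dm X f).
        {h \<in> into X (dm X f). (cmp X f h, res Q h q) \<in> s} \<in> cov X (dm X f) \<longrightarrow> (f, q) \<in> s)"
  unfolding sheafify_def by simp

lemma sheafify_secI:
  assumes "\<And>f q. (f, q) \<in> s \<Longrightarrow> f \<in> into X U \<and> q \<in> sec Q (dm X f)"
    and "\<And>f q h. \<lbrakk>(f, q) \<in> s; h \<in> into X (dm X f)\<rbrakk> \<Longrightarrow> (cmp X f h, res Q h q) \<in> s"
    and "\<And>f q q'. \<lbrakk>(f, q) \<in> s; (f, q') \<in> s\<rbrakk> \<Longrightarrow> loc_eq X Q (dm X f) q q'"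
    and "fst ` s \<in> cov X U"
    and "\<And>f q. \<lbrakk>f \<in> into X U; q \<in> sec Q (dm X f);
        {h \<in> into X (dm X f). (cmp X f h, res Q h q) \<in> s} \<in> cov X (dm X f)\<rbrakk> \<Longrightarrow> (f, q) \<in> s"
  shows "s \<in> sec (sheafify X Q) U"
  unfolding sheafify_sec_iff
proof (intro conjI ballI impI allI)
  show "s \<subseteq> {(f, q). f \<in> into X U \<and> q \<in> sec Q (dm X f)}" using assms(1) by blast
  show "case z of (f, q) \<Rightarrow> \<forall>h\<in>into X (dm X f). (cmp X f h, res Q h q) \<in> s" if "z \<in> s" for z
    using assms(2) that by (cases z) simp
qed (use assms(3-5) in blast)+

lemma sheafify_secD:
  assumes "s \<in> sec (sheafify X Q) U"
  shows sh_sub: "(f, q) \<in> s \<Longrightarrow> f \<in> into X U" "(f, q) \<in> s \<Longrightarrow> q \<in> sec Q (dm X f)"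
    and sh_res: "\<lbrakk>(f, q) \<in> s; h \<in> into X (dm X f)\<rbrakk> \<Longrightarrow> (cmp X f h, res Q h q) \<in> s"
    and sh_eq: "\<lbrakk>(f, q) \<in> s; (f, q') \<in> s\<rbrakk> \<Longrightarrow> loc_eq X Q (dm X f) q q'"
    and sh_cov: "fst ` s \<in> cov X U"
    and sh_glue: "\<lbrakk>f \<in> into X U; q \<in> sec Q (dm X f);
        {h \<in> into X (dm X f). (cmp X f h, res Q h q) \<in> s} \<in> cov X (dm X f)\<rbrakk> \<Longrightarrow> (f, q) \<in> s"
  using assms[unfolded sheafify_sec_iff] by blast+

lemma sheafify_res:
  "res (sheafify X Q) g s = {(f, q). f \<in> into X (dm X g) \<and> (cmp X g f, q) \<in> s}"
  unfolding sheafify_def by simp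

lemma sheafify_presheaf: "is_presheaf X (sheafify X Q)"
proof (rule presheafI)
  fix U g s assume g: "g \<in> into X U" and s: "s \<in> sec (sheafify X Q) U"
  note D = sheafify_secD[OF s]
  have U: "U \<in> obs X" using g into_ars cd_obs by metis
  show "res (sheafify X Q) g s \<in> sec (sheafify X Q) (dm X g)"
    unfolding sheafify_res
  proof (rule sheafify_secI)
    have "fst ` {(f, q). f \<in> into X (dm X g) \<and> (cmp X g f, q) \<in> s} = pull X g (fst ` s)"
      unfolding pull_def by force
    thus "fst ` {(f, q). f \<in> into X (dm X g) \<and> (cmp X g f, q) \<in> s} \<in> cov X (dm X g)"
      using cov_stable[OF U D(5) g] by simp
  next
    fix f q assume f: "f \<in> into X (dm X g)" and q: "q \<in> sec Q (dm X f)"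
      and c: "{h \<in> into X (dm X f). (cmp X f h, res Q h q) \<in>
          {(f, q). f \<in> into X (dm X g) \<and> (cmp X g f, q) \<in> s}} \<in> cov X (dm X f)"
    have "{h \<in> into X (dm X f). (cmp X f h, res Q h q) \<in>
          {(f, q). f \<in> into X (dm X g) \<and> (cmp X g f, q) \<in> s}}
       = {h \<in> into X (dm X (cmp X g f)). (cmp X (cmp X g f) h, res Q h q) \<in> s}"
      using f g by (auto simp: cmp_assoc_into)
    with c have "(cmp X g f, q) \<in> s"
      using D(6)[of "cmp X g f" q] f g q by simp
    thus "(f, q) \<in> {(f, q). f \<in> into X (dm X g) \<and> (cmp X g f, q) \<in> s}" using f by simp
  next
    fix f q h assume "(f, q) \<in> {(f, q). f \<in> into X (dm X g) \<and> (cmp X g f, q) \<in> s}"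
      and h: "h \<in> into X (dm X f)"
    hence f: "f \<in> into X (dm X g)" and fq: "(cmp X g f, q) \<in> s" by auto
    show "(cmp X f h, res Q h q) \<in> {(f, q). f \<in> into X (dm X g) \<and> (cmp X g f, q) \<in> s}"
      using D(3)[OF fq, of h] f g h by (auto simp: cmp_assoc_into)
  next
    fix f q assume "(f, q) \<in> {(f, q). f \<in> into X (dm X g) \<and> (cmp X g f, q) \<in> s}"
    hence "f \<in> into X (dm X g)" "(cmp X g f, q) \<in> s" by auto
    thus "f \<in> into X (dm X g) \<and> q \<in> sec Q (dm X f)"
      using D(2) g by fastforce
  next
    fix f q q' assume "(f, q) \<in> {(f, q). f \<in> into X (dm X g) \<and> (cmp X g f, q) \<in> s}"
      "(f, q') \<in> {(f, q). f \<in> into X (dm X g) \<and> (cmp X g f, q) \<in> s}"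
    hence "f \<in> into X (dm X g)" "(cmp X g f, q) \<in> s" "(cmp X g f, q') \<in> s" by auto
    thus "loc_eq X Q (dm X f) q q'" using D(4)[of "cmp X g f" q q'] g by simp
  qed
next
  fix U s assume U: "U \<in> obs X" and s: "s \<in> sec (sheafify X Q) U"
  show "res (sheafify X Q) (idn X U) s = s"
    unfolding sheafify_res using U sh_sub(1)[OF s] by auto
next
  fix U f h s assume f: "f \<in> into X U" and h: "h \<in> into X (dm X f)"
  show "res (sheafify X Q) (cmp X f h) s = res (sheafify X Q) h (res (sheafify X Q) f s)"
    unfolding sheafify_res using f h by (auto simp: cmp_assoc_into)
qed

lemma to_sheaf_sec:
  assumes U: "U \<in> obs X" and q: "q \<in> sec Q U"
  shows "to_sheaf X Q U q \<in> sec (sheafify X Q) U"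
proof (rule sheafify_secI)
  have "fst ` to_sheaf X Q U q = into X U"
  proof safe
    fix f assume "f \<in> into X U"
    hence "(f, res Q f q) \<in> to_sheaf X Q U q"
      using q loc_eq_refl unfolding to_sheaf_def by (auto simp: res_sec[OF Q])
    thus "f \<in> fst ` to_sheaf X Q U q" by force
  qed (auto simp: to_sheaf_def)
  thus "fst ` to_sheaf X Q U q \<in> cov X U" using cov_max[OF U] by simp
next
  fix f q' h assume "(f, q') \<in> to_sheaf X Q U q" and h: "h \<in> into X (dm X f)"
  hence f: "f \<in> into X U" "q' \<in> sec Q (dm X f)" "loc_eq X Q (dm X f) q' (res Q f q)"
    unfolding to_sheaf_def by auto
  have "loc_eq X Q (dm X h) (res Q h q') (res Q h (res Q f q))"
    using f h q by (intro loc_eq_res) (auto simp: res_sec[OF Q])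
  thus "(cmp X f h, res Q h q') \<in> to_sheaf X Q U q"
    using f h q unfolding to_sheaf_def by (auto simp: res_sec[OF Q] res_cmp[OF Q])
next
  fix f q' q'' assume "(f, q') \<in> to_sheaf X Q U q" "(f, q'') \<in> to_sheaf X Q U q"
  thus "loc_eq X Q (dm X f) q' q''"
    unfolding to_sheaf_def using loc_eq_trans[OF _ _ _ _ loc_eq_sym] by auto
next
  fix f q' assume f: "f \<in> into X U" and q': "q' \<in> sec Q (dm X f)"
    and c: "{h \<in> into X (dm X f). (cmp X f h, res Q h q') \<in> to_sheaf X Q U q} \<in> cov X (dm X f)"
  have "loc_eq X Q (dm X f) q' (res Q f q)"
    by (rule loc_eq_local[OF _ q' _ c])
      (use f q in \<open>auto simp: to_sheaf_def res_sec[OF Q] res_cmp[OF Q]\<close>)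
  thus "(f, q') \<in> to_sheaf X Q U q" using f q' unfolding to_sheaf_def by simp
qed (auto simp: to_sheaf_def)

text \<open>A section of the associated sheaf is the record of all its representatives: the pair \<open>(f,
  q)\<close> belongs to it exactly if it restricts along \<open>f\<close> to the image of \<open>q\<close>.
  Contracted products access the representatives of a section through this equivalence.\<close>

lemma sheafify_mem:
  assumes U: "U \<in> obs X" and s: "s \<in> sec (sheafify X Q) U"
  shows "(f, q) \<in> s \<longleftrightarrow>
     f \<in> into X U \<and> q \<in> sec Q (dm X f) \<and> res (sheafify X Q) f s = to_sheaf X Q (dm X f) q"
proof (intro iffI conjI)
  note D = sheafify_secD[OF s]
  assume fq: "(f, q) \<in> s"
  show f: "f \<in> into X U" and q: "q \<in> sec Q (dm X f)" using D(1,2) fq by auto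
  show "res (sheafify X Q) f s = to_sheaf X Q (dm X f) q"
  proof (rule equalityI; rule subrelI)
    fix g r assume "(g, r) \<in> res (sheafify X Q) f s"
    hence g: "g \<in> into X (dm X f)" and gr: "(cmp X f g, r) \<in> s" unfolding sheafify_res by auto
    show "(g, r) \<in> to_sheaf X Q (dm X f) q"
      using D(2)[OF gr] D(4)[OF gr D(3)[OF fq g]] g f unfolding to_sheaf_def by simp
  next
    fix g r assume "(g, r) \<in> to_sheaf X Q (dm X f) q"
    hence g: "g \<in> into X (dm X f)" and r: "r \<in> sec Q (dm X g)"
      and e: "loc_eq X Q (dm X g) r (res Q g q)" unfolding to_sheaf_def by auto
    have "{h \<in> into X (dm X g). (cmp X (cmp X f g) h, res Q h r) \<in> s} \<in> cov X (dm X g)"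
    proof (rule cov_mono[OF _ e[unfolded loc_eq_def]])
      show "{h \<in> into X (dm X g). res Q h r = res Q h (res Q g q)}
        \<subseteq> {h \<in> into X (dm X g). (cmp X (cmp X f g) h, res Q h r) \<in> s}"
        using D(3)[OF D(3)[OF fq g]] f g by auto
      show "sieve X (dm X g) {h \<in> into X (dm X g). (cmp X (cmp X f g) h, res Q h r) \<in> s}"
        unfolding sieve_def
      proof (intro conjI ballI)
        fix h k assume h: "h \<in> {h \<in> into X (dm X g). (cmp X (cmp X f g) h, res Q h r) \<in> s}"
          and k: "k \<in> into X (dm X h)"
        hence h': "h \<in> into X (dm X g)" "(cmp X (cmp X f g) h, res Q h r) \<in> s" by auto
        have fg: "cmp X f g \<in> into X U" using f g by simp
        have dmfg: "h \<in> into X (dm X (cmp X f g))" using f g h' by simp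
        have dmfgh: "k \<in> into X (dm X (cmp X (cmp X f g) h))"
          using dm_cmp_into[OF fg dmfg] k by simp
        have "(cmp X (cmp X (cmp X f g) h) k, res Q k (res Q h r)) \<in> s"
          using D(3)[OF h'(2) dmfgh] .
        moreover have "cmp X (cmp X (cmp X f g) h) k = cmp X (cmp X f g) (cmp X h k)"
          by (rule cmp_assoc_into[OF fg dmfg k])
        ultimately show "cmp X h k \<in> {h \<in> into X (dm X g). (cmp X (cmp X f g) h, res Q h r) \<in> s}"
          using h' k r by (simp add: res_cmp[OF Q])
      qed auto
    qed (use g in auto)
    hence "(cmp X f g, r) \<in> s" using D(6)[of "cmp X f g" r] f g r by simp
    thus "(g, r) \<in> res (sheafify X Q) f s" using g unfolding sheafify_res by simp
  qed
next
  assume *: "f \<in> into X U \<and> q \<in> sec Q (dm X f) \<and> res (sheafify X Q) f s = to_sheaf X Q (dm X f) q"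
  hence "(idn X (dm X f), q) \<in> res (sheafify X Q) f s"
    using loc_eq_refl by (auto simp: to_sheaf_def res_idn[OF Q])
  hence "(cmp X f (idn X (dm X f)), q) \<in> s" unfolding sheafify_res by blast
  thus "(f, q) \<in> s" using * cmp_idn_into(1)[of f U] by simp
qed

lemma to_sheaf_res:
  assumes "U \<in> obs X" "q \<in> sec Q U" "f \<in> into X U"
  shows "res (sheafify X Q) f (to_sheaf X Q U q) = to_sheaf X Q (dm X f) (res Q f q)"
proof -
  have "(f, res Q f q) \<in> to_sheaf X Q U q"
    using assms loc_eq_refl unfolding to_sheaf_def by (auto simp: res_sec[OF Q])
  thus ?thesis using sheafify_mem[OF assms(1) to_sheaf_sec[OF assms(1,2)]] by blast
qed

text \<open>The pair of an identity arrow and \<open>q\<close> represents the image of \<open>q\<close>;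
  membership in the image of \<open>q'\<close> is local equality by definition.\<close>

lemma to_sheaf_eqD:
  assumes "U \<in> obs X" "q \<in> sec Q U" "q' \<in> sec Q U" "to_sheaf X Q U q = to_sheaf X Q U q'"
  shows "loc_eq X Q U q q'"
proof -
  have "(idn X U, q) \<in> to_sheaf X Q U q"
    using assms(1,2) loc_eq_refl unfolding to_sheaf_def by (auto simp: res_idn[OF Q])
  thus ?thesis using assms unfolding assms(4) by (auto simp: to_sheaf_def res_idn[OF Q])
qed

text \<open>The glued section consists of the pairs \<open>(g, q)\<close> that belong to the given sections after
  restriction along a covering sieve.\<close>

lemma sheafify_sheaf: "is_sheaf X (sheafify X Q)"
  unfolding is_sheaf_def
proof (intro conjI sheafify_presheaf ballI allI impI)
  let ?T = "sheafify X Q"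
  note PT = sheafify_presheaf
  fix U S x assume U: "U \<in> obs X" and S: "S \<in> cov X U"
    and x: "(\<forall>f\<in>S. x f \<in> sec ?T (dm X f)) \<and>
       (\<forall>f\<in>S. \<forall>h\<in>into X (dm X f). x (cmp X f h) = res ?T h (x f))"
  have xs: "x f \<in> sec ?T (dm X f)" if "f \<in> S" for f using x that by blast
  have xr: "x (cmp X f h) = res ?T h (x f)" if "f \<in> S" "h \<in> into X (dm X f)" for f h
    using x that by blast
  have SU: "f \<in> into X U" if "f \<in> S" for f using sieve_into[OF U S that] .
  \<comment> \<open>the arrows \<open>h\<close> along which \<open>(g, q)\<close> lands in \<open>S\<close> and
    then represents the given section; by \<open>mem\<close> below, this says that the section over the domain
    of \<open>h\<close> is the image of \<open>q\<close> restricted along \<open>h\<close>\<close>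
  define L where "L g q = {h \<in> into X (dm X g). cmp X g h \<in> S \<and> (idn X (dm X h), res Q h q) \<in> x (cmp X g h)}"
    for g q
  define s where "s = {(g, q). g \<in> into X U \<and> q \<in> sec Q (dm X g) \<and> L g q \<in> cov X (dm X g)}"
  have mem: "(idn X (dm X h), res Q h q) \<in> x (cmp X g h) \<longleftrightarrow> x (cmp X g h) = to_sheaf X Q (dm X h) (res Q h q)"
    if "g \<in> into X U" "q \<in> sec Q (dm X g)" "h \<in> into X (dm X g)" "cmp X g h \<in> S" for g q h
    using that sheafify_mem[OF _ xs[OF that(4)], of "idn X (dm X h)" "res Q h q"] xs[OF that(4)]
    by (auto simp: res_sec[OF Q] res_idn[OF PT])
  have L_sieve: "sieve X (dm X g) (L g q)" if g: "g \<in> into X U" "q \<in> sec Q (dm X g)" for g q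
    unfolding sieve_def
  proof (intro conjI ballI)
    fix h k assume h: "h \<in> L g q" and k: "k \<in> into X (dm X h)"
    have h': "h \<in> into X (dm X g)" "cmp X g h \<in> S" using h unfolding L_def by auto
    have e: "x (cmp X g h) = to_sheaf X Q (dm X h) (res Q h q)"
      using h mem[OF g h'] unfolding L_def by blast
    have k': "k \<in> into X (dm X (cmp X g h))" using k g h' by simp
    have ghk: "cmp X g (cmp X h k) \<in> S" "cmp X g (cmp X h k) = cmp X (cmp X g h) k"
      using sieve_cmp[OF U S h'(2) k'] cmp_assoc_into[OF g(1) h'(1) k] by auto
    have "x (cmp X g (cmp X h k)) = to_sheaf X Q (dm X k) (res Q k (res Q h q))"
      using ghk(2) xr[OF h'(2) k'] e to_sheaf_res[of "dm X h" "res Q h q" k] h' k g res_sec[OF Q h'(1) g(2)]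
      by simp
    thus "cmp X h k \<in> L g q"
      using mem[OF g, of "cmp X h k"] ghk h' k g res_cmp[OF Q h'(1) g(2) k] unfolding L_def by auto
  qed (auto simp: L_def)
  have L_res: "pull X h (L g q) = L (cmp X g h) (res Q h q)"
    if g: "g \<in> into X U" "q \<in> sec Q (dm X g)" and h: "h \<in> into X (dm X g)" for g q h
    using g h unfolding L_def pull_def by (auto simp: cmp_assoc_into res_cmp[OF Q])
  have s_sec: "s \<in> sec ?T U"
  proof (rule sheafify_secI)
    fix g q h assume gq: "(g, q) \<in> s" and h: "h \<in> into X (dm X g)"
    hence g: "g \<in> into X U" "q \<in> sec Q (dm X g)" "L g q \<in> cov X (dm X g)" unfolding s_def by auto
    show "(cmp X g h, res Q h q) \<in> s"
      using L_res[OF g(1,2) h] cov_stable[OF _ g(3) h] g h res_sec[OF Q h g(2)] unfolding s_def by simp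
  next
    fix g q q' assume "(g, q) \<in> s" "(g, q') \<in> s"
    hence g: "g \<in> into X U" "q \<in> sec Q (dm X g)" "q' \<in> sec Q (dm X g)"
      "L g q \<in> cov X (dm X g)" "L g q' \<in> cov X (dm X g)" unfolding s_def by auto
    have c: "L g q \<inter> L g q' \<in> cov X (dm X g)" using cov_inter g by simp
    show "loc_eq X Q (dm X g) q q'"
    proof (rule loc_eq_local[OF _ g(2,3) c])
      fix h assume "h \<in> L g q \<inter> L g q'"
      hence h: "h \<in> into X (dm X g)" "cmp X g h \<in> S" "x (cmp X g h) = to_sheaf X Q (dm X h) (res Q h q)"
        "x (cmp X g h) = to_sheaf X Q (dm X h) (res Q h q')"
        using mem[OF g(1,2)] mem[OF g(1,3)] unfolding L_def by auto
      thus "loc_eq X Q (dm X h) (res Q h q) (res Q h q')"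
        using to_sheaf_eqD[of "dm X h"] g res_sec[OF Q h(1)] by simp
    qed (use g in auto)
  next
    have "fst ` s \<in> cov X U"
    proof (rule cov_local[OF U S])
      show "sieve X U (fst ` s)"
        unfolding sieve_def
      proof (intro conjI ballI)
        fix g h assume "g \<in> fst ` s" and h: "h \<in> into X (dm X g)"
        then obtain q where g: "g \<in> into X U" "q \<in> sec Q (dm X g)" "L g q \<in> cov X (dm X g)"
          unfolding s_def by auto
        have "(cmp X g h, res Q h q) \<in> s"
          using L_res[OF g(1,2) h] cov_stable[OF _ g(3) h] g h res_sec[OF Q h g(2)] unfolding s_def by simp
        thus "cmp X g h \<in> fst ` s" by force
      qed (auto simp: s_def)
    next
      fix f assume f: "f \<in> S"
      note fD = sheafify_secD[OF xs[OF f]]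
      have "fst ` x f \<subseteq> pull X f (fst ` s)"
      proof
        fix g assume "g \<in> fst ` x f"
        then obtain q where gq: "(g, q) \<in> x f" by auto
        have g: "g \<in> into X (dm X f)" and q: "q \<in> sec Q (dm X g)" using fD(1,2)[OF gq] by auto
        have "L (cmp X f g) q = into X (dm X g)"
        proof (intro Set.set_eqI iffI)
          fix h assume h: "h \<in> into X (dm X g)"
          have fgh: "cmp X (cmp X f g) h = cmp X f (cmp X g h)" by (rule cmp_assoc_into[OF SU[OF f] g h])
          have gh: "cmp X g h \<in> into X (dm X f)" using g h by simp
          have "(cmp X g h, res Q h q) \<in> x f" using fD(3)[OF gq h] .
          hence "(idn X (dm X h), res Q h q) \<in> x (cmp X f (cmp X g h))"
            using xr[OF f gh] h gh g cmp_idn_into(1)[OF gh] by (auto simp: sheafify_res)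
          thus "h \<in> L (cmp X f g) q"
            using h g fgh SU[OF f] sieve_cmp[OF U S f gh] unfolding L_def by simp
        qed (use SU[OF f] g in \<open>auto simp: L_def\<close>)
        hence "(cmp X f g, q) \<in> s" using SU[OF f] g q cov_max unfolding s_def by simp
        thus "g \<in> pull X f (fst ` s)" using g unfolding pull_def by force
      qed
      moreover have "sieve X (dm X f) (pull X f (fst ` s))"
        unfolding sieve_def
      proof (intro conjI ballI)
        fix g h assume "g \<in> pull X f (fst ` s)" and h: "h \<in> into X (dm X g)"
        then obtain q where g0: "g \<in> into X (dm X f)" and
            g: "cmp X f g \<in> into X U" "q \<in> sec Q (dm X (cmp X f g))" "L (cmp X f g) q \<in> cov X (dm X (cmp X f g))"
          unfolding s_def pull_def by auto
        have h': "h \<in> into X (dm X (cmp X f g))" using h SU[OF f] g0 by simp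
        have "(cmp X (cmp X f g) h, res Q h q) \<in> s"
          using L_res[OF g(1,2) h'] cov_stable[OF _ g(3) h'] g h' res_sec[OF Q h' g(2)] unfolding s_def by simp
        thus "cmp X g h \<in> pull X f (fst ` s)"
          using g0 h cmp_assoc_into[OF SU[OF f] g0 h] unfolding pull_def by force
      qed (auto simp: pull_def)
      ultimately show "pull X f (fst ` s) \<in> cov X (dm X f)"
        using cov_mono[OF _ fD(5)] SU[OF f] by simp
    qed
    thus "fst ` s \<in> cov X U" .
  next
    fix g q assume g: "g \<in> into X U" "q \<in> sec Q (dm X g)"
      and c: "{h \<in> into X (dm X g). (cmp X g h, res Q h q) \<in> s} \<in> cov X (dm X g)"
    have "L g q \<in> cov X (dm X g)"
      by (rule cov_local[OF _ c L_sieve[OF g]]) (use g L_res[OF g] in \<open>auto simp: s_def\<close>)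
    thus "(g, q) \<in> s" using g unfolding s_def by simp
  qed (auto simp: s_def)
  have s_res: "res ?T f s = x f" if f: "f \<in> S" for f
  proof (rule equalityI; rule subrelI)
    note fD = sheafify_secD[OF xs[OF f]]
    have *: "L (cmp X f g) q = {h \<in> into X (dm X g). (cmp X g h, res Q h q) \<in> x f}"
      if g: "g \<in> into X (dm X f)" "q \<in> sec Q (dm X g)" for g q
    proof -
      have "(idn X (dm X h), res Q h q) \<in> x (cmp X f (cmp X g h)) \<longleftrightarrow> (cmp X g h, res Q h q) \<in> x f"
        if h: "h \<in> into X (dm X g)" for h
      proof -
        have gh: "cmp X g h \<in> into X (dm X f)" using g h by simp
        have "cmp X (cmp X g h) (idn X (dm X h)) = cmp X g h" using cmp_idn_into(1)[OF gh] g h by simp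
        thus ?thesis using xr[OF f gh] g h gh by (auto simp: sheafify_res)
      qed
      thus ?thesis using g SU[OF f] sieve_cmp[OF U S f] unfolding L_def
        by (auto simp: cmp_assoc_into)
    qed
    fix g q
    {
      assume "(g, q) \<in> res ?T f s"
      hence g: "g \<in> into X (dm X f)" "q \<in> sec Q (dm X g)" "L (cmp X f g) q \<in> cov X (dm X g)"
        using SU[OF f] unfolding sheafify_res s_def by auto
      thus "(g, q) \<in> x f" using fD(6)[OF g(1,2)] *[OF g(1,2)] by simp
    next
      assume gq: "(g, q) \<in> x f"
      have g: "g \<in> into X (dm X f)" "q \<in> sec Q (dm X g)" using fD(1,2)[OF gq] by auto
      have "L (cmp X f g) q = into X (dm X g)" using *[OF g] fD(3)[OF gq] by auto
      thus "(g, q) \<in> res ?T f s"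
        using g SU[OF f] cov_max unfolding sheafify_res s_def by simp
    }
  qed
  have uniq: "a \<subseteq> b" if ab: "a \<in> sec ?T U" "b \<in> sec ?T U" "\<forall>f\<in>S. res ?T f a = res ?T f b" for a b
  proof (rule subrelI)
    fix g q assume gq: "(g, q) \<in> a"
    have g: "g \<in> into X U" "q \<in> sec Q (dm X g)" using sh_sub[OF ab(1) gq] by auto
    show "(g, q) \<in> b"
    proof (rule sh_glue[OF ab(2) g], rule cov_mono[OF _ cov_stable[OF U S g(1)]])
      show "pull X g S \<subseteq> {h \<in> into X (dm X g). (cmp X g h, res Q h q) \<in> b}"
      proof
        fix h assume "h \<in> pull X g S"
        hence h: "h \<in> into X (dm X g)" "cmp X g h \<in> S" unfolding pull_def by auto
        have "cmp X (cmp X g h) (idn X (dm X h)) = cmp X g h"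
          using cmp_idn_into(1)[of "cmp X g h" U] g h by simp
        hence "(idn X (dm X h), res Q h q) \<in> res ?T (cmp X g h) a"
          using sh_res[OF ab(1) gq h(1)] g h by (simp add: sheafify_res)
        hence "(idn X (dm X h), res Q h q) \<in> res ?T (cmp X g h) b" using ab(3) h by simp
        thus "h \<in> {h \<in> into X (dm X g). (cmp X g h, res Q h q) \<in> b}"
          using h \<open>cmp X (cmp X g h) (idn X (dm X h)) = cmp X g h\<close> by (simp add: sheafify_res)
      qed
      show "sieve X (dm X g) {h \<in> into X (dm X g). (cmp X g h, res Q h q) \<in> b}"
        unfolding sieve_def
      proof (intro conjI ballI)
        fix h k assume h: "h \<in> {h \<in> into X (dm X g). (cmp X g h, res Q h q) \<in> b}"
          and k: "k \<in> into X (dm X h)"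
        have "k \<in> into X (dm X (cmp X g h))" using g h k by simp
        thus "cmp X h k \<in> {h \<in> into X (dm X g). (cmp X g h, res Q h q) \<in> b}"
          using sh_res[OF ab(2), of "cmp X g h" "res Q h q" k] g h k res_cmp[OF Q, of h "dm X g" q k]
          by (simp add: cmp_assoc_into)
      qed auto
    qed (use g in auto)
  qed
  show "\<exists>!s. s \<in> sec ?T U \<and> (\<forall>f\<in>S. res ?T f s = x f)"
  proof (rule ex1I[of _ s])
    fix r assume r: "r \<in> sec ?T U \<and> (\<forall>f\<in>S. res ?T f r = x f)"
    show "r = s" using uniq[of r s] uniq[of s r] r s_sec s_res by blast
  qed (use s_sec s_res in blast)
qed

end

end

section \<open>Groups and torsors\<close>

lemma carrier_grp [simp]: "carrier (grp A U) = sec A U"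
  by (simp add: grp_def)

context group
begin

lemma inv_mult_cancel_left [simp]: "\<lbrakk>x \<in> carrier G; y \<in> carrier G\<rbrakk> \<Longrightarrow> inv x \<otimes> (x \<otimes> y) = y"
  by (simp flip: m_assoc)

lemma mult_inv_cancel_left [simp]: "\<lbrakk>x \<in> carrier G; y \<in> carrier G\<rbrakk> \<Longrightarrow> x \<otimes> (inv x \<otimes> y) = y"
  by (simp flip: m_assoc)

end

text \<open>Group laws have membership in the carrier as side conditions. The rewriting below turns these into
  membership in \<open>sec A U\<close>, which is the form in which closure facts about sections are
  available.\<close>

locale section_group =
  fixes A :: "('o, 'm, 'x) gsheaf" and U :: 'o
  assumes section_group: "group (grp A U)"

sublocale section_group \<subseteq> group "grp A U"
  rewrites "carrier (grp A U) = sec A U"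
  by (rule section_group) simp

context grothendieck_site
begin

lemma group_overD:
  assumes "group_over X A"
  shows grp_sheaf: "is_sheaf X A"
    and grp_presheaf: "is_presheaf X A"
    and grp_group: "U \<in> obs X \<Longrightarrow> group (grp A U)"
    and res_hom: "f \<in> into X U \<Longrightarrow> res A f \<in> hom (grp A U) (grp A (dm X f))"
  using assms sheaf_presheaf unfolding group_over_def by (auto simp: into_def)

lemma section_groupI: "\<lbrakk>group_over X A; U \<in> obs X\<rbrakk> \<Longrightarrow> section_group A U"
  using grp_group by (rule section_group.intro)

lemma grp_closed:
  assumes "group_over X A" "U \<in> obs X"
  shows one_sec: "\<one>\<^bsub>grp A U\<^esub> \<in> sec A U"
    and mult_sec: "\<lbrakk>a \<in> sec A U; b \<in> sec A U\<rbrakk> \<Longrightarrow> a \<otimes>\<^bsub>grp A U\<^esub> b \<in> sec A U"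
    and inv_sec: "a \<in> sec A U \<Longrightarrow> inv\<^bsub>grp A U\<^esub> a \<in> sec A U"
proof -
  interpret group "grp A U" using grp_group[OF assms] .
  show "\<one>\<^bsub>grp A U\<^esub> \<in> sec A U" "\<lbrakk>a \<in> sec A U; b \<in> sec A U\<rbrakk> \<Longrightarrow> a \<otimes>\<^bsub>grp A U\<^esub> b \<in> sec A U"
     "a \<in> sec A U \<Longrightarrow> inv\<^bsub>grp A U\<^esub> a \<in> sec A U"
    using one_closed m_closed inv_closed by auto
qed

lemma grp_res:
  assumes A: "group_over X A" and f: "f \<in> into X U"
  shows res_mult: "\<lbrakk>a \<in> sec A U; b \<in> sec A U\<rbrakk>
      \<Longrightarrow> res A f (a \<otimes>\<^bsub>grp A U\<^esub> b) = res A f a \<otimes>\<^bsub>grp A (dm X f)\<^esub> res A f b"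
    and res_one: "res A f \<one>\<^bsub>grp A U\<^esub> = \<one>\<^bsub>grp A (dm X f)\<^esub>"
    and res_inv: "a \<in> sec A U \<Longrightarrow> res A f (inv\<^bsub>grp A U\<^esub> a) = inv\<^bsub>grp A (dm X f)\<^esub> (res A f a)"
proof -
  have U: "U \<in> obs X" using f into_ars cd_obs by metis
  interpret group_hom "grp A U" "grp A (dm X f)" "res A f"
    using grp_group[OF A] res_hom[OF A f] f U by (auto simp: group_hom_def group_hom_axioms_def)
  show "\<lbrakk>a \<in> sec A U; b \<in> sec A U\<rbrakk>
      \<Longrightarrow> res A f (a \<otimes>\<^bsub>grp A U\<^esub> b) = res A f a \<otimes>\<^bsub>grp A (dm X f)\<^esub> res A f b"
    "res A f \<one>\<^bsub>grp A U\<^esub> = \<one>\<^bsub>grp A (dm X f)\<^esub>"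
    "a \<in> sec A U \<Longrightarrow> res A f (inv\<^bsub>grp A U\<^esub> a) = inv\<^bsub>grp A (dm X f)\<^esub> (res A f a)"
    using hom_mult hom_one hom_inv by auto
qed

lemma into_obs: "f \<in> into X U \<Longrightarrow> U \<in> obs X"
  using into_ars cd_obs by metis

lemma torsorD:
  assumes "is_torsor X A P"
  shows tor_sheaf: "is_sheaf X P"
    and tor_presheaf: "is_presheaf X P"
    and tact_sec: "\<lbrakk>U \<in> obs X; u \<in> sec P U; a \<in> sec A U\<rbrakk> \<Longrightarrow> tact P U u a \<in> sec P U"
    and tact_res: "\<lbrakk>f \<in> into X U; u \<in> sec P U; a \<in> sec A U\<rbrakk>
        \<Longrightarrow> res P f (tact P U u a) = tact P (dm X f) (res P f u) (res A f a)"
    and tact_one: "\<lbrakk>U \<in> obs X; u \<in> sec P U\<rbrakk> \<Longrightarrow> tact P U u \<one>\<^bsub>grp A U\<^esub> = u"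
    and tact_mult: "\<lbrakk>U \<in> obs X; u \<in> sec P U; a \<in> sec A U; b \<in> sec A U\<rbrakk>
        \<Longrightarrow> tact P U u (a \<otimes>\<^bsub>grp A U\<^esub> b) = tact P U (tact P U u a) b"
    and tact_ex1: "\<lbrakk>U \<in> obs X; u \<in> sec P U; v \<in> sec P U\<rbrakk> \<Longrightarrow> \<exists>!a. a \<in> sec A U \<and> tact P U u a = v"
    and tor_dense: "densely X (\<lambda>U. sec P U \<noteq> {})"
  using assms sheaf_presheaf unfolding is_torsor_def densely_def by (auto simp: into_def)

lemma tact_diff:
  assumes "is_torsor X A P" "U \<in> obs X" "u \<in> sec P U" "v \<in> sec P U"
  obtains a where "a \<in> sec A U" "v = tact P U u a"
  using ex1_implies_ex[OF tact_ex1[OF assms]] that by blast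

lemma tact_free:
  assumes "is_torsor X A P" "U \<in> obs X" "u \<in> sec P U" "a \<in> sec A U" "b \<in> sec A U"
    and "tact P U u a = tact P U u b"
  shows "a = b"
  by (rule ex1E[OF tact_ex1[OF assms(1,2,3) tact_sec[OF assms(1,2,3,4)]]]) (use assms(4-6) in metis)

lemma tact_inv:
  assumes P: "is_torsor X A P" and A: "group_over X A"
    and U: "U \<in> obs X" and u: "u \<in> sec P U" and a: "a \<in> sec A U"
  shows "tact P U (tact P U u a) (inv\<^bsub>grp A U\<^esub> a) = u"
    and "tact P U (tact P U u (inv\<^bsub>grp A U\<^esub> a)) a = u"
proof -
  interpret group "grp A U" using grp_group[OF A U] .
  note i = inv_sec[OF A U a]
  show "tact P U (tact P U u a) (inv\<^bsub>grp A U\<^esub> a) = u" "tact P U (tact P U u (inv\<^bsub>grp A U\<^esub> a)) a = u"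
    using tact_mult[OF P U u a i] tact_mult[OF P U u i a] tact_one[OF P U u] a by simp_all
qed

end

section \<open>Contracted products\<close>

text \<open>Over an object where \<open>P\<close> has a section \<open>u\<close>, the map \<open>x \<mapsto> (u, x)\<close> identifies \<open>F\<close> with the contracted
  product. Its inverse is the coordinate \<open>co u\<close>; all constructions with contracted products are
  carried out in coordinates.\<close>

locale contracted = grothendieck_site X for X :: "('o, 'm) site" +
  fixes A :: "('o, 'm, 'a) gsheaf"
    and P :: "('o, 'm, 'p, 'a) rtorsor"
    and F :: "('o, 'm, 'x, 'z) presheaf_scheme"
    and l :: "'o \<Rightarrow> 'a \<Rightarrow> 'x \<Rightarrow> 'x"
  assumes A: "group_over X A" and P: "is_torsor X A P" and F: "is_sheaf X F"
    and act_sec: "\<lbrakk>U \<in> obs X; a \<in> sec A U; x \<in> sec F U\<rbrakk> \<Longrightarrow> l U a x \<in> sec F U"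
    and act_res: "\<lbrakk>f \<in> into X U; a \<in> sec A U; x \<in> sec F U\<rbrakk>
        \<Longrightarrow> res F f (l U a x) = l (dm X f) (res A f a) (res F f x)"
    and act_one: "\<lbrakk>U \<in> obs X; x \<in> sec F U\<rbrakk> \<Longrightarrow> l U \<one>\<^bsub>grp A U\<^esub> x = x"
    and act_mult: "\<lbrakk>U \<in> obs X; a \<in> sec A U; b \<in> sec A U; x \<in> sec F U\<rbrakk>
        \<Longrightarrow> l U (a \<otimes>\<^bsub>grp A U\<^esub> b) x = l U a (l U b x)"
begin

lemmas FP = sheaf_presheaf[OF F] and PP = tor_presheaf[OF P]

abbreviation "T \<equiv> ctr X A P F l"
abbreviation "pt \<equiv> ctr_pt X A P F l"
abbreviation "Q \<equiv> ctr_pre X A P F l"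
abbreviation "cls U u x \<equiv> ctr_rel A P F l U `` {(u, x)}"

lemma act_inv: "\<lbrakk>U \<in> obs X; a \<in> sec A U; x \<in> sec F U\<rbrakk> \<Longrightarrow> l U (inv\<^bsub>grp A U\<^esub> a) (l U a x) = x"
proof -
  assume *: "U \<in> obs X" "a \<in> sec A U" "x \<in> sec F U"
  interpret group "grp A U" using grp_group[OF A *(1)] .
  show ?thesis
    using act_mult[OF *(1) inv_sec[OF A *(1,2)] *(2,3)] act_one[OF *(1,3)] * by simp
qed

text \<open>Symmetry moves back along \<open>a\<^sup>-\<^sup>1\<close> and transitivity composes the two group
  elements; this is where \<open>l\<close> has to be an action.\<close>

lemma rel_equiv:
  assumes U: "U \<in> obs X"
  shows "equiv (sec P U \<times> sec F U) (ctr_rel A P F l U)"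
proof (rule equivI)
  show "ctr_rel A P F l U \<subseteq> (sec P U \<times> sec F U) \<times> (sec P U \<times> sec F U)"
    unfolding ctr_rel_def using act_sec tact_sec[OF P] U by blast
  show "refl_on (sec P U \<times> sec F U) (ctr_rel A P F l U)"
  proof (rule refl_onI)
    fix z assume "z \<in> sec P U \<times> sec F U"
    then obtain u x where z: "z = (u, x)" "u \<in> sec P U" "x \<in> sec F U" by blast
    show "(z, z) \<in> ctr_rel A P F l U"
      unfolding ctr_rel_def z(1) using z(2,3) tact_one[OF P U] act_one[OF U] one_sec[OF A U]
      by (intro CollectI exI[of _ u] exI[of _ "\<one>\<^bsub>grp A U\<^esub>"] exI[of _ x]) simp
  qed
  show "sym (ctr_rel A P F l U)"
  proof (rule symI)
    fix z z' assume "(z, z') \<in> ctr_rel A P F l U"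
    then obtain u a x where z: "z = (tact P U u a, x)" "z' = (u, l U a x)" "u \<in> sec P U" "a \<in> sec A U" "x \<in> sec F U"
      unfolding ctr_rel_def by blast
    show "(z', z) \<in> ctr_rel A P F l U"
      unfolding ctr_rel_def z(1,2)
      using z(3-) U act_inv[OF U] act_sec[OF U] tact_sec[OF P U] inv_sec[OF A U] tact_inv[OF P A U]
      by (intro CollectI exI[of _ "tact P U u a"] exI[of _ "inv\<^bsub>grp A U\<^esub> a"] exI[of _ "l U a x"]) simp
  qed
  show "trans (ctr_rel A P F l U)"
  proof (rule transI)
    fix z z' z'' assume "(z, z') \<in> ctr_rel A P F l U" "(z', z'') \<in> ctr_rel A P F l U"
    then obtain u a x v b where z: "z = (tact P U u a, x)" "u \<in> sec P U" "a \<in> sec A U" "x \<in> sec F U"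
      "z'' = (v, l U b (l U a x))" "u = tact P U v b" "v \<in> sec P U" "b \<in> sec A U"
      unfolding ctr_rel_def by blast
    show "(z, z'') \<in> ctr_rel A P F l U"
      unfolding ctr_rel_def z(1,5)
      using z U tact_mult[OF P U] act_mult[OF U] mult_sec[OF A U]
      by (intro CollectI exI[of _ v] exI[of _ "b \<otimes>\<^bsub>grp A U\<^esub> a"] exI[of _ x]) simp
  qed
qed

lemma cls_sec: "\<lbrakk>u \<in> sec P U; x \<in> sec F U\<rbrakk> \<Longrightarrow> cls U u x \<in> sec Q U"
  unfolding ctr_pre_def by (simp add: quotientI)

lemma mem_cls: "\<lbrakk>U \<in> obs X; u \<in> sec P U; x \<in> sec F U\<rbrakk> \<Longrightarrow> (u, x) \<in> cls U u x"
  using equiv_class_self[OF rel_equiv] by blast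

lemma cls_mem:
  assumes "U \<in> obs X" "c \<in> sec Q U" "(u, x) \<in> c"
  shows "u \<in> sec P U" "x \<in> sec F U" "c = cls U u x"
proof -
  obtain v y where c: "v \<in> sec P U" "y \<in> sec F U" "c = cls U v y"
    using assms(2) unfolding ctr_pre_def by (auto elim!: quotientE)
  hence r: "((v, y), (u, x)) \<in> ctr_rel A P F l U" using assms(3) by simp
  show "u \<in> sec P U" "x \<in> sec F U" using equiv_type[OF rel_equiv[OF assms(1)]] r by auto
  show "c = cls U u x" using equiv_class_eq[OF rel_equiv[OF assms(1)] r] c(3) by simp
qed

lemma cls_bal: "\<lbrakk>U \<in> obs X; u \<in> sec P U; a \<in> sec A U; x \<in> sec F U\<rbrakk>
    \<Longrightarrow> cls U (tact P U u a) x = cls U u (l U a x)"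
  by (rule equiv_class_eq[OF rel_equiv]) (auto simp: ctr_rel_def)

text \<open>Two representatives with the same first entry differ by an element that fixes this entry, and the
  action on a torsor is free.\<close>

lemma cls_inj:
  assumes "U \<in> obs X" "u \<in> sec P U" "x \<in> sec F U" "y \<in> sec F U" "cls U u x = cls U u y"
  shows "x = y"
proof -
  have "((u, x), (u, y)) \<in> ctr_rel A P F l U"
    using eq_equiv_class[OF assms(5) rel_equiv[OF assms(1)]] assms by blast
  then obtain a where a: "a \<in> sec A U" "tact P U u a = u" "y = l U a x"
    unfolding ctr_rel_def by auto
  have "a = \<one>\<^bsub>grp A U\<^esub>"
    using tact_free[OF P assms(1,2) a(1) one_sec[OF A assms(1)]] a(2) tact_one[OF P assms(1,2)] by simp
  thus ?thesis using a(3) act_one[OF assms(1,3)] by simp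
qed

text \<open>Transitivity of the action moves the first entry of a representative to the prescribed section
  \<open>u\<close>.\<close>

lemma cls_cover:
  assumes "U \<in> obs X" "u \<in> sec P U" "c \<in> sec Q U"
  obtains x where "x \<in> sec F U" "c = cls U u x"
proof -
  obtain v y where c: "v \<in> sec P U" "y \<in> sec F U" "c = cls U v y"
    using assms(3) unfolding ctr_pre_def by (auto elim!: quotientE)
  obtain a where a: "a \<in> sec A U" "v = tact P U u a" using tact_diff[OF P assms(1,2) c(1)] .
  show ?thesis
    by (rule that[OF act_sec[OF assms(1) a(1) c(2)]]) (use cls_bal[OF assms(1,2) a(1) c(2)] a c in simp)
qed

lemma cls_res:
  assumes f: "f \<in> into X U" and u: "u \<in> sec P U" and x: "x \<in> sec F U"
  shows "res Q f (cls U u x) = cls (dm X f) (res P f u) (res F f x)"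
proof -
  have U: "U \<in> obs X" using into_obs[OF f] .
  have c: "(\<lambda>(u, x). cls (dm X f) (res P f u) (res F f x)) respects ctr_rel A P F l U"
  proof (rule congruentI, clarify)
    fix v y w z assume "((v, y), (w, z)) \<in> ctr_rel A P F l U"
    then obtain a where a: "a \<in> sec A U" "v = tact P U w a" "z = l U a y" "w \<in> sec P U" "y \<in> sec F U"
      unfolding ctr_rel_def by auto
    show "cls (dm X f) (res P f v) (res F f y) = cls (dm X f) (res P f w) (res F f z)"
      unfolding a(2,3) tact_res[OF P f a(4,1)] act_res[OF f a(1,5)]
      by (rule cls_bal[OF dm_into[OF f] res_sec[OF PP f a(4)] res_sec[OF grp_presheaf[OF A] f a(1)]
          res_sec[OF FP f a(5)]])
  qed
  have "res Q f (cls U u x) = (\<Union>z\<in>cls U u x. (\<lambda>(u, x). cls (dm X f) (res P f u) (res F f x)) z)"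
    unfolding ctr_pre_def by simp
  also have "\<dots> = cls (dm X f) (res P f u) (res F f x)"
    using UN_equiv_class[OF rel_equiv[OF U] c, of "(u, x)"] u x by simp
  finally show ?thesis .
qed

lemma sec_QE:
  assumes "c \<in> sec Q U"
  obtains u x where "u \<in> sec P U" "x \<in> sec F U" "c = cls U u x"
  using assms unfolding ctr_pre_def by (auto elim!: quotientE)

lemma Q_presheaf: "is_presheaf X Q"
proof (rule presheafI)
  fix U f c assume f: "f \<in> into X U" and "c \<in> sec Q U"
  then obtain u x where c: "u \<in> sec P U" "x \<in> sec F U" "c = cls U u x" by (elim sec_QE)
  show "res Q f c \<in> sec Q (dm X f)"
    unfolding c(3) cls_res[OF f c(1,2)] by (rule cls_sec[OF res_sec[OF PP f c(1)] res_sec[OF FP f c(2)]])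
next
  fix U c assume U: "U \<in> obs X" and "c \<in> sec Q U"
  then obtain u x where c: "u \<in> sec P U" "x \<in> sec F U" "c = cls U u x" by (elim sec_QE)
  show "res Q (idn X U) c = c"
    unfolding c(3) cls_res[OF idn_into[OF U] c(1,2)]
    using c U by (simp add: res_idn[OF PP U c(1)] res_idn[OF FP U c(2)])
next
  fix U f h c assume f: "f \<in> into X U" and h: "h \<in> into X (dm X f)" and "c \<in> sec Q U"
  then obtain u x where c: "u \<in> sec P U" "x \<in> sec F U" "c = cls U u x" by (elim sec_QE)
  show "res Q (cmp X f h) c = res Q h (res Q f c)"
    unfolding c(3) cls_res[OF f c(1,2)] cls_res[OF cmp_into[OF f h] c(1,2)]
      cls_res[OF h res_sec[OF PP f c(1)] res_sec[OF FP f c(2)]]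
      res_cmp[OF PP f c(1) h] res_cmp[OF FP f c(2) h] dm_cmp_into[OF f h] ..
qed

lemma T_sheaf: "is_sheaf X T"
  unfolding ctr_def by (rule sheafify_sheaf[OF Q_presheaf])

lemmas TP = sheaf_presheaf[OF T_sheaf]

lemma pt_sec: "\<lbrakk>U \<in> obs X; u \<in> sec P U; x \<in> sec F U\<rbrakk> \<Longrightarrow> pt U u x \<in> sec T U"
  unfolding ctr_def ctr_pt_def by (rule to_sheaf_sec[OF Q_presheaf _ cls_sec])

lemma pt_res: "\<lbrakk>f \<in> into X U; u \<in> sec P U; x \<in> sec F U\<rbrakk>
    \<Longrightarrow> res T f (pt U u x) = pt (dm X f) (res P f u) (res F f x)"
  unfolding ctr_def ctr_pt_def using to_sheaf_res[OF Q_presheaf into_obs cls_sec] cls_res by simp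

lemma pt_bal: "\<lbrakk>U \<in> obs X; u \<in> sec P U; a \<in> sec A U; x \<in> sec F U\<rbrakk>
    \<Longrightarrow> pt U (tact P U u a) x = pt U u (l U a x)"
  unfolding ctr_pt_def using cls_bal by simp

text \<open>Equality in the associated sheaf is local equality of classes, and local equality of classes with a
  common first entry is local equality in the sheaf \<open>F\<close>.\<close>

lemma pt_inj:
  assumes "U \<in> obs X" "u \<in> sec P U" "x \<in> sec F U" "y \<in> sec F U" "pt U u x = pt U u y"
  shows "x = y"
proof -
  have "loc_eq X Q U (cls U u x) (cls U u y)"
    using to_sheaf_eqD[OF Q_presheaf assms(1) cls_sec cls_sec] assms unfolding ctr_pt_def by blast
  hence c: "{h \<in> into X U. res Q h (cls U u x) = res Q h (cls U u y)} \<in> cov X U" unfolding loc_eq_def .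
  show ?thesis
  proof (rule sheaf_eqI[OF F assms(1) c assms(3,4)])
    fix f assume "f \<in> {h \<in> into X U. res Q h (cls U u x) = res Q h (cls U u y)}"
    hence f: "f \<in> into X U" and e: "res Q f (cls U u x) = res Q f (cls U u y)" by auto
    show "res F f x = res F f y"
      using e unfolding cls_res[OF f assms(2,3)] cls_res[OF f assms(2,4)]
      by (rule cls_inj[OF dm_into[OF f] res_sec[OF PP f assms(2)] res_sec[OF FP f assms(3)] res_sec[OF FP f assms(4)]])
  qed
qed

text \<open>The pairs occurring in a section of the contracted product are its local representatives.
  Definitions that quantify over the elements of such a section are unfolded with this lemma.\<close>

lemma pt_mem:
  assumes U: "U \<in> obs X" and s: "s \<in> sec T U"
  shows "(f, c) \<in> s \<Longrightarrow> (u, x) \<in> c \<Longrightarrow>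
      f \<in> into X U \<and> u \<in> sec P (dm X f) \<and> x \<in> sec F (dm X f) \<and> res T f s = pt (dm X f) u x"
    and "\<lbrakk>f \<in> into X U; u \<in> sec P (dm X f); x \<in> sec F (dm X f); res T f s = pt (dm X f) u x\<rbrakk>
      \<Longrightarrow> \<exists>c. (f, c) \<in> s \<and> (u, x) \<in> c"
proof -
  note mem = sheafify_mem[OF Q_presheaf U s[unfolded ctr_def], folded ctr_def]
  show "f \<in> into X U \<and> u \<in> sec P (dm X f) \<and> x \<in> sec F (dm X f) \<and> res T f s = pt (dm X f) u x"
    if fc: "(f, c) \<in> s" and ux: "(u, x) \<in> c"
  proof -
    have m: "f \<in> into X U" "c \<in> sec Q (dm X f)" "res T f s = to_sheaf X Q (dm X f) c"
      using mem[THEN iffD1, OF fc] by blast+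
    note c = cls_mem[OF dm_into[OF m(1)] m(2) ux]
    show ?thesis using m(1,3) c(1,2) unfolding ctr_pt_def c(3)[symmetric] by blast
  qed
  show "\<exists>c. (f, c) \<in> s \<and> (u, x) \<in> c"
    if f: "f \<in> into X U" and u: "u \<in> sec P (dm X f)" and x: "x \<in> sec F (dm X f)"
      and e: "res T f s = pt (dm X f) u x"
  proof (intro exI conjI)
    show "(f, cls (dm X f) u x) \<in> s"
      using mem[of f "cls (dm X f) u x"] f cls_sec[OF u x] e[unfolded ctr_pt_def] by blast
    show "(u, x) \<in> cls (dm X f) u x" by (rule mem_cls[OF dm_into[OF f] u x])
  qed
qed

text \<open>Over a covering sieve the section is represented by pairs, whose first entries may be taken to be
  the restrictions of \<open>u\<close> (\<open>cls_cover\<close>). The second entries are then unique by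
  \<open>pt_inj\<close>, hence compatible, and glue because \<open>F\<close> is a sheaf.\<close>

lemma pt_surj:
  assumes U: "U \<in> obs X" and u: "u \<in> sec P U" and s: "s \<in> sec T U"
  shows "\<exists>x\<in>sec F U. s = pt U u x"
proof -
  let ?S = "fst ` s"
  have S: "?S \<in> cov X U" using sh_cov[OF Q_presheaf s[unfolded ctr_def]] .
  have ex: "\<exists>x. x \<in> sec F (dm X f) \<and> res T f s = pt (dm X f) (res P f u) x" if fS: "f \<in> ?S" for f
  proof -
    obtain c where fc: "(f, c) \<in> s" using fS by auto
    have f: "f \<in> into X U" and c: "c \<in> sec Q (dm X f)"
      using sh_sub[OF Q_presheaf s[unfolded ctr_def] fc] by auto
    obtain x where x: "x \<in> sec F (dm X f)" "c = cls (dm X f) (res P f u) x"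
      using cls_cover[OF dm_into[OF f] res_sec[OF PP f u] c] .
    have "(res P f u, x) \<in> c" unfolding x(2) by (rule mem_cls[OF dm_into[OF f] res_sec[OF PP f u] x(1)])
    thus ?thesis using pt_mem(1)[OF U s fc] x(1) by blast
  qed
  define x where "x f = (SOME x. x \<in> sec F (dm X f) \<and> res T f s = pt (dm X f) (res P f u) x)" for f
  have x: "x f \<in> sec F (dm X f)" "res T f s = pt (dm X f) (res P f u) (x f)" if "f \<in> ?S" for f
    using someI_ex[OF ex[OF that]] unfolding x_def by auto
  have "\<exists>!y. y \<in> sec F U \<and> (\<forall>f\<in>?S. res F f y = x f)"
  proof (rule sheaf_glue[OF F U S x(1)])
    fix f h assume fS: "f \<in> ?S" and h: "h \<in> into X (dm X f)"
    have f: "f \<in> into X U" using sieve_into[OF U S fS] .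
    have fh: "cmp X f h \<in> ?S" using sieve_cmp[OF U S fS h] .
    note dm = dm_cmp_into[OF f h]
    have "pt (dm X h) (res P (cmp X f h) u) (x (cmp X f h)) = res T h (res T f s)"
      using x(2)[OF fh] res_cmp[OF TP f s h] dm by simp
    also have "\<dots> = pt (dm X h) (res P (cmp X f h) u) (res F h (x f))"
      unfolding x(2)[OF fS] pt_res[OF h res_sec[OF PP f u] x(1)[OF fS]] res_cmp[OF PP f u h] ..
    finally show "x (cmp X f h) = res F h (x f)"
      by (rule pt_inj[OF dm_into[OF h] res_sec[OF PP cmp_into[OF f h] u, unfolded dm]
            x(1)[OF fh, unfolded dm] res_sec[OF FP h x(1)[OF fS]]])
  qed
  then obtain y where y: "y \<in> sec F U" "\<And>f. f \<in> ?S \<Longrightarrow> res F f y = x f" by blast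
  have "s = pt U u y"
  proof (rule sheaf_eqI[OF T_sheaf U S s pt_sec[OF U u y(1)]])
    fix f assume f: "f \<in> ?S"
    show "res T f s = res T f (pt U u y)"
      unfolding pt_res[OF sieve_into[OF U S f] u y(1)] x(2)[OF f] y(2)[OF f] ..
  qed
  thus ?thesis using y(1) by blast
qed

lemma pt_bij: "\<lbrakk>U \<in> obs X; u \<in> sec P U\<rbrakk> \<Longrightarrow> bij_betw (pt U u) (sec F U) (sec T U)"
  by (rule bij_betw_imageI, rule inj_onI, erule (4) pt_inj) (use pt_surj pt_sec in blast)

definition co :: "'o \<Rightarrow> 'p \<Rightarrow> ('m, 'p, 'x) ctr \<Rightarrow> 'x" where
  "co U u = inv_into (sec F U) (pt U u)"

lemma co:
  assumes "U \<in> obs X" "u \<in> sec P U" "s \<in> sec T U"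
  shows co_sec: "co U u s \<in> sec F U" and pt_co: "pt U u (co U u s) = s"
proof -
  have "s \<in> pt U u ` sec F U" using pt_surj[OF assms] by blast
  thus "co U u s \<in> sec F U" "pt U u (co U u s) = s"
    unfolding co_def by (rule inv_into_into, rule f_inv_into_f)
qed

lemma co_pt: "\<lbrakk>U \<in> obs X; u \<in> sec P U; x \<in> sec F U\<rbrakk> \<Longrightarrow> co U u (pt U u x) = x"
  unfolding co_def using inv_into_f_f[OF bij_betw_imp_inj_on[OF pt_bij]] by blast

lemma co_res:
  assumes f: "f \<in> into X U" and u: "u \<in> sec P U" and s: "s \<in> sec T U"
  shows "res F f (co U u s) = co (dm X f) (res P f u) (res T f s)"
proof -
  note c = co[OF into_obs[OF f] u s]
  have "res T f s = pt (dm X f) (res P f u) (res F f (co U u s))"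
    using pt_res[OF f u c(1)] c(2) by simp
  thus ?thesis
    using co_pt[OF dm_into[OF f] res_sec[OF PP f u] res_sec[OF FP f c(1)]] by simp
qed

text \<open>Change of coordinates: replacing \<open>u\<close> by \<open>u a\<close> acts on the coordinate by
  \<open>a\<^sup>-\<^sup>1\<close>, written without the inverse.\<close>

lemma co_bal:
  assumes "U \<in> obs X" "u \<in> sec P U" "a \<in> sec A U" "s \<in> sec T U"
  shows "co U u s = l U a (co U (tact P U u a) s)"
proof -
  note c = co[OF assms(1) tact_sec[OF P assms(1-3)] assms(4)]
  have "s = pt U u (l U a (co U (tact P U u a) s))"
    using c(2) pt_bal[OF assms(1-3) c(1)] by simp
  thus ?thesis using co_pt[OF assms(1,2) act_sec[OF assms(1,3) c(1)]] by simp
qed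

text \<open>These are the formulas on pairs that descend to the contracted product over \<open>U\<close>. They
  depend on an arrow \<open>f\<close> into \<open>U\<close> because a formula may involve a fixed section over
  \<open>U\<close>, which occurs in it through the restriction along \<open>f\<close>.\<close>

definition balanced :: "('o, 'm, 'y, 'w) presheaf_scheme \<Rightarrow> 'o \<Rightarrow> ('m \<Rightarrow> 'p \<Rightarrow> 'x \<Rightarrow> 'y) \<Rightarrow> bool" where
  "balanced H U k \<longleftrightarrow> (\<forall>f\<in>into X U. \<forall>u\<in>sec P (dm X f). \<forall>x\<in>sec F (dm X f).
      k f u x \<in> sec H (dm X f) \<and>
      (\<forall>h\<in>into X (dm X f). res H h (k f u x) = k (cmp X f h) (res P h u) (res F h x)) \<and>
      (\<forall>a\<in>sec A (dm X f). k f (tact P (dm X f) u a) x = k f u (l (dm X f) a x)))"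

lemma balancedI:
  assumes "\<And>f u x. \<lbrakk>f \<in> into X U; u \<in> sec P (dm X f); x \<in> sec F (dm X f)\<rbrakk> \<Longrightarrow> k f u x \<in> sec H (dm X f)"
    and "\<And>f h u x. \<lbrakk>f \<in> into X U; u \<in> sec P (dm X f); x \<in> sec F (dm X f); h \<in> into X (dm X f)\<rbrakk>
      \<Longrightarrow> res H h (k f u x) = k (cmp X f h) (res P h u) (res F h x)"
    and "\<And>f u x a. \<lbrakk>f \<in> into X U; u \<in> sec P (dm X f); x \<in> sec F (dm X f); a \<in> sec A (dm X f)\<rbrakk>
      \<Longrightarrow> k f (tact P (dm X f) u a) x = k f u (l (dm X f) a x)"
  shows "balanced H U k"
  using assms unfolding balanced_def by blast

lemma balancedD:
  assumes "balanced H U k" "f \<in> into X U" "u \<in> sec P (dm X f)" "x \<in> sec F (dm X f)"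
  shows "k f u x \<in> sec H (dm X f)"
    and "h \<in> into X (dm X f) \<Longrightarrow> res H h (k f u x) = k (cmp X f h) (res P h u) (res F h x)"
    and "a \<in> sec A (dm X f) \<Longrightarrow> k f (tact P (dm X f) u a) x = k f u (l (dm X f) a x)"
  using assms unfolding balanced_def by blast+

text \<open>The condition on all representatives of \<open>s\<close> is a condition on all \<open>u\<close>,
  since for each \<open>u\<close> there is one representative, the coordinate.\<close>

lemma descend_iff:
  assumes U: "U \<in> obs X" and s: "s \<in> sec T U"
  shows "(\<forall>(f, c)\<in>s. \<forall>(u, x)\<in>c. res H f y = k f u x) \<longleftrightarrow>
    (\<forall>f\<in>into X U. \<forall>u\<in>sec P (dm X f). res H f y = k f u (co (dm X f) u (res T f s)))"
proof
  assume L: "\<forall>(f, c)\<in>s. \<forall>(u, x)\<in>c. res H f y = k f u x"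
  show "\<forall>f\<in>into X U. \<forall>u\<in>sec P (dm X f). res H f y = k f u (co (dm X f) u (res T f s))"
  proof (intro ballI)
    fix f u assume f: "f \<in> into X U" and u: "u \<in> sec P (dm X f)"
    note c = co[OF dm_into[OF f] u res_sec[OF TP f s]]
    obtain c where "(f, c) \<in> s" "(u, co (dm X f) u (res T f s)) \<in> c"
      using pt_mem(2)[OF U s f u c(1)] c(2) by auto
    thus "res H f y = k f u (co (dm X f) u (res T f s))" using L by blast
  qed
next
  assume R: "\<forall>f\<in>into X U. \<forall>u\<in>sec P (dm X f). res H f y = k f u (co (dm X f) u (res T f s))"
  have "res H f y = k f u x" if "(f, c) \<in> s" "(u, x) \<in> c" for f c u x
    using R pt_mem(1)[OF U s that] co_pt[of "dm X f" u x] by auto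
  thus "\<forall>(f, c)\<in>s. \<forall>(u, x)\<in>c. res H f y = k f u x" by blast
qed

text \<open>The formula in \<open>u\<close> has the same value at \<open>u\<close> and \<open>u a\<close>, since
  \<open>co_bal\<close> and the balancing of \<open>k\<close> cancel.\<close>

lemma descend_ex1:
  assumes H: "is_sheaf X H" and k: "balanced H U k" and U: "U \<in> obs X" and s: "s \<in> sec T U"
  shows "\<exists>!y. y \<in> sec H U \<and>
    (\<forall>f\<in>into X U. \<forall>u\<in>sec P (dm X f). res H f y = k f u (co (dm X f) u (res T f s)))"
proof (rule glue_over[OF H PP tor_dense[OF P] U])
  fix f u assume f: "f \<in> into X U" and u: "u \<in> sec P (dm X f)"
  note rs = res_sec[OF TP f s]
  note c = co[OF dm_into[OF f] u rs]
  show "k f u (co (dm X f) u (res T f s)) \<in> sec H (dm X f)" by (rule balancedD(1)[OF k f u c(1)])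
  show "res H h (k f u (co (dm X f) u (res T f s)))
      = k (cmp X f h) (res P h u) (co (dm X (cmp X f h)) (res P h u) (res T (cmp X f h) s))"
    if h: "h \<in> into X (dm X f)" for h
    unfolding balancedD(2)[OF k f u c(1) h] co_res[OF h u rs] res_cmp[OF TP f s h] dm_cmp_into[OF f h] ..
  show "k f u (co (dm X f) u (res T f s)) = k f v (co (dm X f) v (res T f s))"
    if v: "v \<in> sec P (dm X f)" for v
  proof -
    obtain a where a: "a \<in> sec A (dm X f)" "v = tact P (dm X f) u a"
      using tact_diff[OF P dm_into[OF f] u v] .
    show ?thesis
      unfolding a(2) balancedD(3)[OF k f u co_sec[OF dm_into[OF f] v[unfolded a(2)] rs] a(1)]
        co_bal[OF dm_into[OF f] u a(1) rs] ..
  qed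
qed

lemma descend_props:
  assumes H: "is_sheaf X H" and k: "balanced H U k" and U: "U \<in> obs X" and s: "s \<in> sec T U"
  shows descend_sec: "descend H U k s \<in> sec H U"
    and descend_res_co: "\<lbrakk>f \<in> into X U; u \<in> sec P (dm X f)\<rbrakk>
        \<Longrightarrow> res H f (descend H U k s) = k f u (co (dm X f) u (res T f s))"
    and descend_unique: "\<lbrakk>y \<in> sec H U; \<And>f u. \<lbrakk>f \<in> into X U; u \<in> sec P (dm X f)\<rbrakk>
        \<Longrightarrow> res H f y = k f u (co (dm X f) u (res T f s))\<rbrakk> \<Longrightarrow> descend H U k s = y"
proof -
  note e = descend_ex1[OF assms]
  have d: "descend H U k s = (THE y. y \<in> sec H U \<and>
    (\<forall>f\<in>into X U. \<forall>u\<in>sec P (dm X f). res H f y = k f u (co (dm X f) u (res T f s))))"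
    unfolding descend_def descend_iff[OF U s] ..
  note t = theI'[OF e, folded d]
  show "descend H U k s \<in> sec H U" using t by blast
  show "res H f (descend H U k s) = k f u (co (dm X f) u (res T f s))"
    if "f \<in> into X U" "u \<in> sec P (dm X f)" using t that by blast
  show "descend H U k s = y" if "y \<in> sec H U" "\<And>f u. \<lbrakk>f \<in> into X U; u \<in> sec P (dm X f)\<rbrakk>
        \<Longrightarrow> res H f y = k f u (co (dm X f) u (res T f s))"
    using e t that by blast
qed

lemma descend_pt:
  assumes H: "is_sheaf X H" and k: "balanced H U k" and U: "U \<in> obs X"
    and u: "u \<in> sec P U" and x: "x \<in> sec F U"
  shows "descend H U k (pt U u x) = k (idn X U) u x"
proof -
  note p = pt_sec[OF U u x]
  have "res H (idn X U) (descend H U k (pt U u x)) = k (idn X U) u (co U u (res T (idn X U) (pt U u x)))"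
    using descend_res_co[OF H k U p idn_into[OF U], of u] u dm_idn[OF U] by simp
  thus ?thesis
    using res_idn[OF sheaf_presheaf[OF H] U descend_sec[OF H k U p]] res_idn[OF TP U p] co_pt[OF U u x] by simp
qed

text \<open>The family \<open>k\<close> is indexed by arrows into \<open>U\<close>, so restriction along
  \<open>h\<close> replaces it by its part over the arrows that factor through \<open>h\<close>.\<close>

lemma descend_res:
  assumes H: "is_sheaf X H" and k: "balanced H U k" and s: "s \<in> sec T U" and h: "h \<in> into X U"
    and k': "\<And>f u x. \<lbrakk>f \<in> into X (dm X h); u \<in> sec P (dm X f); x \<in> sec F (dm X f)\<rbrakk>
        \<Longrightarrow> k' f u x = k (cmp X h f) u x"
    and k'b: "balanced H (dm X h) k'"
  shows "res H h (descend H U k s) = descend H (dm X h) k' (res T h s)"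
proof (rule sym, rule descend_unique[OF H k'b dm_into[OF h] res_sec[OF TP h s]])
  note d = descend_sec[OF H k into_obs[OF h] s]
  show "res H h (descend H U k s) \<in> sec H (dm X h)" by (rule res_sec[OF sheaf_presheaf[OF H] h d])
  fix f u assume f: "f \<in> into X (dm X h)" and u: "u \<in> sec P (dm X f)"
  have u': "u \<in> sec P (dm X (cmp X h f))" using u dm_cmp_into[OF h f] by simp
  show "res H f (res H h (descend H U k s)) = k' f u (co (dm X f) u (res T f (res T h s)))"
    using descend_res_co[OF H k into_obs[OF h] s cmp_into[OF h f] u'] res_cmp[OF sheaf_presheaf[OF H] h d f]
      k'[OF f u co_sec[OF dm_into[OF f] u res_sec[OF TP f res_sec[OF TP h s]]]]
      dm_cmp_into[OF h f] res_cmp[OF TP h s f] by simp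
qed

text \<open>The form in which maps out of a contracted product are constructed: a formula on pairs that commutes
  with restriction and is balanced defines a map of sheaves, which is given by this formula on pairs.\<close>

lemma descend_map:
  assumes H: "is_sheaf X H"
    and k_sec: "\<And>U u x. \<lbrakk>U \<in> obs X; u \<in> sec P U; x \<in> sec F U\<rbrakk> \<Longrightarrow> k U u x \<in> sec H U"
    and k_res: "\<And>U h u x. \<lbrakk>U \<in> obs X; h \<in> into X U; u \<in> sec P U; x \<in> sec F U\<rbrakk>
        \<Longrightarrow> res H h (k U u x) = k (dm X h) (res P h u) (res F h x)"
    and k_bal: "\<And>U u x a. \<lbrakk>U \<in> obs X; u \<in> sec P U; x \<in> sec F U; a \<in> sec A U\<rbrakk>
        \<Longrightarrow> k U (tact P U u a) x = k U u (l U a x)"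
  shows "mk_map X T (\<lambda>U. descend H U (\<lambda>f u x. k (dm X f) u x)) \<in> maps X T H"
    and "\<And>U u x. \<lbrakk>U \<in> obs X; u \<in> sec P U; x \<in> sec F U\<rbrakk>
        \<Longrightarrow> descend H U (\<lambda>f u x. k (dm X f) u x) (pt U u x) = k U u x"
proof -
  have b: "balanced H U (\<lambda>f u x. k (dm X f) u x)" if "U \<in> obs X" for U
  proof (rule balancedI)
    fix f h u x assume f: "f \<in> into X U" and "u \<in> sec P (dm X f)" "x \<in> sec F (dm X f)" "h \<in> into X (dm X f)"
    thus "res H h (k (dm X f) u x) = k (dm X (cmp X f h)) (res P h u) (res F h x)"
      using k_res[of "dm X f" h u x] dm_cmp_into[of f U h] by simp
  qed (use k_sec k_bal in auto)
  show "mk_map X T (\<lambda>U. descend H U (\<lambda>f u x. k (dm X f) u x)) \<in> maps X T H"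
  proof (rule mapsI[OF _ _ TP])
    fix U f s assume U: "U \<in> obs X" and f: "f \<in> into X U" and s: "s \<in> sec T U"
    show "res H f (descend H U (\<lambda>f u x. k (dm X f) u x) s)
        = descend H (dm X f) (\<lambda>f u x. k (dm X f) u x) (res T f s)"
      by (rule descend_res[OF H b[OF U] s f _ b[OF dm_into[OF f]]]) (simp add: dm_cmp_into[OF f])
  qed (use descend_sec[OF H b] in blast)
  show "descend H U (\<lambda>f u x. k (dm X f) u x) (pt U u x) = k U u x"
    if "U \<in> obs X" "u \<in> sec P U" "x \<in> sec F U" for U u x
    using descend_pt[OF H b[OF that(1)] that] dm_idn[OF that(1)] by simp
qed

end

section \<open>Crossed modules over a site\<close>

context grothendieck_site
begin

lemma is_sheaf_cong: "\<lbrakk>sec F = sec H; res F = res H\<rbrakk> \<Longrightarrow> is_sheaf X F = is_sheaf X H"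
  unfolding is_sheaf_def is_presheaf_def by simp

lemma maps_cong: "\<lbrakk>sec F = sec F'; res F = res F'; sec H = sec H'; res H = res H'\<rbrakk>
    \<Longrightarrow> maps X F H = maps X F' H'"
  unfolding maps_def by simp

lemma ghom:
  assumes A: "group_over X A" and B: "group_over X B" and t: "t \<in> ghoms X A B"
  shows ghom_maps: "t \<in> maps X A B"
    and ghom_sec: "\<lbrakk>U \<in> obs X; a \<in> sec A U\<rbrakk> \<Longrightarrow> t U a \<in> sec B U"
    and ghom_res: "\<lbrakk>f \<in> into X U; a \<in> sec A U\<rbrakk> \<Longrightarrow> res B f (t U a) = t (dm X f) (res A f a)"
    and ghom_mult: "\<lbrakk>U \<in> obs X; a \<in> sec A U; b \<in> sec A U\<rbrakk>
        \<Longrightarrow> t U (a \<otimes>\<^bsub>grp A U\<^esub> b) = t U a \<otimes>\<^bsub>grp B U\<^esub> t U b"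
    and ghom_one: "U \<in> obs X \<Longrightarrow> t U \<one>\<^bsub>grp A U\<^esub> = \<one>\<^bsub>grp B U\<^esub>"
    and ghom_inv: "\<lbrakk>U \<in> obs X; a \<in> sec A U\<rbrakk> \<Longrightarrow> t U (inv\<^bsub>grp A U\<^esub> a) = inv\<^bsub>grp B U\<^esub> (t U a)"
proof -
  show m: "t \<in> maps X A B" using t unfolding ghoms_def by blast
  show "\<lbrakk>U \<in> obs X; a \<in> sec A U\<rbrakk> \<Longrightarrow> t U a \<in> sec B U" by (rule maps_sec[OF m])
  show "\<lbrakk>f \<in> into X U; a \<in> sec A U\<rbrakk> \<Longrightarrow> res B f (t U a) = t (dm X f) (res A f a)"
    by (rule maps_res[OF m])
  have h: "group_hom (grp A U) (grp B U) (t U)" if "U \<in> obs X" for U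
    using t that grp_group[OF A that] grp_group[OF B that]
    unfolding ghoms_def group_hom_def group_hom_axioms_def by blast
  show "\<lbrakk>U \<in> obs X; a \<in> sec A U; b \<in> sec A U\<rbrakk>
        \<Longrightarrow> t U (a \<otimes>\<^bsub>grp A U\<^esub> b) = t U a \<otimes>\<^bsub>grp B U\<^esub> t U b"
    using group_hom.hom_mult[OF h, of U a b] by simp
  show "U \<in> obs X \<Longrightarrow> t U \<one>\<^bsub>grp A U\<^esub> = \<one>\<^bsub>grp B U\<^esub>"
    using group_hom.hom_one[OF h, of U] by simp
  show "\<lbrakk>U \<in> obs X; a \<in> sec A U\<rbrakk> \<Longrightarrow> t U (inv\<^bsub>grp A U\<^esub> a) = inv\<^bsub>grp B U\<^esub> (t U a)"
    using group_hom.hom_inv[OF h, of U a] by simp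
qed

lemma endo:
  assumes "group (grp A U)" "t \<in> hom (grp A U) (grp A U)"
  shows "a \<in> sec A U \<Longrightarrow> t a \<in> sec A U"
    and "\<lbrakk>a \<in> sec A U; b \<in> sec A U\<rbrakk> \<Longrightarrow> t (a \<otimes>\<^bsub>grp A U\<^esub> b) = t a \<otimes>\<^bsub>grp A U\<^esub> t b"
    and "t \<one>\<^bsub>grp A U\<^esub> = \<one>\<^bsub>grp A U\<^esub>"
    and "a \<in> sec A U \<Longrightarrow> t (inv\<^bsub>grp A U\<^esub> a) = inv\<^bsub>grp A U\<^esub> (t a)"
proof -
  interpret group_hom "grp A U" "grp A U" t
    using assms by (simp add: group_hom_def group_hom_axioms_def)
  show "a \<in> sec A U \<Longrightarrow> t a \<in> sec A U"
    "\<lbrakk>a \<in> sec A U; b \<in> sec A U\<rbrakk> \<Longrightarrow> t (a \<otimes>\<^bsub>grp A U\<^esub> b) = t a \<otimes>\<^bsub>grp A U\<^esub> t b"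
    "t \<one>\<^bsub>grp A U\<^esub> = \<one>\<^bsub>grp A U\<^esub>"
    "a \<in> sec A U \<Longrightarrow> t (inv\<^bsub>grp A U\<^esub> a) = inv\<^bsub>grp A U\<^esub> (t a)"
    using hom_closed[of a] hom_mult[of a b] hom_one hom_inv[of a] by simp_all
qed

end

text \<open>The names below follow one pattern: \<open>Z\<close> stands for the 2-groupoid with global sections
  as arrows and \<open>W\<close> for the bigroupoid with torsors as arrows; the indices 0, 1, 2 refer to
  objects, arrows and 2-arrows.\<close>

locale gamma_xmod = grothendieck_site X for X :: "('o, 'm) site" +
  fixes \<Gamma> :: "('o, 'm, 'g) gsheaf" and G :: "('o, 'm, 'a, 'b, 'g) xmod"
  assumes \<Gamma>: "group_over X \<Gamma>" and G: "gamma_crossed_module X \<Gamma> G"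
begin

abbreviation "Z0 \<equiv> z_objects X \<Gamma> G"
abbreviation "Z1 \<equiv> z_arrows X \<Gamma> G"
abbreviation "Z2 \<equiv> z_cells X \<Gamma> G"
abbreviation "zone \<equiv> z_one1 X G"
abbreviation "zcomp \<equiv> z_comp1 X G"
abbreviation "ztriv \<equiv> z_triv X G"
abbreviation "zvcomp \<equiv> z_vcomp X G"
abbreviation "zhcomp \<equiv> z_hcomp X G"
abbreviation "Zcat \<equiv> Z_cat X \<Gamma> G"
abbreviation "W1 \<equiv> w_arrows X \<Gamma> G"
abbreviation "W2 \<equiv> w_cells X \<Gamma> G"
abbreviation "wone \<equiv> w_one1 X G"
abbreviation "wcomp \<equiv> w_comp1 X \<Gamma> G"
abbreviation "wone2 \<equiv> w_one2 X"
abbreviation "wvcomp \<equiv> w_vcomp X"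
abbreviation "whcomp \<equiv> w_hcomp X \<Gamma> G"
abbreviation "wassoc \<equiv> w_assoc X \<Gamma> G"
abbreviation "wlunit \<equiv> w_lunit X \<Gamma> G"
abbreviation "wrunit \<equiv> w_runit X \<Gamma> G"
abbreviation "Wcat \<equiv> W_cat X \<Gamma> G"
abbreviation "psi \<equiv> psi_arr X G"
abbreviation "psicomp \<equiv> psi_comp X \<Gamma> G"
abbreviation "\<Psi> \<equiv> Psi X \<Gamma> G"

lemma xmod: "crossed_module X G" and lact0: "left_action X \<Gamma> (G0 G) (lact0 G)"
  using G unfolding gamma_crossed_module_def by blast+

lemma G1: "group_over X (G1 G)" and G0: "group_over X (G0 G)"
  and bd: "bd G \<in> ghoms X (G1 G) (G0 G)"
  using xmod unfolding crossed_module_def by blast+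

lemmas bd_maps = ghom_maps[OF G1 G0 bd] and bd_sec = ghom_sec[OF G1 G0 bd] and bd_res = ghom_res[OF G1 G0 bd]
  and bd_mult = ghom_mult[OF G1 G0 bd] and bd_one = ghom_one[OF G1 G0 bd] and bd_inv = ghom_inv[OF G1 G0 bd]

lemma ract_hom: "\<lbrakk>U \<in> obs X; g \<in> sec (G0 G) U\<rbrakk>
    \<Longrightarrow> (\<lambda>a. ract G U a g) \<in> hom (grp (G1 G) U) (grp (G1 G) U)"
  using xmod unfolding crossed_module_def by blast

lemma ract_res: "\<lbrakk>f \<in> into X U; a \<in> sec (G1 G) U; g \<in> sec (G0 G) U\<rbrakk>
    \<Longrightarrow> res (G1 G) f (ract G U a g) = ract G (dm X f) (res (G1 G) f a) (res (G0 G) f g)"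
  using xmod unfolding crossed_module_def into_def by blast

lemma ract_id: "\<lbrakk>U \<in> obs X; a \<in> sec (G1 G) U\<rbrakk> \<Longrightarrow> ract G U a \<one>\<^bsub>grp (G0 G) U\<^esub> = a"
  using xmod unfolding crossed_module_def by blast

lemma ract_comp: "\<lbrakk>U \<in> obs X; a \<in> sec (G1 G) U; g \<in> sec (G0 G) U; h \<in> sec (G0 G) U\<rbrakk>
    \<Longrightarrow> ract G U a (g \<otimes>\<^bsub>grp (G0 G) U\<^esub> h) = ract G U (ract G U a g) h"
  using xmod unfolding crossed_module_def by blast

lemma bd_ract: "\<lbrakk>U \<in> obs X; a \<in> sec (G1 G) U; g \<in> sec (G0 G) U\<rbrakk>
    \<Longrightarrow> bd G U (ract G U a g) = inv\<^bsub>grp (G0 G) U\<^esub> g \<otimes>\<^bsub>grp (G0 G) U\<^esub> bd G U a \<otimes>\<^bsub>grp (G0 G) U\<^esub> g"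
  using xmod unfolding crossed_module_def by blast

lemma peiffer: "\<lbrakk>U \<in> obs X; a \<in> sec (G1 G) U; b \<in> sec (G1 G) U\<rbrakk>
    \<Longrightarrow> ract G U a (bd G U b) = inv\<^bsub>grp (G1 G) U\<^esub> b \<otimes>\<^bsub>grp (G1 G) U\<^esub> a \<otimes>\<^bsub>grp (G1 G) U\<^esub> b"
  using xmod unfolding crossed_module_def by blast

lemma ract:
  assumes "U \<in> obs X" "g \<in> sec (G0 G) U"
  shows ract_sec: "a \<in> sec (G1 G) U \<Longrightarrow> ract G U a g \<in> sec (G1 G) U"
    and ract_mult: "\<lbrakk>a \<in> sec (G1 G) U; b \<in> sec (G1 G) U\<rbrakk>
        \<Longrightarrow> ract G U (a \<otimes>\<^bsub>grp (G1 G) U\<^esub> b) g = ract G U a g \<otimes>\<^bsub>grp (G1 G) U\<^esub> ract G U b g"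
    and ract_one: "ract G U \<one>\<^bsub>grp (G1 G) U\<^esub> g = \<one>\<^bsub>grp (G1 G) U\<^esub>"
    and ract_inv: "a \<in> sec (G1 G) U \<Longrightarrow> ract G U (inv\<^bsub>grp (G1 G) U\<^esub> a) g = inv\<^bsub>grp (G1 G) U\<^esub> (ract G U a g)"
  using endo[OF grp_group[OF G1 assms(1)] ract_hom[OF assms]] by simp_all

lemma lact0_hom: "\<lbrakk>U \<in> obs X; s \<in> sec \<Gamma> U\<rbrakk> \<Longrightarrow> lact0 G U s \<in> hom (grp (G0 G) U) (grp (G0 G) U)"
  using lact0 unfolding left_action_def by blast

lemma lact:
  assumes "U \<in> obs X" "s \<in> sec \<Gamma> U"
  shows lact0_sec: "a \<in> sec (G0 G) U \<Longrightarrow> lact0 G U s a \<in> sec (G0 G) U"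
    and lact0_mult: "\<lbrakk>a \<in> sec (G0 G) U; b \<in> sec (G0 G) U\<rbrakk>
        \<Longrightarrow> lact0 G U s (a \<otimes>\<^bsub>grp (G0 G) U\<^esub> b) = lact0 G U s a \<otimes>\<^bsub>grp (G0 G) U\<^esub> lact0 G U s b"
    and lact0_one: "lact0 G U s \<one>\<^bsub>grp (G0 G) U\<^esub> = \<one>\<^bsub>grp (G0 G) U\<^esub>"
    and lact0_inv: "a \<in> sec (G0 G) U \<Longrightarrow> lact0 G U s (inv\<^bsub>grp (G0 G) U\<^esub> a) = inv\<^bsub>grp (G0 G) U\<^esub> (lact0 G U s a)"
  using endo[OF grp_group[OF G0 assms(1)] lact0_hom[OF assms]] by simp_all

lemma lact0_res: "\<lbrakk>f \<in> into X U; s \<in> sec \<Gamma> U; a \<in> sec (G0 G) U\<rbrakk>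
    \<Longrightarrow> res (G0 G) f (lact0 G U s a) = lact0 G (dm X f) (res \<Gamma> f s) (res (G0 G) f a)"
  using lact0 unfolding left_action_def into_def by blast

lemma lact0_id: "\<lbrakk>U \<in> obs X; a \<in> sec (G0 G) U\<rbrakk> \<Longrightarrow> lact0 G U \<one>\<^bsub>grp \<Gamma> U\<^esub> a = a"
  using lact0 unfolding left_action_def by blast

lemma zobj:
  assumes "E \<in> Z0"
  shows tot: "group_over X (tot E)"
    and inc: "inc E \<in> ghoms X (G1 G) (tot E)"
    and prj: "prj E \<in> ghoms X (tot E) \<Gamma>"
    and rho: "rho E \<in> maps X (tot E) (G0 G)"
    and rho_inc: "\<lbrakk>U \<in> obs X; a \<in> sec (G1 G) U\<rbrakk> \<Longrightarrow> rho E U (inc E U a) = bd G U a"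
    and rho_mult: "\<lbrakk>U \<in> obs X; x \<in> sec (tot E) U; y \<in> sec (tot E) U\<rbrakk> \<Longrightarrow>
        rho E U (x \<otimes>\<^bsub>grp (tot E) U\<^esub> y) = rho E U x \<otimes>\<^bsub>grp (G0 G) U\<^esub> lact0 G U (prj E U x) (rho E U y)"
    and prj_inc: "\<lbrakk>U \<in> obs X; a \<in> sec (G1 G) U\<rbrakk> \<Longrightarrow> prj E U (inc E U a) = \<one>\<^bsub>grp \<Gamma> U\<^esub>"
proof -
  have e: "is_extension X (G1 G) (tot E) \<Gamma> (inc E) (prj E)"
    using assms unfolding z_objects_def by blast
  show "group_over X (tot E)" "inc E \<in> ghoms X (G1 G) (tot E)" "prj E \<in> ghoms X (tot E) \<Gamma>"
    using e unfolding is_extension_def by blast+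
  show "rho E \<in> maps X (tot E) (G0 G)" using assms unfolding z_objects_def by blast
  show "rho E U (inc E U a) = bd G U a" if "U \<in> obs X" "a \<in> sec (G1 G) U"
    using assms that unfolding z_objects_def by blast
  show "rho E U (x \<otimes>\<^bsub>grp (tot E) U\<^esub> y) = rho E U x \<otimes>\<^bsub>grp (G0 G) U\<^esub> lact0 G U (prj E U x) (rho E U y)"
    if "U \<in> obs X" "x \<in> sec (tot E) U" "y \<in> sec (tot E) U"
    using assms that unfolding z_objects_def by blast
  show "prj E U (inc E U a) = \<one>\<^bsub>grp \<Gamma> U\<^esub>" if "U \<in> obs X" "a \<in> sec (G1 G) U"
  proof -
    have "inc E U ` sec (G1 G) U = {x \<in> sec (tot E) U. prj E U x = \<one>\<^bsub>grp \<Gamma> U\<^esub>}"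
      using e that(1) unfolding is_extension_def by blast
    thus ?thesis using that(2) by blast
  qed
qed

lemma zobj_inc:
  assumes "E \<in> Z0"
  shows inc_sec: "\<lbrakk>U \<in> obs X; a \<in> sec (G1 G) U\<rbrakk> \<Longrightarrow> inc E U a \<in> sec (tot E) U"
    and inc_res: "\<lbrakk>f \<in> into X U; a \<in> sec (G1 G) U\<rbrakk> \<Longrightarrow> res (tot E) f (inc E U a) = inc E (dm X f) (res (G1 G) f a)"
    and inc_mult: "\<lbrakk>U \<in> obs X; a \<in> sec (G1 G) U; b \<in> sec (G1 G) U\<rbrakk>
        \<Longrightarrow> inc E U (a \<otimes>\<^bsub>grp (G1 G) U\<^esub> b) = inc E U a \<otimes>\<^bsub>grp (tot E) U\<^esub> inc E U b"
    and inc_one: "U \<in> obs X \<Longrightarrow> inc E U \<one>\<^bsub>grp (G1 G) U\<^esub> = \<one>\<^bsub>grp (tot E) U\<^esub>"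
    and inc_inv: "\<lbrakk>U \<in> obs X; a \<in> sec (G1 G) U\<rbrakk> \<Longrightarrow> inc E U (inv\<^bsub>grp (G1 G) U\<^esub> a) = inv\<^bsub>grp (tot E) U\<^esub> (inc E U a)"
  by (rule ghom_sec[OF G1 tot[OF assms] inc[OF assms]] ghom_res[OF G1 tot[OF assms] inc[OF assms]]
    ghom_mult[OF G1 tot[OF assms] inc[OF assms]] ghom_one[OF G1 tot[OF assms] inc[OF assms]]
    ghom_inv[OF G1 tot[OF assms] inc[OF assms]]; assumption)+

lemma zobj_prj:
  assumes "E \<in> Z0"
  shows prj_sec: "\<lbrakk>U \<in> obs X; x \<in> sec (tot E) U\<rbrakk> \<Longrightarrow> prj E U x \<in> sec \<Gamma> U"
    and prj_res: "\<lbrakk>f \<in> into X U; x \<in> sec (tot E) U\<rbrakk> \<Longrightarrow> res \<Gamma> f (prj E U x) = prj E (dm X f) (res (tot E) f x)"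
    and prj_mult: "\<lbrakk>U \<in> obs X; x \<in> sec (tot E) U; y \<in> sec (tot E) U\<rbrakk>
        \<Longrightarrow> prj E U (x \<otimes>\<^bsub>grp (tot E) U\<^esub> y) = prj E U x \<otimes>\<^bsub>grp \<Gamma> U\<^esub> prj E U y"
    and rho_sec: "\<lbrakk>U \<in> obs X; x \<in> sec (tot E) U\<rbrakk> \<Longrightarrow> rho E U x \<in> sec (G0 G) U"
    and rho_res: "\<lbrakk>f \<in> into X U; x \<in> sec (tot E) U\<rbrakk> \<Longrightarrow> res (G0 G) f (rho E U x) = rho E (dm X f) (res (tot E) f x)"
  by (rule ghom_sec[OF tot[OF assms] \<Gamma> prj[OF assms]] ghom_res[OF tot[OF assms] \<Gamma> prj[OF assms]]
    ghom_mult[OF tot[OF assms] \<Gamma> prj[OF assms]] maps_sec[OF rho[OF assms]] maps_res[OF rho[OF assms]]; assumption)+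

end

section \<open>Twisted groups\<close>

text \<open>The contracted product of a torsor \<open>P\<close> with a group \<open>E\<close> on which \<open>G\<^sub>1\<close> acts by conjugation is a
  group: over an object where \<open>P\<close> has a section it is a copy of \<open>E\<close>, and the group laws are local.\<close>

locale twisted = gamma_xmod X \<Gamma> G
  for X :: "('o, 'm) site" and \<Gamma> :: "('o, 'm, 'g) gsheaf" and G :: "('o, 'm, 'a, 'b, 'g) xmod" +
  fixes P :: "('o, 'm, 'p, 'a) rtorsor" and E :: "('o, 'm, 'e, 'a, 'b, 'g) zobj"
  assumes P: "is_torsor X (G1 G) P" and E: "group_over X (tot E)" and i: "inc E \<in> ghoms X (G1 G) (tot E)"

sublocale twisted \<subseteq> C: contracted X "G1 G" P "tot E" "conj_act E"
  rewrites "ctr X (G1 G) P (tot E) (conj_act E) = tw_sheaf X G P E"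
    and "ctr_pt X (G1 G) P (tot E) (conj_act E) = tw_pt X G P E"
proof -
  show "contracted X (G1 G) P (tot E) (conj_act E)"
  proof (unfold_locales)
    show "is_sheaf X (tot E)" by (rule grp_sheaf[OF E])
    note i_sec = ghom_sec[OF G1 E i]
    show "conj_act E U a x \<in> sec (tot E) U" if "U \<in> obs X" "a \<in> sec (G1 G) U" "x \<in> sec (tot E) U" for U a x
      unfolding conj_act_def using that i_sec mult_sec[OF E] inv_sec[OF E] by simp
    show "res (tot E) f (conj_act E U a x) = conj_act E (dm X f) (res (G1 G) f a) (res (tot E) f x)"
      if "f \<in> into X U" "a \<in> sec (G1 G) U" "x \<in> sec (tot E) U" for f U a x
      unfolding conj_act_def using that i_sec[OF into_obs[OF that(1)]] mult_sec[OF E into_obs[OF that(1)]]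
        inv_sec[OF E into_obs[OF that(1)]]
      by (simp add: res_mult[OF E that(1)] res_inv[OF E that(1)] ghom_res[OF G1 E i that(1)])
    fix U a x assume U: "U \<in> obs X" and x: "x \<in> sec (tot E) U"
    interpret E: section_group "tot E" U by (rule section_groupI[OF E U])
    show "conj_act E U \<one>\<^bsub>grp (G1 G) U\<^esub> x = x"
      unfolding conj_act_def ghom_one[OF G1 E i U] using x by simp
    fix b assume a: "a \<in> sec (G1 G) U" and b: "b \<in> sec (G1 G) U"
    show "conj_act E U (a \<otimes>\<^bsub>grp (G1 G) U\<^esub> b) x = conj_act E U a (conj_act E U b x)"
      unfolding conj_act_def ghom_mult[OF G1 E i U a b]
      using x i_sec[OF U a] i_sec[OF U b] by (simp add: E.m_assoc E.inv_mult_group)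
  qed (rule G1 P)+
qed (simp_all add: tw_sheaf_def tw_pt_def)

context twisted
begin

abbreviation "T \<equiv> tw_sheaf X G P E"
abbreviation "M \<equiv> tw_group X G P E"
abbreviation "pt \<equiv> tw_pt X G P E"

lemma sec_M [simp]: "sec M = sec T" and res_M [simp]: "res M = res T"
  unfolding tw_group_def by (simp_all add: Let_def)

lemma T_eqI:
  assumes "U \<in> obs X" "s \<in> sec T U" "s' \<in> sec T U"
    and "\<And>f u. \<lbrakk>f \<in> into X U; u \<in> sec P (dm X f)\<rbrakk> \<Longrightarrow> res T f s = res T f s'"
  shows "s = s'"
  by (rule eq_densely[OF C.T_sheaf tor_dense[OF P] assms(1-3)]) (use assms(4) in blast)

text \<open>The condition with \<open>conj_act\<close> expresses that the section \<open>(u, k u)\<close> does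
  not depend on \<open>u\<close>, as \<open>(u a, x) = (u, a x a\<^sup>-\<^sup>1)\<close>.\<close>

lemma glue_T:
  assumes U: "U \<in> obs X"
    and "\<And>f u. \<lbrakk>f \<in> into X U; u \<in> sec P (dm X f)\<rbrakk> \<Longrightarrow> k f u \<in> sec (tot E) (dm X f)"
    and "\<And>f u h. \<lbrakk>f \<in> into X U; u \<in> sec P (dm X f); h \<in> into X (dm X f)\<rbrakk>
        \<Longrightarrow> res (tot E) h (k f u) = k (cmp X f h) (res P h u)"
    and "\<And>f u a. \<lbrakk>f \<in> into X U; u \<in> sec P (dm X f); a \<in> sec (G1 G) (dm X f)\<rbrakk>
        \<Longrightarrow> conj_act E (dm X f) a (k f (tact P (dm X f) u a)) = k f u"
  shows "\<exists>!z. z \<in> sec T U \<and> (\<forall>f\<in>into X U. \<forall>u\<in>sec P (dm X f). res T f z = pt (dm X f) u (k f u))"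
proof (rule glue_over[OF C.T_sheaf C.PP tor_dense[OF P] U])
  fix f u assume f: "f \<in> into X U" and u: "u \<in> sec P (dm X f)"
  note k = assms(2)[OF f u]
  show "pt (dm X f) u (k f u) \<in> sec T (dm X f)" by (rule C.pt_sec[OF dm_into[OF f] u k])
  show "res T h (pt (dm X f) u (k f u)) = pt (dm X (cmp X f h)) (res P h u) (k (cmp X f h) (res P h u))"
    if h: "h \<in> into X (dm X f)" for h
    unfolding C.pt_res[OF h u k] assms(3)[OF f u h] dm_cmp_into[OF f h] ..
  show "pt (dm X f) u (k f u) = pt (dm X f) v (k f v)" if v: "v \<in> sec P (dm X f)" for v
  proof -
    obtain a where a: "a \<in> sec (G1 G) (dm X f)" "v = tact P (dm X f) u a"
      using tact_diff[OF P dm_into[OF f] u v] .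
    show ?thesis
      using C.pt_bal[OF dm_into[OF f] u a(1) assms(2)[OF f v]] assms(4)[OF f u a(1)] a(2) by simp
  qed
qed

lemma conj_act_mult:
  assumes U: "U \<in> obs X" and a: "a \<in> sec (G1 G) U" and x: "x \<in> sec (tot E) U" "y \<in> sec (tot E) U"
  shows "conj_act E U a (x \<otimes>\<^bsub>grp (tot E) U\<^esub> y) = conj_act E U a x \<otimes>\<^bsub>grp (tot E) U\<^esub> conj_act E U a y"
    and "conj_act E U a (inv\<^bsub>grp (tot E) U\<^esub> x) = inv\<^bsub>grp (tot E) U\<^esub> (conj_act E U a x)"
    and "conj_act E U a \<one>\<^bsub>grp (tot E) U\<^esub> = \<one>\<^bsub>grp (tot E) U\<^esub>"
proof -
  interpret E: section_group "tot E" U by (rule section_groupI[OF E U])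
  note [simp] = ghom_sec[OF G1 E i U a]
  show "conj_act E U a (x \<otimes>\<^bsub>grp (tot E) U\<^esub> y) = conj_act E U a x \<otimes>\<^bsub>grp (tot E) U\<^esub> conj_act E U a y"
    "conj_act E U a (inv\<^bsub>grp (tot E) U\<^esub> x) = inv\<^bsub>grp (tot E) U\<^esub> (conj_act E U a x)"
    "conj_act E U a \<one>\<^bsub>grp (tot E) U\<^esub> = \<one>\<^bsub>grp (tot E) U\<^esub>"
    unfolding conj_act_def using x by (simp_all add: E.m_assoc E.inv_mult_group)
qed

text \<open>The product of coordinates prescribes a section because conjugation is an automorphism.\<close>

lemma mult_ex1:
  assumes U: "U \<in> obs X" and s: "s \<in> sec T U" "s' \<in> sec T U"
  shows "\<exists>!z. z \<in> sec T U \<and> (\<forall>f\<in>into X U. \<forall>u\<in>sec P (dm X f). res T f z =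
     pt (dm X f) u (C.co (dm X f) u (res T f s) \<otimes>\<^bsub>grp (tot E) (dm X f)\<^esub> C.co (dm X f) u (res T f s')))"
proof (rule glue_T[OF U])
  fix f u assume f: "f \<in> into X U" and u: "u \<in> sec P (dm X f)"
  note r = res_sec[OF C.TP f s(1)] res_sec[OF C.TP f s(2)]
  note c = C.co_sec[OF dm_into[OF f] u r(1)] C.co_sec[OF dm_into[OF f] u r(2)]
  show "C.co (dm X f) u (res T f s) \<otimes>\<^bsub>grp (tot E) (dm X f)\<^esub> C.co (dm X f) u (res T f s') \<in> sec (tot E) (dm X f)"
    by (rule mult_sec[OF E dm_into[OF f] c])
  show "res (tot E) h (C.co (dm X f) u (res T f s) \<otimes>\<^bsub>grp (tot E) (dm X f)\<^esub> C.co (dm X f) u (res T f s'))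
      = C.co (dm X (cmp X f h)) (res P h u) (res T (cmp X f h) s)
        \<otimes>\<^bsub>grp (tot E) (dm X (cmp X f h))\<^esub> C.co (dm X (cmp X f h)) (res P h u) (res T (cmp X f h) s')"
    if h: "h \<in> into X (dm X f)" for h
    unfolding res_mult[OF E h c] C.co_res[OF h u r(1)] C.co_res[OF h u r(2)] dm_cmp_into[OF f h]
      res_cmp[OF C.TP f s(1) h] res_cmp[OF C.TP f s(2) h] ..
  fix a assume a: "a \<in> sec (G1 G) (dm X f)"
  let ?v = "tact P (dm X f) u a"
  have v: "?v \<in> sec P (dm X f)" by (rule tact_sec[OF P dm_into[OF f] u a])
  show "conj_act E (dm X f) a (C.co (dm X f) ?v (res T f s) \<otimes>\<^bsub>grp (tot E) (dm X f)\<^esub> C.co (dm X f) ?v (res T f s'))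
      = C.co (dm X f) u (res T f s) \<otimes>\<^bsub>grp (tot E) (dm X f)\<^esub> C.co (dm X f) u (res T f s')"
    unfolding conj_act_mult(1)[OF dm_into[OF f] a C.co_sec[OF dm_into[OF f] v r(1)] C.co_sec[OF dm_into[OF f] v r(2)]]
    using C.co_bal[OF dm_into[OF f] u a r(1)] C.co_bal[OF dm_into[OF f] u a r(2)] by simp
qed

text \<open>The multiplication is specified by all pairs of representatives with a common first entry; such
  pairs are the pairs of coordinates.\<close>

lemma gmul_M:
  assumes U: "U \<in> obs X" and s: "s \<in> sec T U" "s' \<in> sec T U"
  shows gmul_sec: "gmul M U s s' \<in> sec T U"
    and gmul_co: "\<lbrakk>f \<in> into X U; u \<in> sec P (dm X f)\<rbrakk> \<Longrightarrow> res T f (gmul M U s s') =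
     pt (dm X f) u (C.co (dm X f) u (res T f s) \<otimes>\<^bsub>grp (tot E) (dm X f)\<^esub> C.co (dm X f) u (res T f s'))"
proof -
  have iff: "(\<forall>f c c' u x y. (f, c) \<in> s \<and> (f, c') \<in> s' \<and> (u, x) \<in> c \<and> (u, y) \<in> c' \<longrightarrow>
           res T f z = pt (dm X f) u (x \<otimes>\<^bsub>grp (tot E) (dm X f)\<^esub> y)) \<longleftrightarrow>
      (\<forall>f\<in>into X U. \<forall>u\<in>sec P (dm X f). res T f z =
     pt (dm X f) u (C.co (dm X f) u (res T f s) \<otimes>\<^bsub>grp (tot E) (dm X f)\<^esub> C.co (dm X f) u (res T f s')))"
    (is "?L \<longleftrightarrow> ?R") for z
  proof
    assume L: ?L
    show ?R
    proof (intro ballI)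
      fix f u assume f: "f \<in> into X U" and u: "u \<in> sec P (dm X f)"
      note r = res_sec[OF C.TP f s(1)] res_sec[OF C.TP f s(2)]
      note c = C.co[OF dm_into[OF f] u r(1)] C.co[OF dm_into[OF f] u r(2)]
      show "res T f z = pt (dm X f) u
         (C.co (dm X f) u (res T f s) \<otimes>\<^bsub>grp (tot E) (dm X f)\<^esub> C.co (dm X f) u (res T f s'))"
        using C.pt_mem(2)[OF U s(1) f u c(1) c(2)[symmetric]] C.pt_mem(2)[OF U s(2) f u c(3) c(4)[symmetric]] L
        by blast
    qed
  next
    assume R: ?R
    show ?L
    proof (intro allI impI, elim conjE)
      fix f c c' u x y
      assume fc: "(f, c) \<in> s" "(f, c') \<in> s'" and ux: "(u, x) \<in> c" "(u, y) \<in> c'"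
      note m = C.pt_mem(1)[OF U s(1) fc(1) ux(1)] C.pt_mem(1)[OF U s(2) fc(2) ux(2)]
      have "C.co (dm X f) u (res T f s) = x" "C.co (dm X f) u (res T f s') = y"
        using m C.co_pt[OF dm_into, of f U u] by auto
      thus "res T f z = pt (dm X f) u (x \<otimes>\<^bsub>grp (tot E) (dm X f)\<^esub> y)" using R m by blast
    qed
  qed
  have d: "gmul M U s s' = (THE z. z \<in> sec T U \<and> (\<forall>f\<in>into X U. \<forall>u\<in>sec P (dm X f). res T f z =
     pt (dm X f) u (C.co (dm X f) u (res T f s) \<otimes>\<^bsub>grp (tot E) (dm X f)\<^esub> C.co (dm X f) u (res T f s'))))"
    unfolding iff[symmetric] tw_group_def by (simp add: Let_def)
  note t = theI'[OF mult_ex1[OF assms], folded d]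
  show "gmul M U s s' \<in> sec T U" using t by blast
  show "res T f (gmul M U s s') =
     pt (dm X f) u (C.co (dm X f) u (res T f s) \<otimes>\<^bsub>grp (tot E) (dm X f)\<^esub> C.co (dm X f) u (res T f s'))"
    if "f \<in> into X U" "u \<in> sec P (dm X f)" using t that by blast
qed

lemma gmul_pt:
  assumes U: "U \<in> obs X" and u: "u \<in> sec P U" and x: "x \<in> sec (tot E) U" "y \<in> sec (tot E) U"
  shows "gmul M U (pt U u x) (pt U u y) = pt U u (x \<otimes>\<^bsub>grp (tot E) U\<^esub> y)"
proof -
  note p = C.pt_sec[OF U u x(1)] C.pt_sec[OF U u x(2)]
  have u': "u \<in> sec P (dm X (idn X U))" using u dm_idn[OF U] by simp
  show ?thesis
    using gmul_co[OF U p idn_into[OF U] u'] dm_idn[OF U]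
    by (simp add: res_idn[OF C.TP U] p gmul_sec[OF U p] C.co_pt[OF U u] x)
qed

lemma gmul_res:
  assumes f: "f \<in> into X U" and s: "s \<in> sec T U" "s' \<in> sec T U"
  shows "res T f (gmul M U s s') = gmul M (dm X f) (res T f s) (res T f s')"
proof (rule T_eqI[OF dm_into[OF f]])
  note U = into_obs[OF f] and r = res_sec[OF C.TP f s(1)] res_sec[OF C.TP f s(2)]
  note g = gmul_sec[OF U s]
  show "res T f (gmul M U s s') \<in> sec T (dm X f)" by (rule res_sec[OF C.TP f g])
  show "gmul M (dm X f) (res T f s) (res T f s') \<in> sec T (dm X f)" by (rule gmul_sec[OF dm_into[OF f] r])
  fix h u assume h: "h \<in> into X (dm X f)" and u: "u \<in> sec P (dm X h)"
  have u': "u \<in> sec P (dm X (cmp X f h))" using u dm_cmp_into[OF f h] by simp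
  show "res T h (res T f (gmul M U s s')) = res T h (gmul M (dm X f) (res T f s) (res T f s'))"
    using gmul_co[OF U s cmp_into[OF f h] u'] gmul_co[OF dm_into[OF f] r h u] dm_cmp_into[OF f h]
      res_cmp[OF C.TP f g h] res_cmp[OF C.TP f s(1) h] res_cmp[OF C.TP f s(2) h] by simp
qed

lemma gone_M:
  assumes U: "U \<in> obs X"
  shows gone_sec: "gone M U \<in> sec T U"
    and gone_res: "\<lbrakk>f \<in> into X U; u \<in> sec P (dm X f)\<rbrakk> \<Longrightarrow> res T f (gone M U) = pt (dm X f) u \<one>\<^bsub>grp (tot E) (dm X f)\<^esub>"
    and gone_pt: "u \<in> sec P U \<Longrightarrow> gone M U = pt U u \<one>\<^bsub>grp (tot E) U\<^esub>"
proof -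
  have e: "\<exists>!z. z \<in> sec T U \<and> (\<forall>f\<in>into X U. \<forall>u\<in>sec P (dm X f).
      res T f z = pt (dm X f) u \<one>\<^bsub>grp (tot E) (dm X f)\<^esub>)"
  proof (rule glue_T[OF U])
    fix f u assume f: "f \<in> into X U"
    show "\<one>\<^bsub>grp (tot E) (dm X f)\<^esub> \<in> sec (tot E) (dm X f)" by (rule one_sec[OF E dm_into[OF f]])
    show "res (tot E) h \<one>\<^bsub>grp (tot E) (dm X f)\<^esub> = \<one>\<^bsub>grp (tot E) (dm X (cmp X f h))\<^esub>"
      if "h \<in> into X (dm X f)" for h using res_one[OF E that] dm_cmp_into[OF f that] by simp
    show "conj_act E (dm X f) a \<one>\<^bsub>grp (tot E) (dm X f)\<^esub> = \<one>\<^bsub>grp (tot E) (dm X f)\<^esub>"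
      if "a \<in> sec (G1 G) (dm X f)" for a
      using conj_act_mult(3)[OF dm_into[OF f] that] one_sec[OF E dm_into[OF f]] by blast
  qed
  have d: "gone M U = (THE z. z \<in> sec T U \<and> (\<forall>f\<in>into X U. \<forall>u\<in>sec P (dm X f).
      res T f z = pt (dm X f) u \<one>\<^bsub>grp (tot E) (dm X f)\<^esub>))"
    unfolding tw_group_def by (simp add: Let_def)
  note t = theI'[OF e, folded d]
  show *: "gone M U \<in> sec T U" using t by blast
  show **: "res T f (gone M U) = pt (dm X f) u \<one>\<^bsub>grp (tot E) (dm X f)\<^esub>"
    if "f \<in> into X U" "u \<in> sec P (dm X f)" for f u using t that by blast
  show "u \<in> sec P U \<Longrightarrow> gone M U = pt U u \<one>\<^bsub>grp (tot E) U\<^esub>"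
    using **[OF idn_into[OF U]] dm_idn[OF U] res_idn[OF C.TP U *] by simp
qed

lemma mult_M: "s \<otimes>\<^bsub>grp M U\<^esub> s' = gmul M U s s'" and one_M: "\<one>\<^bsub>grp M U\<^esub> = gone M U"
  unfolding grp_def by simp_all

lemma M_coE:
  assumes "f \<in> into X U" "u \<in> sec P (dm X f)" "s \<in> sec T U"
  obtains x where "x \<in> sec (tot E) (dm X f)" "res T f s = pt (dm X f) u x"
  using C.co[OF dm_into[OF assms(1)] assms(2) res_sec[OF C.TP assms(1,3)]] by metis

text \<open>Every law holds in coordinates, where it is the same law in \<open>E\<close>, and equality of
  sections is local. Inverses have no formula of their own and are glued from the inverses in
  coordinates.\<close>

lemma M_group: "U \<in> obs X \<Longrightarrow> group (grp M U)"
proof (rule groupI)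
  assume U: "U \<in> obs X"
  have E': "group (grp (tot E) (dm X f))" if "f \<in> into X U" for f
    by (rule grp_group[OF E dm_into[OF that]])
  show "\<one>\<^bsub>grp M U\<^esub> \<in> carrier (grp M U)" using gone_sec[OF U] by (simp add: one_M)
  fix x assume "x \<in> carrier (grp M U)" hence x: "x \<in> sec T U" by simp
  note o = gone_sec[OF U]
  show "\<one>\<^bsub>grp M U\<^esub> \<otimes>\<^bsub>grp M U\<^esub> x = x"
    unfolding mult_M one_M
  proof (rule T_eqI[OF U gmul_sec[OF U o x] x])
    fix f u assume f: "f \<in> into X U" and u: "u \<in> sec P (dm X f)"
    obtain x' where x': "x' \<in> sec (tot E) (dm X f)" "res T f x = pt (dm X f) u x'" using M_coE[OF f u x] .
    interpret E: section_group "tot E" "dm X f" by (rule section_groupI[OF E dm_into[OF f]])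
    show "res T f (gmul M U (gone M U) x) = res T f x"
      unfolding gmul_res[OF f o x] gone_res[OF U f u] x'(2) gmul_pt[OF dm_into[OF f] u E.one_closed x'(1)]
      using x'(1) by simp
  qed
  show "\<exists>y\<in>carrier (grp M U). y \<otimes>\<^bsub>grp M U\<^esub> x = \<one>\<^bsub>grp M U\<^esub>"
  proof -
    have "\<exists>!z. z \<in> sec T U \<and> (\<forall>f\<in>into X U. \<forall>u\<in>sec P (dm X f).
      res T f z = pt (dm X f) u (inv\<^bsub>grp (tot E) (dm X f)\<^esub> (C.co (dm X f) u (res T f x))))"
    proof (rule glue_T[OF U])
      fix f u assume f: "f \<in> into X U" and u: "u \<in> sec P (dm X f)"
      note r = res_sec[OF C.TP f x]
      note c = C.co_sec[OF dm_into[OF f] u r]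
      show "inv\<^bsub>grp (tot E) (dm X f)\<^esub> (C.co (dm X f) u (res T f x)) \<in> sec (tot E) (dm X f)"
        by (rule inv_sec[OF E dm_into[OF f] c])
      show "res (tot E) h (inv\<^bsub>grp (tot E) (dm X f)\<^esub> (C.co (dm X f) u (res T f x)))
        = inv\<^bsub>grp (tot E) (dm X (cmp X f h))\<^esub> (C.co (dm X (cmp X f h)) (res P h u) (res T (cmp X f h) x))"
        if h: "h \<in> into X (dm X f)" for h
        unfolding res_inv[OF E h c] C.co_res[OF h u r] dm_cmp_into[OF f h] res_cmp[OF C.TP f x h] ..
      fix a assume a: "a \<in> sec (G1 G) (dm X f)"
      have v: "tact P (dm X f) u a \<in> sec P (dm X f)" by (rule tact_sec[OF P dm_into[OF f] u a])
      note cv = C.co_sec[OF dm_into[OF f] v r]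
      show "conj_act E (dm X f) a (inv\<^bsub>grp (tot E) (dm X f)\<^esub> (C.co (dm X f) (tact P (dm X f) u a) (res T f x)))
         = inv\<^bsub>grp (tot E) (dm X f)\<^esub> (C.co (dm X f) u (res T f x))"
        unfolding conj_act_mult(2)[OF dm_into[OF f] a cv cv]
        using C.co_bal[OF dm_into[OF f] u a r] by simp
    qed
    then obtain y where y: "y \<in> sec T U" "\<And>f u. \<lbrakk>f \<in> into X U; u \<in> sec P (dm X f)\<rbrakk> \<Longrightarrow>
      res T f y = pt (dm X f) u (inv\<^bsub>grp (tot E) (dm X f)\<^esub> (C.co (dm X f) u (res T f x)))" by blast
    have "gmul M U y x = gone M U"
    proof (rule T_eqI[OF U gmul_sec[OF U y(1) x] o])
      fix f u assume f: "f \<in> into X U" and u: "u \<in> sec P (dm X f)"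
      obtain x' where x': "x' \<in> sec (tot E) (dm X f)" "res T f x = pt (dm X f) u x'" using M_coE[OF f u x] .
      interpret E: section_group "tot E" "dm X f" by (rule section_groupI[OF E dm_into[OF f]])
      have yf: "res T f y = pt (dm X f) u (inv\<^bsub>grp (tot E) (dm X f)\<^esub> x')"
        using y(2)[OF f u] x'(2) C.co_pt[OF dm_into[OF f] u x'(1)] by simp
      show "res T f (gmul M U y x) = res T f (gone M U)"
        unfolding gmul_res[OF f y(1) x] yf x'(2) gmul_pt[OF dm_into[OF f] u E.inv_closed[OF x'(1)] x'(1)]
          gone_res[OF U f u] E.l_inv[OF x'(1)] ..
    qed
    thus ?thesis using y(1) by (auto simp: mult_M one_M)
  qed
  fix y z assume "y \<in> carrier (grp M U)" hence y: "y \<in> sec T U" by simp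
  show "x \<otimes>\<^bsub>grp M U\<^esub> y \<in> carrier (grp M U)" using gmul_sec[OF U x y] by (simp add: mult_M)
  assume "z \<in> carrier (grp M U)" hence z: "z \<in> sec T U" by simp
  note xy = gmul_sec[OF U x y] and yz = gmul_sec[OF U y z]
  show "x \<otimes>\<^bsub>grp M U\<^esub> y \<otimes>\<^bsub>grp M U\<^esub> z = x \<otimes>\<^bsub>grp M U\<^esub> (y \<otimes>\<^bsub>grp M U\<^esub> z)"
    unfolding mult_M
  proof (rule T_eqI[OF U gmul_sec[OF U xy z] gmul_sec[OF U x yz]])
    fix f u assume f: "f \<in> into X U" and u: "u \<in> sec P (dm X f)"
    obtain x' where x': "x' \<in> sec (tot E) (dm X f)" "res T f x = pt (dm X f) u x'" using M_coE[OF f u x] .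
    obtain y' where y': "y' \<in> sec (tot E) (dm X f)" "res T f y = pt (dm X f) u y'" using M_coE[OF f u y] .
    obtain z' where z': "z' \<in> sec (tot E) (dm X f)" "res T f z = pt (dm X f) u z'" using M_coE[OF f u z] .
    interpret E: section_group "tot E" "dm X f" by (rule section_groupI[OF E dm_into[OF f]])
    note [simp] = x'(1) y'(1) z'(1)
    show "res T f (gmul M U (gmul M U x y) z) = res T f (gmul M U x (gmul M U y z))"
      by (simp add: gmul_res[OF f xy z] gmul_res[OF f x yz] gmul_res[OF f x y] gmul_res[OF f y z]
        x'(2) y'(2) z'(2) gmul_pt[OF dm_into[OF f] u] E.m_assoc)
  qed
qed

lemma M_group_over: "group_over X M"
  unfolding group_over_def
proof (intro conjI ballI)
  show "is_sheaf X M" using C.T_sheaf is_sheaf_cong[of M T] by simp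
  show "group (grp M U)" if "U \<in> obs X" for U by (rule M_group[OF that])
  fix f assume "f \<in> ars X"
  hence f: "f \<in> into X (cd X f)" by (rule intoI)
  show "res M f \<in> hom (grp M (cd X f)) (grp M (dm X f))"
    by (rule homI) (use res_sec[OF C.TP f] gmul_res[OF f] in \<open>auto simp: mult_M\<close>)
qed

lemma inv_M:
  assumes U: "U \<in> obs X" and u: "u \<in> sec P U" and x: "x \<in> sec (tot E) U"
  shows "inv\<^bsub>grp M U\<^esub> (pt U u x) = pt U u (inv\<^bsub>grp (tot E) U\<^esub> x)"
proof -
  interpret E: section_group "tot E" U by (rule section_groupI[OF E U])
  show ?thesis
    by (rule group.inv_equality[OF M_group[OF U]])
      (use x C.pt_sec[OF U u] gmul_pt[OF U u _ x] in \<open>auto simp: mult_M one_M gone_pt[OF U u]\<close>)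
qed

end

section \<open>Arrows and 2-arrows in coordinates\<close>

lemma hom_mult': "\<lbrakk>h \<in> hom (grp A U) (grp B V); x \<in> sec A U; y \<in> sec A U\<rbrakk>
    \<Longrightarrow> h (x \<otimes>\<^bsub>grp A U\<^esub> y) = h x \<otimes>\<^bsub>grp B V\<^esub> h y"
  by (rule hom_mult) simp_all

context gamma_xmod
begin

text \<open>The pairs \<open>(P, \<phi>)\<close> of the torsor bigroupoid. A section \<open>u\<close> provides
  the element \<open>\<phi>(u)\<close> that plays the role of the global section \<open>g\<close> of an arrow of
  the 2-groupoid.\<close>

definition framed :: "('o, 'm, 'p, 'a) rtorsor \<Rightarrow> ('o \<Rightarrow> 'p \<Rightarrow> 'b) \<Rightarrow> bool" where
  "framed P \<phi> \<longleftrightarrow> is_torsor X (G1 G) P \<and> \<phi> \<in> maps X P (G0 G) \<and>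
     (\<forall>U\<in>obs X. \<forall>u\<in>sec P U. \<forall>a\<in>sec (G1 G) U.
        \<phi> U (tact P U u a) = \<phi> U u \<otimes>\<^bsub>grp (G0 G) U\<^esub> bd G U a)"

lemma framedD:
  assumes "framed P \<phi>"
  shows framed_torsor: "is_torsor X (G1 G) P" and framed_maps: "\<phi> \<in> maps X P (G0 G)"
    and framed_tact: "\<lbrakk>U \<in> obs X; u \<in> sec P U; a \<in> sec (G1 G) U\<rbrakk>
      \<Longrightarrow> \<phi> U (tact P U u a) = \<phi> U u \<otimes>\<^bsub>grp (G0 G) U\<^esub> bd G U a"
  using assms unfolding framed_def by blast+

text \<open>The conditions on an arrow of extensions at a single object. An arrow given by a global section of
  \<open>G\<^sub>0\<close> satisfies them everywhere; an arrow given by a torsor \<open>(P, \<phi>)\<close>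
  amounts to a family of maps that satisfy them, indexed by the local sections \<open>u\<close> of
  \<open>P\<close>, with \<open>g = \<phi>(u)\<close>, and compatible with restriction and with the action on
  \<open>P\<close>.\<close>

definition local_arrow :: "('o, 'm, 'e, 'a, 'b, 'g) zobj \<Rightarrow> ('o, 'm, 'e, 'a, 'b, 'g) zobj \<Rightarrow> 'o
    \<Rightarrow> ('e \<Rightarrow> 'e) \<Rightarrow> 'b \<Rightarrow> bool" where
  "local_arrow A B U s g \<longleftrightarrow> s \<in> iso (grp (tot A) U) (grp (tot B) U) \<and>
     (\<forall>x\<in>sec (tot A) U. prj B U (s x) = prj A U x) \<and>
     (\<forall>x\<in>sec (tot A) U. g \<otimes>\<^bsub>grp (G0 G) U\<^esub> rho B U (s x)
        = rho A U x \<otimes>\<^bsub>grp (G0 G) U\<^esub> lact0 G U (prj A U x) g) \<and>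
     (\<forall>a\<in>sec (G1 G) U. s (inc A U a) = inc B U (ract G U a g))"

lemma local_arrowD:
  assumes "local_arrow A B U s g"
  shows la_iso: "s \<in> iso (grp (tot A) U) (grp (tot B) U)"
    and la_sec: "x \<in> sec (tot A) U \<Longrightarrow> s x \<in> sec (tot B) U"
    and la_mult: "\<lbrakk>x \<in> sec (tot A) U; y \<in> sec (tot A) U\<rbrakk>
      \<Longrightarrow> s (x \<otimes>\<^bsub>grp (tot A) U\<^esub> y) = s x \<otimes>\<^bsub>grp (tot B) U\<^esub> s y"
    and la_bij: "bij_betw s (sec (tot A) U) (sec (tot B) U)"
    and la_prj: "x \<in> sec (tot A) U \<Longrightarrow> prj B U (s x) = prj A U x"
    and la_rho: "x \<in> sec (tot A) U \<Longrightarrow> g \<otimes>\<^bsub>grp (G0 G) U\<^esub> rho B U (s x)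
        = rho A U x \<otimes>\<^bsub>grp (G0 G) U\<^esub> lact0 G U (prj A U x) g"
    and la_inc: "a \<in> sec (G1 G) U \<Longrightarrow> s (inc A U a) = inc B U (ract G U a g)"
  using assms hom_mult'[of s "tot A" U "tot B" U x y] unfolding local_arrow_def iso_def hom_def by auto

lemma local_arrow_comp:
  assumes s: "local_arrow A B U s g" and r: "local_arrow B C U r h"
    and A: "A \<in> Z0" and B: "B \<in> Z0" and C: "C \<in> Z0"
    and U: "U \<in> obs X" and g: "g \<in> sec (G0 G) U" and h: "h \<in> sec (G0 G) U"
  shows "local_arrow A C U (\<lambda>x. r (s x)) (g \<otimes>\<^bsub>grp (G0 G) U\<^esub> h)"
  unfolding local_arrow_def
proof (intro conjI ballI)
  interpret K: section_group "G0 G" U by (rule section_groupI[OF G0 U])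
  show "(\<lambda>x. r (s x)) \<in> iso (grp (tot A) U) (grp (tot C) U)"
    using iso_set_trans[OF la_iso[OF s] la_iso[OF r]] by (simp add: comp_def)
  fix x assume x: "x \<in> sec (tot A) U"
  note sx = la_sec[OF s x]
  show "prj C U (r (s x)) = prj A U x" using la_prj[OF r sx] la_prj[OF s x] by simp
  note closed = rho_sec[OF A U x] rho_sec[OF B U sx] rho_sec[OF C U la_sec[OF r sx]] prj_sec[OF A U x]
    lact0_sec[OF U prj_sec[OF A U x] g] lact0_sec[OF U prj_sec[OF A U x] h]
  have "g \<otimes>\<^bsub>grp (G0 G) U\<^esub> h \<otimes>\<^bsub>grp (G0 G) U\<^esub> rho C U (r (s x))
      = g \<otimes>\<^bsub>grp (G0 G) U\<^esub> (rho B U (s x) \<otimes>\<^bsub>grp (G0 G) U\<^esub> lact0 G U (prj A U x) h)"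
    using la_rho[OF r sx] la_prj[OF s x] closed g h by (simp add: K.m_assoc)
  also have "\<dots> = (rho A U x \<otimes>\<^bsub>grp (G0 G) U\<^esub> lact0 G U (prj A U x) g) \<otimes>\<^bsub>grp (G0 G) U\<^esub> lact0 G U (prj A U x) h"
    using la_rho[OF s x] closed g h by (simp flip: K.m_assoc)
  also have "\<dots> = rho A U x \<otimes>\<^bsub>grp (G0 G) U\<^esub> lact0 G U (prj A U x) (g \<otimes>\<^bsub>grp (G0 G) U\<^esub> h)"
    using closed g h by (simp add: K.m_assoc lact0_mult[OF U])
  finally show "g \<otimes>\<^bsub>grp (G0 G) U\<^esub> h \<otimes>\<^bsub>grp (G0 G) U\<^esub> rho C U (r (s x))
    = rho A U x \<otimes>\<^bsub>grp (G0 G) U\<^esub> lact0 G U (prj A U x) (g \<otimes>\<^bsub>grp (G0 G) U\<^esub> h)" .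
next
  fix a assume a: "a \<in> sec (G1 G) U"
  show "r (s (inc A U a)) = inc C U (ract G U a (g \<otimes>\<^bsub>grp (G0 G) U\<^esub> h))"
    unfolding la_inc[OF s a] la_inc[OF r ract_sec[OF U g a]] ract_comp[OF U a g h] ..
qed

lemma local_arrow_id:
  assumes A: "A \<in> Z0" and U: "U \<in> obs X"
  shows "local_arrow A A U (\<lambda>x. x) \<one>\<^bsub>grp (G0 G) U\<^esub>"
proof -
  interpret K: section_group "G0 G" U by (rule section_groupI[OF G0 U])
  show ?thesis
    using rho_sec[OF A U] prj_sec[OF A U] lact0_one[OF U] ract_id[OF U] iso_set_refl[of "grp (tot A) U"]
    unfolding local_arrow_def by simp
qed

text \<open>In \<open>local_arrow\<close> the condition on \<open>\<rho>\<close> is multiplied by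
  \<open>g\<close>, so that conditions for composable arrows can be chained without inverses.\<close>

lemma z_arrows_iff:
  "(A, B, t, g) \<in> Z1 \<longleftrightarrow> A \<in> Z0 \<and> B \<in> Z0 \<and>
     g \<in> gsec X (G0 G) \<and> t \<in> maps X (tot A) (tot B) \<and> (\<forall>U\<in>obs X. local_arrow A B U (t U) (g U))"
proof (cases "A \<in> Z0 \<and> B \<in> Z0 \<and> g \<in> gsec X (G0 G) \<and> t \<in> maps X (tot A) (tot B)")
  case True
  hence A: "A \<in> Z0" and B: "B \<in> Z0"
    and g: "\<And>U. U \<in> obs X \<Longrightarrow> g U \<in> sec (G0 G) U" and t: "t \<in> maps X (tot A) (tot B)"
    unfolding gsec_def by auto
  have eq: "inv\<^bsub>grp (G0 G) U\<^esub> (g U) \<otimes>\<^bsub>grp (G0 G) U\<^esub> rho A U x \<otimes>\<^bsub>grp (G0 G) U\<^esub> lact0 G U (prj A U x) (g U)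
          = rho B U (t U x) \<longleftrightarrow> g U \<otimes>\<^bsub>grp (G0 G) U\<^esub> rho B U (t U x)
        = rho A U x \<otimes>\<^bsub>grp (G0 G) U\<^esub> lact0 G U (prj A U x) (g U)"
    if U: "U \<in> obs X" and x: "x \<in> sec (tot A) U" for U x
  proof -
    interpret K: section_group "G0 G" U by (rule section_groupI[OF G0 U])
    note [simp] = rho_sec[OF A U x] rho_sec[OF B U maps_sec[OF t U x]] g[OF U]
      lact0_sec[OF U prj_sec[OF A U x] g[OF U]]
    show ?thesis
    proof
      assume "inv\<^bsub>grp (G0 G) U\<^esub> (g U) \<otimes>\<^bsub>grp (G0 G) U\<^esub> rho A U x \<otimes>\<^bsub>grp (G0 G) U\<^esub> lact0 G U (prj A U x) (g U)
          = rho B U (t U x)"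
      from this[symmetric] show "g U \<otimes>\<^bsub>grp (G0 G) U\<^esub> rho B U (t U x)
        = rho A U x \<otimes>\<^bsub>grp (G0 G) U\<^esub> lact0 G U (prj A U x) (g U)" by (simp add: K.m_assoc)
    next
      assume "g U \<otimes>\<^bsub>grp (G0 G) U\<^esub> rho B U (t U x)
        = rho A U x \<otimes>\<^bsub>grp (G0 G) U\<^esub> lact0 G U (prj A U x) (g U)"
      from this[symmetric] show "inv\<^bsub>grp (G0 G) U\<^esub> (g U) \<otimes>\<^bsub>grp (G0 G) U\<^esub> rho A U x
        \<otimes>\<^bsub>grp (G0 G) U\<^esub> lact0 G U (prj A U x) (g U) = rho B U (t U x)" by (simp add: K.m_assoc)
    qed
  qed
  have "(A, B, t, g) \<in> Z1 \<longleftrightarrow> (\<forall>U\<in>obs X. t U \<in> iso (grp (tot A) U) (grp (tot B) U)) \<and>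
     (\<forall>U\<in>obs X. \<forall>x\<in>sec (tot A) U. prj A U x = prj B U (t U x)) \<and>
     (\<forall>U\<in>obs X. \<forall>x\<in>sec (tot A) U. g U \<otimes>\<^bsub>grp (G0 G) U\<^esub> rho B U (t U x)
        = rho A U x \<otimes>\<^bsub>grp (G0 G) U\<^esub> lact0 G U (prj A U x) (g U)) \<and>
     (\<forall>U\<in>obs X. \<forall>a\<in>sec (G1 G) U. inc B U (ract G U a (g U)) = t U (inc A U a))"
    unfolding z_arrows_def gisos_def using True eq by simp
  also have "\<dots> \<longleftrightarrow> (\<forall>U\<in>obs X. local_arrow A B U (t U) (g U))"
    unfolding local_arrow_def
    by (simp only: ball_conj_distrib eq_commute[of "prj A _ _"] eq_commute[of "inc B _ _"])
  finally show ?thesis using True by blast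
next
  case False
  thus ?thesis unfolding z_arrows_def gisos_def by blast
qed

end

context twisted
begin

lemma tot_twist [simp]: "tot (twist X \<Gamma> G P \<phi> E) = M"
  unfolding twist_def by (simp add: Let_def)

text \<open>The formula \<open>(u, \<iota>(a\<^sup>\<phi>\<^sup>(\<^sup>u\<^sup>)))\<close> does not depend on
  \<open>u\<close>: with \<open>\<phi>(u c) = \<phi>(u) \<partial>(c)\<close> the Peiffer identity turns
  \<open>a\<^sup>\<phi>\<^sup>(\<^sup>u\<^sup>)\<close> into its conjugate by \<open>c\<close>, which the
  contracted product conjugates back.\<close>

lemma inc_twist:
  assumes \<phi>: "framed P \<phi>" and U: "U \<in> obs X" and a: "a \<in> sec (G1 G) U"
  shows inc_twist_sec: "inc (twist X \<Gamma> G P \<phi> E) U a \<in> sec T U"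
    and inc_twist_res: "\<lbrakk>f \<in> into X U; u \<in> sec P (dm X f)\<rbrakk> \<Longrightarrow> res T f (inc (twist X \<Gamma> G P \<phi> E) U a)
       = pt (dm X f) u (inc E (dm X f) (ract G (dm X f) (res (G1 G) f a) (\<phi> (dm X f) u)))"
    and inc_twist_pt: "u \<in> sec P U \<Longrightarrow> inc (twist X \<Gamma> G P \<phi> E) U a = pt U u (inc E U (ract G U a (\<phi> U u)))"
proof -
  note m = framed_maps[OF \<phi>]
  have e: "\<exists>!z. z \<in> sec T U \<and> (\<forall>f\<in>into X U. \<forall>u\<in>sec P (dm X f).
      res T f z = pt (dm X f) u (inc E (dm X f) (ract G (dm X f) (res (G1 G) f a) (\<phi> (dm X f) u))))"
  proof (rule glue_T[OF U])
    fix f u assume f: "f \<in> into X U" and u: "u \<in> sec P (dm X f)"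
    note V = dm_into[OF f] and ra = res_sec[OF grp_presheaf[OF G1] f a]
    note p = maps_sec[OF m V u]
    note b = ract_sec[OF V p ra]
    show "inc E (dm X f) (ract G (dm X f) (res (G1 G) f a) (\<phi> (dm X f) u)) \<in> sec (tot E) (dm X f)"
      by (rule ghom_sec[OF G1 E i V b])
    show "res (tot E) h (inc E (dm X f) (ract G (dm X f) (res (G1 G) f a) (\<phi> (dm X f) u)))
       = inc E (dm X (cmp X f h)) (ract G (dm X (cmp X f h)) (res (G1 G) (cmp X f h) a)
          (\<phi> (dm X (cmp X f h)) (res P h u)))"
      if h: "h \<in> into X (dm X f)" for h
      unfolding ghom_res[OF G1 E i h b] ract_res[OF h ra p] maps_res[OF m h u] dm_cmp_into[OF f h]
        res_cmp[OF grp_presheaf[OF G1] f a h] ..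
    fix c assume c: "c \<in> sec (G1 G) (dm X f)"
    interpret A: section_group "G1 G" "dm X f" by (rule section_groupI[OF G1 V])
    interpret E: section_group "tot E" "dm X f" by (rule section_groupI[OF E V])
    note [simp] = ghom_mult[OF G1 E i V] ghom_inv[OF G1 E i V] ghom_sec[OF G1 E i V] b c
    show "conj_act E (dm X f) c (inc E (dm X f) (ract G (dm X f) (res (G1 G) f a)
          (\<phi> (dm X f) (tact P (dm X f) u c))))
       = inc E (dm X f) (ract G (dm X f) (res (G1 G) f a) (\<phi> (dm X f) u))"
      unfolding framed_tact[OF \<phi> V u c] ract_comp[OF V ra p bd_sec[OF V c]] peiffer[OF V b c] conj_act_def
      by (simp add: E.m_assoc)
  qed
  have d: "inc (twist X \<Gamma> G P \<phi> E) U a = (THE z. z \<in> sec T U \<and> (\<forall>f\<in>into X U. \<forall>u\<in>sec P (dm X f).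
      res T f z = pt (dm X f) u (inc E (dm X f) (ract G (dm X f) (res (G1 G) f a) (\<phi> (dm X f) u)))))"
    unfolding twist_def using U a by (simp add: Let_def)
  note t = theI'[OF e, folded d]
  show *: "inc (twist X \<Gamma> G P \<phi> E) U a \<in> sec T U" using t by blast
  show **: "res T f (inc (twist X \<Gamma> G P \<phi> E) U a)
       = pt (dm X f) u (inc E (dm X f) (ract G (dm X f) (res (G1 G) f a) (\<phi> (dm X f) u)))"
    if "f \<in> into X U" "u \<in> sec P (dm X f)" for f u using t that by blast
  show "u \<in> sec P U \<Longrightarrow> inc (twist X \<Gamma> G P \<phi> E) U a = pt U u (inc E U (ract G U a (\<phi> U u)))"
    using **[OF idn_into[OF U]] dm_idn[OF U] res_idn[OF C.TP U *] res_idn[OF grp_presheaf[OF G1] U a] by simp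
qed

lemma inc_twist_maps:
  assumes \<phi>: "framed P \<phi>"
  shows "inc (twist X \<Gamma> G P \<phi> E) \<in> maps X (G1 G) T"
proof -
  have "inc (twist X \<Gamma> G P \<phi> E) = mk_map X (G1 G) (inc (twist X \<Gamma> G P \<phi> E))"
    unfolding twist_def mk_map_def by (simp add: Let_def fun_eq_iff)
  also have "\<dots> \<in> maps X (G1 G) T"
  proof (rule mapsI[OF inc_twist_sec[OF \<phi>] _ grp_presheaf[OF G1]])
    fix U f a assume U: "U \<in> obs X" and f: "f \<in> into X U" and a: "a \<in> sec (G1 G) U"
    note ra = res_sec[OF grp_presheaf[OF G1] f a] and s = inc_twist_sec[OF \<phi> U a]
    show "res T f (inc (twist X \<Gamma> G P \<phi> E) U a) = inc (twist X \<Gamma> G P \<phi> E) (dm X f) (res (G1 G) f a)"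
    proof (rule T_eqI[OF dm_into[OF f] res_sec[OF C.TP f s] inc_twist_sec[OF \<phi> dm_into[OF f] ra]])
      fix h u assume h: "h \<in> into X (dm X f)" and u: "u \<in> sec P (dm X h)"
      have u': "u \<in> sec P (dm X (cmp X f h))" using u dm_cmp_into[OF f h] by simp
      show "res T h (res T f (inc (twist X \<Gamma> G P \<phi> E) U a))
          = res T h (inc (twist X \<Gamma> G P \<phi> E) (dm X f) (res (G1 G) f a))"
        using inc_twist_res[OF \<phi> U a cmp_into[OF f h] u'] inc_twist_res[OF \<phi> dm_into[OF f] ra h u]
          res_cmp[OF C.TP f s h] res_cmp[OF grp_presheaf[OF G1] f a h] dm_cmp_into[OF f h] by simp
    qed
  qed
  finally show ?thesis .
qed

lemma inc_twist_ghom: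
  assumes \<phi>: "framed P \<phi>"
  shows "inc (twist X \<Gamma> G P \<phi> E) \<in> ghoms X (G1 G) M"
  unfolding ghoms_def
proof (intro CollectI conjI ballI)
  note m = inc_twist_maps[OF \<phi>]
  show "inc (twist X \<Gamma> G P \<phi> E) \<in> maps X (G1 G) M"
    using m maps_cong[of "G1 G" "G1 G" M T] by simp
  fix U assume U: "U \<in> obs X"
  show "inc (twist X \<Gamma> G P \<phi> E) U \<in> hom (grp (G1 G) U) (grp M U)"
  proof (rule homI)
    fix a assume "a \<in> carrier (grp (G1 G) U)"
    hence a: "a \<in> sec (G1 G) U" by simp
    show "inc (twist X \<Gamma> G P \<phi> E) U a \<in> carrier (grp M U)" using inc_twist_sec[OF \<phi> U a] by simp
    fix b assume "b \<in> carrier (grp (G1 G) U)"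
    hence b: "b \<in> sec (G1 G) U" by simp
    note ab = mult_sec[OF G1 U a b]
    note s = inc_twist_sec[OF \<phi> U a] inc_twist_sec[OF \<phi> U b] inc_twist_sec[OF \<phi> U ab]
    show "inc (twist X \<Gamma> G P \<phi> E) U (a \<otimes>\<^bsub>grp (G1 G) U\<^esub> b)
        = inc (twist X \<Gamma> G P \<phi> E) U a \<otimes>\<^bsub>grp M U\<^esub> inc (twist X \<Gamma> G P \<phi> E) U b"
      unfolding mult_M
    proof (rule T_eqI[OF U s(3) gmul_sec[OF U s(1,2)]])
      fix f u assume f: "f \<in> into X U" and u: "u \<in> sec P (dm X f)"
      note V = dm_into[OF f] and ra = res_sec[OF grp_presheaf[OF G1] f a] res_sec[OF grp_presheaf[OF G1] f b]
      note p = maps_sec[OF framed_maps[OF \<phi>] V u]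
      note r = ract_sec[OF V p ra(1)] ract_sec[OF V p ra(2)]
      show "res T f (inc (twist X \<Gamma> G P \<phi> E) U (a \<otimes>\<^bsub>grp (G1 G) U\<^esub> b))
        = res T f (gmul M U (inc (twist X \<Gamma> G P \<phi> E) U a) (inc (twist X \<Gamma> G P \<phi> E) U b))"
        unfolding inc_twist_res[OF \<phi> U ab f u] gmul_res[OF f s(1,2)] inc_twist_res[OF \<phi> U a f u]
          inc_twist_res[OF \<phi> U b f u] res_mult[OF G1 f a b] ract_mult[OF V p ra] ghom_mult[OF G1 E i V r]
          gmul_pt[OF V u ghom_sec[OF G1 E i V r(1)] ghom_sec[OF G1 E i V r(2)]] ..
    qed
  qed
qed

context
  fixes \<phi>
  assumes \<phi>: "framed P \<phi>" and Ez: "E \<in> Z0"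
begin

text \<open>How the structure maps change under conjugation by \<open>\<iota>(a)\<close>. Since
  \<open>\<pi>\<iota>\<close> is trivial, \<open>\<pi>\<close> is invariant; since \<open>\<rho>\<close> is a
  crossed homomorphism with \<open>\<rho>\<iota> = \<partial>\<close>, it picks up \<open>\<partial>(a)\<close>
  on the left, and on the right the inverse of \<open>\<partial>(a)\<close> acted on by
  \<open>\<pi>(x)\<close>.\<close>

lemma prj_conj_act:
  assumes U: "U \<in> obs X" and a: "a \<in> sec (G1 G) U" and x: "x \<in> sec (tot E) U"
  shows "prj E U (conj_act E U a x) = prj E U x"
    and "rho E U (conj_act E U a x) = bd G U a \<otimes>\<^bsub>grp (G0 G) U\<^esub> rho E U x
      \<otimes>\<^bsub>grp (G0 G) U\<^esub> lact0 G U (prj E U x) (inv\<^bsub>grp (G0 G) U\<^esub> (bd G U a))"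
proof -
  interpret \<Gamma>: section_group \<Gamma> U by (rule section_groupI[OF \<Gamma> U])
  note a' = inv_sec[OF G1 U a]
  note s = inc_sec[OF Ez U a] inc_sec[OF Ez U a']
  note [simp] = prj_sec[OF Ez U x] prj_inc[OF Ez U a] prj_inc[OF Ez U a'] rho_inc[OF Ez U a] rho_inc[OF Ez U a']
    mult_sec[OF E U s(1) x] s x rho_sec[OF Ez U x]
  have c: "conj_act E U a x = inc E U a \<otimes>\<^bsub>grp (tot E) U\<^esub> x \<otimes>\<^bsub>grp (tot E) U\<^esub> inc E U (inv\<^bsub>grp (G1 G) U\<^esub> a)"
    unfolding conj_act_def inc_inv[OF Ez U a] ..
  show "prj E U (conj_act E U a x) = prj E U x"
    unfolding c by (simp add: prj_mult[OF Ez U])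
  show "rho E U (conj_act E U a x) = bd G U a \<otimes>\<^bsub>grp (G0 G) U\<^esub> rho E U x
      \<otimes>\<^bsub>grp (G0 G) U\<^esub> lact0 G U (prj E U x) (inv\<^bsub>grp (G0 G) U\<^esub> (bd G U a))"
    unfolding c using bd_inv[OF U a] by (simp add: rho_mult[OF Ez U] prj_mult[OF Ez U] lact0_id[OF U])
qed

lemma prj_twist:
  shows prj_twist_maps: "prj (twist X \<Gamma> G P \<phi> E) \<in> maps X T \<Gamma>"
    and prj_twist_pt: "\<lbrakk>U \<in> obs X; u \<in> sec P U; x \<in> sec (tot E) U\<rbrakk>
      \<Longrightarrow> prj (twist X \<Gamma> G P \<phi> E) U (pt U u x) = prj E U x"
proof -
  have d: "prj (twist X \<Gamma> G P \<phi> E) = mk_map X T (\<lambda>U. descend \<Gamma> U (\<lambda>f u x. prj E (dm X f) x))"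
    unfolding twist_def by (simp add: Let_def)
  note D = C.descend_map[OF grp_sheaf[OF \<Gamma>], where k = "\<lambda>U u x. prj E U x"]
  show "prj (twist X \<Gamma> G P \<phi> E) \<in> maps X T \<Gamma>"
    unfolding d by (rule D(1)) (use prj_sec[OF Ez] prj_res[OF Ez] prj_conj_act(1) in auto)
  show "prj (twist X \<Gamma> G P \<phi> E) U (pt U u x) = prj E U x"
    if "U \<in> obs X" "u \<in> sec P U" "x \<in> sec (tot E) U" for U u x
    unfolding d mk_map_apply[OF that(1) C.pt_sec[OF that]]
    by (rule D(2)) (use that prj_sec[OF Ez] prj_res[OF Ez] prj_conj_act(1) in auto)
qed

text \<open>Replacing \<open>u\<close> by \<open>u a\<close> changes \<open>\<phi>(u)\<close> by the factor
  \<open>\<partial>(a)\<close>, which is the change of \<open>\<rho>\<close> in \<open>prj_conj_act\<close>; so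
  the formula is balanced.\<close>

lemma rho_twist:
  shows rho_twist_maps: "rho (twist X \<Gamma> G P \<phi> E) \<in> maps X T (G0 G)"
    and rho_twist_pt: "\<lbrakk>U \<in> obs X; u \<in> sec P U; x \<in> sec (tot E) U\<rbrakk>
      \<Longrightarrow> rho (twist X \<Gamma> G P \<phi> E) U (pt U u x) = \<phi> U u \<otimes>\<^bsub>grp (G0 G) U\<^esub> rho E U x
          \<otimes>\<^bsub>grp (G0 G) U\<^esub> lact0 G U (prj E U x) (inv\<^bsub>grp (G0 G) U\<^esub> (\<phi> U u))"
proof -
  define k where "k U u x = \<phi> U u \<otimes>\<^bsub>grp (G0 G) U\<^esub> rho E U x
          \<otimes>\<^bsub>grp (G0 G) U\<^esub> lact0 G U (prj E U x) (inv\<^bsub>grp (G0 G) U\<^esub> (\<phi> U u))" for U u x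
  have d: "rho (twist X \<Gamma> G P \<phi> E) = mk_map X T (\<lambda>U. descend (G0 G) U (\<lambda>f u x. k (dm X f) u x))"
    unfolding twist_def k_def by (simp add: Let_def)
  note m = framed_maps[OF \<phi>]
  have k: "k U u x \<in> sec (G0 G) U" if U: "U \<in> obs X" and u: "u \<in> sec P U" and x: "x \<in> sec (tot E) U" for U u x
    unfolding k_def using maps_sec[OF m U u] rho_sec[OF Ez U x] prj_sec[OF Ez U x]
    by (intro mult_sec[OF G0 U] lact0_sec[OF U] inv_sec[OF G0 U])
  have r: "res (G0 G) h (k U u x) = k (dm X h) (res P h u) (res (tot E) h x)"
    if U: "U \<in> obs X" and h: "h \<in> into X U" and u: "u \<in> sec P U" and x: "x \<in> sec (tot E) U" for U h u x
  proof -
    note c = maps_sec[OF m U u] rho_sec[OF Ez U x] prj_sec[OF Ez U x]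
    note c' = inv_sec[OF G0 U c(1)]
    show ?thesis unfolding k_def
        res_mult[OF G0 h mult_sec[OF G0 U c(1,2)] lact0_sec[OF U c(3) c']]
        res_mult[OF G0 h c(1,2)] lact0_res[OF h c(3) c'] res_inv[OF G0 h c(1)]
        maps_res[OF m h u] rho_res[OF Ez h x] prj_res[OF Ez h x] ..
  qed
  have b: "k U (tact P U u a) x = k U u (conj_act E U a x)"
    if U: "U \<in> obs X" and u: "u \<in> sec P U" and x: "x \<in> sec (tot E) U" and a: "a \<in> sec (G1 G) U" for U u x a
  proof -
    interpret K: section_group "G0 G" U by (rule section_groupI[OF G0 U])
    note s = prj_sec[OF Ez U x]
    note [simp] = maps_sec[OF m U u] bd_sec[OF U a] rho_sec[OF Ez U x] lact0_sec[OF U s]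
    show ?thesis
      unfolding k_def framed_tact[OF \<phi> U u a] prj_conj_act(1)[OF U a x] prj_conj_act(2)[OF U a x]
      by (simp add: K.m_assoc K.inv_mult_group lact0_mult[OF U s])
  qed
  note D = C.descend_map[OF grp_sheaf[OF G0], of k, OF k r b]
  show "rho (twist X \<Gamma> G P \<phi> E) \<in> maps X T (G0 G)"
    unfolding d by (rule D(1))
  show "rho (twist X \<Gamma> G P \<phi> E) U (pt U u x) = \<phi> U u \<otimes>\<^bsub>grp (G0 G) U\<^esub> rho E U x
          \<otimes>\<^bsub>grp (G0 G) U\<^esub> lact0 G U (prj E U x) (inv\<^bsub>grp (G0 G) U\<^esub> (\<phi> U u))"
    if "U \<in> obs X" "u \<in> sec P U" "x \<in> sec (tot E) U" for U u x
    unfolding d mk_map_apply[OF that(1) C.pt_sec[OF that]] k_def[symmetric]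
    by (rule D(2)) (use that in auto)
qed

end

end

context gamma_xmod
begin

lemma twistedI:
  assumes "framed P \<phi>" "E \<in> Z0"
  shows "twisted X \<Gamma> G P E"
  by (unfold_locales) (rule framed_torsor[OF assms(1)] tot[OF assms(2)] inc[OF assms(2)])+

lemma w_arrows_iff:
  "(A, B, t, P, \<phi>) \<in> W1 \<longleftrightarrow> A \<in> Z0 \<and> B \<in> Z0 \<and>
     framed P \<phi> \<and> t \<in> gisos X (tot A) (tot (twist X \<Gamma> G P \<phi> B)) \<and>
     (\<forall>U\<in>obs X. \<forall>x\<in>sec (tot A) U. prj (twist X \<Gamma> G P \<phi> B) U (t U x) = prj A U x) \<and>
     (\<forall>U\<in>obs X. \<forall>x\<in>sec (tot A) U. rho (twist X \<Gamma> G P \<phi> B) U (t U x) = rho A U x) \<and>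
     (\<forall>U\<in>obs X. \<forall>a\<in>sec (G1 G) U. t U (inc A U a) = inc (twist X \<Gamma> G P \<phi> B) U a)"
  unfolding w_arrows_def framed_def by blast

text \<open>The germ at \<open>u\<close> is \<open>t\<close> read in the coordinate given by \<open>u\<close>.
  Each condition on \<open>t\<close> evaluates at the pair \<open>(u, s x)\<close> to the corresponding
  condition of a local arrow.\<close>

lemma w_arrowD:
  assumes f: "(A, B, t, P, \<phi>) \<in> W1"
  shows wa_obj: "A \<in> Z0" "B \<in> Z0" and wa_framed: "framed P \<phi>"
    and wa_maps: "t \<in> maps X (tot A) (tw_sheaf X G P B)"
    and wa_local: "\<lbrakk>U \<in> obs X; u \<in> sec P U\<rbrakk> \<Longrightarrow> \<exists>s. local_arrow A B U s (\<phi> U u) \<and>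
       (\<forall>x\<in>sec (tot A) U. t U x = tw_pt X G P B U u (s x))"
proof -
  show A: "A \<in> Z0" and B: "B \<in> Z0" and \<phi>: "framed P \<phi>"
    using f unfolding w_arrows_iff by blast+
  interpret tw: twisted X \<Gamma> G P B by (rule twistedI[OF \<phi> B])
  have t: "t \<in> gisos X (tot A) tw.M"
    using f unfolding w_arrows_iff by simp
  show m: "t \<in> maps X (tot A) (tw_sheaf X G P B)"
    using t maps_cong[of "tot A" "tot A" tw.M tw.T] unfolding gisos_def by simp
  show "\<exists>s. local_arrow A B U s (\<phi> U u) \<and> (\<forall>x\<in>sec (tot A) U. t U x = tw_pt X G P B U u (s x))"
    if U: "U \<in> obs X" and u: "u \<in> sec P U"
  proof (intro exI conjI ballI)
    let ?s = "\<lambda>x. tw.C.co U u (t U x)"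
    note ts = maps_sec[OF m U]
    note s = tw.C.co_sec[OF U u ts]
    show ts': "t U x = tw_pt X G P B U u (?s x)" if "x \<in> sec (tot A) U" for x
      using tw.C.pt_co[OF U u ts[OF that]] by simp
    have ti: "t U \<in> iso (grp (tot A) U) (grp tw.M U)" using t U unfolding gisos_def by blast
    have hom: "?s (x \<otimes>\<^bsub>grp (tot A) U\<^esub> y) = ?s x \<otimes>\<^bsub>grp (tot B) U\<^esub> ?s y"
      if x: "x \<in> sec (tot A) U" and y: "y \<in> sec (tot A) U" for x y
    proof -
      have "t U (x \<otimes>\<^bsub>grp (tot A) U\<^esub> y) = gmul tw.M U (t U x) (t U y)"
        using ti hom_mult'[of "t U" "tot A" U tw.M U, OF _ x y] unfolding iso_def tw.mult_M by blast
      also have "\<dots> = tw.pt U u (?s x \<otimes>\<^bsub>grp (tot B) U\<^esub> ?s y)"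
        using tw.gmul_pt[OF U u s[OF x] s[OF y]] unfolding ts'[OF x, symmetric] ts'[OF y, symmetric] .
      finally show ?thesis
        using tw.C.co_pt[OF U u mult_sec[OF tot[OF B] U s[OF x] s[OF y]]] by simp
    qed
    have tb: "bij_betw (t U) (sec (tot A) U) (sec tw.T U)" using ti unfolding iso_def by simp
    have "bij_betw (tw.C.co U u) (sec tw.T U) (sec (tot B) U)"
      unfolding tw.C.co_def by (rule bij_betw_inv_into[OF tw.C.pt_bij[OF U u]])
    hence bij: "bij_betw ?s (sec (tot A) U) (sec (tot B) U)"
      using bij_betw_trans[OF tb] unfolding comp_def by blast
    show "local_arrow A B U ?s (\<phi> U u)"
      unfolding local_arrow_def
    proof (intro conjI ballI)
      show "?s \<in> iso (grp (tot A) U) (grp (tot B) U)"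
        unfolding iso_def using bij hom s by (auto intro!: homI)
      show "?s (inc A U a) = inc B U (ract G U a (\<phi> U u))" if a: "a \<in> sec (G1 G) U" for a
      proof -
        have "t U (inc A U a) = inc (twist X \<Gamma> G P \<phi> B) U a"
          using f U a unfolding w_arrows_iff by blast
        also have "\<dots> = tw.pt U u (inc B U (ract G U a (\<phi> U u)))" by (rule tw.inc_twist_pt[OF \<phi> U a u])
        finally show ?thesis
          using tw.C.co_pt[OF U u inc_sec[OF B U ract_sec[OF U maps_sec[OF framed_maps[OF \<phi>] U u] a]]] by simp
      qed
      fix x assume x: "x \<in> sec (tot A) U"
      have "prj (twist X \<Gamma> G P \<phi> B) U (t U x) = prj A U x" "rho (twist X \<Gamma> G P \<phi> B) U (t U x) = rho A U x"
        using f U x unfolding w_arrows_iff by blast+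
      hence e: "prj B U (?s x) = prj A U x"
        "\<phi> U u \<otimes>\<^bsub>grp (G0 G) U\<^esub> rho B U (?s x)
          \<otimes>\<^bsub>grp (G0 G) U\<^esub> lact0 G U (prj B U (?s x)) (inv\<^bsub>grp (G0 G) U\<^esub> (\<phi> U u)) = rho A U x"
        using tw.prj_twist_pt[OF \<phi> B U u s[OF x]] tw.rho_twist_pt[OF \<phi> B U u s[OF x]] ts'[OF x] by simp_all
      show "prj B U (?s x) = prj A U x" by (rule e)
      interpret K: section_group "G0 G" U by (rule section_groupI[OF G0 U])
      note p = maps_sec[OF framed_maps[OF \<phi>] U u] and px = prj_sec[OF A U x]
      note [simp] = p rho_sec[OF B U s[OF x]] lact0_sec[OF U px p] lact0_sec[OF U px inv_sec[OF G0 U p]]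
      show "\<phi> U u \<otimes>\<^bsub>grp (G0 G) U\<^esub> rho B U (?s x) = rho A U x \<otimes>\<^bsub>grp (G0 G) U\<^esub> lact0 G U (prj A U x) (\<phi> U u)"
        unfolding e(2)[symmetric] e(1) lact0_inv[OF U px p] by (simp add: K.m_assoc)
    qed
  qed
qed

text \<open>All conditions on an arrow are equalities of sections, together with bijectivity, and are thus
  local; where one germ exists, they can be read off from it. One section \<open>u\<close> over each object with
  \<open>D\<close> suffices.\<close>

lemma w_arrowI:
  assumes A: "A \<in> Z0" and B: "B \<in> Z0" and \<phi>: "framed P \<phi>"
    and t: "t \<in> maps X (tot A) (tw_sheaf X G P B)" and D: "densely X D"
    and loc: "\<And>U. \<lbrakk>U \<in> obs X; D U\<rbrakk> \<Longrightarrow> \<exists>u\<in>sec P U. \<exists>s. local_arrow A B U s (\<phi> U u) \<and>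
       (\<forall>x\<in>sec (tot A) U. t U x = tw_pt X G P B U u (s x))"
  shows "(A, B, t, P, \<phi>) \<in> W1"
  unfolding w_arrows_iff
proof (intro conjI ballI A B \<phi>)
  interpret tw: twisted X \<Gamma> G P B by (rule twistedI[OF \<phi> B])
  note AP = grp_presheaf[OF tot[OF A]]
  have *: "bij_betw (t U) (sec (tot A) U) (sec tw.T U) \<and>
     (\<forall>x\<in>sec (tot A) U. \<forall>y\<in>sec (tot A) U. t U (x \<otimes>\<^bsub>grp (tot A) U\<^esub> y) = gmul tw.M U (t U x) (t U y)) \<and>
     (\<forall>x\<in>sec (tot A) U. prj (twist X \<Gamma> G P \<phi> B) U (t U x) = prj A U x) \<and>
     (\<forall>x\<in>sec (tot A) U. rho (twist X \<Gamma> G P \<phi> B) U (t U x) = rho A U x) \<and>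
     (\<forall>a\<in>sec (G1 G) U. t U (inc A U a) = inc (twist X \<Gamma> G P \<phi> B) U a)"
    if U: "U \<in> obs X" and DU: "D U" for U
  proof -
    obtain u s where u: "u \<in> sec P U" and s: "local_arrow A B U s (\<phi> U u)"
      and ts: "\<And>x. x \<in> sec (tot A) U \<Longrightarrow> t U x = tw.pt U u (s x)" using loc[OF U DU] by blast
    have "bij_betw (\<lambda>x. tw.pt U u (s x)) (sec (tot A) U) (sec tw.T U)"
      using bij_betw_trans[OF la_bij[OF s] tw.C.pt_bij[OF U u]] unfolding comp_def .
    hence 1: "bij_betw (t U) (sec (tot A) U) (sec tw.T U)" 
      using bij_betw_cong[of "sec (tot A) U" "t U" "\<lambda>x. tw.pt U u (s x)" "sec tw.T U"] ts by simp
    have 2: "t U (x \<otimes>\<^bsub>grp (tot A) U\<^esub> y) = gmul tw.M U (t U x) (t U y)"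
      if x: "x \<in> sec (tot A) U" and y: "y \<in> sec (tot A) U" for x y
      unfolding ts[OF x] ts[OF y] ts[OF mult_sec[OF tot[OF A] U x y]]
        tw.gmul_pt[OF U u la_sec[OF s x] la_sec[OF s y]] la_mult[OF s x y] ..
    have 3: "prj (twist X \<Gamma> G P \<phi> B) U (t U x) = prj A U x" if x: "x \<in> sec (tot A) U" for x
      unfolding ts[OF x] tw.prj_twist_pt[OF \<phi> B U u la_sec[OF s x]] by (rule la_prj[OF s x])
    have 4: "rho (twist X \<Gamma> G P \<phi> B) U (t U x) = rho A U x" if x: "x \<in> sec (tot A) U" for x
    proof -
      interpret K: section_group "G0 G" U by (rule section_groupI[OF G0 U])
      note p = maps_sec[OF framed_maps[OF \<phi>] U u] and px = prj_sec[OF A U x]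
      note [simp] = p rho_sec[OF A U x] lact0_sec[OF U px p]
      show ?thesis
        unfolding ts[OF x] tw.rho_twist_pt[OF \<phi> B U u la_sec[OF s x]] la_rho[OF s x] la_prj[OF s x]
          lact0_inv[OF U px p] by (simp add: K.m_assoc)
    qed
    have 5: "t U (inc A U a) = inc (twist X \<Gamma> G P \<phi> B) U a" if a: "a \<in> sec (G1 G) U" for a
      unfolding ts[OF inc_sec[OF A U a]] tw.inc_twist_pt[OF \<phi> U a u] la_inc[OF s a] ..
    show ?thesis using 1 2 3 4 5 by blast
  qed
  have tM: "t \<in> maps X (tot A) tw.M"
    using t maps_cong[of "tot A" "tot A" tw.M tw.T] by simp
  have hom: "t U (x \<otimes>\<^bsub>grp (tot A) U\<^esub> y) = gmul tw.M U (t U x) (t U y)"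
    if U: "U \<in> obs X" and x: "x \<in> sec (tot A) U" and y: "y \<in> sec (tot A) U" for U x y
  proof (rule eq_densely[OF tw.C.T_sheaf D U])
    note xy = mult_sec[OF tot[OF A] U x y] and tx = maps_sec[OF t U x] and ty = maps_sec[OF t U y]
    show "t U (x \<otimes>\<^bsub>grp (tot A) U\<^esub> y) \<in> sec tw.T U" by (rule maps_sec[OF t U xy])
    show "gmul tw.M U (t U x) (t U y) \<in> sec tw.T U" by (rule tw.gmul_sec[OF U tx ty])
    fix f assume f: "f \<in> into X U" and Df: "D (dm X f)"
    show "res tw.T f (t U (x \<otimes>\<^bsub>grp (tot A) U\<^esub> y)) = res tw.T f (gmul tw.M U (t U x) (t U y))"
      unfolding maps_res[OF t f xy] tw.gmul_res[OF f tx ty] maps_res[OF t f x] maps_res[OF t f y]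
        res_mult[OF tot[OF A] f x y]
      using *[OF dm_into[OF f] Df] res_sec[OF AP f x] res_sec[OF AP f y] by blast
  qed
  have bij: "bij_betw (t U) (sec (tot A) U) (sec tw.T U)" if "U \<in> obs X" for U
    by (rule bij_densely[OF t grp_sheaf[OF tot[OF A]] tw.C.T_sheaf D _ that]) (use * in blast)
  show "t \<in> gisos X (tot A) (tot (twist X \<Gamma> G P \<phi> B))"
    unfolding tw.tot_twist gisos_def iso_def
    using tM bij hom maps_sec[OF t] by (auto intro!: homI simp: tw.mult_M)
  fix U assume U: "U \<in> obs X"
  show "t U (inc A U a) = inc (twist X \<Gamma> G P \<phi> B) U a" if a: "a \<in> sec (G1 G) U" for a
  proof (rule eq_densely[OF tw.C.T_sheaf D U maps_sec[OF t U inc_sec[OF A U a]] tw.inc_twist_sec[OF \<phi> U a]])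
    fix f assume f: "f \<in> into X U" and Df: "D (dm X f)"
    show "res tw.T f (t U (inc A U a)) = res tw.T f (inc (twist X \<Gamma> G P \<phi> B) U a)"
      unfolding maps_res[OF t f inc_sec[OF A U a]] inc_res[OF A f a] maps_res[OF tw.inc_twist_maps[OF \<phi>] f a]
      using *[OF dm_into[OF f] Df] res_sec[OF grp_presheaf[OF G1] f a] by blast
  qed
  fix x assume x: "x \<in> sec (tot A) U"
  note tx = maps_sec[OF t U x]
  note pm = tw.prj_twist_maps[OF \<phi> B] and rm = tw.rho_twist_maps[OF \<phi> B]
  show "prj (twist X \<Gamma> G P \<phi> B) U (t U x) = prj A U x"
  proof (rule eq_densely[OF grp_sheaf[OF \<Gamma>] D U maps_sec[OF pm U tx] prj_sec[OF A U x]])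
    fix f assume f: "f \<in> into X U" and Df: "D (dm X f)"
    show "res \<Gamma> f (prj (twist X \<Gamma> G P \<phi> B) U (t U x)) = res \<Gamma> f (prj A U x)"
      unfolding maps_res[OF pm f tx] maps_res[OF t f x] prj_res[OF A f x]
      using *[OF dm_into[OF f] Df] res_sec[OF AP f x] by blast
  qed
  show "rho (twist X \<Gamma> G P \<phi> B) U (t U x) = rho A U x"
  proof (rule eq_densely[OF grp_sheaf[OF G0] D U maps_sec[OF rm U tx] rho_sec[OF A U x]])
    fix f assume f: "f \<in> into X U" and Df: "D (dm X f)"
    show "res (G0 G) f (rho (twist X \<Gamma> G P \<phi> B) U (t U x)) = res (G0 G) f (rho A U x)"
      unfolding maps_res[OF rm f tx] maps_res[OF t f x] rho_res[OF A f x]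
      using *[OF dm_into[OF f] Df] res_sec[OF AP f x] by blast
  qed
qed

text \<open>Over an object where \<open>P\<close> has a section both torsors are copies of the group, and the
  map is a translation; bijectivity is local by \<open>bij_densely\<close>.\<close>

lemma torsor_map_bij:
  assumes P: "is_torsor X (G1 G) P" and P': "is_torsor X (G1 G) P'" and m: "m \<in> maps X P P'"
    and eqv: "\<And>U u a. \<lbrakk>U \<in> obs X; u \<in> sec P U; a \<in> sec (G1 G) U\<rbrakk> \<Longrightarrow> m U (tact P U u a) = tact P' U (m U u) a"
  shows "m \<in> torsor_isos X (G1 G) P P'"
  unfolding torsor_isos_def
proof (intro CollectI conjI ballI m)
  show "m U (tact P U u a) = tact P' U (m U u) a" if "U \<in> obs X" "u \<in> sec P U" "a \<in> sec (G1 G) U" for U u a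
    by (rule eqv[OF that])
  fix U assume U: "U \<in> obs X"
  show "bij_betw (m U) (sec P U) (sec P' U)"
  proof (rule bij_densely[OF m tor_sheaf[OF P] tor_sheaf[OF P'] tor_dense[OF P] _ U])
    fix V assume V: "V \<in> obs X" and "sec P V \<noteq> {}"
    then obtain u where u: "u \<in> sec P V" by blast
    note mu = maps_sec[OF m V u]
    show "bij_betw (m V) (sec P V) (sec P' V)"
    proof (rule bij_betw_imageI)
      show "inj_on (m V) (sec P V)"
      proof (rule inj_onI)
        fix v w assume v: "v \<in> sec P V" and w: "w \<in> sec P V" and e: "m V v = m V w"
        obtain a where a: "a \<in> sec (G1 G) V" "w = tact P V v a" using tact_diff[OF P V v w] .
        note mv = maps_sec[OF m V v]
        have "tact P' V (m V v) a = tact P' V (m V v) \<one>\<^bsub>grp (G1 G) V\<^esub>"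
          using e eqv[OF V v a(1)] a(2) tact_one[OF P' V mv] by simp
        hence "a = \<one>\<^bsub>grp (G1 G) V\<^esub>" by (rule tact_free[OF P' V mv a(1) one_sec[OF G1 V]])
        thus "v = w" using a(2) tact_one[OF P V v] by simp
      qed
      show "m V ` sec P V = sec P' V"
      proof (intro equalityI subsetI)
        fix y assume "y \<in> m V ` sec P V" thus "y \<in> sec P' V" using maps_sec[OF m V] by blast
      next
        fix y assume y: "y \<in> sec P' V"
        obtain a where a: "a \<in> sec (G1 G) V" "y = tact P' V (m V u) a" using tact_diff[OF P' V mu y] .
        thus "y \<in> m V ` sec P V" using eqv[OF V u a(1)] tact_sec[OF P V u a(1)] by force
      qed
    qed
  qed
qed

text \<open>Equivariance of \<open>m\<close> is what makes \<open>(u, x) \<mapsto> (m u, x)\<close>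
  balanced.\<close>

lemma ctr_map_fst_pt:
  assumes P: "twisted X \<Gamma> G P B" and P': "twisted X \<Gamma> G P' B" and m: "m \<in> torsor_isos X (G1 G) P P'"
  shows "ctr_map_fst X G P P' B m \<in> maps X (tw_sheaf X G P B) (tw_sheaf X G P' B)"
    and "\<lbrakk>U \<in> obs X; u \<in> sec P U; x \<in> sec (tot B) U\<rbrakk>
      \<Longrightarrow> ctr_map_fst X G P P' B m U (tw_pt X G P B U u x) = tw_pt X G P' B U (m U u) x"
proof -
  interpret p: twisted X \<Gamma> G P B by (rule P)
  interpret q: twisted X \<Gamma> G P' B by (rule P')
  have mm: "m \<in> maps X P P'" and eqv: "\<And>U u a. \<lbrakk>U \<in> obs X; u \<in> sec P U; a \<in> sec (G1 G) U\<rbrakk>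
      \<Longrightarrow> m U (tact P U u a) = tact P' U (m U u) a"
    using m unfolding torsor_isos_def by blast+
  let ?k = "\<lambda>U u x. q.pt U (m U u) x"
  have s: "?k U u x \<in> sec q.T U" if "U \<in> obs X" "u \<in> sec P U" "x \<in> sec (tot B) U" for U u x
    by (rule q.C.pt_sec[OF that(1) maps_sec[OF mm that(1,2)] that(3)])
  have r: "res q.T h (?k U u x) = ?k (dm X h) (res P h u) (res (tot B) h x)"
    if "U \<in> obs X" "h \<in> into X U" "u \<in> sec P U" "x \<in> sec (tot B) U" for U h u x
    using q.C.pt_res[OF that(2) maps_sec[OF mm that(1,3)] that(4)] maps_res[OF mm that(2,3)] by simp
  have b: "?k U (tact P U u a) x = ?k U u (conj_act B U a x)"
    if "U \<in> obs X" "u \<in> sec P U" "x \<in> sec (tot B) U" "a \<in> sec (G1 G) U" for U u x a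
    using q.C.pt_bal[OF that(1) maps_sec[OF mm that(1,2)] that(4,3)] eqv[OF that(1,2,4)] by simp
  note D = p.C.descend_map[OF q.C.T_sheaf, of ?k, OF s r b]
  show "ctr_map_fst X G P P' B m \<in> maps X (tw_sheaf X G P B) (tw_sheaf X G P' B)"
    unfolding ctr_map_fst_def by (rule D(1))
  show "ctr_map_fst X G P P' B m U (tw_pt X G P B U u x) = tw_pt X G P' B U (m U u) x"
    if "U \<in> obs X" "u \<in> sec P U" "x \<in> sec (tot B) U" for U u x
    unfolding ctr_map_fst_def mk_map_apply[OF that(1) p.C.pt_sec[OF that]] by (rule D(2); (assumption | rule that))
qed

lemma w_cellD:
  assumes c: "((A, B, t, P, \<phi>), (A', B', t', P', \<phi>'), m) \<in> W2"
  shows wc_arr: "(A, B, t, P, \<phi>) \<in> W1" "(A', B', t', P', \<phi>') \<in> W1" "A' = A" "B' = B"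
    and wc_iso: "m \<in> torsor_isos X (G1 G) P P'"
    and wc_maps: "m \<in> maps X P P'"
    and wc_tact: "\<lbrakk>U \<in> obs X; u \<in> sec P U; a \<in> sec (G1 G) U\<rbrakk> \<Longrightarrow> m U (tact P U u a) = tact P' U (m U u) a"
    and wc_phi: "\<lbrakk>U \<in> obs X; u \<in> sec P U\<rbrakk> \<Longrightarrow> \<phi>' U (m U u) = \<phi> U u"
    and wc_pt: "\<lbrakk>U \<in> obs X; u \<in> sec P U; x \<in> sec (tot A) U; y \<in> sec (tot B) U; t U x = tw_pt X G P B U u y\<rbrakk>
      \<Longrightarrow> t' U x = tw_pt X G P' B U (m U u) y"
proof -
  show a: "(A, B, t, P, \<phi>) \<in> W1" "(A', B', t', P', \<phi>') \<in> W1" "A' = A" "B' = B"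
    and m: "m \<in> torsor_isos X (G1 G) P P'"
    using c unfolding w_cells_def by blast+
  show "m \<in> maps X P P'" "\<lbrakk>U \<in> obs X; u \<in> sec P U; a \<in> sec (G1 G) U\<rbrakk> \<Longrightarrow> m U (tact P U u a) = tact P' U (m U u) a"
    using m unfolding torsor_isos_def by blast+
  show "\<lbrakk>U \<in> obs X; u \<in> sec P U\<rbrakk> \<Longrightarrow> \<phi>' U (m U u) = \<phi> U u"
    using c unfolding w_cells_def by blast
  have P: "twisted X \<Gamma> G P B" by (rule twistedI[OF wa_framed[OF a(1)] wa_obj(2)[OF a(1)]])
  have P': "twisted X \<Gamma> G P' B" using twistedI[OF wa_framed[OF a(2)] wa_obj(2)[OF a(2)]] a(4) by simp
  show "t' U x = tw_pt X G P' B U (m U u) y"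
    if U: "U \<in> obs X" and u: "u \<in> sec P U" and x: "x \<in> sec (tot A) U" and y: "y \<in> sec (tot B) U"
      and e: "t U x = tw_pt X G P B U u y"
  proof -
    have "ctr_map_fst X G P P' B m U (t U x) = t' U x" using c U x unfolding w_cells_def by blast
    thus ?thesis using ctr_map_fst_pt(2)[OF P P' m U u y] e by simp
  qed
qed

text \<open>Equivariance propagates the conditions from one section \<open>u\<close> to all sections of
  \<open>P\<close> over the same object, because these are translates of \<open>u\<close>.\<close>

lemma w_cellI:
  assumes f: "(A, B, t, P, \<phi>) \<in> W1" and f': "(A, B, t', P', \<phi>') \<in> W1"
    and m: "m \<in> maps X P P'"
    and eqv: "\<And>U u a. \<lbrakk>U \<in> obs X; u \<in> sec P U; a \<in> sec (G1 G) U\<rbrakk> \<Longrightarrow> m U (tact P U u a) = tact P' U (m U u) a"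
    and D: "densely X D"
    and loc: "\<And>U. \<lbrakk>U \<in> obs X; D U\<rbrakk> \<Longrightarrow> \<exists>u\<in>sec P U. \<phi>' U (m U u) = \<phi> U u \<and>
       (\<forall>x\<in>sec (tot A) U. \<exists>y\<in>sec (tot B) U. t U x = tw_pt X G P B U u y \<and> t' U x = tw_pt X G P' B U (m U u) y)"
  shows "((A, B, t, P, \<phi>), (A, B, t', P', \<phi>'), m) \<in> W2"
proof -
  note \<phi> = wa_framed[OF f] and \<phi>' = wa_framed[OF f'] and A = wa_obj(1)[OF f] and B = wa_obj(2)[OF f]
  have iso: "m \<in> torsor_isos X (G1 G) P P'"
    by (rule torsor_map_bij[OF framed_torsor[OF \<phi>] framed_torsor[OF \<phi>'] m eqv])
  interpret p: twisted X \<Gamma> G P B by (rule twistedI[OF \<phi> B])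
  interpret q: twisted X \<Gamma> G P' B by (rule twistedI[OF \<phi>' B])
  note k = ctr_map_fst_pt[OF p.twisted_axioms q.twisted_axioms iso]
  have 1: "\<phi>' U (m U u) = \<phi> U u" if U: "U \<in> obs X" and u: "u \<in> sec P U" for U u
  proof (rule eq_densely[OF grp_sheaf[OF G0] D U maps_sec[OF framed_maps[OF \<phi>'] U maps_sec[OF m U u]]
        maps_sec[OF framed_maps[OF \<phi>] U u]])
    fix h assume h: "h \<in> into X U" and Dh: "D (dm X h)"
    note V = dm_into[OF h] and v = res_sec[OF p.C.PP h u]
    obtain w where w: "w \<in> sec P (dm X h)" "\<phi>' (dm X h) (m (dm X h) w) = \<phi> (dm X h) w"
      using loc[OF V Dh] by blast
    obtain a where a: "a \<in> sec (G1 G) (dm X h)" "res P h u = tact P (dm X h) w a"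
      using tact_diff[OF p.P V w(1) v] .
    show "res (G0 G) h (\<phi>' U (m U u)) = res (G0 G) h (\<phi> U u)"
      unfolding maps_res[OF framed_maps[OF \<phi>'] h maps_sec[OF m U u]] maps_res[OF m h u]
        maps_res[OF framed_maps[OF \<phi>] h u] a(2) eqv[OF V w(1) a(1)]
        framed_tact[OF \<phi> V w(1) a(1)] framed_tact[OF \<phi>' V maps_sec[OF m V w(1)] a(1)] w(2) ..
  qed
  have 2: "ctr_map_fst X G P P' B m U (t U x) = t' U x" if U: "U \<in> obs X" and x: "x \<in> sec (tot A) U" for U x
  proof -
    note tx = maps_sec[OF wa_maps[OF f] U x]
    show ?thesis
    proof (rule eq_densely[OF q.C.T_sheaf D U maps_sec[OF k(1) U tx] maps_sec[OF wa_maps[OF f'] U x]])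
      fix h assume h: "h \<in> into X U" and Dh: "D (dm X h)"
      obtain u y where uy: "u \<in> sec P (dm X h)" "y \<in> sec (tot B) (dm X h)"
        "t (dm X h) (res (tot A) h x) = p.pt (dm X h) u y"
        "t' (dm X h) (res (tot A) h x) = q.pt (dm X h) (m (dm X h) u) y"
        using loc[OF dm_into[OF h] Dh] res_sec[OF grp_presheaf[OF tot[OF A]] h x] by blast
      show "res q.T h (ctr_map_fst X G P P' B m U (t U x)) = res q.T h (t' U x)"
        unfolding maps_res[OF k(1) h tx] maps_res[OF wa_maps[OF f] h x] maps_res[OF wa_maps[OF f'] h x]
          uy(3,4) k(2)[OF dm_into[OF h] uy(1,2)] ..
    qed
  qed
  show ?thesis using f f' iso 1 2 unfolding w_cells_def by blast
qed

end

section \<open>Products of torsors\<close>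

context grothendieck_site
begin

text \<open>Passing to a weaker property requires stability along arrows, since the arrows on which it holds
  have to form a sieve.\<close>

lemma densely_mono:
  assumes D: "densely X D" and imp: "\<And>U. \<lbrakk>U \<in> obs X; D U\<rbrakk> \<Longrightarrow> D' U"
    and stable: "\<And>U f. \<lbrakk>f \<in> into X U; D' U\<rbrakk> \<Longrightarrow> D' (dm X f)"
  shows "densely X D'"
  unfolding densely_def
proof
  fix U assume U: "U \<in> obs X"
  have S: "{f \<in> into X U. D (dm X f)} \<in> cov X U" using D U unfolding densely_def by blast
  show "{f \<in> into X U. D' (dm X f)} \<in> cov X U"
  proof (rule cov_mono[OF U S])
    show "{f \<in> into X U. D (dm X f)} \<subseteq> {f \<in> into X U. D' (dm X f)}" using imp dm_into by blast
    show "sieve X U {f \<in> into X U. D' (dm X f)}"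
      unfolding sieve_def using stable cmp_into dm_cmp_into by (metis (no_types, lifting) mem_Collect_eq subsetI)
  qed
qed

text \<open>The gluing condition only involves restriction and equality, so it passes to copies of the sets of
  sections. The injections may be chosen independently over each object, since \<open>R\<close> carries the
  restriction maps that they transport.\<close>

lemma sheaf_transport:
  assumes T: "is_sheaf X T" and inj: "\<And>U. U \<in> obs X \<Longrightarrow> inj_on (c U) (sec T U)"
    and secR: "\<And>U. U \<in> obs X \<Longrightarrow> sec R U = c U ` sec T U"
    and resR: "\<And>U f s. \<lbrakk>f \<in> into X U; s \<in> sec T U\<rbrakk> \<Longrightarrow> res R f (c U s) = c (dm X f) (res T f s)"
  shows "is_sheaf X R"
  unfolding is_sheaf_def
proof (intro conjI ballI allI impI)
  note TP = sheaf_presheaf[OF T]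
  show "is_presheaf X R"
  proof (rule presheafI)
    fix U f p assume f: "f \<in> into X U" and "p \<in> sec R U"
    then obtain s where s: "s \<in> sec T U" "p = c U s" using secR[OF into_obs[OF f]] by auto
    show "res R f p \<in> sec R (dm X f)"
      unfolding s(2) resR[OF f s(1)] using secR[OF dm_into[OF f]] res_sec[OF TP f s(1)] by blast
  next
    fix U p assume U: "U \<in> obs X" and "p \<in> sec R U"
    then obtain s where s: "s \<in> sec T U" "p = c U s" using secR[OF U] by auto
    show "res R (idn X U) p = p"
      unfolding s(2) resR[OF idn_into[OF U] s(1)] res_idn[OF TP U s(1)] dm_idn[OF U] ..
  next
    fix U f h p assume f: "f \<in> into X U" and h: "h \<in> into X (dm X f)" and "p \<in> sec R U"
    then obtain s where s: "s \<in> sec T U" "p = c U s" using secR[OF into_obs[OF f]] by auto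
    show "res R (cmp X f h) p = res R h (res R f p)"
      unfolding s(2) resR[OF f s(1)] resR[OF h res_sec[OF TP f s(1)]] resR[OF cmp_into[OF f h] s(1)]
        res_cmp[OF TP f s(1) h] dm_cmp_into[OF f h] ..
  qed
  fix U S x assume U: "U \<in> obs X" and S: "S \<in> cov X U" and
    x: "(\<forall>f\<in>S. x f \<in> sec R (dm X f)) \<and> (\<forall>f\<in>S. \<forall>h\<in>into X (dm X f). x (cmp X f h) = res R h (x f))"
  have V: "f \<in> into X U" "dm X f \<in> obs X" if "f \<in> S" for f
    using sieve_into[OF U S that] dm_into by auto
  define y where "y f = inv_into (sec T (dm X f)) (c (dm X f)) (x f)" for f
  have y: "y f \<in> sec T (dm X f)" "c (dm X f) (y f) = x f" if "f \<in> S" for f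
  proof -
    have "x f \<in> c (dm X f) ` sec T (dm X f)" using x that secR[OF V(2)[OF that]] by blast
    thus "y f \<in> sec T (dm X f)" "c (dm X f) (y f) = x f"
      unfolding y_def by (rule inv_into_into, rule f_inv_into_f)
  qed
  have "\<exists>!s. s \<in> sec T U \<and> (\<forall>f\<in>S. res T f s = y f)"
  proof (rule sheaf_glue[OF T U S y(1)])
    fix f h assume f: "f \<in> S" and h: "h \<in> into X (dm X f)"
    note fh = sieve_cmp[OF U S f h] and dm = dm_cmp_into[OF V(1)[OF f] h]
    have "c (dm X h) (y (cmp X f h)) = c (dm X h) (res T h (y f))"
      using y(2)[OF fh] x f h resR[OF h y(1)[OF f]] y(2)[OF f] dm by simp
    thus "y (cmp X f h) = res T h (y f)"
      using inj_onD[OF inj[OF dm_into[OF h]]] y(1)[OF fh] res_sec[OF TP h y(1)[OF f]] dm by simp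
  qed
  then obtain s where s: "s \<in> sec T U" "\<And>f. f \<in> S \<Longrightarrow> res T f s = y f"
    and u: "\<And>r. \<lbrakk>r \<in> sec T U; \<And>f. f \<in> S \<Longrightarrow> res T f r = y f\<rbrakk> \<Longrightarrow> r = s" by (elim ex1E) blast
  show "\<exists>!p. p \<in> sec R U \<and> (\<forall>f\<in>S. res R f p = x f)"
  proof (rule ex1I[of _ "c U s"])
    have "res R f (c U s) = x f" if "f \<in> S" for f
      unfolding resR[OF V(1)[OF that] s(1)] s(2)[OF that] by (rule y(2)[OF that])
    thus "c U s \<in> sec R U \<and> (\<forall>f\<in>S. res R f (c U s) = x f)" using secR[OF U] s(1) by blast
    fix p assume p: "p \<in> sec R U \<and> (\<forall>f\<in>S. res R f p = x f)"
    then obtain r where r: "r \<in> sec T U" "p = c U r" using secR[OF U] by auto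
    have "r = s"
    proof (rule u[OF r(1)])
      fix f assume f: "f \<in> S"
      have "c (dm X f) (res T f r) = c (dm X f) (y f)"
        using p f r(2) resR[OF V(1)[OF f] r(1)] y(2)[OF f] by simp
      thus "res T f r = y f"
        using inj_onD[OF inj[OF V(2)[OF f]]] y(1)[OF f] res_sec[OF TP V(1)[OF f] r(1)] by simp
    qed
    thus "p = c U s" using r(2) by simp
  qed
qed

end

locale torsor_pair = gamma_xmod X \<Gamma> G
  for X :: "('o, 'm) site" and \<Gamma> :: "('o, 'm, 'g) gsheaf" and G :: "('o, 'm, 'a, 'b, 'g) xmod" +
  fixes P P' :: "('o, 'm, 'a, 'a) rtorsor" and \<phi>' :: "'o \<Rightarrow> 'a \<Rightarrow> 'b"
  assumes P: "is_torsor X (G1 G) P" and \<phi>': "framed P' \<phi>'"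
begin

lemmas P' = framed_torsor[OF \<phi>'] and m' = framed_maps[OF \<phi>']

abbreviation "b \<equiv> bitorsor_act G P' \<phi>'"

text \<open>The left action \<open>a v = v a\<^sup>\<phi>\<^sup>'\<^sup>(\<^sup>v\<^sup>)\<close> commutes with
  the right action by the Peiffer identity: \<open>\<phi>'(v d) = \<phi>'(v) \<partial>(d)\<close>, so that
  \<open>a (v d) = v d (d\<^sup>-\<^sup>1 a\<^sup>\<phi>\<^sup>'\<^sup>(\<^sup>v\<^sup>) d) = v
  a\<^sup>\<phi>\<^sup>'\<^sup>(\<^sup>v\<^sup>) d\<close>. It is an action for the same reason.\<close>

lemma bitorsor:
  assumes U: "U \<in> obs X" and a: "a \<in> sec (G1 G) U" and v: "v \<in> sec P' U"
  shows bit_sec: "b U a v \<in> sec P' U"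
    and bit_tact: "c \<in> sec (G1 G) U \<Longrightarrow> b U a (tact P' U v c) = tact P' U (b U a v) c"
    and bit_mult: "c \<in> sec (G1 G) U \<Longrightarrow> b U (c \<otimes>\<^bsub>grp (G1 G) U\<^esub> a) v = b U c (b U a v)"
    and bit_phi: "\<phi>' U (b U a v) = bd G U a \<otimes>\<^bsub>grp (G0 G) U\<^esub> \<phi>' U v"
proof -
  interpret A: section_group "G1 G" U by (rule section_groupI[OF G1 U])
  interpret K: section_group "G0 G" U by (rule section_groupI[OF G0 U])
  note g = maps_sec[OF m' U v]
  note ag = ract_sec[OF U g a]
  show bs: "b U a v \<in> sec P' U" unfolding bitorsor_act_def by (rule tact_sec[OF P' U v ag])
  show "\<phi>' U (b U a v) = bd G U a \<otimes>\<^bsub>grp (G0 G) U\<^esub> \<phi>' U v"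
    unfolding bitorsor_act_def framed_tact[OF \<phi>' U v ag] bd_ract[OF U a g]
    using g bd_sec[OF U a] by (simp add: K.m_assoc)
  have *: "b U c (tact P' U v d) = tact P' U v (ract G U c (\<phi>' U v) \<otimes>\<^bsub>grp (G1 G) U\<^esub> d)"
    if c: "c \<in> sec (G1 G) U" and d: "d \<in> sec (G1 G) U" for c d
  proof -
    note cg = ract_sec[OF U g c]
    have "b U c (tact P' U v d) = tact P' U (tact P' U v d)
        (inv\<^bsub>grp (G1 G) U\<^esub> d \<otimes>\<^bsub>grp (G1 G) U\<^esub> ract G U c (\<phi>' U v) \<otimes>\<^bsub>grp (G1 G) U\<^esub> d)"
      unfolding bitorsor_act_def framed_tact[OF \<phi>' U v d] ract_comp[OF U c g bd_sec[OF U d]] peiffer[OF U cg d] ..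
    also have "\<dots> = tact P' U v (ract G U c (\<phi>' U v) \<otimes>\<^bsub>grp (G1 G) U\<^esub> d)"
      using cg d by (simp add: A.m_assoc tact_mult[OF P' U v, symmetric])
    finally show ?thesis .
  qed
  show "c \<in> sec (G1 G) U \<Longrightarrow> b U a (tact P' U v c) = tact P' U (b U a v) c"
    using *[OF a] tact_mult[OF P' U v ag] unfolding bitorsor_act_def by simp
  show "b U (c \<otimes>\<^bsub>grp (G1 G) U\<^esub> a) v = b U c (b U a v)" if c: "c \<in> sec (G1 G) U"
    using *[OF c ag] unfolding bitorsor_act_def ract_mult[OF U g c a] by simp
qed

end

sublocale torsor_pair \<subseteq> C: contracted X "G1 G" P P' "bitorsor_act G P' \<phi>'"
proof unfold_locales
  show "bitorsor_act G P' \<phi>' U a v \<in> sec P' U" if "U \<in> obs X" "a \<in> sec (G1 G) U" "v \<in> sec P' U" for U a v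
    by (rule bit_sec[OF that])
  show "res P' f (bitorsor_act G P' \<phi>' U a v) = bitorsor_act G P' \<phi>' (dm X f) (res (G1 G) f a) (res P' f v)"
    if f: "f \<in> into X U" and a: "a \<in> sec (G1 G) U" and v: "v \<in> sec P' U" for f U a v
  proof -
    note g = maps_sec[OF m' into_obs[OF f] v]
    show ?thesis unfolding bitorsor_act_def tact_res[OF P' f v ract_sec[OF into_obs[OF f] g a]]
        ract_res[OF f a g] maps_res[OF m' f v] ..
  qed
  show "bitorsor_act G P' \<phi>' U \<one>\<^bsub>grp (G1 G) U\<^esub> v = v" if U: "U \<in> obs X" and v: "v \<in> sec P' U" for U v
    unfolding bitorsor_act_def ract_one[OF U maps_sec[OF m' U v]] by (rule tact_one[OF P' U v])
  show "bitorsor_act G P' \<phi>' U (a \<otimes>\<^bsub>grp (G1 G) U\<^esub> c) v = bitorsor_act G P' \<phi>' U a (bitorsor_act G P' \<phi>' U c v)"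
    if "U \<in> obs X" "a \<in> sec (G1 G) U" "c \<in> sec (G1 G) U" "v \<in> sec P' U" for U a c v
    by (rule bit_mult[OF that(1,3,4,2)])
qed (rule G1 P tor_sheaf[OF P'])+

context torsor_pair
begin

abbreviation "W \<equiv> ctr_torsor X G P P' \<phi>'"

lemma sec_W [simp]: "sec W = sec C.T" and res_W [simp]: "res W = res C.T"
  unfolding ctr_torsor_def by (simp_all add: Let_def)

lemma tact_W: "tact W U s c = descend C.T U
    (\<lambda>f u v. C.pt (dm X f) u (tact P' (dm X f) v (res (G1 G) f c))) s"
  unfolding ctr_torsor_def by (simp add: Let_def)

text \<open>Acting on the second entry is well defined on classes because the two actions on \<open>P'\<close>
  commute.\<close>

lemma tact_W_balanced:
  assumes U: "U \<in> obs X" and c: "c \<in> sec (G1 G) U"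
  shows "C.balanced C.T U (\<lambda>f u v. C.pt (dm X f) u (tact P' (dm X f) v (res (G1 G) f c)))"
proof (rule C.balancedI)
  fix f u v assume f: "f \<in> into X U" and u: "u \<in> sec P (dm X f)" and v: "v \<in> sec P' (dm X f)"
  note V = dm_into[OF f] and rc = res_sec[OF grp_presheaf[OF G1] f c]
  note vc = tact_sec[OF P' V v rc]
  show "C.pt (dm X f) u (tact P' (dm X f) v (res (G1 G) f c)) \<in> sec C.T (dm X f)" by (rule C.pt_sec[OF V u vc])
  show "res C.T h (C.pt (dm X f) u (tact P' (dm X f) v (res (G1 G) f c))) =
     C.pt (dm X (cmp X f h)) (res P h u) (tact P' (dm X (cmp X f h)) (res P' h v) (res (G1 G) (cmp X f h) c))"
    if h: "h \<in> into X (dm X f)" for h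
    unfolding C.pt_res[OF h u vc] tact_res[OF P' h v rc] dm_cmp_into[OF f h]
      res_cmp[OF grp_presheaf[OF G1] f c h] ..
  show "C.pt (dm X f) (tact P (dm X f) u a) (tact P' (dm X f) v (res (G1 G) f c))
     = C.pt (dm X f) u (tact P' (dm X f) (b (dm X f) a v) (res (G1 G) f c))"
    if a: "a \<in> sec (G1 G) (dm X f)" for a
    unfolding C.pt_bal[OF V u a vc] bit_tact[OF V a v rc] ..
qed

lemma tact_W_pt:
  assumes U: "U \<in> obs X" and u: "u \<in> sec P U" and v: "v \<in> sec P' U" and c: "c \<in> sec (G1 G) U"
  shows "tact W U (C.pt U u v) c = C.pt U u (tact P' U v c)"
  unfolding tact_W C.descend_pt[OF C.T_sheaf tact_W_balanced[OF U c] U u v] dm_idn[OF U]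
    res_idn[OF grp_presheaf[OF G1] U c] ..

lemma tact_W_sec: "\<lbrakk>U \<in> obs X; s \<in> sec C.T U; c \<in> sec (G1 G) U\<rbrakk> \<Longrightarrow> tact W U s c \<in> sec C.T U"
  unfolding tact_W by (rule C.descend_sec[OF C.T_sheaf tact_W_balanced])

lemma tact_W_res:
  assumes f: "f \<in> into X U" and s: "s \<in> sec C.T U" and c: "c \<in> sec (G1 G) U"
  shows "res C.T f (tact W U s c) = tact W (dm X f) (res C.T f s) (res (G1 G) f c)"
  unfolding tact_W
proof (rule C.descend_res[OF C.T_sheaf tact_W_balanced[OF into_obs[OF f] c] s f _
      tact_W_balanced[OF dm_into[OF f] res_sec[OF grp_presheaf[OF G1] f c]]])
  fix h u v assume h: "h \<in> into X (dm X f)"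
  show "C.pt (dm X h) u (tact P' (dm X h) v (res (G1 G) h (res (G1 G) f c)))
     = C.pt (dm X (cmp X f h)) u (tact P' (dm X (cmp X f h)) v (res (G1 G) (cmp X f h) c))"
    unfolding dm_cmp_into[OF f h] res_cmp[OF grp_presheaf[OF G1] f c h] ..
qed

lemma W_eqI:
  assumes "U \<in> obs X" "s \<in> sec C.T U" "s' \<in> sec C.T U"
    and "\<And>f u. \<lbrakk>f \<in> into X U; u \<in> sec P (dm X f)\<rbrakk> \<Longrightarrow> res C.T f s = res C.T f s'"
  shows "s = s'"
  by (rule eq_densely[OF C.T_sheaf tor_dense[OF P] assms(1-3)]) (use assms(4) in blast)

lemma W_ptE:
  assumes "U \<in> obs X" "u \<in> sec P U" "s \<in> sec C.T U"
  obtains v where "v \<in> sec P' U" "s = C.pt U u v"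
  using C.co[OF assms] by metis

text \<open>In the coordinate of \<open>u\<close> the contracted product is the torsor
  \<open>P'\<close>.\<close>

lemma W_ex1_local:
  assumes U: "U \<in> obs X" and u: "u \<in> sec P U" and s: "s \<in> sec C.T U" "s' \<in> sec C.T U"
  shows "\<exists>!c. c \<in> sec (G1 G) U \<and> tact W U s c = s'"
proof -
  obtain v where v: "v \<in> sec P' U" "s = C.pt U u v" using W_ptE[OF U u s(1)] .
  obtain w where w: "w \<in> sec P' U" "s' = C.pt U u w" using W_ptE[OF U u s(2)] .
  have "tact W U s c = s' \<longleftrightarrow> tact P' U v c = w" if c: "c \<in> sec (G1 G) U" for c
    unfolding v(2) w(2) tact_W_pt[OF U u v(1) c]
    using C.pt_inj[OF U u tact_sec[OF P' U v(1) c] w(1)] by blast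
  thus ?thesis using tact_ex1[OF P' U v(1) w(1)] by (metis (no_types, lifting))
qed

text \<open>The group element relating two sections exists over objects where \<open>P\<close> has a section.
  Being unique there, it is compatible with restriction, so it glues to a section over \<open>U\<close> even if
  \<open>P\<close> has none over \<open>U\<close>.\<close>

lemma W_ex1:
  assumes U: "U \<in> obs X" and s: "s \<in> sec C.T U" "s' \<in> sec C.T U"
  shows "\<exists>!c. c \<in> sec (G1 G) U \<and> tact W U s c = s'"
proof -
  \<comment> \<open>the relating element over the domain of \<open>f\<close>, meaningful if \<open>P\<close> has
    sections there\<close>
  define k where "k f = (THE c. c \<in> sec (G1 G) (dm X f) \<and> tact W (dm X f) (res C.T f s) c = res C.T f s')" for f
  have k: "k f \<in> sec (G1 G) (dm X f)" "tact W (dm X f) (res C.T f s) (k f) = res C.T f s'"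
    and k': "\<And>c. \<lbrakk>c \<in> sec (G1 G) (dm X f); tact W (dm X f) (res C.T f s) c = res C.T f s'\<rbrakk> \<Longrightarrow> c = k f"
    if f: "f \<in> into X U" and u: "u \<in> sec P (dm X f)" for f u
  proof -
    note e = W_ex1_local[OF dm_into[OF f] u res_sec[OF C.TP f s(1)] res_sec[OF C.TP f s(2)]]
    show "k f \<in> sec (G1 G) (dm X f)" "tact W (dm X f) (res C.T f s) (k f) = res C.T f s'"
      using theI'[OF e] unfolding k_def by blast+
    show "c = k f" if "c \<in> sec (G1 G) (dm X f)" "tact W (dm X f) (res C.T f s) c = res C.T f s'" for c
      using the1_equality[OF e] that unfolding k_def by blast
  qed
  have "\<exists>!c. c \<in> sec (G1 G) U \<and> (\<forall>f\<in>into X U. \<forall>u\<in>sec P (dm X f). res (G1 G) f c = k f)"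
  proof (rule glue_over[OF grp_sheaf[OF G1] C.PP tor_dense[OF P] U, where k = "\<lambda>f u. k f"])
    show "k f \<in> sec (G1 G) (dm X f)" if "f \<in> into X U" "u \<in> sec P (dm X f)" for f u by (rule k(1)[OF that])
  next
    fix f u h assume f: "f \<in> into X U" and u: "u \<in> sec P (dm X f)" and h: "h \<in> into X (dm X f)"
    have fh: "res P h u \<in> sec P (dm X (cmp X f h))" using res_sec[OF C.PP h u] dm_cmp_into[OF f h] by simp
    show "res (G1 G) h (k f) = k (cmp X f h)"
    proof (rule k'[OF cmp_into[OF f h] fh])
      show "res (G1 G) h (k f) \<in> sec (G1 G) (dm X (cmp X f h))"
        using res_sec[OF grp_presheaf[OF G1] h k(1)[OF f u]] dm_cmp_into[OF f h] by simp
      show "tact W (dm X (cmp X f h)) (res C.T (cmp X f h) s) (res (G1 G) h (k f)) = res C.T (cmp X f h) s'"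
        unfolding dm_cmp_into[OF f h] res_cmp[OF C.TP f s(1) h] res_cmp[OF C.TP f s(2) h]
          tact_W_res[OF h res_sec[OF C.TP f s(1)] k(1)[OF f u], symmetric] k(2)[OF f u] ..
    qed
  qed (rule refl)
  then obtain c where c: "c \<in> sec (G1 G) U" "\<And>f u. \<lbrakk>f \<in> into X U; u \<in> sec P (dm X f)\<rbrakk> \<Longrightarrow> res (G1 G) f c = k f"
    by blast
  show ?thesis
  proof (rule ex1I[of _ c], intro conjI c(1))
    show "tact W U s c = s'"
    proof (rule W_eqI[OF U tact_W_sec[OF U s(1) c(1)] s(2)])
      fix f u assume f: "f \<in> into X U" and u: "u \<in> sec P (dm X f)"
      show "res C.T f (tact W U s c) = res C.T f s'"
        unfolding tact_W_res[OF f s(1) c(1)] c(2)[OF f u] by (rule k(2)[OF f u])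
    qed
    fix d assume d: "d \<in> sec (G1 G) U \<and> tact W U s d = s'"
    show "d = c"
    proof (rule eq_densely[OF grp_sheaf[OF G1] tor_dense[OF P] U _ c(1)])
      fix f assume f: "f \<in> into X U" and "sec P (dm X f) \<noteq> {}"
      then obtain u where u: "u \<in> sec P (dm X f)" by blast
      have "res (G1 G) f d = k f"
        by (rule k'[OF f u]) (use d res_sec[OF grp_presheaf[OF G1] f] tact_W_res[OF f s(1), of d] in auto)
      thus "res (G1 G) f d = res (G1 G) f c" using c(2)[OF f u] by simp
    qed (use d in blast)
  qed
qed

abbreviation "cd' U \<equiv> (code (sec C.T U) :: _ \<Rightarrow> 'a)"

text \<open>An injection into the type of sections of \<open>G\<^sub>1\<close> exists since the sections of a
  torsor over \<open>U\<close>, if there are any, are in bijection with those of the group; hence the injection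
  selected by \<open>code\<close> is one.\<close>

lemma code_inj:
  assumes U: "U \<in> obs X"
  shows "inj_on (cd' U) (sec C.T U)"
proof -
  have "\<exists>c :: _ \<Rightarrow> 'a. inj_on c (sec C.T U)"
  proof (cases "sec C.T U = {}")
    case False
    then obtain s where s: "s \<in> sec C.T U" by blast
    have "inj_on (\<lambda>r. THE a. a \<in> sec (G1 G) U \<and> tact W U s a = r) (sec C.T U)"
    proof (rule inj_onI)
      fix r q assume r: "r \<in> sec C.T U" and q: "q \<in> sec C.T U"
        and e: "(THE a. a \<in> sec (G1 G) U \<and> tact W U s a = r) = (THE a. a \<in> sec (G1 G) U \<and> tact W U s a = q)"
      show "r = q" using theI'[OF W_ex1[OF U s r]] theI'[OF W_ex1[OF U s q]] unfolding e by simp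
    qed
    thus ?thesis by blast
  qed simp
  thus ?thesis unfolding code_def by (rule someI_ex)
qed

lemma decode_code: "\<lbrakk>U \<in> obs X; s \<in> sec C.T U\<rbrakk> \<Longrightarrow> decode (sec C.T U) (cd' U s) = s"
  unfolding decode_def by (rule inv_into_f_f[OF code_inj])

abbreviation "R \<equiv> tprod X G P P' \<phi>'"
abbreviation "tp \<equiv> tpair X G P P' \<phi>'"

lemma sec_R: "sec R U = cd' U ` sec C.T U"
  unfolding tprod_def by (simp add: Let_def)

lemma sec_RE:
  assumes "p \<in> sec R U" obtains s where "s \<in> sec C.T U" "p = cd' U s"
  using assms sec_R by auto

lemma code_sec: "s \<in> sec C.T U \<Longrightarrow> cd' U s \<in> sec R U"
  unfolding sec_R by blast

lemma res_R: "\<lbrakk>f \<in> into X U; s \<in> sec C.T U\<rbrakk> \<Longrightarrow> res R f (cd' U s) = cd' (dm X f) (res C.T f s)"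
  using decode_code[OF into_obs] into_ars(2)[of f U] unfolding tprod_def by (simp add: Let_def)

lemma tact_R: "\<lbrakk>U \<in> obs X; s \<in> sec C.T U\<rbrakk> \<Longrightarrow> tact R U (cd' U s) c = cd' U (tact W U s c)"
  using decode_code unfolding tprod_def by (simp add: Let_def)

lemma R_sheaf: "is_sheaf X R"
  by (rule sheaf_transport[OF C.T_sheaf code_inj sec_R res_R])

lemma tp_sec: "\<lbrakk>U \<in> obs X; u \<in> sec P U; v \<in> sec P' U\<rbrakk> \<Longrightarrow> tp U u v \<in> sec R U"
  unfolding tpair_def sec_W by (rule code_sec[OF C.pt_sec])

lemma tp_res: "\<lbrakk>f \<in> into X U; u \<in> sec P U; v \<in> sec P' U\<rbrakk>
    \<Longrightarrow> res R f (tp U u v) = tp (dm X f) (res P f u) (res P' f v)"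
  unfolding tpair_def sec_W using res_R C.pt_sec[OF into_obs] C.pt_res by simp

lemma tp_bal: "\<lbrakk>U \<in> obs X; u \<in> sec P U; a \<in> sec (G1 G) U; v \<in> sec P' U\<rbrakk>
    \<Longrightarrow> tp U (tact P U u a) v = tp U u (b U a v)"
  unfolding tpair_def using C.pt_bal by simp

lemma tp_tact: "\<lbrakk>U \<in> obs X; u \<in> sec P U; v \<in> sec P' U; c \<in> sec (G1 G) U\<rbrakk>
    \<Longrightarrow> tact R U (tp U u v) c = tp U u (tact P' U v c)"
  unfolding tpair_def sec_W using tact_R C.pt_sec tact_W_pt by simp

lemma tpE:
  assumes "U \<in> obs X" "u \<in> sec P U" "p \<in> sec R U"
  obtains v where "v \<in> sec P' U" "p = tp U u v"
proof -
  obtain s where s: "s \<in> sec C.T U" "p = cd' U s" using sec_RE[OF assms(3)] .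
  obtain v where "v \<in> sec P' U" "s = C.pt U u v" using W_ptE[OF assms(1,2) s(1)] .
  thus ?thesis using that s(2) unfolding tpair_def sec_W by blast
qed

text \<open>The product of torsors is a torsor: the laws of the action hold in coordinates, where they are those
  of \<open>P'\<close>, and sections exist where both \<open>P\<close> and \<open>P'\<close> have some.\<close>

lemma R_torsor: "is_torsor X (G1 G) R"
  unfolding is_torsor_def
proof (intro conjI ballI R_sheaf)
  fix U p assume U: "U \<in> obs X" and "p \<in> sec R U"
  then obtain s where s: "s \<in> sec C.T U" "p = cd' U s" using sec_RE by blast
  note T = tact_R[OF U s(1)]
  show "tact R U p a \<in> sec R U" if a: "a \<in> sec (G1 G) U" for a
    unfolding s(2) T by (rule code_sec[OF tact_W_sec[OF U s(1) a]])
  show "tact R U p \<one>\<^bsub>grp (G1 G) U\<^esub> = p"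
  proof -
    note o = one_sec[OF G1 U]
    have "tact W U s \<one>\<^bsub>grp (G1 G) U\<^esub> = s"
    proof (rule W_eqI[OF U tact_W_sec[OF U s(1) o] s(1)])
      fix f u assume f: "f \<in> into X U" and u: "u \<in> sec P (dm X f)"
      obtain v where v: "v \<in> sec P' (dm X f)" "res C.T f s = C.pt (dm X f) u v"
        using W_ptE[OF dm_into[OF f] u res_sec[OF C.TP f s(1)]] .
      show "res C.T f (tact W U s \<one>\<^bsub>grp (G1 G) U\<^esub>) = res C.T f s"
        unfolding tact_W_res[OF f s(1) o] res_one[OF G1 f] v(2)
          tact_W_pt[OF dm_into[OF f] u v(1) one_sec[OF G1 dm_into[OF f]]] tact_one[OF P' dm_into[OF f] v(1)] ..
    qed
    thus ?thesis unfolding s(2) T by simp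
  qed
  show "tact R U p (a \<otimes>\<^bsub>grp (G1 G) U\<^esub> c) = tact R U (tact R U p a) c"
    if a: "a \<in> sec (G1 G) U" and c: "c \<in> sec (G1 G) U" for a c
  proof -
    note ac = mult_sec[OF G1 U a c] and sa = tact_W_sec[OF U s(1) a]
    have "tact W U s (a \<otimes>\<^bsub>grp (G1 G) U\<^esub> c) = tact W U (tact W U s a) c"
    proof (rule W_eqI[OF U tact_W_sec[OF U s(1) ac] tact_W_sec[OF U sa c]])
      fix f u assume f: "f \<in> into X U" and u: "u \<in> sec P (dm X f)"
      note V = dm_into[OF f]
      obtain v where v: "v \<in> sec P' (dm X f)" "res C.T f s = C.pt (dm X f) u v"
        using W_ptE[OF V u res_sec[OF C.TP f s(1)]] .
      note ra = res_sec[OF grp_presheaf[OF G1] f a] and rc = res_sec[OF grp_presheaf[OF G1] f c]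
      show "res C.T f (tact W U s (a \<otimes>\<^bsub>grp (G1 G) U\<^esub> c)) = res C.T f (tact W U (tact W U s a) c)"
        unfolding tact_W_res[OF f s(1) ac] tact_W_res[OF f sa c] tact_W_res[OF f s(1) a] res_mult[OF G1 f a c] v(2)
          tact_W_pt[OF V u v(1) mult_sec[OF G1 V ra rc]] tact_W_pt[OF V u v(1) ra]
          tact_W_pt[OF V u tact_sec[OF P' V v(1) ra] rc] tact_mult[OF P' V v(1) ra rc] ..
    qed
    thus ?thesis unfolding s(2) T tact_R[OF U sa] by simp
  qed
  fix q assume "q \<in> sec R U"
  then obtain r where r: "r \<in> sec C.T U" "q = cd' U r" using sec_RE by blast
  have "tact R U p a = q \<longleftrightarrow> tact W U s a = r" if a: "a \<in> sec (G1 G) U" for a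
    unfolding s(2) r(2) T using inj_onD[OF code_inj[OF U]] tact_W_sec[OF U s(1) a] r(1) by blast
  thus "\<exists>!a. a \<in> sec (G1 G) U \<and> tact R U p a = q"
    using W_ex1[OF U s(1) r(1)] by (metis (no_types, lifting))
next
  fix f p a assume "f \<in> ars X" and p: "p \<in> sec R (cd X f)" and a: "a \<in> sec (G1 G) (cd X f)"
  hence f: "f \<in> into X (cd X f)" by (intro intoI)
  obtain s where s: "s \<in> sec C.T (cd X f)" "p = cd' (cd X f) s" using sec_RE[OF p] .
  show "res R f (tact R (cd X f) p a) = tact R (dm X f) (res R f p) (res (G1 G) f a)"
    unfolding s(2) tact_R[OF into_obs[OF f] s(1)] res_R[OF f s(1)]
      res_R[OF f tact_W_sec[OF into_obs[OF f] s(1) a]] tact_W_res[OF f s(1) a]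
      tact_R[OF dm_into[OF f] res_sec[OF C.TP f s(1)]] ..
next
  fix U assume U: "U \<in> obs X"
  have "densely X (\<lambda>U. sec R U \<noteq> {})"
  proof (rule densely_mono[OF densely_conj[OF tor_dense[OF P] tor_dense[OF P']]])
    show "sec R U \<noteq> {}" if "U \<in> obs X" "sec P U \<noteq> {} \<and> sec P' U \<noteq> {}" for U
      using tp_sec that by blast
    show "sec R (dm X f) \<noteq> {}" if "f \<in> into X U" "sec R U \<noteq> {}" for f U
      using res_sec[OF sheaf_presheaf[OF R_sheaf] that(1)] that(2) by blast
  qed
  thus "{f \<in> into X U. sec R (dm X f) \<noteq> {}} \<in> cov X U" using U unfolding densely_def by blast
qed

lemmas RP = tor_presheaf[OF R_torsor]

lemma tdescend_code:
  "\<lbrakk>U \<in> obs X; s \<in> sec C.T U\<rbrakk> \<Longrightarrow> tdescend X G P P' \<phi>' H U k (cd' U s) = descend H U k s"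
  unfolding tdescend_def sec_W using decode_code by simp

lemma tdescend:
  assumes H: "is_sheaf X H" and k: "C.balanced H U k" and U: "U \<in> obs X"
  shows tdescend_sec: "p \<in> sec R U \<Longrightarrow> tdescend X G P P' \<phi>' H U k p \<in> sec H U"
    and tdescend_tp: "\<lbrakk>u \<in> sec P U; v \<in> sec P' U\<rbrakk>
      \<Longrightarrow> tdescend X G P P' \<phi>' H U k (tp U u v) = k (idn X U) u v"
proof -
  show "tdescend X G P P' \<phi>' H U k p \<in> sec H U" if p: "p \<in> sec R U"
    using sec_RE[OF p] tdescend_code[OF U] C.descend_sec[OF H k U] by metis
  show "tdescend X G P P' \<phi>' H U k (tp U u v) = k (idn X U) u v" if u: "u \<in> sec P U" and v: "v \<in> sec P' U"
    unfolding tpair_def sec_W tdescend_code[OF U C.pt_sec[OF U u v]] by (rule C.descend_pt[OF H k U u v])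
qed

lemma tdescend_res:
  assumes H: "is_sheaf X H" and k: "C.balanced H U k" and p: "p \<in> sec R U" and h: "h \<in> into X U"
    and k': "\<And>f u x. \<lbrakk>f \<in> into X (dm X h); u \<in> sec P (dm X f); x \<in> sec P' (dm X f)\<rbrakk>
        \<Longrightarrow> k' f u x = k (cmp X h f) u x"
    and k'b: "C.balanced H (dm X h) k'"
  shows "res H h (tdescend X G P P' \<phi>' H U k p) = tdescend X G P P' \<phi>' H (dm X h) k' (res R h p)"
proof -
  obtain s where s: "s \<in> sec C.T U" "p = cd' U s" using sec_RE[OF p] .
  show ?thesis
    unfolding s(2) res_R[OF h s(1)] tdescend_code[OF into_obs[OF h] s(1)]
      tdescend_code[OF dm_into[OF h] res_sec[OF C.TP h s(1)]]
    by (rule C.descend_res[OF H k s(1) h k' k'b])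
qed

lemma tdescend_map:
  assumes H: "is_sheaf X H"
    and k_sec: "\<And>U u x. \<lbrakk>U \<in> obs X; u \<in> sec P U; x \<in> sec P' U\<rbrakk> \<Longrightarrow> k U u x \<in> sec H U"
    and k_res: "\<And>U h u x. \<lbrakk>U \<in> obs X; h \<in> into X U; u \<in> sec P U; x \<in> sec P' U\<rbrakk>
        \<Longrightarrow> res H h (k U u x) = k (dm X h) (res P h u) (res P' h x)"
    and k_bal: "\<And>U u x a. \<lbrakk>U \<in> obs X; u \<in> sec P U; x \<in> sec P' U; a \<in> sec (G1 G) U\<rbrakk>
        \<Longrightarrow> k U (tact P U u a) x = k U u (b U a x)"
  shows "mk_map X R (\<lambda>U. tdescend X G P P' \<phi>' H U (\<lambda>f u x. k (dm X f) u x)) \<in> maps X R H"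
    and "\<And>U u x. \<lbrakk>U \<in> obs X; u \<in> sec P U; x \<in> sec P' U\<rbrakk>
        \<Longrightarrow> mk_map X R (\<lambda>U. tdescend X G P P' \<phi>' H U (\<lambda>f u x. k (dm X f) u x)) U (tp U u x) = k U u x"
proof -
  have bal: "C.balanced H U (\<lambda>f u x. k (dm X f) u x)" if "U \<in> obs X" for U
  proof (rule C.balancedI)
    fix f h u x assume f: "f \<in> into X U" and "u \<in> sec P (dm X f)" "x \<in> sec P' (dm X f)" "h \<in> into X (dm X f)"
    thus "res H h (k (dm X f) u x) = k (dm X (cmp X f h)) (res P h u) (res P' h x)"
      using k_res[of "dm X f" h u x] dm_cmp_into[of f U h] by simp
  qed (use k_sec k_bal in auto)
  show "mk_map X R (\<lambda>U. tdescend X G P P' \<phi>' H U (\<lambda>f u x. k (dm X f) u x)) \<in> maps X R H"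
  proof (rule mapsI[OF _ _ RP])
    fix U f p assume U: "U \<in> obs X" and f: "f \<in> into X U" and p: "p \<in> sec R U"
    show "res H f (tdescend X G P P' \<phi>' H U (\<lambda>f u x. k (dm X f) u x) p)
        = tdescend X G P P' \<phi>' H (dm X f) (\<lambda>f u x. k (dm X f) u x) (res R f p)"
      by (rule tdescend_res[OF H bal[OF U] p f _ bal[OF dm_into[OF f]]]) (simp add: dm_cmp_into[OF f])
  qed (use tdescend_sec[OF H bal] in blast)
  show "mk_map X R (\<lambda>U. tdescend X G P P' \<phi>' H U (\<lambda>f u x. k (dm X f) u x)) U (tp U u x) = k U u x"
    if "U \<in> obs X" "u \<in> sec P U" "x \<in> sec P' U" for U u x
    unfolding mk_map_apply[OF that(1) tp_sec[OF that]] tdescend_tp[OF H bal[OF that(1)] that] dm_idn[OF that(1)] ..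
qed

lemma R_eqI:
  assumes "U \<in> obs X" "is_sheaf X H" "s \<in> sec H U" "s' \<in> sec H U" "p \<in> sec R U"
    and "\<And>f u v. \<lbrakk>f \<in> into X U; u \<in> sec P (dm X f); v \<in> sec P' (dm X f); res R f p = tp (dm X f) u v\<rbrakk>
      \<Longrightarrow> res H f s = res H f s'"
  shows "s = s'"
proof (rule eq_densely[OF assms(2) tor_dense[OF P] assms(1,3,4)])
  fix f assume f: "f \<in> into X U" and "sec P (dm X f) \<noteq> {}"
  then obtain u where u: "u \<in> sec P (dm X f)" by blast
  obtain v where "v \<in> sec P' (dm X f)" "res R f p = tp (dm X f) u v"
    using tpE[OF dm_into[OF f] u res_sec[OF RP f assms(5)]] .
  thus "res H f s = res H f s'" using assms(6)[OF f u] by blast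
qed

text \<open>Equivariance of a map out of a product of torsors is tested on pairs, where the group acts on the
  second entry.\<close>

lemma tact_map_on_tp:
  assumes m: "m \<in> maps X R S" and S: "is_torsor X (G1 G) S" and D: "densely X D"
    and eqv: "\<And>U u v a. \<lbrakk>U \<in> obs X; D U; u \<in> sec P U; v \<in> sec P' U; a \<in> sec (G1 G) U\<rbrakk>
      \<Longrightarrow> m U (tp U u (tact P' U v a)) = tact S U (m U (tp U u v)) a"
    and U: "U \<in> obs X" and p: "p \<in> sec R U" and a: "a \<in> sec (G1 G) U"
  shows "m U (tact R U p a) = tact S U (m U p) a"
proof (rule eq_densely[OF tor_sheaf[OF S] densely_conj[OF D tor_dense[OF P]] U])
  note pa = tact_sec[OF R_torsor U p a] and mp = maps_sec[OF m U p]
  show "m U (tact R U p a) \<in> sec S U" "tact S U (m U p) a \<in> sec S U"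
    by (rule maps_sec[OF m U pa], rule tact_sec[OF S U mp a])
  fix f assume f: "f \<in> into X U" and "D (dm X f) \<and> sec P (dm X f) \<noteq> {}"
  then obtain u where Df: "D (dm X f)" and u: "u \<in> sec P (dm X f)" by blast
  note V = dm_into[OF f] and ra = res_sec[OF grp_presheaf[OF G1] f a]
  obtain v where v: "v \<in> sec P' (dm X f)" "res R f p = tp (dm X f) u v"
    using tpE[OF V u res_sec[OF RP f p]] .
  show "res S f (m U (tact R U p a)) = res S f (tact S U (m U p) a)"
    unfolding maps_res[OF m f pa] tact_res[OF R_torsor f p a] tact_res[OF S f mp a] maps_res[OF m f p] v(2)
      tp_tact[OF V u v(1) ra] by (rule eqv[OF V Df u v(1) ra])
qed

abbreviation "pairs_exist U \<equiv> sec P U \<noteq> {} \<and> sec P' U \<noteq> {}"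

lemma dense_pairs: "densely X (\<lambda>U. pairs_exist U)"
  by (rule densely_conj[OF tor_dense[OF P] tor_dense[OF P']])

text \<open>The product \<open>\<phi>(u) \<phi>'(v)\<close> is balanced because \<open>\<phi>'\<close> carries
  the left action of \<open>a\<close> to left multiplication by \<open>\<partial>(a)\<close>
  (\<open>bit_phi\<close>).\<close>

lemma tprod_map:
  assumes \<phi>: "framed P \<phi>"
  shows tprod_map_framed: "framed R (tprod_map X G P \<phi> P' \<phi>')"
    and tprod_map_tp: "\<lbrakk>U \<in> obs X; u \<in> sec P U; v \<in> sec P' U\<rbrakk>
      \<Longrightarrow> tprod_map X G P \<phi> P' \<phi>' U (tp U u v) = \<phi> U u \<otimes>\<^bsub>grp (G0 G) U\<^esub> \<phi>' U v"
proof -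
  note m = framed_maps[OF \<phi>]
  define k where "k U u v = \<phi> U u \<otimes>\<^bsub>grp (G0 G) U\<^esub> \<phi>' U v" for U u v
  have d: "tprod_map X G P \<phi> P' \<phi>' = mk_map X R (\<lambda>U. tdescend X G P P' \<phi>' (G0 G) U (\<lambda>f u x. k (dm X f) u x))"
    unfolding tprod_map_def k_def ..
  have s: "k U u v \<in> sec (G0 G) U" if "U \<in> obs X" "u \<in> sec P U" "v \<in> sec P' U" for U u v
    unfolding k_def by (rule mult_sec[OF G0 that(1) maps_sec[OF m that(1,2)] maps_sec[OF m' that(1,3)]])
  have r: "res (G0 G) h (k U u v) = k (dm X h) (res P h u) (res P' h v)"
    if "U \<in> obs X" "h \<in> into X U" "u \<in> sec P U" "v \<in> sec P' U" for U h u v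
    unfolding k_def res_mult[OF G0 that(2) maps_sec[OF m that(1,3)] maps_sec[OF m' that(1,4)]]
      maps_res[OF m that(2,3)] maps_res[OF m' that(2,4)] ..
  have bal: "k U (tact P U u a) v = k U u (b U a v)"
    if U: "U \<in> obs X" and u: "u \<in> sec P U" and v: "v \<in> sec P' U" and a: "a \<in> sec (G1 G) U" for U u v a
  proof -
    interpret K: section_group "G0 G" U by (rule section_groupI[OF G0 U])
    show ?thesis
      unfolding k_def framed_tact[OF \<phi> U u a] bit_phi[OF U a v]
      by (rule K.m_assoc[OF maps_sec[OF m U u] bd_sec[OF U a] maps_sec[OF m' U v]])
  qed
  note D = tdescend_map[OF grp_sheaf[OF G0], of k, OF s r bal, folded d]
  show *: "tprod_map X G P \<phi> P' \<phi>' U (tp U u v) = \<phi> U u \<otimes>\<^bsub>grp (G0 G) U\<^esub> \<phi>' U v"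
    if "U \<in> obs X" "u \<in> sec P U" "v \<in> sec P' U" for U u v
    using D(2)[of U u v] that unfolding k_def by blast
  have mR: "tprod_map X G P \<phi> P' \<phi>' \<in> maps X R (G0 G)" using D(1) by blast
  show "framed R (tprod_map X G P \<phi> P' \<phi>')"
    unfolding framed_def
  proof (intro conjI ballI R_torsor mR)
    fix U p a assume U: "U \<in> obs X" and p: "p \<in> sec R U" and a: "a \<in> sec (G1 G) U"
    note pa = tact_sec[OF R_torsor U p a]
    show "tprod_map X G P \<phi> P' \<phi>' U (tact R U p a) = tprod_map X G P \<phi> P' \<phi>' U p \<otimes>\<^bsub>grp (G0 G) U\<^esub> bd G U a"
    proof (rule R_eqI[OF U grp_sheaf[OF G0] maps_sec[OF mR U pa]
          mult_sec[OF G0 U maps_sec[OF mR U p] bd_sec[OF U a]] p])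
      fix f u v assume f: "f \<in> into X U" and u: "u \<in> sec P (dm X f)" and v: "v \<in> sec P' (dm X f)"
        and e: "res R f p = tp (dm X f) u v"
      note V = dm_into[OF f] and ra = res_sec[OF grp_presheaf[OF G1] f a]
      interpret K: section_group "G0 G" "dm X f" by (rule section_groupI[OF G0 V])
      show "res (G0 G) f (tprod_map X G P \<phi> P' \<phi>' U (tact R U p a))
          = res (G0 G) f (tprod_map X G P \<phi> P' \<phi>' U p \<otimes>\<^bsub>grp (G0 G) U\<^esub> bd G U a)"
        unfolding maps_res[OF mR f pa] tact_res[OF R_torsor f p a]
          res_mult[OF G0 f maps_sec[OF mR U p] bd_sec[OF U a]] maps_res[OF mR f p] bd_res[OF f a] e
          tp_tact[OF V u v ra] *[OF V u v] *[OF V u tact_sec[OF P' V v ra]] framed_tact[OF \<phi>' V v ra]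
        using maps_sec[OF m V u] maps_sec[OF m' V v] bd_sec[OF V ra] by (simp add: K.m_assoc)
    qed
  qed
qed

end

section \<open>Composition of arrows\<close>

context twisted
begin

text \<open>Conjugation in the twisted group is conjugation in \<open>E\<close> by the twisted element; this is
  the left action that defines the product of torsors, and it makes \<open>ctr_assoc\<close> well
  defined.\<close>

lemma conj_act_twist:
  assumes \<phi>: "framed P \<phi>" and U: "U \<in> obs X" and a: "a \<in> sec (G1 G) U"
    and v: "v \<in> sec P U" and x: "x \<in> sec (tot E) U"
  shows "conj_act (twist X \<Gamma> G P \<phi> E) U a (pt U v x) = pt U v (conj_act E U (ract G U a (\<phi> U v)) x)"
proof -
  note s = ghom_sec[OF G1 E i U ract_sec[OF U maps_sec[OF framed_maps[OF \<phi>] U v] a]]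
  show ?thesis
    unfolding conj_act_def tot_twist mult_M inc_twist_pt[OF \<phi> U a v] inv_M[OF U v s] gmul_pt[OF U v s x]
      gmul_pt[OF U v mult_sec[OF E U s x] inv_sec[OF E U s]] ..
qed

end

context gamma_xmod
begin

lemma twisted_twist:
  assumes P: "is_torsor X (G1 G) P" and \<phi>': "framed P' \<phi>'" and C: "C \<in> Z0"
  shows "twisted X \<Gamma> G P (twist X \<Gamma> G P' \<phi>' C)"
proof -
  interpret t: twisted X \<Gamma> G P' C by (rule twistedI[OF \<phi>' C])
  show ?thesis
  proof (unfold_locales, rule P)
    show "group_over X (tot (twist X \<Gamma> G P' \<phi>' C))" using t.M_group_over by simp
    show "inc (twist X \<Gamma> G P' \<phi>' C) \<in> ghoms X (G1 G) (tot (twist X \<Gamma> G P' \<phi>' C))"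
      using t.inc_twist_ghom[OF \<phi>'] by simp
  qed
qed

lemma wa_ghom:
  assumes f: "(A, B, t, P, \<phi>) \<in> W1"
  shows "t \<in> ghoms X (tot A) (tot (twist X \<Gamma> G P \<phi> B))"
    and "\<lbrakk>U \<in> obs X; a \<in> sec (G1 G) U\<rbrakk> \<Longrightarrow> t U (inc A U a) = inc (twist X \<Gamma> G P \<phi> B) U a"
  using f unfolding w_arrows_iff gisos_def ghoms_def iso_def by blast+

text \<open>The map \<open>(u, x) \<mapsto> (u, t x)\<close> is balanced since \<open>t\<close> is a
  homomorphism with \<open>t \<iota> = \<iota>'\<close> and so commutes with conjugation by
  \<open>G\<^sub>1\<close>.\<close>

lemma ctr_map_snd_pt:
  assumes P: "is_torsor X (G1 G) P" and f: "(B, C, t, P', \<phi>') \<in> W1"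
  defines "E \<equiv> twist X \<Gamma> G P' \<phi>' C"
  shows "ctr_map_snd X G P B E t \<in> maps X (tw_sheaf X G P B) (tw_sheaf X G P E)"
    and "\<lbrakk>U \<in> obs X; u \<in> sec P U; x \<in> sec (tot B) U\<rbrakk>
      \<Longrightarrow> ctr_map_snd X G P B E t U (tw_pt X G P B U u x) = tw_pt X G P E U u (t U x)"
proof -
  note B = wa_obj(1)[OF f] and C = wa_obj(2)[OF f] and \<phi>' = wa_framed[OF f]
  interpret p: twisted X \<Gamma> G P B by (unfold_locales) (rule P tot[OF B] inc[OF B])+
  interpret q: twisted X \<Gamma> G P E unfolding E_def by (rule twisted_twist[OF P \<phi>' C])
  note h = wa_ghom(1)[OF f, folded E_def]
  note t_sec = ghom_sec[OF p.E q.E h]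
  let ?k = "\<lambda>U u x. q.pt U u (t U x)"
  have s: "?k U u x \<in> sec q.T U" if "U \<in> obs X" "u \<in> sec P U" "x \<in> sec (tot B) U" for U u x
    by (rule q.C.pt_sec[OF that(1,2) t_sec[OF that(1,3)]])
  have r: "res q.T h (?k U u x) = ?k (dm X h) (res P h u) (res (tot B) h x)"
    if "U \<in> obs X" "h \<in> into X U" "u \<in> sec P U" "x \<in> sec (tot B) U" for U h u x
    unfolding q.C.pt_res[OF that(2,3) t_sec[OF that(1,4)]] ghom_res[OF p.E q.E h that(2,4)] ..
  have b: "?k U (tact P U u a) x = ?k U u (conj_act B U a x)"
    if U: "U \<in> obs X" and u: "u \<in> sec P U" and x: "x \<in> sec (tot B) U" and a: "a \<in> sec (G1 G) U" for U u x a
  proof -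
    note i = inc_sec[OF B U a]
    have "conj_act E U a (t U x) = t U (conj_act B U a x)"
      unfolding conj_act_def wa_ghom(2)[OF f U a, folded E_def, symmetric]
        ghom_mult[OF p.E q.E h U mult_sec[OF p.E U i x] inv_sec[OF p.E U i]] ghom_mult[OF p.E q.E h U i x]
        ghom_inv[OF p.E q.E h U i] ..
    thus ?thesis unfolding q.C.pt_bal[OF U u a t_sec[OF U x]] by simp
  qed
  note D = p.C.descend_map[OF q.C.T_sheaf, of ?k, OF s r b]
  show "ctr_map_snd X G P B E t \<in> maps X (tw_sheaf X G P B) (tw_sheaf X G P E)"
    unfolding ctr_map_snd_def by (rule D(1))
  show "ctr_map_snd X G P B E t U (tw_pt X G P B U u x) = tw_pt X G P E U u (t U x)"
    if "U \<in> obs X" "u \<in> sec P U" "x \<in> sec (tot B) U" for U u x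
    unfolding ctr_map_snd_def mk_map_apply[OF that(1) p.C.pt_sec[OF that]] by (rule D(2); (assumption | rule that))
qed

end

context torsor_pair
begin

text \<open>Descent is carried out twice: in \<open>(v, x)\<close> for fixed \<open>u\<close>, where the
  balancing is that of the product torsor, on which \<open>G\<^sub>1\<close> acts through \<open>v\<close>, and
  then in \<open>u\<close>, where \<open>(u a, v) = (u, a v)\<close> has to match conjugation by
  \<open>a\<close> in the inner twisted group (\<open>conj_act_twist\<close>).\<close>

lemma ctr_assoc_pt:
  assumes C: "C \<in> Z0"
  defines "E \<equiv> twist X \<Gamma> G P' \<phi>' C"
  shows "ctr_assoc X \<Gamma> G P P' \<phi>' C \<in> maps X (tw_sheaf X G P E) (tw_sheaf X G R C)"
    and "\<lbrakk>U \<in> obs X; u \<in> sec P U; v \<in> sec P' U; x \<in> sec (tot C) U\<rbrakk>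
      \<Longrightarrow> ctr_assoc X \<Gamma> G P P' \<phi>' C U (tw_pt X G P E U u (tw_pt X G P' C U v x)) = tw_pt X G R C U (tp U u v) x"
proof -
  interpret p: twisted X \<Gamma> G P' C by (rule twistedI[OF \<phi>' C])
  interpret q: twisted X \<Gamma> G P E unfolding E_def by (rule twisted_twist[OF P \<phi>' C])
  interpret r: twisted X \<Gamma> G R C by (unfold_locales) (rule R_torsor p.E p.i)+
  have [simp]: "sec (tot E) = sec p.T" "res (tot E) = res p.T" unfolding E_def by simp_all
  define j where "j u = (\<lambda>h v x. r.pt (dm X h) (tp (dm X h) (res P h u) v) x)" for u
  define k where "k U u w = descend r.T U (j u) w" for U u w
  have j: "p.C.balanced r.T U (j u)" if U: "U \<in> obs X" and u: "u \<in> sec P U" for U u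
  proof (rule p.C.balancedI)
    fix f v x assume f: "f \<in> into X U" and v: "v \<in> sec P' (dm X f)" and x: "x \<in> sec (tot C) (dm X f)"
    note V = dm_into[OF f] and ru = res_sec[OF C.PP f u]
    note t = tp_sec[OF V ru v]
    show "j u f v x \<in> sec r.T (dm X f)" unfolding j_def by (rule r.C.pt_sec[OF V t x])
    show "res r.T h (j u f v x) = j u (cmp X f h) (res P' h v) (res (tot C) h x)" if h: "h \<in> into X (dm X f)" for h
      unfolding j_def r.C.pt_res[OF h t x] tp_res[OF h ru v] dm_cmp_into[OF f h] res_cmp[OF C.PP f u h] ..
    show "j u f (tact P' (dm X f) v a) x = j u f v (conj_act C (dm X f) a x)" if a: "a \<in> sec (G1 G) (dm X f)" for a
      unfolding j_def tp_tact[OF V ru v a, symmetric] by (rule r.C.pt_bal[OF V t a x])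
  qed
  have k_pt: "k U u (p.pt U v x) = r.pt U (tp U u v) x"
    if U: "U \<in> obs X" and u: "u \<in> sec P U" and v: "v \<in> sec P' U" and x: "x \<in> sec (tot C) U" for U u v x
    unfolding k_def p.C.descend_pt[OF r.C.T_sheaf j[OF U u] U v x] unfolding j_def dm_idn[OF U] res_idn[OF C.PP U u] ..
  have s: "k U u w \<in> sec r.T U" if "U \<in> obs X" "u \<in> sec P U" "w \<in> sec (tot E) U" for U u w
    unfolding k_def using p.C.descend_sec[OF r.C.T_sheaf j[OF that(1,2)] that(1)] that(3) by simp
  have rs: "res r.T h (k U u w) = k (dm X h) (res P h u) (res (tot E) h w)"
    if U: "U \<in> obs X" and h: "h \<in> into X U" and u: "u \<in> sec P U" and w: "w \<in> sec (tot E) U" for U h u w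
  proof -
    have w': "w \<in> sec p.T U" using w by simp
    have e: "j (res P h u) f v x = j u (cmp X h f) v x" if f: "f \<in> into X (dm X h)" for f v x
      unfolding j_def dm_cmp_into[OF h f] res_cmp[OF C.PP h u f] ..
    show ?thesis unfolding k_def
      using p.C.descend_res[OF r.C.T_sheaf j[OF U u] w' h e j[OF dm_into[OF h] res_sec[OF C.PP h u]]] by simp
  qed
  have b: "k U (tact P U u a) w = k U u (conj_act E U a w)"
    if U: "U \<in> obs X" and u: "u \<in> sec P U" and w: "w \<in> sec (tot E) U" and a: "a \<in> sec (G1 G) U" for U u w a
  proof (rule eq_densely[OF r.C.T_sheaf tor_dense[OF P'] U])
    note ua = tact_sec[OF P U u a] and aw = q.C.act_sec[OF U a w]
    show "k U (tact P U u a) w \<in> sec r.T U" by (rule s[OF U ua w])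
    show "k U u (conj_act E U a w) \<in> sec r.T U" by (rule s[OF U u aw])
    fix f assume f: "f \<in> into X U" and "sec P' (dm X f) \<noteq> {}"
    then obtain v where v: "v \<in> sec P' (dm X f)" by blast
    note V = dm_into[OF f] and ru = res_sec[OF C.PP f u] and ra = res_sec[OF grp_presheaf[OF G1] f a]
    have "res p.T f w \<in> sec p.T (dm X f)" using res_sec[OF p.C.TP f] w by simp
    then obtain x where x: "x \<in> sec (tot C) (dm X f)" "res p.T f w = p.pt (dm X f) v x"
      using p.C.co[OF V v] by metis
    note av = ract_sec[OF V maps_sec[OF m' V v] ra]
    have "k (dm X f) (tact P (dm X f) (res P f u) (res (G1 G) f a)) (p.pt (dm X f) v x)
        = r.pt (dm X f) (tp (dm X f) (res P f u) (b (dm X f) (res (G1 G) f a) v)) x"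
      unfolding k_pt[OF V tact_sec[OF P V ru ra] v x(1)] tp_bal[OF V ru ra v] ..
    also have "\<dots> = r.pt (dm X f) (tp (dm X f) (res P f u) v)
        (conj_act C (dm X f) (ract G (dm X f) (res (G1 G) f a) (\<phi>' (dm X f) v)) x)"
      unfolding bitorsor_act_def tp_tact[OF V ru v av, symmetric] by (rule r.C.pt_bal[OF V tp_sec[OF V ru v] av x(1)])
    also have "\<dots> = k (dm X f) (res P f u) (p.pt (dm X f) v
        (conj_act C (dm X f) (ract G (dm X f) (res (G1 G) f a) (\<phi>' (dm X f) v)) x))"
      by (rule k_pt[OF V ru v p.C.act_sec[OF V av x(1)], symmetric])
    also have "\<dots> = k (dm X f) (res P f u) (conj_act E (dm X f) (res (G1 G) f a) (p.pt (dm X f) v x))"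
      unfolding E_def p.conj_act_twist[OF \<phi>' V ra v x(1)] ..
    finally show "res r.T f (k U (tact P U u a) w) = res r.T f (k U u (conj_act E U a w))"
      unfolding rs[OF U f ua w] rs[OF U f u aw] q.C.act_res[OF f a w] tact_res[OF P f u a] using x(2) by simp
  qed
  have d: "ctr_assoc X \<Gamma> G P P' \<phi>' C = mk_map X (tw_sheaf X G P E) (\<lambda>U. descend r.T U (\<lambda>f u x. k (dm X f) u x))"
    unfolding ctr_assoc_def k_def j_def E_def by (simp add: Let_def)
  note D = q.C.descend_map[OF r.C.T_sheaf, of k, OF s rs b]
  show "ctr_assoc X \<Gamma> G P P' \<phi>' C \<in> maps X (tw_sheaf X G P E) (tw_sheaf X G R C)"
    unfolding d by (rule D(1))
  show "ctr_assoc X \<Gamma> G P P' \<phi>' C U (tw_pt X G P E U u (tw_pt X G P' C U v x)) = tw_pt X G R C U (tp U u v) x"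
    if U: "U \<in> obs X" and u: "u \<in> sec P U" and v: "v \<in> sec P' U" and x: "x \<in> sec (tot C) U" for U u v x
  proof -
    have w: "p.pt U v x \<in> sec (tot E) U" using p.C.pt_sec[OF U v x] by simp
    have "ctr_assoc X \<Gamma> G P P' \<phi>' C U (q.pt U u (p.pt U v x)) = k U u (p.pt U v x)"
      unfolding d mk_map_apply[OF U q.C.pt_sec[OF U u w]] by (rule D(2); (assumption | rule U u w))
    thus ?thesis unfolding k_pt[OF U u v x] .
  qed
qed

end

context gamma_xmod
begin

definition w_t :: "('o, 'm, 'e, 'a, 'b, 'g) warr \<Rightarrow> 'o \<Rightarrow> 'e \<Rightarrow> ('m, 'a, 'e) ctr" where
  "w_t = (\<lambda>(A, B, t, P, \<phi>). t)"

text \<open>\<open>germ F U u s\<close>: at the section \<open>u\<close> of its torsor, the arrow \<open>F\<close> is the local arrow \<open>s\<close>. Composition of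
  arrows composes germs, and a 2-arrow is a map of torsors that preserves germs and the maps to \<open>G\<^sub>0\<close>.\<close>

definition germ :: "('o, 'm, 'e, 'a, 'b, 'g) warr \<Rightarrow> 'o \<Rightarrow> 'a \<Rightarrow> ('e \<Rightarrow> 'e) \<Rightarrow> bool" where
  "germ F U u s \<longleftrightarrow> u \<in> sec (w_tor F) U \<and> local_arrow (fst F) (fst (snd F)) U s (w_phi F U u) \<and>
     (\<forall>x\<in>sec (tot (fst F)) U. w_t F U x = tw_pt X G (w_tor F) (fst (snd F)) U u (s x))"

lemma w_arr_simps [simp]: "w_tor (A, B, t, P, \<phi>) = P" "w_phi (A, B, t, P, \<phi>) = \<phi>" "w_t (A, B, t, P, \<phi>) = t"
  by (simp_all add: w_tor_def w_phi_def w_t_def)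

lemma w_arr_eq: "F = (fst F, fst (snd F), w_t F, w_tor F, w_phi F)"
  by (cases F rule: prod_cases5) simp

lemma w_arr:
  assumes "F \<in> W1"
  shows w_src: "fst F \<in> Z0" and w_trg: "fst (snd F) \<in> Z0"
    and w_framed: "framed (w_tor F) (w_phi F)" and w_torsor: "is_torsor X (G1 G) (w_tor F)"
    and w_phi_maps: "w_phi F \<in> maps X (w_tor F) (G0 G)"
    and w_maps: "w_t F \<in> maps X (tot (fst F)) (tw_sheaf X G (w_tor F) (fst (snd F)))"
    and ex_germ: "\<lbrakk>U \<in> obs X; u \<in> sec (w_tor F) U\<rbrakk> \<Longrightarrow> \<exists>s. germ F U u s"
proof -
  have F: "(fst F, fst (snd F), w_t F, w_tor F, w_phi F) \<in> W1" using assms w_arr_eq[of F] by simp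
  show "fst F \<in> Z0" "fst (snd F) \<in> Z0" by (rule wa_obj[OF F])+
  show p: "framed (w_tor F) (w_phi F)" by (rule wa_framed[OF F])
  show "is_torsor X (G1 G) (w_tor F)" "w_phi F \<in> maps X (w_tor F) (G0 G)"
    by (rule framed_torsor[OF p], rule framed_maps[OF p])
  show "w_t F \<in> maps X (tot (fst F)) (tw_sheaf X G (w_tor F) (fst (snd F)))" by (rule wa_maps[OF F])
  show "\<exists>s. germ F U u s" if "U \<in> obs X" "u \<in> sec (w_tor F) U"
    using wa_local[OF F that] that(2) unfolding germ_def by blast
qed

lemma w_arrI:
  assumes "fst F \<in> Z0" "fst (snd F) \<in> Z0" "framed (w_tor F) (w_phi F)"
    and "w_t F \<in> maps X (tot (fst F)) (tw_sheaf X G (w_tor F) (fst (snd F)))" and "densely X D"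
    and loc: "\<And>U. \<lbrakk>U \<in> obs X; D U\<rbrakk> \<Longrightarrow> \<exists>u s. germ F U u s"
  shows "F \<in> W1"
proof -
  have "(fst F, fst (snd F), w_t F, w_tor F, w_phi F) \<in> W1"
    by (rule w_arrowI[OF assms(1-5)]) (use loc in \<open>unfold germ_def, blast\<close>)
  thus ?thesis using w_arr_eq[of F] by simp
qed

lemma w_comp1_simps [simp]:
  "fst (wcomp F F') = fst F" "fst (snd (wcomp F F')) = fst (snd F')"
  "w_tor (wcomp F F') = tprod X G (w_tor F) (w_tor F') (w_phi F')"
  "w_phi (wcomp F F') = tprod_map X G (w_tor F) (w_phi F) (w_tor F') (w_phi F')"
  unfolding w_comp1_def by (cases F rule: prod_cases5; cases F' rule: prod_cases5; simp)+

lemma torsor_pairI: "\<lbrakk>F \<in> W1; F' \<in> W1\<rbrakk>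
    \<Longrightarrow> torsor_pair X \<Gamma> G (w_tor F) (w_tor F') (w_phi F')"
  by unfold_locales (rule w_torsor w_framed; assumption)+

text \<open>On the pair \<open>(u, v)\<close> the composite sends \<open>x\<close> to \<open>(u, s x)\<close>,
  then to \<open>(u, (v, r (s x)))\<close>, then to \<open>((u, v), r (s x))\<close>. That the composite is an
  arrow follows from the existence of these germs.\<close>

lemma w_comp:
  assumes F: "F \<in> W1" and F': "F' \<in> W1" and c: "fst (snd F) = fst F'"
  shows w_comp_germ: "\<lbrakk>U \<in> obs X; germ F U u s; germ F' U v r\<rbrakk> \<Longrightarrow>
      germ (wcomp F F') U (tpair X G (w_tor F) (w_tor F') (w_phi F') U u v) (\<lambda>x. r (s x))"
    and w_comp_arr: "wcomp F F' \<in> W1"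
proof -
  obtain A B t P \<phi> where Fe: "F = (A, B, t, P, \<phi>)" by (cases F rule: prod_cases5)
  obtain B' C t' P' \<phi>' where Fe': "F' = (B', C, t', P', \<phi>')" by (cases F' rule: prod_cases5)
  have [simp]: "B' = B" using c Fe Fe' by simp
  have f: "(A, B, t, P, \<phi>) \<in> W1" and f': "(B, C, t', P', \<phi>') \<in> W1"
    using F F' Fe Fe' by simp_all
  note A = wa_obj(1)[OF f] and B = wa_obj(2)[OF f] and C = wa_obj(2)[OF f']
  note \<phi> = wa_framed[OF f] and \<phi>' = wa_framed[OF f']
  interpret r: torsor_pair X \<Gamma> G P P' \<phi>' by unfold_locales (rule framed_torsor[OF \<phi>] \<phi>')+
  note cm = ctr_map_snd_pt[OF r.P f'] and ca = r.ctr_assoc_pt[OF C]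
  let ?tt = "mk_map X (tot A) (\<lambda>U x. ctr_assoc X \<Gamma> G P P' \<phi>' C U
       (ctr_map_snd X G P B (twist X \<Gamma> G P' \<phi>' C) t' U (t U x)))"
  have e: "wcomp F F' = (A, C, ?tt, r.R, tprod_map X G P \<phi> P' \<phi>')"
    unfolding w_comp1_def Fe Fe' by simp
  have m: "?tt \<in> maps X (tot A) (tw_sheaf X G r.R C)"
  proof (rule mapsI[OF _ _ grp_presheaf[OF tot[OF A]]])
    fix U x assume U: "U \<in> obs X" and x: "x \<in> sec (tot A) U"
    note tx = maps_sec[OF wa_maps[OF f] U x]
    note sx = maps_sec[OF cm(1) U tx]
    show "ctr_assoc X \<Gamma> G P P' \<phi>' C U (ctr_map_snd X G P B (twist X \<Gamma> G P' \<phi>' C) t' U (t U x)) \<in> sec (tw_sheaf X G r.R C) U"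
      by (rule maps_sec[OF ca(1) U sx])
    fix h assume h: "h \<in> into X U"
    show "res (tw_sheaf X G r.R C) h (ctr_assoc X \<Gamma> G P P' \<phi>' C U (ctr_map_snd X G P B (twist X \<Gamma> G P' \<phi>' C) t' U (t U x)))
      = ctr_assoc X \<Gamma> G P P' \<phi>' C (dm X h) (ctr_map_snd X G P B (twist X \<Gamma> G P' \<phi>' C) t' (dm X h) (t (dm X h) (res (tot A) h x)))"
      unfolding maps_res[OF ca(1) h sx] maps_res[OF cm(1) h tx] maps_res[OF wa_maps[OF f] h x] ..
  qed
  show g: "germ (wcomp F F') U (tpair X G (w_tor F) (w_tor F') (w_phi F') U u v) (\<lambda>x. r (s x))"
    if U: "U \<in> obs X" and gs: "germ F U u s" and gr: "germ F' U v r" for U u v r s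
    unfolding germ_def e
  proof (simp only: fst_conv snd_conv w_arr_simps Fe Fe', intro conjI ballI)
    have u: "u \<in> sec P U" and s: "local_arrow A B U s (\<phi> U u)"
      and ts: "\<And>x. x \<in> sec (tot A) U \<Longrightarrow> t U x = tw_pt X G P B U u (s x)"
      using gs unfolding germ_def Fe by simp_all
    have v: "v \<in> sec P' U" and r: "local_arrow B C U r (\<phi>' U v)"
      and tr: "\<And>x. x \<in> sec (tot B) U \<Longrightarrow> t' U x = tw_pt X G P' C U v (r x)"
      using gr unfolding germ_def Fe' by simp_all
    show "r.tp U u v \<in> sec r.R U" by (rule r.tp_sec[OF U u v])
    show "local_arrow A C U (\<lambda>x. r (s x)) (tprod_map X G P \<phi> P' \<phi>' U (r.tp U u v))"
      unfolding r.tprod_map_tp[OF \<phi> U u v]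
      by (rule local_arrow_comp[OF s r A B C U maps_sec[OF framed_maps[OF \<phi>] U u] maps_sec[OF framed_maps[OF \<phi>'] U v]])
    fix x assume x: "x \<in> sec (tot A) U"
    show "?tt U x = tw_pt X G r.R C U (r.tp U u v) (r (s x))"
      unfolding mk_map_apply[OF U x] ts[OF x] cm(2)[OF U u la_sec[OF s x]] tr[OF la_sec[OF s x]]
      by (rule ca(2)[OF U u v la_sec[OF r la_sec[OF s x]]])
  qed
  show "wcomp F F' \<in> W1"
  proof (rule w_arrI[OF _ _ _ _ r.dense_pairs])
    show "fst (wcomp F F') \<in> Z0" "fst (snd (wcomp F F')) \<in> Z0"
      unfolding e using A C by simp_all
    show "framed (w_tor (wcomp F F')) (w_phi (wcomp F F'))"
      unfolding e using r.tprod_map_framed[OF \<phi>] by simp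
    show "w_t (wcomp F F') \<in> maps X (tot (fst (wcomp F F')))
       (tw_sheaf X G (w_tor (wcomp F F')) (fst (snd (wcomp F F'))))"
      unfolding e using m by simp
    fix U assume U: "U \<in> obs X" and "r.pairs_exist U"
    then obtain u v where "u \<in> sec (w_tor F) U" "v \<in> sec (w_tor F') U" using Fe Fe' by auto
    thus "\<exists>u s. germ (wcomp F F') U u s"
      using ex_germ[OF F U] ex_germ[OF F' U] g[OF U] by blast
  qed
qed

lemma w_cell:
  assumes c: "(F, F', m) \<in> W2"
  shows cell_dom: "F \<in> W1" and cell_cod: "F' \<in> W1"
    and cell_src: "fst F' = fst F" and cell_trg: "fst (snd F') = fst (snd F)"
    and cell_iso: "m \<in> torsor_isos X (G1 G) (w_tor F) (w_tor F')"
    and cell_maps: "m \<in> maps X (w_tor F) (w_tor F')"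
    and cell_tact: "\<lbrakk>U \<in> obs X; u \<in> sec (w_tor F) U; a \<in> sec (G1 G) U\<rbrakk>
      \<Longrightarrow> m U (tact (w_tor F) U u a) = tact (w_tor F') U (m U u) a"
    and cell_phi: "\<lbrakk>U \<in> obs X; u \<in> sec (w_tor F) U\<rbrakk> \<Longrightarrow> w_phi F' U (m U u) = w_phi F U u"
    and cell_germ: "\<lbrakk>U \<in> obs X; germ F U u s\<rbrakk> \<Longrightarrow> germ F' U (m U u) s"
proof -
  obtain A B t P \<phi> where Fe: "F = (A, B, t, P, \<phi>)" by (cases F rule: prod_cases5)
  obtain A' B' t' P' \<phi>' where Fe': "F' = (A', B', t', P', \<phi>')" by (cases F' rule: prod_cases5)
  have c': "((A, B, t, P, \<phi>), (A', B', t', P', \<phi>'), m) \<in> W2" using c Fe Fe' by simp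
  show "F \<in> W1" "F' \<in> W1" "fst F' = fst F" "fst (snd F') = fst (snd F)"
    using wc_arr[OF c'] Fe Fe' by simp_all
  show "m \<in> torsor_isos X (G1 G) (w_tor F) (w_tor F')" "m \<in> maps X (w_tor F) (w_tor F')"
    using wc_iso[OF c'] wc_maps[OF c'] Fe Fe' by simp_all
  show "\<lbrakk>U \<in> obs X; u \<in> sec (w_tor F) U; a \<in> sec (G1 G) U\<rbrakk>
      \<Longrightarrow> m U (tact (w_tor F) U u a) = tact (w_tor F') U (m U u) a"
    using wc_tact[OF c'] Fe Fe' by simp
  show "\<lbrakk>U \<in> obs X; u \<in> sec (w_tor F) U\<rbrakk> \<Longrightarrow> w_phi F' U (m U u) = w_phi F U u"
    using wc_phi[OF c'] Fe Fe' by simp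
  show "germ F' U (m U u) s" if U: "U \<in> obs X" and g: "germ F U u s"
  proof -
    have u: "u \<in> sec P U" and s: "local_arrow A B U s (\<phi> U u)"
      and ts: "\<And>x. x \<in> sec (tot A) U \<Longrightarrow> t U x = tw_pt X G P B U u (s x)"
      using g unfolding germ_def Fe by simp_all
    have "t' U x = tw_pt X G P' B U (m U u) (s x)" if x: "x \<in> sec (tot A) U" for x
      by (rule wc_pt[OF c' U u x la_sec[OF s x] ts[OF x]])
    thus ?thesis
      using maps_sec[OF wc_maps[OF c'] U u] s wc_phi[OF c' U u] wc_arr(3,4)[OF c'] unfolding germ_def Fe' by simp
  qed
qed

lemma w_cell_germI:
  assumes F: "F \<in> W1" and F': "F' \<in> W1"
    and e: "fst F' = fst F" "fst (snd F') = fst (snd F)"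
    and m: "m \<in> maps X (w_tor F) (w_tor F')"
    and eqv: "\<And>U u a. \<lbrakk>U \<in> obs X; u \<in> sec (w_tor F) U; a \<in> sec (G1 G) U\<rbrakk>
      \<Longrightarrow> m U (tact (w_tor F) U u a) = tact (w_tor F') U (m U u) a"
    and D: "densely X D"
    and loc: "\<And>U. \<lbrakk>U \<in> obs X; D U\<rbrakk> \<Longrightarrow> \<exists>u s. germ F U u s \<and> germ F' U (m U u) s \<and>
       w_phi F' U (m U u) = w_phi F U u"
  shows "(F, F', m) \<in> W2"
proof -
  obtain A B t P \<phi> where Fe: "F = (A, B, t, P, \<phi>)" by (cases F rule: prod_cases5)
  obtain t' P' \<phi>' where Fe': "F' = (A, B, t', P', \<phi>')" using e Fe by (cases F' rule: prod_cases5) simp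
  have "((A, B, t, P, \<phi>), (A, B, t', P', \<phi>'), m) \<in> W2"
  proof (rule w_cellI[OF _ _ _ _ D])
    fix U assume U: "U \<in> obs X" and DU: "D U"
    obtain u s where g: "germ F U u s" "germ F' U (m U u) s" "w_phi F' U (m U u) = w_phi F U u"
      using loc[OF U DU] by blast
    have u: "u \<in> sec P U" and s: "local_arrow A B U s (\<phi> U u)"
      and ts: "\<And>x. x \<in> sec (tot A) U \<Longrightarrow> t U x = tw_pt X G P B U u (s x)"
      using g(1) unfolding germ_def Fe by simp_all
    have "\<And>x. x \<in> sec (tot A) U \<Longrightarrow> t' U x = tw_pt X G P' B U (m U u) (s x)"
      using g(2) unfolding germ_def Fe' by simp
    thus "\<exists>u\<in>sec P U. \<phi>' U (m U u) = \<phi> U u \<and>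
       (\<forall>x\<in>sec (tot A) U. \<exists>y\<in>sec (tot B) U. t U x = tw_pt X G P B U u y \<and> t' U x = tw_pt X G P' B U (m U u) y)"
      using u ts la_sec[OF s] g(3) Fe Fe' by (intro bexI[of _ u] conjI ballI) auto
  qed (use F F' m eqv Fe Fe' in auto)
  thus ?thesis using Fe Fe' by simp
qed

lemma w_cell_eqI:
  assumes c: "(F, F', m) \<in> W2" "(F, F', m') \<in> W2" and D: "densely X D"
    and eq: "\<And>U u. \<lbrakk>U \<in> obs X; D U; u \<in> sec (w_tor F) U\<rbrakk> \<Longrightarrow> m U u = m' U u"
  shows "m = m'"
  by (rule maps_eq_densely[OF cell_maps[OF c(1)] cell_maps[OF c(2)] tor_sheaf[OF w_torsor[OF cell_cod[OF c(1)]]]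
    tor_presheaf[OF w_torsor[OF cell_dom[OF c(1)]]] D eq])

end

section \<open>The bigroupoid of torsor arrows\<close>

context torsor_pair
begin

text \<open>The left action on a product of torsors is the left action on the first factor:
  \<open>a\<^sup>\<phi>\<^sup>(\<^sup>u\<^sup>)\<^sup>\<phi>\<^sup>'\<^sup>(\<^sup>v\<^sup>)\<close> acting on
  \<open>v\<close> from the right is \<open>a\<^sup>\<phi>\<^sup>(\<^sup>u\<^sup>)\<close> acting on
  \<open>v\<close> from the left, which moves across the pair.\<close>

lemma bit_tp:
  assumes \<phi>: "framed P \<phi>" and U: "U \<in> obs X" and a: "a \<in> sec (G1 G) U" and u: "u \<in> sec P U" and v: "v \<in> sec P' U"
  shows "bitorsor_act G R (tprod_map X G P \<phi> P' \<phi>') U a (tp U u v) = tp U (bitorsor_act G P \<phi> U a u) v"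
proof -
  note g = maps_sec[OF framed_maps[OF \<phi>] U u] and g' = maps_sec[OF m' U v]
  note ag = ract_sec[OF U g a]
  show ?thesis
    unfolding bitorsor_act_def tprod_map_tp[OF \<phi> U u v] ract_comp[OF U a g g'] tp_bal[OF U u ag v]
    by (rule tp_tact[OF U u v ract_sec[OF U g' ag]])
qed

end

context gamma_xmod
begin

abbreviation "cellmap c \<equiv> snd (snd c)"
abbreviation "tpw F F' \<equiv> tpair X G (w_tor F) (w_tor F') (w_phi F')"

lemma cell_eqI:
  assumes c: "c \<in> W2" "d \<in> W2" and e: "fst c = fst d" "fst (snd c) = fst (snd d)"
    and D: "densely X D"
    and eq: "\<And>U u. \<lbrakk>U \<in> obs X; D U; u \<in> sec (w_tor (fst c)) U\<rbrakk> \<Longrightarrow> cellmap c U u = cellmap d U u"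
  shows "c = d"
proof -
  have "(fst d, fst (snd d), cellmap c) \<in> W2" "(fst d, fst (snd d), cellmap d) \<in> W2"
    using c e by (metis prod.collapse)+
  from w_cell_eqI[OF this D] have "cellmap c = cellmap d" using eq e by simp
  thus ?thesis using e by (simp add: prod_eq_iff)
qed

lemma vcomp_simps [simp]:
  "fst (wvcomp c d) = fst c" "fst (snd (wvcomp c d)) = fst (snd d)"
  unfolding w_vcomp_def by (simp_all add: case_prod_beta)

lemma vcomp_map: "\<lbrakk>U \<in> obs X; u \<in> sec (w_tor (fst c)) U\<rbrakk>
    \<Longrightarrow> cellmap (wvcomp c d) U u = cellmap d U (cellmap c U u)"
  unfolding w_vcomp_def by (simp add: case_prod_beta)

lemma one2_simps [simp]: "fst (wone2 F) = F" "fst (snd (wone2 F)) = F"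
  unfolding w_one2_def by simp_all

lemma one2_map: "\<lbrakk>U \<in> obs X; u \<in> sec (w_tor F) U\<rbrakk> \<Longrightarrow> cellmap (wone2 F) U u = u"
  unfolding w_one2_def by simp

lemma mk_map_maps:
  assumes "\<And>U x. \<lbrakk>U \<in> obs X; x \<in> sec F U\<rbrakk> \<Longrightarrow> t U x \<in> sec H U"
    and "\<And>U f x. \<lbrakk>U \<in> obs X; f \<in> into X U; x \<in> sec F U\<rbrakk> \<Longrightarrow> res H f (t U x) = t (dm X f) (res F f x)"
    and "is_torsor X (G1 G) F"
  shows "mk_map X F t \<in> maps X F H"
  by (rule mapsI[OF assms(1,2) tor_presheaf[OF assms(3)]])

lemma one2_cell:
  assumes F: "F \<in> W1"
  shows "wone2 F \<in> W2"
  unfolding w_one2_def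
proof (rule w_cell_germI[OF F F refl refl _ _ tor_dense[OF w_torsor[OF F]]])
  note P = w_torsor[OF F]
  show "mk_map X (w_tor F) (\<lambda>U u. u) \<in> maps X (w_tor F) (w_tor F)"
    by (rule mk_map_maps[OF _ _ P]) simp_all
  show "mk_map X (w_tor F) (\<lambda>U u. u) U (tact (w_tor F) U u a) = tact (w_tor F) U (mk_map X (w_tor F) (\<lambda>U u. u) U u) a"
    if "U \<in> obs X" "u \<in> sec (w_tor F) U" "a \<in> sec (G1 G) U" for U u a
    using that tact_sec[OF P that] by simp
  fix U assume U: "U \<in> obs X" and "sec (w_tor F) U \<noteq> {}"
  then obtain u where u: "u \<in> sec (w_tor F) U" by blast
  obtain s where "germ F U u s" using ex_germ[OF F U u] by blast
  thus "\<exists>u s. germ F U u s \<and> germ F U (mk_map X (w_tor F) (\<lambda>U u. u) U u) s \<and>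
       w_phi F U (mk_map X (w_tor F) (\<lambda>U u. u) U u) = w_phi F U u"
    using U u by (intro exI[of _ u] exI[of _ s]) simp
qed

lemma cell_map_sec: "\<lbrakk>(F, F', m) \<in> W2; U \<in> obs X; u \<in> sec (w_tor F) U\<rbrakk> \<Longrightarrow> m U u \<in> sec (w_tor F') U"
  using maps_sec[OF cell_maps] by blast

lemma vcomp_cell:
  assumes c: "(F, F', m) \<in> W2" and d: "(F', F'', n) \<in> W2"
  shows "wvcomp (F, F', m) (F', F'', n) \<in> W2"
proof -
  let ?n = "mk_map X (w_tor F) (\<lambda>U u. n U (m U u))"
  have "(F, F'', ?n) \<in> W2"
  proof (rule w_cell_germI[OF cell_dom[OF c] cell_cod[OF d] _ _ _ _ tor_dense[OF w_torsor[OF cell_dom[OF c]]]])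
    show "fst F'' = fst F" "fst (snd F'') = fst (snd F)"
      using cell_src[OF c] cell_trg[OF c] cell_src[OF d] cell_trg[OF d] by simp_all
    show "?n \<in> maps X (w_tor F) (w_tor F'')"
    proof (rule mk_map_maps[OF _ _ w_torsor[OF cell_dom[OF c]]])
      fix U u assume U: "U \<in> obs X" and u: "u \<in> sec (w_tor F) U"
      note mu = cell_map_sec[OF c U u]
      show "n U (m U u) \<in> sec (w_tor F'') U" by (rule cell_map_sec[OF d U mu])
      show "res (w_tor F'') f (n U (m U u)) = n (dm X f) (m (dm X f) (res (w_tor F) f u))"
        if f: "f \<in> into X U" for f
        unfolding maps_res[OF cell_maps[OF d] f mu] maps_res[OF cell_maps[OF c] f u] ..
    qed
    fix U assume U: "U \<in> obs X"
    show "?n U (tact (w_tor F) U u a) = tact (w_tor F'') U (?n U u) a"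
      if u: "u \<in> sec (w_tor F) U" and a: "a \<in> sec (G1 G) U" for u a
      unfolding mk_map_apply[OF U u] mk_map_apply[OF U tact_sec[OF w_torsor[OF cell_dom[OF c]] U u a]]
        cell_tact[OF c U u a] cell_tact[OF d U cell_map_sec[OF c U u] a] ..
    assume "sec (w_tor F) U \<noteq> {}"
    then obtain u where u: "u \<in> sec (w_tor F) U" by blast
    obtain s where s: "germ F U u s" using ex_germ[OF cell_dom[OF c] U u] by blast
    have "germ F'' U (?n U u) s" unfolding mk_map_apply[OF U u] by (rule cell_germ[OF d U cell_germ[OF c U s]])
    thus "\<exists>u s. germ F U u s \<and> germ F'' U (?n U u) s \<and> w_phi F'' U (?n U u) = w_phi F U u"
      using s cell_phi[OF d U cell_map_sec[OF c U u]] cell_phi[OF c U u] mk_map_apply[OF U u, of "\<lambda>U u. n U (m U u)"]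
      by (intro exI[of _ u] exI[of _ s]) simp
  qed
  thus ?thesis unfolding w_vcomp_def by simp
qed

text \<open>The inverse of the map of torsors preserves germs and the maps to \<open>G\<^sub>0\<close> because
  every section of the target torsor is the image of one of the source.\<close>

lemma cell_inverse:
  assumes c: "(F, F', m) \<in> W2"
  shows "\<exists>n. (F', F, n) \<in> W2 \<and> wvcomp (F, F', m) (F', F, n) = wone2 F \<and>
     wvcomp (F', F, n) (F, F', m) = wone2 F'"
proof -
  note P = w_torsor[OF cell_dom[OF c]] and P' = w_torsor[OF cell_cod[OF c]]
  have bij: "bij_betw (m U) (sec (w_tor F) U) (sec (w_tor F') U)" if "U \<in> obs X" for U
    using cell_iso[OF c] that unfolding torsor_isos_def by blast
  let ?i = "\<lambda>U. inv_into (sec (w_tor F) U) (m U)"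
  let ?n = "mk_map X (w_tor F') ?i"
  have i: "?i U v \<in> sec (w_tor F) U" "m U (?i U v) = v" if U: "U \<in> obs X" and v: "v \<in> sec (w_tor F') U" for U v
  proof -
    have "v \<in> m U ` sec (w_tor F) U" using bij[OF U] v unfolding bij_betw_def by simp
    thus "?i U v \<in> sec (w_tor F) U" "m U (?i U v) = v" by (rule inv_into_into, rule f_inv_into_f)
  qed
  have i': "?i U (m U u) = u" if U: "U \<in> obs X" and u: "u \<in> sec (w_tor F) U" for U u
    by (rule inv_into_f_f[OF bij_betw_imp_inj_on[OF bij[OF U]] u])
  have d: "(F', F, ?n) \<in> W2"
  proof (rule w_cell_germI[OF cell_cod[OF c] cell_dom[OF c] _ _ _ _ tor_dense[OF P]])
    show "fst F = fst F'" "fst (snd F) = fst (snd F')"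
      using cell_src[OF c] cell_trg[OF c] by simp_all
    show "?n \<in> maps X (w_tor F') (w_tor F)"
    proof (rule mk_map_maps[OF i(1) _ P'])
      fix U f v assume U: "U \<in> obs X" and f: "f \<in> into X U" and v: "v \<in> sec (w_tor F') U"
      have "m (dm X f) (res (w_tor F) f (?i U v)) = res (w_tor F') f v"
        using maps_res[OF cell_maps[OF c] f i(1)[OF U v]] i(2)[OF U v] by simp
      thus "res (w_tor F) f (?i U v) = ?i (dm X f) (res (w_tor F') f v)"
        using i'[OF dm_into[OF f] res_sec[OF tor_presheaf[OF P] f i(1)[OF U v]]] by simp
    qed
    fix U assume U: "U \<in> obs X"
    show "?n U (tact (w_tor F') U v a) = tact (w_tor F) U (?n U v) a"
      if v: "v \<in> sec (w_tor F') U" and a: "a \<in> sec (G1 G) U" for v a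
      unfolding mk_map_apply[OF U v] mk_map_apply[OF U tact_sec[OF P' U v a]]
      using i'[OF U tact_sec[OF P U i(1)[OF U v] a]] cell_tact[OF c U i(1)[OF U v] a] i(2)[OF U v] by simp
    assume "sec (w_tor F) U \<noteq> {}"
    then obtain u where u: "u \<in> sec (w_tor F) U" by blast
    obtain s where s: "germ F U u s" using ex_germ[OF cell_dom[OF c] U u] by blast
    note mu = cell_map_sec[OF c U u]
    have "?n U (m U u) = u" using mk_map_apply[OF U mu, of ?i] i'[OF U u] by simp
    thus "\<exists>v s. germ F' U v s \<and> germ F U (?n U v) s \<and> w_phi F U (?n U v) = w_phi F' U v"
      using s cell_germ[OF c U s] cell_phi[OF c U u] by (intro exI[of _ "m U u"] exI[of _ s]) simp
  qed
  have "wvcomp (F, F', m) (F', F, ?n) = wone2 F"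
    by (rule cell_eqI[OF vcomp_cell[OF c d] one2_cell[OF cell_dom[OF c]] _ _ densely_True])
      (simp_all add: vcomp_map one2_map i' cell_map_sec[OF c])
  moreover have "wvcomp (F', F, ?n) (F, F', m) = wone2 F'"
    by (rule cell_eqI[OF vcomp_cell[OF d c] one2_cell[OF cell_cod[OF c]] _ _ densely_True])
      (simp_all add: vcomp_map one2_map i)
  ultimately show ?thesis using d by blast
qed

lemma hcomp_simps [simp]:
  "fst (whcomp c d) = wcomp (fst c) (fst d)" "fst (snd (whcomp c d)) = wcomp (fst (snd c)) (fst (snd d))"
  unfolding w_hcomp_def by (simp_all add: case_prod_beta)

text \<open>The left action is built from the right action and \<open>\<phi>\<close>, both of which a 2-arrow
  preserves; therefore maps of pairs descend in the first factor.\<close>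

lemma cell_bit:
  assumes c: "(F, F', m) \<in> W2" and U: "U \<in> obs X" and a: "a \<in> sec (G1 G) U" and v: "v \<in> sec (w_tor F) U"
  shows "m U (bitorsor_act G (w_tor F) (w_phi F) U a v) = bitorsor_act G (w_tor F') (w_phi F') U a (m U v)"
  unfolding bitorsor_act_def cell_phi[OF c U v]
  by (rule cell_tact[OF c U v ract_sec[OF U maps_sec[OF w_phi_maps[OF cell_dom[OF c]] U v] a]])

lemma hcomp:
  assumes c: "(F, H, m) \<in> W2" and d: "(F', H', n) \<in> W2" and e: "fst (snd F) = fst F'"
  shows hcomp_map: "\<lbrakk>U \<in> obs X; u \<in> sec (w_tor F) U; v \<in> sec (w_tor F') U\<rbrakk>
      \<Longrightarrow> cellmap (whcomp (F, H, m) (F', H', n)) U (tpw F F' U u v) = tpw H H' U (m U u) (n U v)"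
    and hcomp_cell: "whcomp (F, H, m) (F', H', n) \<in> W2"
proof -
  note F = cell_dom[OF c] and H = cell_cod[OF c] and F' = cell_dom[OF d] and H' = cell_cod[OF d]
  have e': "fst (snd H) = fst H'" using e cell_trg[OF c] cell_src[OF d] by simp
  interpret p: torsor_pair X \<Gamma> G "w_tor F" "w_tor F'" "w_phi F'" by (rule torsor_pairI[OF F F'])
  interpret q: torsor_pair X \<Gamma> G "w_tor H" "w_tor H'" "w_phi H'" by (rule torsor_pairI[OF H H'])
  note ms = cell_map_sec[OF c] and ns = cell_map_sec[OF d]
  let ?k = "\<lambda>U u v. q.tp U (m U u) (n U v)"
  have s: "?k U u v \<in> sec q.R U" if "U \<in> obs X" "u \<in> sec (w_tor F) U" "v \<in> sec (w_tor F') U" for U u v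
    by (rule q.tp_sec[OF that(1) ms[OF that(1,2)] ns[OF that(1,3)]])
  have r: "res q.R h (?k U u v) = ?k (dm X h) (res (w_tor F) h u) (res (w_tor F') h v)"
    if "U \<in> obs X" "h \<in> into X U" "u \<in> sec (w_tor F) U" "v \<in> sec (w_tor F') U" for U h u v
    unfolding q.tp_res[OF that(2) ms[OF that(1,3)] ns[OF that(1,4)]]
      maps_res[OF cell_maps[OF c] that(2,3)] maps_res[OF cell_maps[OF d] that(2,4)] ..
  have b: "?k U (tact (w_tor F) U u a) v = ?k U u (bitorsor_act G (w_tor F') (w_phi F') U a v)"
    if "U \<in> obs X" "u \<in> sec (w_tor F) U" "v \<in> sec (w_tor F') U" "a \<in> sec (G1 G) U" for U u v a
    unfolding cell_tact[OF c that(1,2,4)] q.tp_bal[OF that(1) ms[OF that(1,2)] that(4) ns[OF that(1,3)]]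
      cell_bit[OF d that(1,4,3)] ..
  note D = p.tdescend_map[OF q.R_sheaf, of ?k, OF s r b]
  let ?hm = "mk_map X p.R (\<lambda>U. tdescend X G (w_tor F) (w_tor F') (w_phi F') q.R U (\<lambda>f u x. ?k (dm X f) u x))"
  have w: "whcomp (F, H, m) (F', H', n) = (wcomp F F', wcomp H H', ?hm)"
    unfolding w_hcomp_def by simp
  show tp: "cellmap (whcomp (F, H, m) (F', H', n)) U (p.tp U u v) = q.tp U (m U u) (n U v)"
    if "U \<in> obs X" "u \<in> sec (w_tor F) U" "v \<in> sec (w_tor F') U" for U u v
    unfolding w snd_conv by (rule D(2); (assumption | rule that))
  have hm: "?hm \<in> maps X p.R q.R" by (rule D(1))
  show "whcomp (F, H, m) (F', H', n) \<in> W2"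
    unfolding w
  proof (rule w_cell_germI[OF w_comp_arr[OF F F' e] w_comp_arr[OF H H' e'] _ _ _ _ p.dense_pairs])
    show "fst (wcomp H H') = fst (wcomp F F')" "fst (snd (wcomp H H')) = fst (snd (wcomp F F'))"
      using cell_src[OF c] cell_trg[OF d] by simp_all
    show "?hm \<in> maps X (w_tor (wcomp F F')) (w_tor (wcomp H H'))" using hm by simp
    have tp': "?hm U (p.tp U u v) = q.tp U (m U u) (n U v)"
      if "U \<in> obs X" "u \<in> sec (w_tor F) U" "v \<in> sec (w_tor F') U" for U u v
      using tp[OF that] unfolding w by simp
    have "?hm U (tact p.R U y a) = tact q.R U (?hm U y) a"
      if "U \<in> obs X" "y \<in> sec p.R U" "a \<in> sec (G1 G) U" for U y a
    proof (rule p.tact_map_on_tp[OF hm q.R_torsor densely_True _ that])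
      fix U u v a assume U: "U \<in> obs X" and u: "u \<in> sec (w_tor F) U" and v: "v \<in> sec (w_tor F') U" and a: "a \<in> sec (G1 G) U"
      show "?hm U (p.tp U u (tact (w_tor F') U v a)) = tact q.R U (?hm U (p.tp U u v)) a"
        unfolding tp'[OF U u tact_sec[OF p.P' U v a]] tp'[OF U u v] cell_tact[OF d U v a]
        by (rule q.tp_tact[OF U ms[OF U u] ns[OF U v] a, symmetric])
    qed
    thus "?hm U (tact (w_tor (wcomp F F')) U y a) = tact (w_tor (wcomp H H')) U (?hm U y) a"
      if "U \<in> obs X" "y \<in> sec (w_tor (wcomp F F')) U" "a \<in> sec (G1 G) U" for U y a using that by simp
    fix U assume U: "U \<in> obs X" and "p.pairs_exist U"
    then obtain u v where u: "u \<in> sec (w_tor F) U" and v: "v \<in> sec (w_tor F') U" by blast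
    obtain s where s: "germ F U u s" using ex_germ[OF F U u] by blast
    obtain t where t: "germ F' U v t" using ex_germ[OF F' U v] by blast
    show "\<exists>y s. germ (wcomp F F') U y s \<and> germ (wcomp H H') U (?hm U y) s \<and>
       w_phi (wcomp H H') U (?hm U y) = w_phi (wcomp F F') U y"
    proof (intro exI conjI)
      show "germ (wcomp F F') U (p.tp U u v) (\<lambda>x. t (s x))" by (rule w_comp_germ[OF F F' e U s t])
      show "germ (wcomp H H') U (?hm U (p.tp U u v)) (\<lambda>x. t (s x))"
        unfolding tp'[OF U u v] by (rule w_comp_germ[OF H H' e' U cell_germ[OF c U s] cell_germ[OF d U t]])
      show "w_phi (wcomp H H') U (?hm U (p.tp U u v)) = w_phi (wcomp F F') U (p.tp U u v)"
        unfolding tp'[OF U u v] w_comp1_simps q.tprod_map_tp[OF w_framed[OF H] U ms[OF U u] ns[OF U v]]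
          p.tprod_map_tp[OF w_framed[OF F] U u v] cell_phi[OF c U u] cell_phi[OF d U v] ..
    qed
  qed
qed

lemma one1_simps [simp]: "fst (wone A) = A" "fst (snd (wone A)) = A"
  "w_tor (wone A) = triv_torsor (G1 G)" "w_phi (wone A) = bd G"
  unfolding w_one1_def by simp_all

lemma triv_simps [simp]: "sec (triv_torsor (G1 G)) = sec (G1 G)" "res (triv_torsor (G1 G)) = res (G1 G)"
  "tact (triv_torsor (G1 G)) U a c = a \<otimes>\<^bsub>grp (G1 G) U\<^esub> c"
  unfolding triv_torsor_def grp_def by simp_all

lemma triv_torsor: "is_torsor X (G1 G) (triv_torsor (G1 G))"
  unfolding is_torsor_def triv_simps
proof (intro conjI ballI)
  show "is_sheaf X (triv_torsor (G1 G))"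
    using grp_sheaf[OF G1] is_sheaf_cong[of "triv_torsor (G1 G)" "G1 G"] by simp
  fix f u a assume f: "f \<in> ars X" and u: "u \<in> sec (G1 G) (cd X f)" and a: "a \<in> sec (G1 G) (cd X f)"
  show "res (G1 G) f (u \<otimes>\<^bsub>grp (G1 G) (cd X f)\<^esub> a) = res (G1 G) f u \<otimes>\<^bsub>grp (G1 G) (dm X f)\<^esub> res (G1 G) f a"
    by (rule res_mult[OF G1 intoI[OF f] u a])
next
  fix U assume U: "U \<in> obs X"
  interpret A: section_group "G1 G" U by (rule section_groupI[OF G1 U])
  have "{f \<in> into X U. sec (G1 G) (dm X f) \<noteq> {}} = into X U" using one_sec[OF G1] dm_into by blast
  thus "{f \<in> into X U. sec (G1 G) (dm X f) \<noteq> {}} \<in> cov X U" using cov_max[OF U] by simp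
  fix u assume u: "u \<in> sec (G1 G) U"
  show "u \<otimes>\<^bsub>grp (G1 G) U\<^esub> \<one>\<^bsub>grp (G1 G) U\<^esub> = u" using u by simp
  fix a assume a: "a \<in> sec (G1 G) U"
  show "u \<otimes>\<^bsub>grp (G1 G) U\<^esub> a \<in> sec (G1 G) U" using u a by simp
  show "u \<otimes>\<^bsub>grp (G1 G) U\<^esub> (a \<otimes>\<^bsub>grp (G1 G) U\<^esub> c) = u \<otimes>\<^bsub>grp (G1 G) U\<^esub> a \<otimes>\<^bsub>grp (G1 G) U\<^esub> c"
    if "c \<in> sec (G1 G) U" for c using u a that by (simp add: A.m_assoc)
  show "\<exists>!c. c \<in> sec (G1 G) U \<and> u \<otimes>\<^bsub>grp (G1 G) U\<^esub> c = a"
    by (rule ex1I[of _ "inv\<^bsub>grp (G1 G) U\<^esub> u \<otimes>\<^bsub>grp (G1 G) U\<^esub> a"]) (use u a in auto)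
qed

lemma triv_framed: "framed (triv_torsor (G1 G)) (bd G)"
  unfolding framed_def triv_simps
proof (intro conjI ballI triv_torsor)
  show "bd G \<in> maps X (triv_torsor (G1 G)) (G0 G)"
    using bd_maps maps_cong[of "triv_torsor (G1 G)" "G1 G" "G0 G" "G0 G"] by simp
qed (rule bd_mult)

text \<open>By the Peiffer identity, \<open>c a\<^sup>\<partial>\<^sup>c = a c\<close>.\<close>

lemma triv_bit: "\<lbrakk>U \<in> obs X; a \<in> sec (G1 G) U; c \<in> sec (G1 G) U\<rbrakk>
    \<Longrightarrow> bitorsor_act G (triv_torsor (G1 G)) (bd G) U a c = a \<otimes>\<^bsub>grp (G1 G) U\<^esub> c"
proof -
  assume U: "U \<in> obs X" and a: "a \<in> sec (G1 G) U" and c: "c \<in> sec (G1 G) U"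
  interpret A: section_group "G1 G" U by (rule section_groupI[OF G1 U])
  show ?thesis unfolding bitorsor_act_def triv_simps peiffer[OF U a c] using a c by (simp add: A.m_assoc)
qed

lemma one1:
  assumes A: "A \<in> Z0"
  shows one1_germ: "U \<in> obs X \<Longrightarrow> germ (wone A) U \<one>\<^bsub>grp (G1 G) U\<^esub> (\<lambda>x. x)"
    and one1_arr: "wone A \<in> W1"
proof -
  let ?I = "triv_torsor (G1 G)"
  interpret t: twisted X \<Gamma> G ?I A by (rule twistedI[OF triv_framed A])
  have t: "w_t (wone A) = mk_map X (tot A) (\<lambda>U x. t.pt U \<one>\<^bsub>grp (G1 G) U\<^esub> x)"
    unfolding w_one1_def by simp
  have o: "\<one>\<^bsub>grp (G1 G) U\<^esub> \<in> sec ?I U" if "U \<in> obs X" for U using one_sec[OF G1 that] by simp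
  show g: "germ (wone A) U \<one>\<^bsub>grp (G1 G) U\<^esub> (\<lambda>x. x)" if U: "U \<in> obs X" for U
    unfolding germ_def t using o[OF U] local_arrow_id[OF A U] bd_one[OF U] U by simp
  have m: "w_t (wone A) \<in> maps X (tot A) t.T"
    unfolding t
  proof (rule mapsI[OF _ _ grp_presheaf[OF tot[OF A]]])
    fix U x assume U: "U \<in> obs X" and x: "x \<in> sec (tot A) U"
    show "t.pt U \<one>\<^bsub>grp (G1 G) U\<^esub> x \<in> sec t.T U" by (rule t.C.pt_sec[OF U o[OF U] x])
    show "res t.T f (t.pt U \<one>\<^bsub>grp (G1 G) U\<^esub> x) = t.pt (dm X f) \<one>\<^bsub>grp (G1 G) (dm X f)\<^esub> (res (tot A) f x)"
      if f: "f \<in> into X U" for f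
      using t.C.pt_res[OF f o[OF U] x] res_one[OF G1 f] by simp
  qed
  show "wone A \<in> W1"
    by (rule w_arrI[OF _ _ _ _ densely_True]) (use A triv_framed m g in auto)
qed

text \<open>The left action is balanced in \<open>(a, v)\<close> because it is an action; at \<open>a =
  1\<close> it preserves the germ of \<open>F\<close>.\<close>

lemma lunit:
  assumes F: "F \<in> W1"
  shows lunit_dom: "fst (wlunit F) = wcomp (wone (fst F)) F" "fst (snd (wlunit F)) = F"
    and lunit_map: "\<lbrakk>U \<in> obs X; a \<in> sec (G1 G) U; v \<in> sec (w_tor F) U\<rbrakk>
      \<Longrightarrow> cellmap (wlunit F) U (tpw (wone (fst F)) F U a v) = bitorsor_act G (w_tor F) (w_phi F) U a v"
    and lunit_cell: "wlunit F \<in> W2"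
proof -
  let ?I = "triv_torsor (G1 G)" and ?P = "w_tor F" and ?\<phi> = "w_phi F" and ?O = "wone (fst F)"
  note O = one1_arr[OF w_src[OF F]]
  interpret p: torsor_pair X \<Gamma> G ?I ?P ?\<phi> by (unfold_locales) (rule triv_torsor w_framed[OF F])+
  have s: "p.b U a v \<in> sec ?P U" if "U \<in> obs X" "a \<in> sec ?I U" "v \<in> sec ?P U" for U a v
    using p.bit_sec that by simp
  have r: "res ?P h (p.b U a v) = p.b (dm X h) (res ?I h a) (res ?P h v)"
    if "U \<in> obs X" "h \<in> into X U" "a \<in> sec ?I U" "v \<in> sec ?P U" for U h a v
    using p.C.act_res that by simp
  have bal: "p.b U (tact ?I U a c) v = p.b U a (p.b U c v)"
    if "U \<in> obs X" "a \<in> sec ?I U" "v \<in> sec ?P U" "c \<in> sec (G1 G) U" for U a v c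
    using p.bit_mult[OF that(1,4,3), of a] that(2) by simp
  note D = p.tdescend_map[OF tor_sheaf[OF p.P'], of "\<lambda>U a v. p.b U a v", OF s r bal]
  let ?m = "mk_map X p.R (\<lambda>U. tdescend X G ?I ?P ?\<phi> ?P U (\<lambda>k a v. p.b (dm X k) a v))"
  have w: "wlunit F = (wcomp ?O F, F, ?m)"
    unfolding w_lunit_def by (simp add: Let_def)
  show "fst (wlunit F) = wcomp ?O F" "fst (snd (wlunit F)) = F" unfolding w by simp_all
  have mm: "?m \<in> maps X p.R ?P" by (rule D(1))
  have tp: "?m U (p.tp U a v) = p.b U a v" if "U \<in> obs X" "a \<in> sec (G1 G) U" "v \<in> sec ?P U" for U a v
    by (rule D(2); (assumption | simp add: that))
  show "cellmap (wlunit F) U (tpw ?O F U a v) = p.b U a v"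
    if "U \<in> obs X" "a \<in> sec (G1 G) U" "v \<in> sec ?P U" for U a v
    using tp[OF that] unfolding w by simp
  show "wlunit F \<in> W2"
    unfolding w
  proof (rule w_cell_germI[OF w_comp_arr[OF O F] F _ _ _ _ tor_dense[OF p.P']])
    have "?m U (tact p.R U y a) = tact ?P U (?m U y) a"
      if "U \<in> obs X" "y \<in> sec p.R U" "a \<in> sec (G1 G) U" for U y a
    proof (rule p.tact_map_on_tp[OF mm p.P' densely_True _ that])
      fix U u v a assume U: "U \<in> obs X" and u: "u \<in> sec ?I U" and v: "v \<in> sec ?P U" and a: "a \<in> sec (G1 G) U"
      have u': "u \<in> sec (G1 G) U" using u by simp
      show "?m U (p.tp U u (tact ?P U v a)) = tact ?P U (?m U (p.tp U u v)) a"
        unfolding tp[OF U u' tact_sec[OF p.P' U v a]] tp[OF U u' v] by (rule p.bit_tact[OF U u' v a])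
    qed
    thus "?m U (tact (w_tor (wcomp ?O F)) U y a) = tact ?P U (?m U y) a"
      if "U \<in> obs X" "y \<in> sec (w_tor (wcomp ?O F)) U" "a \<in> sec (G1 G) U" for U y a using that by simp
    fix U assume U: "U \<in> obs X" and "sec ?P U \<noteq> {}"
    then obtain v where v: "v \<in> sec ?P U" by blast
    obtain s where s: "germ F U v s" using ex_germ[OF F U v] by blast
    note o = one_sec[OF G1 U]
    have o': "\<one>\<^bsub>grp (G1 G) U\<^esub> \<in> sec ?I U" using o by simp
    have e: "?m U (p.tp U \<one>\<^bsub>grp (G1 G) U\<^esub> v) = v" unfolding tp[OF U o v] by (rule p.C.act_one[OF U v])
    interpret K: section_group "G0 G" U by (rule section_groupI[OF G0 U])
    show "\<exists>u s. germ (wcomp ?O F) U u s \<and> germ F U (?m U u) s \<and> w_phi F U (?m U u) = w_phi (wcomp ?O F) U u"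
    proof (intro exI conjI)
      show "germ (wcomp ?O F) U (p.tp U \<one>\<^bsub>grp (G1 G) U\<^esub> v) s"
        using w_comp_germ[OF O F _ U one1_germ[OF w_src[OF F] U] s] by simp
      show "germ F U (?m U (p.tp U \<one>\<^bsub>grp (G1 G) U\<^esub> v)) s" unfolding e by (rule s)
      show "w_phi F U (?m U (p.tp U \<one>\<^bsub>grp (G1 G) U\<^esub> v)) = w_phi (wcomp ?O F) U (p.tp U \<one>\<^bsub>grp (G1 G) U\<^esub> v)"
        unfolding e using p.tprod_map_tp[OF triv_framed U o' v] bd_one[OF U] maps_sec[OF w_phi_maps[OF F] U v] by simp
    qed
  qed (use mm in simp_all)
qed

text \<open>The right action is balanced in \<open>(u, c)\<close> because the left action on the trivial torsor
  is left multiplication (\<open>triv_bit\<close>).\<close>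

lemma runit:
  assumes F: "F \<in> W1"
  shows runit_dom: "fst (wrunit F) = wcomp F (wone (fst (snd F)))" "fst (snd (wrunit F)) = F"
    and runit_map: "\<lbrakk>U \<in> obs X; u \<in> sec (w_tor F) U; c \<in> sec (G1 G) U\<rbrakk>
      \<Longrightarrow> cellmap (wrunit F) U (tpw F (wone (fst (snd F))) U u c) = tact (w_tor F) U u c"
    and runit_cell: "wrunit F \<in> W2"
proof -
  let ?I = "triv_torsor (G1 G)" and ?P = "w_tor F" and ?\<phi> = "w_phi F" and ?O = "wone (fst (snd F))"
  note O = one1_arr[OF w_trg[OF F]] and P = w_torsor[OF F]
  interpret p: torsor_pair X \<Gamma> G ?P ?I "bd G" by (unfold_locales) (rule P triv_framed)+
  let ?m = "mk_map X p.R (\<lambda>U. tdescend X G ?P ?I (bd G) ?P U (\<lambda>k u c. tact ?P (dm X k) u c))"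
  have s: "tact ?P U u c \<in> sec ?P U" if "U \<in> obs X" "u \<in> sec ?P U" "c \<in> sec ?I U" for U u c
    using tact_sec[OF P] that by simp
  have r: "res ?P h (tact ?P U u c) = tact ?P (dm X h) (res ?P h u) (res ?I h c)"
    if "U \<in> obs X" "h \<in> into X U" "u \<in> sec ?P U" "c \<in> sec ?I U" for U h u c
    using tact_res[OF P] that by simp
  have bal: "tact ?P U (tact ?P U u a) c = tact ?P U u (p.b U a c)"
    if "U \<in> obs X" "u \<in> sec ?P U" "c \<in> sec ?I U" "a \<in> sec (G1 G) U" for U u c a
    using triv_bit[OF that(1,4), of c] tact_mult[OF P that(1,2,4), of c] that(3) by simp
  note D = p.tdescend_map[OF tor_sheaf[OF P], of "\<lambda>U u c. tact ?P U u c", OF s r bal]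
  have w: "wrunit F = (wcomp F ?O, F, ?m)"
    unfolding w_runit_def by (simp add: Let_def)
  show "fst (wrunit F) = wcomp F ?O" "fst (snd (wrunit F)) = F" unfolding w by simp_all
  have mm: "?m \<in> maps X p.R ?P" by (rule D(1))
  have tp: "?m U (p.tp U u c) = tact ?P U u c" if "U \<in> obs X" "u \<in> sec ?P U" "c \<in> sec (G1 G) U" for U u c
    by (rule D(2); (assumption | simp add: that))
  show "cellmap (wrunit F) U (tpw F ?O U u c) = tact ?P U u c"
    if "U \<in> obs X" "u \<in> sec ?P U" "c \<in> sec (G1 G) U" for U u c
    using tp[OF that] unfolding w by simp
  show "wrunit F \<in> W2"
    unfolding w
  proof (rule w_cell_germI[OF w_comp_arr[OF F O] F _ _ _ _ tor_dense[OF P]])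
    have "?m U (tact p.R U y a) = tact ?P U (?m U y) a"
      if "U \<in> obs X" "y \<in> sec p.R U" "a \<in> sec (G1 G) U" for U y a
    proof (rule p.tact_map_on_tp[OF mm P densely_True _ that])
      fix U u v a assume U: "U \<in> obs X" and u: "u \<in> sec ?P U" and v: "v \<in> sec ?I U" and a: "a \<in> sec (G1 G) U"
      have v': "v \<in> sec (G1 G) U" using v by simp
      show "?m U (p.tp U u (tact ?I U v a)) = tact ?P U (?m U (p.tp U u v)) a"
        unfolding triv_simps tp[OF U u mult_sec[OF G1 U v' a]] tp[OF U u v'] by (rule tact_mult[OF P U u v' a])
    qed
    thus "?m U (tact (w_tor (wcomp F ?O)) U y a) = tact ?P U (?m U y) a"
      if "U \<in> obs X" "y \<in> sec (w_tor (wcomp F ?O)) U" "a \<in> sec (G1 G) U" for U y a using that by simp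
    fix U assume U: "U \<in> obs X" and "sec ?P U \<noteq> {}"
    then obtain u where u: "u \<in> sec ?P U" by blast
    obtain s where s: "germ F U u s" using ex_germ[OF F U u] by blast
    note o = one_sec[OF G1 U]
    have o': "\<one>\<^bsub>grp (G1 G) U\<^esub> \<in> sec ?I U" using o by simp
    have e: "?m U (p.tp U u \<one>\<^bsub>grp (G1 G) U\<^esub>) = u" unfolding tp[OF U u o] by (rule tact_one[OF P U u])
    interpret K: section_group "G0 G" U by (rule section_groupI[OF G0 U])
    show "\<exists>u s. germ (wcomp F ?O) U u s \<and> germ F U (?m U u) s \<and> w_phi F U (?m U u) = w_phi (wcomp F ?O) U u"
    proof (intro exI conjI)
      show "germ (wcomp F ?O) U (p.tp U u \<one>\<^bsub>grp (G1 G) U\<^esub>) s"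
        using w_comp_germ[OF F O _ U s one1_germ[OF w_trg[OF F] U]] by simp
      show "germ F U (?m U (p.tp U u \<one>\<^bsub>grp (G1 G) U\<^esub>)) s" unfolding e by (rule s)
      show "w_phi F U (?m U (p.tp U u \<one>\<^bsub>grp (G1 G) U\<^esub>)) = w_phi (wcomp F ?O) U (p.tp U u \<one>\<^bsub>grp (G1 G) U\<^esub>)"
        unfolding e using p.tprod_map_tp[OF w_framed[OF F] U u o'] bd_one[OF U] maps_sec[OF w_phi_maps[OF F] U u] by simp
    qed
  qed (use mm in simp_all)
qed

text \<open>The map \<open>((u, v), w) \<mapsto> (u, (v, w))\<close> is defined on pairs \<open>(u, v)\<close>
  for a fixed \<open>w\<close> first, and then as a function of \<open>w\<close>. The first step is balanced by
  \<open>bit_tp\<close>, the second because the group acts on \<open>(u, v)\<close> through \<open>v\<close>.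
  Both sides have the composite of the three germs as their germ.\<close>

lemma assoc:
  assumes F: "F \<in> W1" and H: "H \<in> W1" and K: "K \<in> W1"
    and e: "fst (snd F) = fst H" "fst (snd H) = fst K"
  shows assoc_dom: "fst (wassoc F H K) = wcomp (wcomp F H) K"
      "fst (snd (wassoc F H K)) = wcomp F (wcomp H K)"
    and assoc_map: "\<lbrakk>U \<in> obs X; u \<in> sec (w_tor F) U; v \<in> sec (w_tor H) U; w \<in> sec (w_tor K) U\<rbrakk>
      \<Longrightarrow> cellmap (wassoc F H K) U (tpw (wcomp F H) K U (tpw F H U u v) w)
        = tpw F (wcomp H K) U u (tpw H K U v w)"
    and assoc_cell: "wassoc F H K \<in> W2"
proof -
  note FH = w_comp_arr[OF F H e(1)] and HK = w_comp_arr[OF H K e(2)]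
  have e': "fst (snd (wcomp F H)) = fst K" "fst (snd F) = fst (wcomp H K)" using e by simp_all
  interpret fh: torsor_pair X \<Gamma> G "w_tor F" "w_tor H" "w_phi H" by (rule torsor_pairI[OF F H])
  interpret hk: torsor_pair X \<Gamma> G "w_tor H" "w_tor K" "w_phi K" by (rule torsor_pairI[OF H K])
  interpret p: torsor_pair X \<Gamma> G fh.R "w_tor K" "w_phi K" using torsor_pairI[OF FH K] by simp
  interpret q: torsor_pair X \<Gamma> G "w_tor F" hk.R "tprod_map X G (w_tor H) (w_phi H) (w_tor K) (w_phi K)"
    using torsor_pairI[OF F HK] by simp
  note KP = tor_presheaf[OF hk.P'] and qR = q.R_sheaf
  define j where "j w = (\<lambda>l u v. q.tp (dm X l) u (hk.tp (dm X l) v (res (w_tor K) l w)))" for w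
  define k where "k U y w = tdescend X G (w_tor F) (w_tor H) (w_phi H) q.R U (j w) y" for U y w
  have j: "fh.C.balanced q.R U (j w)" if w: "w \<in> sec (w_tor K) U" for U w
  proof (rule fh.C.balancedI)
    fix f u v assume f: "f \<in> into X U" and u: "u \<in> sec (w_tor F) (dm X f)" and v: "v \<in> sec (w_tor H) (dm X f)"
    note V = dm_into[OF f] and rw = res_sec[OF KP f w]
    note vw = hk.tp_sec[OF V v rw]
    show "j w f u v \<in> sec q.R (dm X f)" unfolding j_def by (rule q.tp_sec[OF V u vw])
    show "res q.R h (j w f u v) = j w (cmp X f h) (res (w_tor F) h u) (res (w_tor H) h v)" if h: "h \<in> into X (dm X f)" for h
      unfolding j_def q.tp_res[OF h u vw] hk.tp_res[OF h v rw] dm_cmp_into[OF f h] res_cmp[OF KP f w h] ..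
    show "j w f (tact (w_tor F) (dm X f) u a) v = j w f u (fh.b (dm X f) a v)" if a: "a \<in> sec (G1 G) (dm X f)" for a
      unfolding j_def q.tp_bal[OF V u a vw] hk.bit_tp[OF w_framed[OF H] V a v rw] ..
  qed
  have k_tp: "k U (fh.tp U u v) w = q.tp U u (hk.tp U v w)"
    if U: "U \<in> obs X" and u: "u \<in> sec (w_tor F) U" and v: "v \<in> sec (w_tor H) U" and w: "w \<in> sec (w_tor K) U" for U u v w
    unfolding k_def fh.tdescend_tp[OF qR j[OF w] U u v] unfolding j_def dm_idn[OF U] res_idn[OF KP U w] ..
  have s: "k U y w \<in> sec q.R U" if "U \<in> obs X" "y \<in> sec fh.R U" "w \<in> sec (w_tor K) U" for U y w
    unfolding k_def by (rule fh.tdescend_sec[OF qR j[OF that(3)] that(1,2)])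
  have r: "res q.R h (k U y w) = k (dm X h) (res fh.R h y) (res (w_tor K) h w)"
    if U: "U \<in> obs X" and h: "h \<in> into X U" and y: "y \<in> sec fh.R U" and w: "w \<in> sec (w_tor K) U" for U h y w
  proof -
    have "j (res (w_tor K) h w) f u x = j w (cmp X h f) u x" if f: "f \<in> into X (dm X h)" for f u x
      unfolding j_def dm_cmp_into[OF h f] res_cmp[OF KP h w f] ..
    thus ?thesis unfolding k_def
      by (intro fh.tdescend_res[OF qR j[OF w] y h _ j[OF res_sec[OF KP h w]]])
  qed
  have b: "k U (tact fh.R U y a) w = k U y (p.b U a w)"
    if U: "U \<in> obs X" and y: "y \<in> sec fh.R U" and w: "w \<in> sec (w_tor K) U" and a: "a \<in> sec (G1 G) U" for U y w a
  proof -
    note ya = tact_sec[OF fh.R_torsor U y a] and aw = p.bit_sec[OF U a w]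
    show ?thesis
    proof (rule fh.R_eqI[OF U qR s[OF U ya w] s[OF U y aw] y])
      fix f u v assume f: "f \<in> into X U" and u: "u \<in> sec (w_tor F) (dm X f)" and v: "v \<in> sec (w_tor H) (dm X f)"
        and yf: "res fh.R f y = fh.tp (dm X f) u v"
      note V = dm_into[OF f] and ra = res_sec[OF grp_presheaf[OF G1] f a] and rw = res_sec[OF KP f w]
      show "res q.R f (k U (tact fh.R U y a) w) = res q.R f (k U y (p.b U a w))"
        unfolding r[OF U f ya w] r[OF U f y aw] tact_res[OF fh.R_torsor f y a] p.C.act_res[OF f a w] yf
          fh.tp_tact[OF V u v ra] k_tp[OF V u v p.bit_sec[OF V ra rw]] k_tp[OF V u tact_sec[OF fh.P' V v ra] rw]
          hk.tp_bal[OF V v ra rw] ..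
    qed
  qed
  note D = p.tdescend_map[OF qR, of k, OF s r b]
  let ?m = "mk_map X p.R (\<lambda>U. tdescend X G fh.R (w_tor K) (w_phi K) q.R U (\<lambda>f u x. k (dm X f) u x))"
  have wa: "wassoc F H K = (wcomp (wcomp F H) K, wcomp F (wcomp H K), ?m)"
    unfolding w_assoc_def k_def j_def by (simp add: Let_def)
  show "fst (wassoc F H K) = wcomp (wcomp F H) K"
      "fst (snd (wassoc F H K)) = wcomp F (wcomp H K)" unfolding wa by simp_all
  have mm: "?m \<in> maps X p.R q.R" by (rule D(1))
  have tp: "?m U (p.tp U (fh.tp U u v) w) = q.tp U u (hk.tp U v w)"
    if U: "U \<in> obs X" and u: "u \<in> sec (w_tor F) U" and v: "v \<in> sec (w_tor H) U" and w: "w \<in> sec (w_tor K) U" for U u v w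
  proof -
    have "?m U (p.tp U (fh.tp U u v) w) = k U (fh.tp U u v) w"
      by (rule D(2); (assumption | rule U fh.tp_sec[OF U u v] w))
    thus ?thesis unfolding k_tp[OF that] .
  qed
  show "cellmap (wassoc F H K) U (tpw (wcomp F H) K U (tpw F H U u v) w)
        = tpw F (wcomp H K) U u (tpw H K U v w)"
    if "U \<in> obs X" "u \<in> sec (w_tor F) U" "v \<in> sec (w_tor H) U" "w \<in> sec (w_tor K) U" for U u v w
    using tp[OF that] unfolding wa by simp
  have D3: "densely X (\<lambda>U. fh.pairs_exist U \<and> sec (w_tor K) U \<noteq> {})"
    by (rule densely_conj[OF fh.dense_pairs tor_dense[OF hk.P']])
  show "wassoc F H K \<in> W2"
    unfolding wa
  proof (rule w_cell_germI[OF w_comp_arr[OF FH K e'(1)] w_comp_arr[OF F HK e'(2)] _ _ _ _ D3])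
    have "?m U (tact p.R U y a) = tact q.R U (?m U y) a"
      if "U \<in> obs X" "y \<in> sec p.R U" "a \<in> sec (G1 G) U" for U y a
    proof (rule p.tact_map_on_tp[OF mm q.R_torsor fh.dense_pairs _ that])
      fix U z w a assume U: "U \<in> obs X" and "fh.pairs_exist U" and z: "z \<in> sec fh.R U"
        and w: "w \<in> sec (w_tor K) U" and a: "a \<in> sec (G1 G) U"
      then obtain u where u: "u \<in> sec (w_tor F) U" by blast
      obtain v where v: "v \<in> sec (w_tor H) U" "z = fh.tp U u v" using fh.tpE[OF U u z] .
      show "?m U (p.tp U z (tact (w_tor K) U w a)) = tact q.R U (?m U (p.tp U z w)) a"
        unfolding v(2) tp[OF U u v(1) w] tp[OF U u v(1) tact_sec[OF hk.P' U w a]] q.tp_tact[OF U u hk.tp_sec[OF U v(1) w] a]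
          hk.tp_tact[OF U v(1) w a] ..
    qed
    thus "?m U (tact (w_tor (wcomp (wcomp F H) K)) U y a) = tact (w_tor (wcomp F (wcomp H K))) U (?m U y) a"
      if "U \<in> obs X" "y \<in> sec (w_tor (wcomp (wcomp F H) K)) U" "a \<in> sec (G1 G) U" for U y a using that by simp
    fix U assume U: "U \<in> obs X" and "fh.pairs_exist U \<and> sec (w_tor K) U \<noteq> {}"
    then obtain u v w where u: "u \<in> sec (w_tor F) U" and v: "v \<in> sec (w_tor H) U" and w: "w \<in> sec (w_tor K) U" by blast
    obtain a where a: "germ F U u a" using ex_germ[OF F U u] by blast
    obtain b where b: "germ H U v b" using ex_germ[OF H U v] by blast
    obtain c where c: "germ K U w c" using ex_germ[OF K U w] by blast
    interpret G0: section_group "G0 G" U by (rule section_groupI[OF G0 U])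
    show "\<exists>y s. germ (wcomp (wcomp F H) K) U y s \<and> germ (wcomp F (wcomp H K)) U (?m U y) s \<and>
       w_phi (wcomp F (wcomp H K)) U (?m U y) = w_phi (wcomp (wcomp F H) K) U y"
    proof (intro exI conjI)
      show "germ (wcomp (wcomp F H) K) U (p.tp U (fh.tp U u v) w) (\<lambda>x. c (b (a x)))"
        using w_comp_germ[OF FH K e'(1) U w_comp_germ[OF F H e(1) U a b] c] by simp
      show "germ (wcomp F (wcomp H K)) U (?m U (p.tp U (fh.tp U u v) w)) (\<lambda>x. c (b (a x)))"
        unfolding tp[OF U u v w]
        using w_comp_germ[OF F HK e'(2) U a w_comp_germ[OF H K e(2) U b c]] by simp
      show "w_phi (wcomp F (wcomp H K)) U (?m U (p.tp U (fh.tp U u v) w))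
          = w_phi (wcomp (wcomp F H) K) U (p.tp U (fh.tp U u v) w)"
        unfolding tp[OF U u v w] w_comp1_simps q.tprod_map_tp[OF w_framed[OF F] U u hk.tp_sec[OF U v w]]
          hk.tprod_map_tp[OF w_framed[OF H] U v w]
          p.tprod_map_tp[OF fh.tprod_map_framed[OF w_framed[OF F]] U fh.tp_sec[OF U u v] w]
          fh.tprod_map_tp[OF w_framed[OF F] U u v]
        using maps_sec[OF w_phi_maps[OF F] U u] maps_sec[OF w_phi_maps[OF H] U v] maps_sec[OF w_phi_maps[OF K] U w]
        by (simp add: G0.m_assoc)
    qed
  qed (use mm in simp_all)
qed

end

context gamma_xmod
begin

abbreviation "cdom c \<equiv> fst c"
abbreviation "ccod c \<equiv> fst (snd c)"

lemma cellD:
  assumes c: "c \<in> W2"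
  shows cdom_arr: "cdom c \<in> W1" and ccod_arr: "ccod c \<in> W1"
    and ccod_src: "fst (ccod c) = fst (cdom c)" and ccod_trg: "fst (snd (ccod c)) = fst (snd (cdom c))"
    and cellmap_sec: "\<lbrakk>U \<in> obs X; u \<in> sec (w_tor (cdom c)) U\<rbrakk> \<Longrightarrow> cellmap c U u \<in> sec (w_tor (ccod c)) U"
    and cellmap_tact: "\<lbrakk>U \<in> obs X; u \<in> sec (w_tor (cdom c)) U; a \<in> sec (G1 G) U\<rbrakk>
      \<Longrightarrow> cellmap c U (tact (w_tor (cdom c)) U u a) = tact (w_tor (ccod c)) U (cellmap c U u) a"
    and cellmap_bit: "\<lbrakk>U \<in> obs X; u \<in> sec (w_tor (cdom c)) U; a \<in> sec (G1 G) U\<rbrakk>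
      \<Longrightarrow> cellmap c U (bitorsor_act G (w_tor (cdom c)) (w_phi (cdom c)) U a u)
        = bitorsor_act G (w_tor (ccod c)) (w_phi (ccod c)) U a (cellmap c U u)"
proof -
  have c': "(cdom c, ccod c, cellmap c) \<in> W2" using c by simp
  show "cdom c \<in> W1" "ccod c \<in> W1" "fst (ccod c) = fst (cdom c)"
    "fst (snd (ccod c)) = fst (snd (cdom c))"
    by (rule cell_dom[OF c'] cell_cod[OF c'] cell_src[OF c'] cell_trg[OF c'])+
  show "\<lbrakk>U \<in> obs X; u \<in> sec (w_tor (cdom c)) U\<rbrakk> \<Longrightarrow> cellmap c U u \<in> sec (w_tor (ccod c)) U"
    by (rule cell_map_sec[OF c'])
  show "\<lbrakk>U \<in> obs X; u \<in> sec (w_tor (cdom c)) U; a \<in> sec (G1 G) U\<rbrakk>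
      \<Longrightarrow> cellmap c U (tact (w_tor (cdom c)) U u a) = tact (w_tor (ccod c)) U (cellmap c U u) a"
    by (rule cell_tact[OF c'])
  show "\<lbrakk>U \<in> obs X; u \<in> sec (w_tor (cdom c)) U; a \<in> sec (G1 G) U\<rbrakk>
      \<Longrightarrow> cellmap c U (bitorsor_act G (w_tor (cdom c)) (w_phi (cdom c)) U a u)
        = bitorsor_act G (w_tor (ccod c)) (w_phi (ccod c)) U a (cellmap c U u)"
    by (rule cell_bit[OF c'])
qed

lemma vcomp_cells: "\<lbrakk>c \<in> W2; d \<in> W2; ccod c = cdom d\<rbrakk> \<Longrightarrow> wvcomp c d \<in> W2"
  by (cases c rule: prod_cases3; cases d rule: prod_cases3) (simp add: vcomp_cell)

lemma hcomps:
  assumes c: "c \<in> W2" and d: "d \<in> W2" and e: "fst (snd (cdom c)) = fst (cdom d)"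
  shows hcomps_cells: "whcomp c d \<in> W2"
    and hcomps_map: "\<lbrakk>U \<in> obs X; u \<in> sec (w_tor (cdom c)) U; v \<in> sec (w_tor (cdom d)) U\<rbrakk>
      \<Longrightarrow> cellmap (whcomp c d) U (tpw (cdom c) (cdom d) U u v)
        = tpw (ccod c) (ccod d) U (cellmap c U u) (cellmap d U v)"
proof -
  have c': "(cdom c, ccod c, cellmap c) \<in> W2" and d': "(cdom d, ccod d, cellmap d) \<in> W2"
    using c d by simp_all
  show "whcomp c d \<in> W2" using hcomp_cell[OF c' d' e] by simp
  show "\<lbrakk>U \<in> obs X; u \<in> sec (w_tor (cdom c)) U; v \<in> sec (w_tor (cdom d)) U\<rbrakk>
      \<Longrightarrow> cellmap (whcomp c d) U (tpw (cdom c) (cdom d) U u v)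
        = tpw (ccod c) (ccod d) U (cellmap c U u) (cellmap d U v)"
    using hcomp_map[OF c' d' e] by simp
qed

lemma tpw_sec: "\<lbrakk>F \<in> W1; F' \<in> W1; U \<in> obs X; u \<in> sec (w_tor F) U; v \<in> sec (w_tor F') U\<rbrakk>
    \<Longrightarrow> tpw F F' U u v \<in> sec (w_tor (wcomp F F')) U"
  using torsor_pair.tp_sec[OF torsor_pairI] by simp

lemma tpwE:
  assumes "F \<in> W1" "F' \<in> W1" "U \<in> obs X" "u \<in> sec (w_tor F) U"
    and "p \<in> sec (w_tor (wcomp F F')) U"
  obtains v where "v \<in> sec (w_tor F') U" "p = tpw F F' U u v"
  using torsor_pair.tpE[OF torsor_pairI[OF assms(1,2)] assms(3,4)] assms(5) by auto

text \<open>Over an object where the torsor of \<open>F\<close> has a section \<open>u\<close>, every section of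
  the torsor of the composite is a pair with first entry \<open>u\<close>. This lemma and its iterations reduce
  the coherence laws to computations with tuples.\<close>

lemma comp_cell_eqI:
  assumes c: "c \<in> W2" "d \<in> W2" and e: "cdom c = cdom d" "ccod c = ccod d"
    and F: "cdom c = wcomp F F'" "F \<in> W1" "F' \<in> W1"
    and D: "densely X D"
    and eq: "\<And>U u v. \<lbrakk>U \<in> obs X; D U; u \<in> sec (w_tor F) U; v \<in> sec (w_tor F') U\<rbrakk>
      \<Longrightarrow> cellmap c U (tpw F F' U u v) = cellmap d U (tpw F F' U u v)"
  shows "c = d"
proof (rule cell_eqI[OF c e densely_conj[OF D tor_dense[OF w_torsor[OF F(2)]]]])
  fix U p assume U: "U \<in> obs X" and "D U \<and> sec (w_tor F) U \<noteq> {}" and p: "p \<in> sec (w_tor (cdom c)) U"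
  then obtain u where u: "u \<in> sec (w_tor F) U" and D: "D U" by blast
  obtain v where "v \<in> sec (w_tor F') U" "p = tpw F F' U u v" using tpwE[OF F(2,3) U u] p F(1) by metis
  thus "cellmap c U p = cellmap d U p" using eq[OF U D u] by blast
qed

lemma comp3_cell_eqI:
  assumes c: "c \<in> W2" "d \<in> W2" and e: "cdom c = cdom d" "ccod c = ccod d"
    and F: "cdom c = wcomp (wcomp F H) K" "F \<in> W1" "H \<in> W1" "K \<in> W1"
    and FH: "fst (snd F) = fst H" and D: "densely X D"
    and eq: "\<And>U u v w. \<lbrakk>U \<in> obs X; D U; u \<in> sec (w_tor F) U; v \<in> sec (w_tor H) U; w \<in> sec (w_tor K) U\<rbrakk>
      \<Longrightarrow> cellmap c U (tpw (wcomp F H) K U (tpw F H U u v) w) = cellmap d U (tpw (wcomp F H) K U (tpw F H U u v) w)"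
  shows "c = d"
proof (rule comp_cell_eqI[OF c e F(1) w_comp_arr[OF F(2,3) FH] F(4) densely_conj[OF D tor_dense[OF w_torsor[OF F(2)]]]])
  fix U p w assume U: "U \<in> obs X" and "D U \<and> sec (w_tor F) U \<noteq> {}" and p: "p \<in> sec (w_tor (wcomp F H)) U"
    and w: "w \<in> sec (w_tor K) U"
  then obtain u where u: "u \<in> sec (w_tor F) U" and D: "D U" by blast
  obtain v where "v \<in> sec (w_tor H) U" "p = tpw F H U u v" using tpwE[OF F(2,3) U u p] .
  thus "cellmap c U (tpw (wcomp F H) K U p w) = cellmap d U (tpw (wcomp F H) K U p w)" using eq[OF U D u _ w] by blast
qed

lemma comp4_cell_eqI:
  assumes c: "c \<in> W2" "d \<in> W2" and e: "cdom c = cdom d" "ccod c = ccod d"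
    and F: "cdom c = wcomp (wcomp (wcomp F H) K) L" "F \<in> W1" "H \<in> W1"
      "K \<in> W1" "L \<in> W1"
    and FH: "fst (snd F) = fst H" "fst (snd H) = fst K"
    and eq: "\<And>U u v w x. \<lbrakk>U \<in> obs X; u \<in> sec (w_tor F) U; v \<in> sec (w_tor H) U; w \<in> sec (w_tor K) U; x \<in> sec (w_tor L) U\<rbrakk>
      \<Longrightarrow> cellmap c U (tpw (wcomp (wcomp F H) K) L U (tpw (wcomp F H) K U (tpw F H U u v) w) x)
        = cellmap d U (tpw (wcomp (wcomp F H) K) L U (tpw (wcomp F H) K U (tpw F H U u v) w) x)"
  shows "c = d"
proof (rule comp3_cell_eqI[OF c e F(1) w_comp_arr[OF F(2,3) FH(1)] F(4,5) _ tor_dense[OF w_torsor[OF F(2)]]])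
  show "fst (snd (wcomp F H)) = fst K" using FH by simp
  fix U p w x assume U: "U \<in> obs X" and "sec (w_tor F) U \<noteq> {}" and p: "p \<in> sec (w_tor (wcomp F H)) U"
    and w: "w \<in> sec (w_tor K) U" and x: "x \<in> sec (w_tor L) U"
  then obtain u where u: "u \<in> sec (w_tor F) U" by blast
  obtain v where "v \<in> sec (w_tor H) U" "p = tpw F H U u v" using tpwE[OF F(2,3) U u p] .
  thus "cellmap c U (tpw (wcomp (wcomp F H) K) L U (tpw (wcomp F H) K U p w) x)
      = cellmap d U (tpw (wcomp (wcomp F H) K) L U (tpw (wcomp F H) K U p w) x)" using eq[OF U u _ w x] by blast
qed

lemma W_simps [simp]:
  "Ob Wcat = Z0" "Ar Wcat = W1" "Ce Wcat = W2"
  "src Wcat F = fst F" "trg Wcat F = fst (snd F)"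
  "vdom Wcat c = cdom c" "vcod Wcat c = ccod c"
  "one1 Wcat = wone" "comp1 Wcat = wcomp" "one2 Wcat = wone2"
  "vcomp Wcat = wvcomp" "hcomp Wcat = whcomp" "assoc Wcat = wassoc"
  "lunit Wcat = wlunit" "runit Wcat = wrunit"
  unfolding W_cat_def by (simp_all add: case_prod_beta)

lemma w_iso2:
  assumes c: "c \<in> W2" and e: "cdom c = F" "ccod c = F'"
  shows "c \<in> iso2 Wcat F F'"
proof -
  obtain m where m: "c = (F, F', m)" using e by (cases c rule: prod_cases3) simp
  obtain n where "(F', F, n) \<in> W2" "wvcomp c (F', F, n) = wone2 F"
    "wvcomp (F', F, n) c = wone2 F'"
    using cell_inverse[of F F' m] c m by blast
  thus ?thesis using c e unfolding iso2_def hom2_def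
    by (intro CollectI conjI bexI[of _ "(F', F, n)"]) simp_all
qed

lemma w_hcomp_one:
  assumes F: "F \<in> W1" and H: "H \<in> W1" and e: "fst (snd F) = fst H"
  shows "whcomp (wone2 F) (wone2 H) = wone2 (wcomp F H)"
proof (rule comp_cell_eqI[OF _ one2_cell[OF w_comp_arr[OF F H e]] _ _ _ F H densely_True])
  note c = one2_cell[OF F] and d = one2_cell[OF H]
  have e': "fst (snd (cdom (wone2 F))) = fst (cdom (wone2 H))" using e by simp
  show "whcomp (wone2 F) (wone2 H) \<in> W2" by (rule hcomps_cells[OF c d e'])
  fix U u v assume U: "U \<in> obs X" and u: "u \<in> sec (w_tor F) U" and v: "v \<in> sec (w_tor H) U"
  show "cellmap (whcomp (wone2 F) (wone2 H)) U (tpw F H U u v) = cellmap (wone2 (wcomp F H)) U (tpw F H U u v)"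
    using hcomps_map[OF c d e' U, of u v] one2_map[OF U u] one2_map[OF U v] u v
      one2_map[OF U tpw_sec[OF F H U u v]] by simp
qed simp_all

text \<open>Both sides send \<open>(u, v)\<close> to the pair of the iterated images.\<close>

lemma w_interchange:
  assumes c: "c \<in> W2" and c': "c' \<in> W2" and d: "d \<in> W2" and d': "d' \<in> W2"
    and cc: "ccod c = cdom c'" and dd: "ccod d = cdom d'" and cd: "fst (snd (cdom c)) = fst (cdom d)"
  shows "whcomp (wvcomp c c') (wvcomp d d') = wvcomp (whcomp c d) (whcomp c' d')"
proof -
  have cd': "fst (snd (cdom c')) = fst (cdom d')"
    using cd ccod_trg[OF c] ccod_src[OF d] cc dd by simp
  note vc = vcomp_cells[OF c c' cc] and vd = vcomp_cells[OF d d' dd]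
  have e: "fst (snd (cdom (wvcomp c c'))) = fst (cdom (wvcomp d d'))" using cd by simp
  note h = hcomps_cells[OF vc vd e] and h1 = hcomps_cells[OF c d cd] and h2 = hcomps_cells[OF c' d' cd']
  have e2: "ccod (whcomp c d) = cdom (whcomp c' d')" using cc dd by simp
  show ?thesis
  proof (rule comp_cell_eqI[OF h vcomp_cells[OF h1 h2 e2] _ _ _ cdom_arr[OF c] cdom_arr[OF d] densely_True])
    fix U u v assume U: "U \<in> obs X" and u: "u \<in> sec (w_tor (cdom c)) U" and v: "v \<in> sec (w_tor (cdom d)) U"
    have u': "cellmap c U u \<in> sec (w_tor (cdom c')) U" and v': "cellmap d U v \<in> sec (w_tor (cdom d')) U"
      using cellmap_sec[OF c U u] cellmap_sec[OF d U v] cc dd by simp_all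
    note p = tpw_sec[OF cdom_arr[OF c] cdom_arr[OF d] U u v]
    have "cellmap (whcomp (wvcomp c c') (wvcomp d d')) U (tpw (cdom c) (cdom d) U u v)
        = tpw (ccod c') (ccod d') U (cellmap c' U (cellmap c U u)) (cellmap d' U (cellmap d U v))"
      using hcomps_map[OF vc vd e U, of u v] u v vcomp_map[OF U u] vcomp_map[OF U v] by simp
    also have "\<dots> = cellmap (whcomp c' d') U (cellmap (whcomp c d) U (tpw (cdom c) (cdom d) U u v))"
      unfolding hcomps_map[OF c d cd U u v] cc dd by (rule hcomps_map[OF c' d' cd' U u' v', symmetric])
    also have "\<dots> = cellmap (wvcomp (whcomp c d) (whcomp c' d')) U (tpw (cdom c) (cdom d) U u v)"
      by (rule vcomp_map[OF U, symmetric]) (use p in simp)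
    finally show "cellmap (whcomp (wvcomp c c') (wvcomp d d')) U (tpw (cdom c) (cdom d) U u v)
      = cellmap (wvcomp (whcomp c d) (whcomp c' d')) U (tpw (cdom c) (cdom d) U u v)" .
  qed (use cc dd in simp_all)
qed

lemma w_assoc_natural:
  assumes c: "c \<in> W2" and d: "d \<in> W2" and k: "k \<in> W2"
    and cd: "fst (snd (cdom c)) = fst (cdom d)" and dk: "fst (snd (cdom d)) = fst (cdom k)"
  shows "wvcomp (whcomp (whcomp c d) k) (wassoc (ccod c) (ccod d) (ccod k))
      = wvcomp (wassoc (cdom c) (cdom d) (cdom k)) (whcomp c (whcomp d k))"
proof -
  note C = cdom_arr[OF c] and D = cdom_arr[OF d] and K = cdom_arr[OF k]
  note C' = ccod_arr[OF c] and D' = ccod_arr[OF d] and K' = ccod_arr[OF k]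
  have cd': "fst (snd (ccod c)) = fst (ccod d)" and dk': "fst (snd (ccod d)) = fst (ccod k)"
    using cd dk ccod_trg[OF c] ccod_trg[OF d] ccod_src[OF d] ccod_src[OF k] by simp_all
  note hcd = hcomps_cells[OF c d cd] and hdk = hcomps_cells[OF d k dk]
  have e1: "fst (snd (cdom (whcomp c d))) = fst (cdom k)" and e2: "fst (snd (cdom c)) = fst (cdom (whcomp d k))"
    using cd dk by simp_all
  note h1 = hcomps_cells[OF hcd k e1] and h2 = hcomps_cells[OF c hdk e2]
  note a = assoc_cell[OF C D K cd dk] and a' = assoc_cell[OF C' D' K' cd' dk']
  note ad = assoc_dom[OF C D K cd dk] and ad' = assoc_dom[OF C' D' K' cd' dk']
  have v1: "ccod (whcomp (whcomp c d) k) = cdom (wassoc (ccod c) (ccod d) (ccod k))"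
    and v2: "ccod (wassoc (cdom c) (cdom d) (cdom k)) = cdom (whcomp c (whcomp d k))"
    using ad ad' by simp_all
  show ?thesis
  proof (rule comp3_cell_eqI[OF vcomp_cells[OF h1 a' v1] vcomp_cells[OF a h2 v2] _ _ _ C D K cd densely_True])
    fix U u v w assume U: "U \<in> obs X" and u: "u \<in> sec (w_tor (cdom c)) U" and v: "v \<in> sec (w_tor (cdom d)) U"
      and w: "w \<in> sec (w_tor (cdom k)) U"
    note uv = tpw_sec[OF C D U u v] and vw = tpw_sec[OF D K U v w]
    let ?x = "tpw (wcomp (cdom c) (cdom d)) (cdom k) U (tpw (cdom c) (cdom d) U u v) w"
    have x: "?x \<in> sec (w_tor (wcomp (wcomp (cdom c) (cdom d)) (cdom k))) U"
      by (rule tpw_sec[OF w_comp_arr[OF C D cd] K U uv w])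
    have 1: "cellmap (whcomp (whcomp c d) k) U ?x = tpw (wcomp (ccod c) (ccod d)) (ccod k) U
        (tpw (ccod c) (ccod d) U (cellmap c U u) (cellmap d U v)) (cellmap k U w)"
      using hcomps_map[OF hcd k e1 U, of "tpw (cdom c) (cdom d) U u v" w] uv w hcomps_map[OF c d cd U u v] by simp
    have 2: "cellmap (whcomp c (whcomp d k)) U
         (tpw (cdom c) (wcomp (cdom d) (cdom k)) U u (tpw (cdom d) (cdom k) U v w))
       = tpw (ccod c) (wcomp (ccod d) (ccod k)) U (cellmap c U u) (tpw (ccod d) (ccod k) U (cellmap d U v) (cellmap k U w))"
      using hcomps_map[OF c hdk e2 U, of u "tpw (cdom d) (cdom k) U v w"] u vw hcomps_map[OF d k dk U v w] by simp
    have "cellmap (wvcomp (whcomp (whcomp c d) k) (wassoc (ccod c) (ccod d) (ccod k))) U ?x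
        = cellmap (wassoc (ccod c) (ccod d) (ccod k)) U (cellmap (whcomp (whcomp c d) k) U ?x)"
      by (rule vcomp_map[OF U]) (use x in simp)
    also have "\<dots> = tpw (ccod c) (wcomp (ccod d) (ccod k)) U (cellmap c U u) (tpw (ccod d) (ccod k) U (cellmap d U v) (cellmap k U w))"
      unfolding 1 by (rule assoc_map[OF C' D' K' cd' dk' U cellmap_sec[OF c U u] cellmap_sec[OF d U v] cellmap_sec[OF k U w]])
    also have "\<dots> = cellmap (whcomp c (whcomp d k)) U (cellmap (wassoc (cdom c) (cdom d) (cdom k)) U ?x)"
      unfolding assoc_map[OF C D K cd dk U u v w] 2 ..
    also have "\<dots> = cellmap (wvcomp (wassoc (cdom c) (cdom d) (cdom k)) (whcomp c (whcomp d k))) U ?x"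
      by (rule vcomp_map[OF U, symmetric]) (use x ad(1) in simp)
    finally show "cellmap (wvcomp (whcomp (whcomp c d) k) (wassoc (ccod c) (ccod d) (ccod k))) U ?x
       = cellmap (wvcomp (wassoc (cdom c) (cdom d) (cdom k)) (whcomp c (whcomp d k))) U ?x" .
  qed (use ad ad' in simp_all)
qed

lemma w_lunit_natural:
  assumes c: "c \<in> W2"
  shows "wvcomp (whcomp (wone2 (wone (fst (cdom c)))) c) (wlunit (ccod c))
      = wvcomp (wlunit (cdom c)) c"
proof -
  let ?O = "wone (fst (cdom c))"
  note F = cdom_arr[OF c] and F' = ccod_arr[OF c]
  note O = one1_arr[OF w_src[OF F]]
  have e: "fst (snd (cdom (wone2 ?O))) = fst (cdom c)" by simp
  note h = hcomps_cells[OF one2_cell[OF O] c e]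
  note l = lunit_cell[OF F] and l' = lunit_cell[OF F'] and ld = lunit_dom[OF F] and ld' = lunit_dom[OF F']
  have v: "ccod (whcomp (wone2 ?O) c) = cdom (wlunit (ccod c))" using ld' ccod_src[OF c] by simp
  show ?thesis
  proof (rule comp_cell_eqI[OF vcomp_cells[OF h l' v] vcomp_cells[OF l c ld(2)] _ _ _ O F densely_True])
    fix U a u assume U: "U \<in> obs X" and a': "a \<in> sec (w_tor ?O) U" and u: "u \<in> sec (w_tor (cdom c)) U"
    have a: "a \<in> sec (G1 G) U" using a' by simp
    have x: "tpw ?O (cdom c) U a u \<in> sec (w_tor (wcomp ?O (cdom c))) U" by (rule tpw_sec[OF O F U a' u])
    have "cellmap (wvcomp (whcomp (wone2 ?O) c) (wlunit (ccod c))) U (tpw ?O (cdom c) U a u)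
       = cellmap (wlunit (ccod c)) U (cellmap (whcomp (wone2 ?O) c) U (tpw ?O (cdom c) U a u))"
      by (rule vcomp_map[OF U]) (use x in simp)
    also have "cellmap (whcomp (wone2 ?O) c) U (tpw ?O (cdom c) U a u) = tpw (wone (fst (ccod c))) (ccod c) U a (cellmap c U u)"
      using hcomps_map[OF one2_cell[OF O] c e U, of a u] a' u one2_map[OF U a'] ccod_src[OF c] by simp
    also have "cellmap (wlunit (ccod c)) U \<dots> = cellmap c U (cellmap (wlunit (cdom c)) U (tpw ?O (cdom c) U a u))"
      unfolding lunit_map[OF F U a u] lunit_map[OF F' U a cellmap_sec[OF c U u]] by (rule cellmap_bit[OF c U u a, symmetric])
    also have "\<dots> = cellmap (wvcomp (wlunit (cdom c)) c) U (tpw ?O (cdom c) U a u)"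
      by (rule vcomp_map[OF U, symmetric]) (use x ld in simp)
    finally show "cellmap (wvcomp (whcomp (wone2 ?O) c) (wlunit (ccod c))) U (tpw ?O (cdom c) U a u)
      = cellmap (wvcomp (wlunit (cdom c)) c) U (tpw ?O (cdom c) U a u)" .
  qed (use ld ld' in simp_all)
qed

lemma w_runit_natural:
  assumes c: "c \<in> W2"
  shows "wvcomp (whcomp c (wone2 (wone (fst (snd (cdom c)))))) (wrunit (ccod c))
      = wvcomp (wrunit (cdom c)) c"
proof -
  let ?O = "wone (fst (snd (cdom c)))"
  note F = cdom_arr[OF c] and F' = ccod_arr[OF c]
  note O = one1_arr[OF w_trg[OF F]]
  have e: "fst (snd (cdom c)) = fst (cdom (wone2 ?O))" by simp
  note h = hcomps_cells[OF c one2_cell[OF O] e]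
  note l = runit_cell[OF F] and l' = runit_cell[OF F'] and ld = runit_dom[OF F] and ld' = runit_dom[OF F']
  have v: "ccod (whcomp c (wone2 ?O)) = cdom (wrunit (ccod c))" using ld' ccod_trg[OF c] by simp
  show ?thesis
  proof (rule comp_cell_eqI[OF vcomp_cells[OF h l' v] vcomp_cells[OF l c ld(2)] _ _ _ F O densely_True])
    fix U u a assume U: "U \<in> obs X" and a': "a \<in> sec (w_tor ?O) U" and u: "u \<in> sec (w_tor (cdom c)) U"
    have a: "a \<in> sec (G1 G) U" using a' by simp
    have x: "tpw (cdom c) ?O U u a \<in> sec (w_tor (wcomp (cdom c) ?O)) U" by (rule tpw_sec[OF F O U u a'])
    have "cellmap (wvcomp (whcomp c (wone2 ?O)) (wrunit (ccod c))) U (tpw (cdom c) ?O U u a)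
       = cellmap (wrunit (ccod c)) U (cellmap (whcomp c (wone2 ?O)) U (tpw (cdom c) ?O U u a))"
      by (rule vcomp_map[OF U]) (use x in simp)
    also have "cellmap (whcomp c (wone2 ?O)) U (tpw (cdom c) ?O U u a) = tpw (ccod c) (wone (fst (snd (ccod c)))) U (cellmap c U u) a"
      using hcomps_map[OF c one2_cell[OF O] e U, of u a] a' u one2_map[OF U a'] ccod_trg[OF c] by simp
    also have "cellmap (wrunit (ccod c)) U \<dots> = cellmap c U (cellmap (wrunit (cdom c)) U (tpw (cdom c) ?O U u a))"
      unfolding runit_map[OF F U u a] runit_map[OF F' U cellmap_sec[OF c U u] a] by (rule cellmap_tact[OF c U u a, symmetric])
    also have "\<dots> = cellmap (wvcomp (wrunit (cdom c)) c) U (tpw (cdom c) ?O U u a)"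
      by (rule vcomp_map[OF U, symmetric]) (use x ld in simp)
    finally show "cellmap (wvcomp (whcomp c (wone2 ?O)) (wrunit (ccod c))) U (tpw (cdom c) ?O U u a)
      = cellmap (wvcomp (wrunit (cdom c)) c) U (tpw (cdom c) ?O U u a)" .
  qed (use ld ld' in simp_all)
qed

text \<open>On \<open>((u, c), w)\<close> the two sides are \<open>(u, c w)\<close> and \<open>(u c, w)\<close>,
  which the relation defining the contracted product identifies.\<close>

lemma w_triangle:
  assumes F: "F \<in> W1" and H: "H \<in> W1" and e: "fst (snd F) = fst H"
  shows "wvcomp (wassoc F (wone (fst (snd F))) H) (whcomp (wone2 F) (wlunit H))
      = whcomp (wrunit F) (wone2 H)"
proof -
  let ?O = "wone (fst (snd F))"
  note O = one1_arr[OF w_trg[OF F]]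
  have e1: "fst (snd F) = fst ?O" "fst (snd ?O) = fst H" using e by simp_all
  note a = assoc_cell[OF F O H e1] and ad = assoc_dom[OF F O H e1]
  note l = lunit_cell[OF H] and ld = lunit_dom[OF H] and r = runit_cell[OF F] and rd = runit_dom[OF F]
  have e2: "fst (snd (cdom (wone2 F))) = fst (cdom (wlunit H))" using e ld by simp
  have e3: "fst (snd (cdom (wrunit F))) = fst (cdom (wone2 H))" using e rd by simp
  note h1 = hcomps_cells[OF one2_cell[OF F] l e2] and h2 = hcomps_cells[OF r one2_cell[OF H] e3]
  have v: "ccod (wassoc F ?O H) = cdom (whcomp (wone2 F) (wlunit H))" using ad ld e by simp
  show ?thesis
  proof (rule comp3_cell_eqI[OF vcomp_cells[OF a h1 v] h2 _ _ _ F O H e1(1) densely_True])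
    fix U u c w assume U: "U \<in> obs X" and u: "u \<in> sec (w_tor F) U" and c': "c \<in> sec (w_tor ?O) U" and w: "w \<in> sec (w_tor H) U"
    have c: "c \<in> sec (G1 G) U" using c' by simp
    interpret p: torsor_pair X \<Gamma> G "w_tor F" "w_tor H" "w_phi H" by (rule torsor_pairI[OF F H])
    let ?x = "tpw (wcomp F ?O) H U (tpw F ?O U u c) w"
    note uc = tpw_sec[OF F O U u c'] and cw = tpw_sec[OF O H U c' w]
    have x: "?x \<in> sec (w_tor (wcomp (wcomp F ?O) H)) U" by (rule tpw_sec[OF w_comp_arr[OF F O e1(1)] H U uc w])
    have "cellmap (wvcomp (wassoc F ?O H) (whcomp (wone2 F) (wlunit H))) U ?x
        = cellmap (whcomp (wone2 F) (wlunit H)) U (cellmap (wassoc F ?O H) U ?x)"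
      by (rule vcomp_map[OF U]) (use x ad in simp)
    also have "\<dots> = p.tp U u (p.b U c w)"
      using assoc_map[OF F O H e1 U u c' w] hcomps_map[OF one2_cell[OF F] l e2 U, of u "tpw ?O H U c w"] ld e u cw
        one2_map[OF U u] lunit_map[OF H U c w] by simp
    also have "\<dots> = p.tp U (tact (w_tor F) U u c) w" by (rule p.tp_bal[OF U u c w, symmetric])
    also have "\<dots> = cellmap (whcomp (wrunit F) (wone2 H)) U ?x"
      using hcomps_map[OF r one2_cell[OF H] e3 U, of "tpw F ?O U u c" w] rd uc w runit_map[OF F U u c] one2_map[OF U w] by simp
    finally show "cellmap (wvcomp (wassoc F ?O H) (whcomp (wone2 F) (wlunit H))) U ?x
      = cellmap (whcomp (wrunit F) (wone2 H)) U ?x" .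
  qed (use ad rd ld in simp_all)
qed

text \<open>Both sides rebracket \<open>(((u, v), w), z)\<close> to \<open>(u, (v, (w, z)))\<close>.\<close>

lemma w_pentagon:
  assumes F: "F \<in> W1" and H: "H \<in> W1" and K: "K \<in> W1" and L: "L \<in> W1"
    and e: "fst (snd F) = fst H" "fst (snd H) = fst K" "fst (snd K) = fst L"
  shows "wvcomp (wassoc (wcomp F H) K L) (wassoc F H (wcomp K L))
      = wvcomp (whcomp (wassoc F H K) (wone2 L))
          (wvcomp (wassoc F (wcomp H K) L) (whcomp (wone2 F) (wassoc H K L)))"
    (is "?lhs = ?rhs")
proof -
  note FH = w_comp_arr[OF F H e(1)] and HK = w_comp_arr[OF H K e(2)] and KL = w_comp_arr[OF K L e(3)]
  have e1: "fst (snd (wcomp F H)) = fst K" and e2: "fst (snd H) = fst (wcomp K L)"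
    and e3: "fst (snd F) = fst (wcomp H K)" and e4: "fst (snd (wcomp H K)) = fst L" using e by simp_all
  note FHK = w_comp_arr[OF FH K e1]
  note a1 = assoc_cell[OF FH K L e1 e(3)] and d1 = assoc_dom[OF FH K L e1 e(3)]
  note a2 = assoc_cell[OF F H KL e(1) e2] and d2 = assoc_dom[OF F H KL e(1) e2]
  note a3 = assoc_cell[OF F H K e(1,2)] and d3 = assoc_dom[OF F H K e(1,2)]
  note a4 = assoc_cell[OF F HK L e3 e4] and d4 = assoc_dom[OF F HK L e3 e4]
  note a5 = assoc_cell[OF H K L e(2,3)] and d5 = assoc_dom[OF H K L e(2,3)]
  have e5: "fst (snd (cdom (wassoc F H K))) = fst (cdom (wone2 L))" using d3 e by simp
  have e6: "fst (snd (cdom (wone2 F))) = fst (cdom (wassoc H K L))" using d5 e by simp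
  note h1 = hcomps_cells[OF a3 one2_cell[OF L] e5] and h2 = hcomps_cells[OF one2_cell[OF F] a5 e6]
  have v1: "ccod (wassoc (wcomp F H) K L) = cdom (wassoc F H (wcomp K L))" using d1 d2 by simp
  have v2: "ccod (wassoc F (wcomp H K) L) = cdom (whcomp (wone2 F) (wassoc H K L))" using d4 d5 by simp
  note v2c = vcomp_cells[OF a4 h2 v2]
  have v3: "ccod (whcomp (wassoc F H K) (wone2 L))
      = cdom (wvcomp (wassoc F (wcomp H K) L) (whcomp (wone2 F) (wassoc H K L)))" using d3 d4 by simp
  show ?thesis
  proof (rule comp4_cell_eqI[OF vcomp_cells[OF a1 a2 v1] vcomp_cells[OF h1 v2c v3] _ _ _ F H K L e(1,2)])
    fix U u v w z assume U: "U \<in> obs X" and u: "u \<in> sec (w_tor F) U" and v: "v \<in> sec (w_tor H) U"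
      and w: "w \<in> sec (w_tor K) U" and z: "z \<in> sec (w_tor L) U"
    note uv = tpw_sec[OF F H U u v] and vw = tpw_sec[OF H K U v w] and wz = tpw_sec[OF K L U w z]
    note uvw = tpw_sec[OF FH K U uv w] and uvw' = tpw_sec[OF F HK U u vw] and vwz = tpw_sec[OF HK L U vw z]
    let ?x = "tpw (wcomp (wcomp F H) K) L U (tpw (wcomp F H) K U (tpw F H U u v) w) z"
    have x: "?x \<in> sec (w_tor (wcomp (wcomp (wcomp F H) K) L)) U" by (rule tpw_sec[OF FHK L U uvw z])
    let ?y = "tpw F (wcomp H (wcomp K L)) U u (tpw H (wcomp K L) U v (tpw K L U w z))"
    have "cellmap ?lhs U ?x = cellmap (wassoc F H (wcomp K L)) U (cellmap (wassoc (wcomp F H) K L) U ?x)"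
      by (rule vcomp_map[OF U]) (use x d1 in simp)
    also have "\<dots> = ?y"
      unfolding assoc_map[OF FH K L e1 e(3) U uv w z] by (rule assoc_map[OF F H KL e(1) e2 U u v wz])
    finally have l: "cellmap ?lhs U ?x = ?y" .
    have 1: "cellmap (whcomp (wassoc F H K) (wone2 L)) U ?x
        = tpw (wcomp F (wcomp H K)) L U (tpw F (wcomp H K) U u (tpw H K U v w)) z"
      using hcomps_map[OF a3 one2_cell[OF L] e5 U, of "tpw (wcomp F H) K U (tpw F H U u v) w" z] d3 uvw z
        assoc_map[OF F H K e(1,2) U u v w] one2_map[OF U z] by simp
    have 2: "cellmap (whcomp (wone2 F) (wassoc H K L)) U
        (tpw F (wcomp (wcomp H K) L) U u (tpw (wcomp H K) L U (tpw H K U v w) z)) = ?y"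
      using hcomps_map[OF one2_cell[OF F] a5 e6 U, of u "tpw (wcomp H K) L U (tpw H K U v w) z"] d5 u vwz
        assoc_map[OF H K L e(2,3) U v w z] one2_map[OF U u] by simp
    have 3: "tpw (wcomp F (wcomp H K)) L U (tpw F (wcomp H K) U u (tpw H K U v w)) z
        \<in> sec (w_tor (wcomp (wcomp F (wcomp H K)) L)) U"
      by (rule tpw_sec[OF w_comp_arr[OF F HK e3] L U uvw' z])
    have "cellmap ?rhs U ?x = cellmap (wvcomp (wassoc F (wcomp H K) L) (whcomp (wone2 F) (wassoc H K L))) U
        (cellmap (whcomp (wassoc F H K) (wone2 L)) U ?x)"
      by (rule vcomp_map[OF U]) (use x d3 in simp)
    also have "\<dots> = cellmap (whcomp (wone2 F) (wassoc H K L)) U (cellmap (wassoc F (wcomp H K) L) U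
        (tpw (wcomp F (wcomp H K)) L U (tpw F (wcomp H K) U u (tpw H K U v w)) z))"
      unfolding 1 by (rule vcomp_map[OF U]) (use 3 d4 in simp)
    also have "\<dots> = ?y" unfolding assoc_map[OF F HK L e3 e4 U u vw z] by (rule 2)
    finally show "cellmap ?lhs U ?x = cellmap ?rhs U ?x" using l by simp
  qed (use d1 d2 d3 d5 in simp_all)
qed

lemma W_bicategory: "bicategory Wcat"
proof (unfold_locales, unfold W_simps)
  fix F H K L :: "('o, 'm, 'e, 'a, 'b, 'g) warr" and c d k c' d' :: "('o, 'm, 'e, 'a, 'b, 'g) wcell"
    and A :: "('o, 'm, 'e, 'a, 'b, 'g) zobj"
  show "F \<in> W1 \<Longrightarrow> fst F \<in> Z0" by (rule w_src)
  show "F \<in> W1 \<Longrightarrow> fst (snd F) \<in> Z0" by (rule w_trg)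
  show "c \<in> W2 \<Longrightarrow> cdom c \<in> W1" by (rule cdom_arr)
  show "c \<in> W2 \<Longrightarrow> ccod c \<in> W1" by (rule ccod_arr)
  show "c \<in> W2 \<Longrightarrow> fst (cdom c) = fst (ccod c)" by (rule ccod_src[symmetric])
  show "c \<in> W2 \<Longrightarrow> fst (snd (cdom c)) = fst (snd (ccod c))" by (rule ccod_trg[symmetric])
  show "A \<in> Z0 \<Longrightarrow> wone A \<in> hom1 Wcat A A"
    using one1_arr[of A] unfolding hom1_def by simp
  show "\<lbrakk>F \<in> W1; H \<in> W1; fst (snd F) = fst H\<rbrakk>
      \<Longrightarrow> wcomp F H \<in> hom1 Wcat (fst F) (fst (snd H))"
    using w_comp_arr[of F H] unfolding hom1_def by simp
  show "F \<in> W1 \<Longrightarrow> wone2 F \<in> hom2 Wcat F F"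
    using one2_cell[of F] unfolding hom2_def by simp
  show "\<lbrakk>c \<in> W2; d \<in> W2; ccod c = cdom d\<rbrakk>
      \<Longrightarrow> wvcomp c d \<in> hom2 Wcat (cdom c) (ccod d)"
    using vcomp_cells[of c d] unfolding hom2_def by simp
  show "wvcomp (wone2 (cdom c)) c = c" if c: "c \<in> W2"
    by (rule cell_eqI[OF vcomp_cells[OF one2_cell[OF cdom_arr[OF c]] c] c _ _ densely_True])
      (simp_all add: vcomp_map one2_map)
  show "wvcomp c (wone2 (ccod c)) = c" if c: "c \<in> W2"
    by (rule cell_eqI[OF vcomp_cells[OF c one2_cell[OF ccod_arr[OF c]]] c _ _ densely_True])
      (simp_all add: vcomp_map one2_map cellmap_sec[OF c])
  show "wvcomp (wvcomp c d) k = wvcomp c (wvcomp d k)"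
    if c: "c \<in> W2" and d: "d \<in> W2" and k: "k \<in> W2"
      and e: "ccod c = cdom d" "ccod d = cdom k"
  proof (rule cell_eqI[OF vcomp_cells[OF vcomp_cells[OF c d e(1)] k] vcomp_cells[OF c vcomp_cells[OF d k e(2)]] _ _ densely_True])
    fix U u assume U: "U \<in> obs X" and "u \<in> sec (w_tor (cdom (wvcomp (wvcomp c d) k))) U"
    hence u: "u \<in> sec (w_tor (cdom c)) U" by simp
    have "cellmap c U u \<in> sec (w_tor (cdom d)) U" using cellmap_sec[OF c U u] e(1) by simp
    thus "cellmap (wvcomp (wvcomp c d) k) U u = cellmap (wvcomp c (wvcomp d k)) U u"
      using U u by (simp add: vcomp_map)
  qed (use e in simp_all)
  show "\<lbrakk>c \<in> W2; d \<in> W2; fst (snd (cdom c)) = fst (cdom d)\<rbrakk>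
      \<Longrightarrow> whcomp c d \<in> hom2 Wcat (wcomp (cdom c) (cdom d)) (wcomp (ccod c) (ccod d))"
    using hcomps_cells[of c d] unfolding hom2_def by simp
  show "\<lbrakk>F \<in> W1; H \<in> W1; fst (snd F) = fst H\<rbrakk>
      \<Longrightarrow> whcomp (wone2 F) (wone2 H) = wone2 (wcomp F H)" by (rule w_hcomp_one)
  show "\<lbrakk>c \<in> W2; c' \<in> W2; d \<in> W2; d' \<in> W2; ccod c = cdom c'; ccod d = cdom d';
      fst (snd (cdom c)) = fst (cdom d)\<rbrakk>
    \<Longrightarrow> whcomp (wvcomp c c') (wvcomp d d') = wvcomp (whcomp c d) (whcomp c' d')"
    by (rule w_interchange)
  show "wassoc F H K \<in> iso2 Wcat (wcomp (wcomp F H) K) (wcomp F (wcomp H K))"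
    if "F \<in> W1" "H \<in> W1" "K \<in> W1" "fst (snd F) = fst H" "fst (snd H) = fst K"
    by (rule w_iso2[OF assoc_cell[OF that] assoc_dom[OF that]])
  show "\<lbrakk>c \<in> W2; d \<in> W2; k \<in> W2; fst (snd (cdom c)) = fst (cdom d);
      fst (snd (cdom d)) = fst (cdom k)\<rbrakk>
    \<Longrightarrow> wvcomp (whcomp (whcomp c d) k) (wassoc (ccod c) (ccod d) (ccod k))
      = wvcomp (wassoc (cdom c) (cdom d) (cdom k)) (whcomp c (whcomp d k))"
    by (rule w_assoc_natural)
  show "wlunit F \<in> iso2 Wcat (wcomp (wone (fst F)) F) F" if "F \<in> W1"
    by (rule w_iso2[OF lunit_cell[OF that] lunit_dom[OF that]])
  show "c \<in> W2 \<Longrightarrow>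
      wvcomp (whcomp (wone2 (wone (fst (cdom c)))) c) (wlunit (ccod c)) = wvcomp (wlunit (cdom c)) c"
    by (rule w_lunit_natural)
  show "wrunit F \<in> iso2 Wcat (wcomp F (wone (fst (snd F)))) F" if "F \<in> W1"
    by (rule w_iso2[OF runit_cell[OF that] runit_dom[OF that]])
  show "c \<in> W2 \<Longrightarrow>
      wvcomp (whcomp c (wone2 (wone (fst (snd (cdom c)))))) (wrunit (ccod c)) = wvcomp (wrunit (cdom c)) c"
    by (rule w_runit_natural)
  show "\<lbrakk>F \<in> W1; H \<in> W1; K \<in> W1; L \<in> W1;
      fst (snd F) = fst H; fst (snd H) = fst K; fst (snd K) = fst L\<rbrakk>
    \<Longrightarrow> wvcomp (wassoc (wcomp F H) K L) (wassoc F H (wcomp K L))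
      = wvcomp (whcomp (wassoc F H K) (wone2 L))
          (wvcomp (wassoc F (wcomp H K) L) (whcomp (wone2 F) (wassoc H K L)))"
    by (rule w_pentagon)
  show "\<lbrakk>F \<in> W1; H \<in> W1; fst (snd F) = fst H\<rbrakk>
    \<Longrightarrow> wvcomp (wassoc F (wone (fst (snd F))) H) (whcomp (wone2 F) (wlunit H))
      = whcomp (wrunit F) (wone2 H)"
    by (rule w_triangle)
qed

lemma W_locally_groupoidal: "locally_groupoidal Wcat"
  unfolding locally_groupoidal_def by (simp add: w_iso2)

end

section \<open>The 2-groupoid of arrows given by global sections\<close>

context grothendieck_site
begin

lemma gsecD:
  assumes "s \<in> gsec X F"
  shows gsec_sec: "U \<in> obs X \<Longrightarrow> s U \<in> sec F U"
    and gsec_res: "f \<in> into X U \<Longrightarrow> res F f (s U) = s (dm X f)"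
  using assms unfolding gsec_def by (auto simp: into_def)

lemma gsecI:
  assumes "\<And>U. U \<in> obs X \<Longrightarrow> k U \<in> sec F U"
    and "\<And>U f. f \<in> into X U \<Longrightarrow> res F f (k U) = k (dm X f)"
  shows "(\<lambda>U\<in>obs X. k U) \<in> gsec X F"
  using assms(1) assms(2)[OF intoI] cd_obs dm_obs unfolding gsec_def by auto

lemma gsec_eqI:
  assumes "s \<in> gsec X F" "s' \<in> gsec X F" "\<And>U. U \<in> obs X \<Longrightarrow> s U = s' U"
  shows "s = s'"
proof (rule extensionalityI[of _ "obs X"])
  show "s \<in> extensional (obs X)" "s' \<in> extensional (obs X)"
    using assms(1,2) unfolding gsec_def PiE_def by auto
qed (rule assms(3))

end

context gamma_xmod
begin

abbreviation "zt F \<equiv> fst (snd (snd F))"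
abbreviation "zg F \<equiv> snd (snd (snd F))"

lemma z_arr_iff:
  "F \<in> Z1 \<longleftrightarrow> fst F \<in> Z0 \<and> fst (snd F) \<in> Z0 \<and> zg F \<in> gsec X (G0 G) \<and>
     zt F \<in> maps X (tot (fst F)) (tot (fst (snd F))) \<and>
     (\<forall>U\<in>obs X. local_arrow (fst F) (fst (snd F)) U (zt F U) (zg F U))"
  using z_arrows_iff[of "fst F" "fst (snd F)" "zt F" "zg F"] by simp

lemma z_arr:
  assumes "F \<in> Z1"
  shows z_src: "fst F \<in> Z0" and z_trg: "fst (snd F) \<in> Z0"
    and zg_gsec: "zg F \<in> gsec X (G0 G)" and zt_maps: "zt F \<in> maps X (tot (fst F)) (tot (fst (snd F)))"
    and z_local: "U \<in> obs X \<Longrightarrow> local_arrow (fst F) (fst (snd F)) U (zt F U) (zg F U)"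
    and zg_sec: "U \<in> obs X \<Longrightarrow> zg F U \<in> sec (G0 G) U"
proof -
  show "fst F \<in> Z0" "fst (snd F) \<in> Z0" and g: "zg F \<in> gsec X (G0 G)"
    and "zt F \<in> maps X (tot (fst F)) (tot (fst (snd F)))"
    and "U \<in> obs X \<Longrightarrow> local_arrow (fst F) (fst (snd F)) U (zt F U) (zg F U)"
    using assms unfolding z_arr_iff by blast+
  show "U \<in> obs X \<Longrightarrow> zg F U \<in> sec (G0 G) U" by (rule gsec_sec[OF g])
qed

lemma z_cell_iff:
  "c \<in> Z2 \<longleftrightarrow> cdom c \<in> Z1 \<and> ccod c \<in> Z1 \<and>
     fst (ccod c) = fst (cdom c) \<and> fst (snd (ccod c)) = fst (snd (cdom c)) \<and> cellmap c \<in> gsec X (G1 G) \<and>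
     (\<forall>U\<in>obs X. zg (cdom c) U \<otimes>\<^bsub>grp (G0 G) U\<^esub> bd G U (cellmap c U) = zg (ccod c) U) \<and>
     (\<forall>U\<in>obs X. \<forall>x\<in>sec (tot (fst (cdom c))) U. zt (ccod c) U x =
        inv\<^bsub>grp (tot (fst (snd (cdom c)))) U\<^esub> (inc (fst (snd (cdom c))) U (cellmap c U))
          \<otimes>\<^bsub>grp (tot (fst (snd (cdom c)))) U\<^esub> zt (cdom c) U x
          \<otimes>\<^bsub>grp (tot (fst (snd (cdom c)))) U\<^esub> inc (fst (snd (cdom c))) U (cellmap c U))"
proof -
  obtain A B t g A' B' t' g' m where c: "c = ((A, B, t, g), (A', B', t', g'), m)"
    by (metis prod.collapse)
  show ?thesis unfolding c z_cells_def by simp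
qed

lemma z_cell:
  assumes "c \<in> Z2"
  shows zc_dom: "cdom c \<in> Z1" and zc_cod: "ccod c \<in> Z1"
    and zc_src: "fst (ccod c) = fst (cdom c)" and zc_trg: "fst (snd (ccod c)) = fst (snd (cdom c))"
    and zc_gsec: "cellmap c \<in> gsec X (G1 G)"
    and zc_g: "U \<in> obs X \<Longrightarrow> zg (ccod c) U = zg (cdom c) U \<otimes>\<^bsub>grp (G0 G) U\<^esub> bd G U (cellmap c U)"
    and zc_t: "\<lbrakk>U \<in> obs X; x \<in> sec (tot (fst (cdom c))) U\<rbrakk> \<Longrightarrow> zt (ccod c) U x =
        inv\<^bsub>grp (tot (fst (snd (cdom c)))) U\<^esub> (inc (fst (snd (cdom c))) U (cellmap c U))
          \<otimes>\<^bsub>grp (tot (fst (snd (cdom c)))) U\<^esub> zt (cdom c) U x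
          \<otimes>\<^bsub>grp (tot (fst (snd (cdom c)))) U\<^esub> inc (fst (snd (cdom c))) U (cellmap c U)"
    and zc_sec: "U \<in> obs X \<Longrightarrow> cellmap c U \<in> sec (G1 G) U"
proof -
  note a = assms[unfolded z_cell_iff]
  show "cdom c \<in> Z1" "ccod c \<in> Z1" "fst (ccod c) = fst (cdom c)"
    "fst (snd (ccod c)) = fst (snd (cdom c))" and g: "cellmap c \<in> gsec X (G1 G)" using a by blast+
  show "U \<in> obs X \<Longrightarrow> zg (ccod c) U = zg (cdom c) U \<otimes>\<^bsub>grp (G0 G) U\<^esub> bd G U (cellmap c U)" using a by simp
  show "\<lbrakk>U \<in> obs X; x \<in> sec (tot (fst (cdom c))) U\<rbrakk> \<Longrightarrow> zt (ccod c) U x =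
        inv\<^bsub>grp (tot (fst (snd (cdom c)))) U\<^esub> (inc (fst (snd (cdom c))) U (cellmap c U))
          \<otimes>\<^bsub>grp (tot (fst (snd (cdom c)))) U\<^esub> zt (cdom c) U x
          \<otimes>\<^bsub>grp (tot (fst (snd (cdom c)))) U\<^esub> inc (fst (snd (cdom c))) U (cellmap c U)" using a by blast
  show "U \<in> obs X \<Longrightarrow> cellmap c U \<in> sec (G1 G) U" by (rule gsec_sec[OF g])
qed

lemma zcell_eqI:
  assumes "c \<in> Z2" "d \<in> Z2" "cdom c = cdom d" "ccod c = ccod d"
    and "\<And>U. U \<in> obs X \<Longrightarrow> cellmap c U = cellmap d U"
  shows "c = d"
  using gsec_eqI[OF zc_gsec[OF assms(1)] zc_gsec[OF assms(2)] assms(5)] assms(3,4) by (simp add: prod_eq_iff)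

lemma Z_simps [simp]:
  "Ob Zcat = Z0" "Ar Zcat = Z1" "Ce Zcat = Z2"
  "src Zcat F = fst F" "trg Zcat F = fst (snd F)"
  "vdom Zcat c = cdom c" "vcod Zcat c = ccod c"
  "one1 Zcat = zone" "comp1 Zcat = zcomp" "one2 Zcat F = ztriv F F"
  "vcomp Zcat = zvcomp" "hcomp Zcat = zhcomp"
  "assoc Zcat F H K = ztriv (zcomp (zcomp F H) K) (zcomp F (zcomp H K))"
  "lunit Zcat F = ztriv (zcomp (zone (fst F)) F) F"
  "runit Zcat F = ztriv (zcomp F (zone (fst (snd F)))) F"
  unfolding Z_cat_def by (simp_all add: case_prod_beta)

lemma z_data_simps [simp]:
  "fst (zcomp F H) = fst F" "fst (snd (zcomp F H)) = fst (snd H)"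
  "zt (zcomp F H) = mk_map X (tot (fst F)) (\<lambda>U x. zt H U (zt F U x))"
  "zg (zcomp F H) = (\<lambda>U\<in>obs X. zg F U \<otimes>\<^bsub>grp (G0 G) U\<^esub> zg H U)"
  "fst (zone A) = A" "fst (snd (zone A)) = A" "zt (zone A) = mk_map X (tot A) (\<lambda>U x. x)"
  "zg (zone A) = (\<lambda>U\<in>obs X. \<one>\<^bsub>grp (G0 G) U\<^esub>)"
  "cdom (ztriv F H) = F" "ccod (ztriv F H) = H" "cellmap (ztriv F H) = (\<lambda>U\<in>obs X. \<one>\<^bsub>grp (G1 G) U\<^esub>)"
  "cdom (zvcomp c d) = cdom c" "ccod (zvcomp c d) = ccod d"
  "cellmap (zvcomp c d) = (\<lambda>U\<in>obs X. cellmap c U \<otimes>\<^bsub>grp (G1 G) U\<^esub> cellmap d U)"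
  "cdom (zhcomp c d) = zcomp (cdom c) (cdom d)" "ccod (zhcomp c d) = zcomp (ccod c) (ccod d)"
  "cellmap (zhcomp c d) = (\<lambda>U\<in>obs X. ract G U (cellmap c U) (zg (cdom d) U) \<otimes>\<^bsub>grp (G1 G) U\<^esub> cellmap d U)"
  unfolding z_comp1_def z_one1_def z_triv_def z_vcomp_def z_hcomp_def by (simp_all add: case_prod_beta)

lemma local_arrow_cong:
  assumes A: "A \<in> Z0" and U: "U \<in> obs X" and s: "\<And>x. x \<in> sec (tot A) U \<Longrightarrow> s x = r x"
  shows "local_arrow A B U s g \<longleftrightarrow> local_arrow A B U r g"
proof -
  have "s \<in> iso (grp (tot A) U) (grp (tot B) U) \<longleftrightarrow> r \<in> iso (grp (tot A) U) (grp (tot B) U)"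
    using s mult_sec[OF tot[OF A] U] bij_betw_cong[of "sec (tot A) U" s r]
    unfolding iso_def hom_def by (auto simp: Pi_iff)
  thus ?thesis using s inc_sec[OF A U] unfolding local_arrow_def by simp
qed

lemma z_comp_arr:
  assumes F: "F \<in> Z1" and H: "H \<in> Z1" and e: "fst (snd F) = fst H"
  shows "zcomp F H \<in> Z1"
  unfolding z_arr_iff z_data_simps
proof (intro conjI ballI z_src[OF F] z_trg[OF H])
  note P = grp_presheaf[OF tot[OF z_src[OF F]]]
  note tF = zt_maps[OF F] and tH = zt_maps[OF H]
  show "(\<lambda>U\<in>obs X. zg F U \<otimes>\<^bsub>grp (G0 G) U\<^esub> zg H U) \<in> gsec X (G0 G)"
  proof (rule gsecI)
    show "zg F U \<otimes>\<^bsub>grp (G0 G) U\<^esub> zg H U \<in> sec (G0 G) U" if U: "U \<in> obs X" for U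
      by (rule mult_sec[OF G0 U zg_sec[OF F U] zg_sec[OF H U]])
    show "res (G0 G) f (zg F U \<otimes>\<^bsub>grp (G0 G) U\<^esub> zg H U) = zg F (dm X f) \<otimes>\<^bsub>grp (G0 G) (dm X f)\<^esub> zg H (dm X f)"
      if f: "f \<in> into X U" for U f
      unfolding res_mult[OF G0 f zg_sec[OF F into_obs[OF f]] zg_sec[OF H into_obs[OF f]]]
        gsec_res[OF zg_gsec[OF F] f] gsec_res[OF zg_gsec[OF H] f] ..
  qed
  have s: "zt F U x \<in> sec (tot (fst H)) U" if "U \<in> obs X" "x \<in> sec (tot (fst F)) U" for U x
    using maps_sec[OF tF that] e by simp
  show "mk_map X (tot (fst F)) (\<lambda>U x. zt H U (zt F U x)) \<in> maps X (tot (fst F)) (tot (fst (snd H)))"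
  proof (rule mapsI[OF _ _ P])
    fix U x assume U: "U \<in> obs X" and x: "x \<in> sec (tot (fst F)) U"
    show "zt H U (zt F U x) \<in> sec (tot (fst (snd H))) U" by (rule maps_sec[OF tH U s[OF U x]])
    show "res (tot (fst (snd H))) f (zt H U (zt F U x)) = zt H (dm X f) (zt F (dm X f) (res (tot (fst F)) f x))"
      if f: "f \<in> into X U" for f
      using maps_res[OF tH f s[OF U x]] maps_res[OF tF f x] e by simp
  qed
  fix U assume U: "U \<in> obs X"
  have H': "local_arrow (fst (snd F)) (fst (snd H)) U (zt H U) (zg H U)" using z_local[OF H U] e by simp
  have l: "local_arrow (fst F) (fst (snd H)) U (\<lambda>x. zt H U (zt F U x)) (zg F U \<otimes>\<^bsub>grp (G0 G) U\<^esub> zg H U)"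
    by (rule local_arrow_comp[OF z_local[OF F U] H' z_src[OF F] z_trg[OF F] z_trg[OF H] U zg_sec[OF F U] zg_sec[OF H U]])
  show "local_arrow (fst F) (fst (snd H)) U (mk_map X (tot (fst F)) (\<lambda>U x. zt H U (zt F U x)) U)
      ((\<lambda>U\<in>obs X. zg F U \<otimes>\<^bsub>grp (G0 G) U\<^esub> zg H U) U)"
    using l local_arrow_cong[OF z_src[OF F] U, of "mk_map X (tot (fst F)) (\<lambda>U x. zt H U (zt F U x)) U" "\<lambda>x. zt H U (zt F U x)"]
      U by simp
qed

lemma z_one_arr:
  assumes A: "A \<in> Z0"
  shows "zone A \<in> Z1"
  unfolding z_arr_iff z_data_simps
proof (intro conjI ballI A)
  show "(\<lambda>U\<in>obs X. \<one>\<^bsub>grp (G0 G) U\<^esub>) \<in> gsec X (G0 G)"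
    by (rule gsecI) (rule one_sec[OF G0] res_one[OF G0]; assumption)+
  show "mk_map X (tot A) (\<lambda>U x. x) \<in> maps X (tot A) (tot A)"
    by (rule mapsI[OF _ _ grp_presheaf[OF tot[OF A]]]) simp_all
  fix U assume U: "U \<in> obs X"
  show "local_arrow A A U (mk_map X (tot A) (\<lambda>U x. x) U) ((\<lambda>U\<in>obs X. \<one>\<^bsub>grp (G0 G) U\<^esub>) U)"
    using local_arrow_id[OF A U] local_arrow_cong[OF A U, of "mk_map X (tot A) (\<lambda>U x. x) U" "\<lambda>x. x"] U by simp
qed

text \<open>Composites in \<open>G\<^sub>0\<close> and of maps are strictly associative and unital, so the unit
  section is a 2-arrow between the two sides of each of these laws; this lemma supplies all structural
  2-arrows.\<close>

lemma z_triv_cell: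
  assumes F: "F \<in> Z1" and H: "H \<in> Z1"
    and e: "fst H = fst F" "fst (snd H) = fst (snd F)"
    and g: "\<And>U. U \<in> obs X \<Longrightarrow> zg F U = zg H U"
    and t: "\<And>U x. \<lbrakk>U \<in> obs X; x \<in> sec (tot (fst F)) U\<rbrakk> \<Longrightarrow> zt F U x = zt H U x"
  shows "ztriv F H \<in> Z2"
  unfolding z_cell_iff z_data_simps
proof (intro conjI ballI F H e)
  show "(\<lambda>U\<in>obs X. \<one>\<^bsub>grp (G1 G) U\<^esub>) \<in> gsec X (G1 G)"
    by (rule gsecI) (rule one_sec[OF G1] res_one[OF G1]; assumption)+
  fix U assume U: "U \<in> obs X"
  interpret K: section_group "G0 G" U by (rule section_groupI[OF G0 U])
  show "zg F U \<otimes>\<^bsub>grp (G0 G) U\<^esub> bd G U ((\<lambda>U\<in>obs X. \<one>\<^bsub>grp (G1 G) U\<^esub>) U) = zg H U"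
    using g[OF U] U bd_one[OF U] zg_sec[OF H U] by simp
  fix x assume x: "x \<in> sec (tot (fst F)) U"
  interpret E: section_group "tot (fst (snd F))" U by (rule section_groupI[OF tot[OF z_trg[OF F]] U])
  show "zt H U x = inv\<^bsub>grp (tot (fst (snd F))) U\<^esub> (inc (fst (snd F)) U ((\<lambda>U\<in>obs X. \<one>\<^bsub>grp (G1 G) U\<^esub>) U))
      \<otimes>\<^bsub>grp (tot (fst (snd F))) U\<^esub> zt F U x \<otimes>\<^bsub>grp (tot (fst (snd F))) U\<^esub> inc (fst (snd F)) U ((\<lambda>U\<in>obs X. \<one>\<^bsub>grp (G1 G) U\<^esub>) U)"
    using t[OF U x] U inc_one[OF z_trg[OF F] U] maps_sec[OF zt_maps[OF F] U x] by simp
qed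

lemma z_vcomp_cell:
  assumes c: "c \<in> Z2" and d: "d \<in> Z2" and e: "ccod c = cdom d"
  shows "zvcomp c d \<in> Z2"
  unfolding z_cell_iff z_data_simps
proof (intro conjI ballI zc_dom[OF c] zc_cod[OF d])
  show "fst (ccod d) = fst (cdom c)" "fst (snd (ccod d)) = fst (snd (cdom c))"
    using zc_src[OF c] zc_src[OF d] zc_trg[OF c] zc_trg[OF d] e by simp_all
  show "(\<lambda>U\<in>obs X. cellmap c U \<otimes>\<^bsub>grp (G1 G) U\<^esub> cellmap d U) \<in> gsec X (G1 G)"
  proof (rule gsecI)
    show "cellmap c U \<otimes>\<^bsub>grp (G1 G) U\<^esub> cellmap d U \<in> sec (G1 G) U" if U: "U \<in> obs X" for U
      by (rule mult_sec[OF G1 U zc_sec[OF c U] zc_sec[OF d U]])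
    show "res (G1 G) f (cellmap c U \<otimes>\<^bsub>grp (G1 G) U\<^esub> cellmap d U)
        = cellmap c (dm X f) \<otimes>\<^bsub>grp (G1 G) (dm X f)\<^esub> cellmap d (dm X f)" if f: "f \<in> into X U" for U f
      unfolding res_mult[OF G1 f zc_sec[OF c into_obs[OF f]] zc_sec[OF d into_obs[OF f]]]
        gsec_res[OF zc_gsec[OF c] f] gsec_res[OF zc_gsec[OF d] f] ..
  qed
  fix U assume U: "U \<in> obs X"
  interpret K: section_group "G0 G" U by (rule section_groupI[OF G0 U])
  note m = zc_sec[OF c U] and n = zc_sec[OF d U]
  show "zg (cdom c) U \<otimes>\<^bsub>grp (G0 G) U\<^esub> bd G U ((\<lambda>U\<in>obs X. cellmap c U \<otimes>\<^bsub>grp (G1 G) U\<^esub> cellmap d U) U) = zg (ccod d) U"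
    using zc_g[OF c U] zc_g[OF d U] e U bd_mult[OF U m n] zg_sec[OF zc_dom[OF c] U] bd_sec[OF U m] bd_sec[OF U n]
    by (simp add: K.m_assoc)
  fix x assume x: "x \<in> sec (tot (fst (cdom c))) U"
  let ?B = "fst (snd (cdom c))"
  note B = z_trg[OF zc_dom[OF c]]
  interpret E: section_group "tot ?B" U by (rule section_groupI[OF tot[OF B] U])
  have x': "x \<in> sec (tot (fst (cdom d))) U" using x zc_src[OF c] e by simp
  have B': "fst (snd (cdom d)) = ?B" using zc_trg[OF c] e by simp
  show "zt (ccod d) U x = inv\<^bsub>grp (tot ?B) U\<^esub> (inc ?B U ((\<lambda>U\<in>obs X. cellmap c U \<otimes>\<^bsub>grp (G1 G) U\<^esub> cellmap d U) U))
      \<otimes>\<^bsub>grp (tot ?B) U\<^esub> zt (cdom c) U x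
      \<otimes>\<^bsub>grp (tot ?B) U\<^esub> inc ?B U ((\<lambda>U\<in>obs X. cellmap c U \<otimes>\<^bsub>grp (G1 G) U\<^esub> cellmap d U) U)"
    using zc_t[OF d U x'] zc_t[OF c U x] e U inc_mult[OF B U m n] inc_sec[OF B U m] inc_sec[OF B U n]
      maps_sec[OF zt_maps[OF zc_dom[OF c]] U x]
    unfolding B' by (simp add: E.m_assoc E.inv_mult_group)
qed

text \<open>Applying \<open>t'\<close> to a conjugate by \<open>\<iota>(\<mu>)\<close> gives a conjugate by
  \<open>\<iota>(\<mu>\<^sup>g\<^sup>')\<close>, as \<open>t' \<iota>(\<mu>) =
  \<iota>(\<mu>\<^sup>g\<^sup>')\<close>; the second 2-arrow then conjugates by
  \<open>\<iota>(\<mu>')\<close>.\<close>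

lemma z_hcomp_cell:
  assumes c: "c \<in> Z2" and d: "d \<in> Z2" and e: "fst (snd (cdom c)) = fst (cdom d)"
  shows "zhcomp c d \<in> Z2"
proof -
  note F = zc_dom[OF c] and F' = zc_dom[OF d] and H = zc_cod[OF c] and H' = zc_cod[OF d]
  have e': "fst (snd (ccod c)) = fst (ccod d)" using e zc_trg[OF c] zc_src[OF d] by simp
  let ?m = "\<lambda>U. ract G U (cellmap c U) (zg (cdom d) U) \<otimes>\<^bsub>grp (G1 G) U\<^esub> cellmap d U"
  have ms: "ract G U (cellmap c U) (zg (cdom d) U) \<in> sec (G1 G) U" if U: "U \<in> obs X" for U
    by (rule ract_sec[OF U zg_sec[OF F' U] zc_sec[OF c U]])
  show ?thesis
    unfolding z_cell_iff z_data_simps(9-17) z_data_simps(1,2)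
  proof (intro conjI ballI z_comp_arr[OF F F' e] z_comp_arr[OF H H' e'])
    show "fst (ccod c) = fst (cdom c)" "fst (snd (ccod d)) = fst (snd (cdom d))"
      by (rule zc_src[OF c] zc_trg[OF d])+
    show "(\<lambda>U\<in>obs X. ?m U) \<in> gsec X (G1 G)"
    proof (rule gsecI)
      show "?m U \<in> sec (G1 G) U" if U: "U \<in> obs X" for U by (rule mult_sec[OF G1 U ms[OF U] zc_sec[OF d U]])
      show "res (G1 G) f (?m U) = ?m (dm X f)" if f: "f \<in> into X U" for U f
        unfolding res_mult[OF G1 f ms[OF into_obs[OF f]] zc_sec[OF d into_obs[OF f]]]
          ract_res[OF f zc_sec[OF c into_obs[OF f]] zg_sec[OF F' into_obs[OF f]]]
          gsec_res[OF zc_gsec[OF c] f] gsec_res[OF zc_gsec[OF d] f] gsec_res[OF zg_gsec[OF F'] f] ..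
    qed
    fix U assume U: "U \<in> obs X"
    note m = zc_sec[OF c U] and n = zc_sec[OF d U] and g = zg_sec[OF F U] and g' = zg_sec[OF F' U]
    interpret K: section_group "G0 G" U by (rule section_groupI[OF G0 U])
    show "zg (zcomp (cdom c) (cdom d)) U \<otimes>\<^bsub>grp (G0 G) U\<^esub> bd G U ((\<lambda>U\<in>obs X. ?m U) U)
        = zg (zcomp (ccod c) (ccod d)) U"
      using U zc_g[OF c U] zc_g[OF d U] bd_mult[OF U ms[OF U] n] bd_ract[OF U m g'] g g' bd_sec[OF U m] bd_sec[OF U n]
      by (simp add: K.m_assoc)
    fix x assume x: "x \<in> sec (tot (fst (cdom c))) U"
    let ?B = "fst (cdom d)" and ?C = "fst (snd (cdom d))" and ?t = "zt (cdom d) U"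
    note B = z_src[OF F'] and C = z_trg[OF F']
    interpret B: section_group "tot ?B" U by (rule section_groupI[OF tot[OF B] U])
    interpret E: section_group "tot ?C" U by (rule section_groupI[OF tot[OF C] U])
    have x': "x \<in> sec (tot (fst (ccod c))) U" using x zc_src[OF c] by simp
    have tx: "zt (cdom c) U x \<in> sec (tot ?B) U" using maps_sec[OF zt_maps[OF F] U x] e by simp
    have t'x: "zt (ccod c) U x = inv\<^bsub>grp (tot ?B) U\<^esub> (inc ?B U (cellmap c U)) \<otimes>\<^bsub>grp (tot ?B) U\<^esub> zt (cdom c) U x
        \<otimes>\<^bsub>grp (tot ?B) U\<^esub> inc ?B U (cellmap c U)" using zc_t[OF c U x] e by simp
    note im = inc_sec[OF B U m] and imi = inc_sec[OF B U inv_sec[OF G1 U m]]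
    note loc = z_local[OF F' U]
    have t'xs: "zt (ccod c) U x \<in> sec (tot ?B) U" unfolding t'x using im tx by simp
    have "?t (zt (ccod c) U x) = inv\<^bsub>grp (tot ?C) U\<^esub> (inc ?C U (ract G U (cellmap c U) (zg (cdom d) U)))
        \<otimes>\<^bsub>grp (tot ?C) U\<^esub> ?t (zt (cdom c) U x) \<otimes>\<^bsub>grp (tot ?C) U\<^esub> inc ?C U (ract G U (cellmap c U) (zg (cdom d) U))"
      unfolding t'x inc_inv[OF B U m, symmetric] la_mult[OF loc mult_sec[OF tot[OF B] U imi tx] im]
        la_mult[OF loc imi tx] la_inc[OF loc m] la_inc[OF loc inv_sec[OF G1 U m]] ract_inv[OF U g' m]
        inc_inv[OF C U ms[OF U]] ..
    thus "zt (zcomp (ccod c) (ccod d)) U x = inv\<^bsub>grp (tot ?C) U\<^esub> (inc ?C U ((\<lambda>U\<in>obs X. ?m U) U))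
      \<otimes>\<^bsub>grp (tot ?C) U\<^esub> zt (zcomp (cdom c) (cdom d)) U x \<otimes>\<^bsub>grp (tot ?C) U\<^esub> inc ?C U ((\<lambda>U\<in>obs X. ?m U) U)"
      using U x x' zc_t[OF d U t'xs] inc_mult[OF C U ms[OF U] n] inc_sec[OF C U ms[OF U]] inc_sec[OF C U n] la_sec[OF loc tx]
      by (simp add: E.m_assoc E.inv_mult_group)
  qed
qed

lemma z_cell_inverse:
  assumes c: "c \<in> Z2"
  shows "\<exists>d\<in>Z2. cdom d = ccod c \<and> ccod d = cdom c \<and> zvcomp c d = ztriv (cdom c) (cdom c) \<and>
     zvcomp d c = ztriv (ccod c) (ccod c)"
proof -
  let ?i = "\<lambda>U\<in>obs X. inv\<^bsub>grp (G1 G) U\<^esub> (cellmap c U)"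
  let ?d = "(ccod c, cdom c, ?i)"
  have A: "group (grp (G1 G) U)" if "U \<in> obs X" for U by (rule grp_group[OF G1 that])
  have d: "?d \<in> Z2"
    unfolding z_cell_iff fst_conv snd_conv
  proof (intro conjI ballI zc_dom[OF c] zc_cod[OF c])
    show "fst (cdom c) = fst (ccod c)" "fst (snd (cdom c)) = fst (snd (ccod c))"
      by (rule zc_src[OF c, symmetric], rule zc_trg[OF c, symmetric])
    show "?i \<in> gsec X (G1 G)"
    proof (rule gsecI)
      show "inv\<^bsub>grp (G1 G) U\<^esub> (cellmap c U) \<in> sec (G1 G) U" if U: "U \<in> obs X" for U
        by (rule inv_sec[OF G1 U zc_sec[OF c U]])
      show "res (G1 G) f (inv\<^bsub>grp (G1 G) U\<^esub> (cellmap c U)) = inv\<^bsub>grp (G1 G) (dm X f)\<^esub> (cellmap c (dm X f))"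
        if f: "f \<in> into X U" for U f
        unfolding res_inv[OF G1 f zc_sec[OF c into_obs[OF f]]] gsec_res[OF zc_gsec[OF c] f] ..
    qed
    fix U assume U: "U \<in> obs X"
    note m = zc_sec[OF c U]
    interpret K: section_group "G0 G" U by (rule section_groupI[OF G0 U])
    show "zg (ccod c) U \<otimes>\<^bsub>grp (G0 G) U\<^esub> bd G U (?i U) = zg (cdom c) U"
      using U zc_g[OF c U] bd_inv[OF U m] bd_sec[OF U m] zg_sec[OF zc_dom[OF c] U] by (simp add: K.m_assoc)
    fix x assume "x \<in> sec (tot (fst (ccod c))) U"
    hence x: "x \<in> sec (tot (fst (cdom c))) U" using zc_src[OF c] by simp
    let ?B = "fst (snd (cdom c))"
    note B = z_trg[OF zc_dom[OF c]]
    interpret E: section_group "tot ?B" U by (rule section_groupI[OF tot[OF B] U])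
    show "zt (cdom c) U x = inv\<^bsub>grp (tot (fst (snd (ccod c)))) U\<^esub> (inc (fst (snd (ccod c))) U (?i U))
       \<otimes>\<^bsub>grp (tot (fst (snd (ccod c)))) U\<^esub> zt (ccod c) U x \<otimes>\<^bsub>grp (tot (fst (snd (ccod c)))) U\<^esub> inc (fst (snd (ccod c))) U (?i U)"
      using U zc_t[OF c U x] inc_inv[OF B U m] inc_sec[OF B U m] maps_sec[OF zt_maps[OF zc_dom[OF c]] U x]
      unfolding zc_trg[OF c] by (simp add: E.m_assoc)
  qed
  have t: "ztriv F F \<in> Z2" if "F \<in> Z1" for F
    by (rule z_triv_cell[OF that that]) simp_all
  have e: "cdom ?d = ccod c" "ccod ?d = cdom c" by simp_all
  have i: "inv\<^bsub>grp (G1 G) U\<^esub> (cellmap c U) \<otimes>\<^bsub>grp (G1 G) U\<^esub> cellmap c U = \<one>\<^bsub>grp (G1 G) U\<^esub>"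
      "cellmap c U \<otimes>\<^bsub>grp (G1 G) U\<^esub> inv\<^bsub>grp (G1 G) U\<^esub> (cellmap c U) = \<one>\<^bsub>grp (G1 G) U\<^esub>"
    if U: "U \<in> obs X" for U
    using group.l_inv[OF A[OF U]] group.r_inv[OF A[OF U]] zc_sec[OF c U] by simp_all
  have "zvcomp c ?d = ztriv (cdom c) (cdom c)"
    by (rule zcell_eqI[OF z_vcomp_cell[OF c d e(1)[symmetric]] t[OF zc_dom[OF c]]]) (simp_all add: i)
  moreover have "zvcomp ?d c = ztriv (ccod c) (ccod c)"
    by (rule zcell_eqI[OF z_vcomp_cell[OF d c e(2)] t[OF zc_cod[OF c]]]) (simp_all add: i)
  ultimately show ?thesis using d e by blast
qed

lemma z_iso2:
  assumes c: "c \<in> Z2" and e: "cdom c = F" "ccod c = H"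
  shows "c \<in> iso2 Zcat F H"
proof -
  obtain d where "d \<in> Z2" "cdom d = H" "ccod d = F" "zvcomp c d = ztriv F F"
     "zvcomp d c = ztriv H H" using z_cell_inverse[OF c] e by blast
  thus ?thesis using c e unfolding iso2_def hom2_def by (intro CollectI conjI bexI[of _ d]) simp_all
qed

lemma z_one2: "F \<in> Z1 \<Longrightarrow> ztriv F F \<in> Z2"
  by (rule z_triv_cell) simp_all

lemma z_zt_sec:
  assumes "F \<in> Z1" "fst (snd F) = B" "U \<in> obs X" "x \<in> sec (tot (fst F)) U"
  shows "zt F U x \<in> sec (tot B) U"
  using maps_sec[OF zt_maps[OF assms(1)] assms(3,4)] assms(2) by simp

lemma z_assoc_cell:
  assumes F: "F \<in> Z1" and H: "H \<in> Z1" and K: "K \<in> Z1"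
    and e: "fst (snd F) = fst H" "fst (snd H) = fst K"
  shows "ztriv (zcomp (zcomp F H) K) (zcomp F (zcomp H K)) \<in> Z2"
proof (rule z_triv_cell)
  have e': "fst (snd (zcomp F H)) = fst K" "fst (snd F) = fst (zcomp H K)" using e by simp_all
  show "zcomp (zcomp F H) K \<in> Z1" "zcomp F (zcomp H K) \<in> Z1"
    by (rule z_comp_arr[OF z_comp_arr[OF F H e(1)] K e'(1)], rule z_comp_arr[OF F z_comp_arr[OF H K e(2)] e'(2)])
  fix U assume U: "U \<in> obs X"
  interpret G0: section_group "G0 G" U by (rule section_groupI[OF G0 U])
  show "zg (zcomp (zcomp F H) K) U = zg (zcomp F (zcomp H K)) U"
    using U zg_sec[OF F U] zg_sec[OF H U] zg_sec[OF K U] by (simp add: G0.m_assoc)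
  show "zt (zcomp (zcomp F H) K) U x = zt (zcomp F (zcomp H K)) U x"
    if "x \<in> sec (tot (fst (zcomp (zcomp F H) K))) U" for x
    using U that z_zt_sec[OF F e(1) U, of x] by simp
qed simp_all

lemma z_lunit_cell:
  assumes F: "F \<in> Z1"
  shows "ztriv (zcomp (zone (fst F)) F) F \<in> Z2"
proof (rule z_triv_cell[OF z_comp_arr[OF z_one_arr[OF z_src[OF F]] F] F])
  fix U assume U: "U \<in> obs X"
  interpret G0: section_group "G0 G" U by (rule section_groupI[OF G0 U])
  show "zg (zcomp (zone (fst F)) F) U = zg F U" using U zg_sec[OF F U] by simp
  show "zt (zcomp (zone (fst F)) F) U x = zt F U x"
    if "x \<in> sec (tot (fst (zcomp (zone (fst F)) F))) U" for x using U that by simp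
qed simp_all

lemma z_runit_cell:
  assumes F: "F \<in> Z1"
  shows "ztriv (zcomp F (zone (fst (snd F)))) F \<in> Z2"
proof (rule z_triv_cell[OF z_comp_arr[OF F z_one_arr[OF z_trg[OF F]]] F])
  fix U assume U: "U \<in> obs X"
  interpret G0: section_group "G0 G" U by (rule section_groupI[OF G0 U])
  show "zg (zcomp F (zone (fst (snd F)))) U = zg F U" using U zg_sec[OF F U] by simp
  show "zt (zcomp F (zone (fst (snd F)))) U x = zt F U x"
    if "x \<in> sec (tot (fst (zcomp F (zone (fst (snd F)))))) U" for x
    using U that z_zt_sec[OF F refl U, of x] by simp
qed simp_all

text \<open>The second composite is formed over \<open>g' \<partial>(\<nu>)\<close> instead of
  \<open>g'\<close>, where \<open>\<nu>\<close> is the first of the two 2-arrows of the right-hand factor; by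
  the Peiffer identity this conjugates by \<open>\<nu>\<close> and so moves \<open>\<nu>\<close> past the
  twisted factor.\<close>

lemma z_interchange:
  assumes c: "c \<in> Z2" and c': "c' \<in> Z2" and d: "d \<in> Z2" and d': "d' \<in> Z2"
    and cc: "ccod c = cdom c'" and dd: "ccod d = cdom d'" and cd: "fst (snd (cdom c)) = fst (cdom d)"
  shows "zhcomp (zvcomp c c') (zvcomp d d') = zvcomp (zhcomp c d) (zhcomp c' d')"
proof -
  have cd': "fst (snd (cdom c')) = fst (cdom d')"
    using cd zc_trg[OF c] zc_src[OF d] cc dd by simp
  note vc = z_vcomp_cell[OF c c' cc] and vd = z_vcomp_cell[OF d d' dd]
  have e: "fst (snd (cdom (zvcomp c c'))) = fst (cdom (zvcomp d d'))" using cd by simp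
  have e2: "ccod (zhcomp c d) = cdom (zhcomp c' d')" using cc dd by simp
  show ?thesis
  proof (rule zcell_eqI[OF z_hcomp_cell[OF vc vd e] z_vcomp_cell[OF z_hcomp_cell[OF c d cd] z_hcomp_cell[OF c' d' cd'] e2]])
    fix U assume U: "U \<in> obs X"
    interpret A: section_group "G1 G" U by (rule section_groupI[OF G1 U])
    note m = zc_sec[OF c U] and m' = zc_sec[OF c' U] and n = zc_sec[OF d U] and n' = zc_sec[OF d' U]
    note g = zg_sec[OF zc_dom[OF d] U]
    note mg = ract_sec[OF U g m] and m'g = ract_sec[OF U g m']
    have "zg (cdom d') U = zg (cdom d) U \<otimes>\<^bsub>grp (G0 G) U\<^esub> bd G U (cellmap d U)" using zc_g[OF d U] dd by simp
    hence "ract G U (cellmap c' U) (zg (cdom d') U) = inv\<^bsub>grp (G1 G) U\<^esub> (cellmap d U)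
        \<otimes>\<^bsub>grp (G1 G) U\<^esub> ract G U (cellmap c' U) (zg (cdom d) U) \<otimes>\<^bsub>grp (G1 G) U\<^esub> cellmap d U"
      using ract_comp[OF U m' g bd_sec[OF U n]] peiffer[OF U m'g n] by simp
    thus "cellmap (zhcomp (zvcomp c c') (zvcomp d d')) U
        = cellmap (zvcomp (zhcomp c d) (zhcomp c' d')) U"
      using U mg m'g n n' ract_mult[OF U g m m'] by (simp add: A.m_assoc)
  qed (use cc dd in simp_all)
qed

lemma z_assoc_natural:
  assumes c: "c \<in> Z2" and d: "d \<in> Z2" and k: "k \<in> Z2"
    and cd: "fst (snd (cdom c)) = fst (cdom d)" and dk: "fst (snd (cdom d)) = fst (cdom k)"
  shows "zvcomp (zhcomp (zhcomp c d) k)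
        (ztriv (zcomp (zcomp (ccod c) (ccod d)) (ccod k)) (zcomp (ccod c) (zcomp (ccod d) (ccod k))))
      = zvcomp (ztriv (zcomp (zcomp (cdom c) (cdom d)) (cdom k)) (zcomp (cdom c) (zcomp (cdom d) (cdom k))))
         (zhcomp c (zhcomp d k))"
proof -
  have cd': "fst (snd (ccod c)) = fst (ccod d)" and dk': "fst (snd (ccod d)) = fst (ccod k)"
    using cd dk zc_trg[OF c] zc_trg[OF d] zc_src[OF d] zc_src[OF k] by simp_all
  note a = z_assoc_cell[OF zc_dom[OF c] zc_dom[OF d] zc_dom[OF k] cd dk]
  note a' = z_assoc_cell[OF zc_cod[OF c] zc_cod[OF d] zc_cod[OF k] cd' dk']
  note h1 = z_hcomp_cell[OF z_hcomp_cell[OF c d cd] k] and h2 = z_hcomp_cell[OF c z_hcomp_cell[OF d k dk]]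
  show ?thesis
  proof (rule zcell_eqI[OF z_vcomp_cell[OF h1 a'] z_vcomp_cell[OF a h2]])
    fix U assume U: "U \<in> obs X"
    interpret A: section_group "G1 G" U by (rule section_groupI[OF G1 U])
    note m = zc_sec[OF c U] and n = zc_sec[OF d U] and p = zc_sec[OF k U]
    note g = zg_sec[OF zc_dom[OF d] U] and h = zg_sec[OF zc_dom[OF k] U]
    show "cellmap (zvcomp (zhcomp (zhcomp c d) k)
        (ztriv (zcomp (zcomp (ccod c) (ccod d)) (ccod k)) (zcomp (ccod c) (zcomp (ccod d) (ccod k))))) U
      = cellmap (zvcomp (ztriv (zcomp (zcomp (cdom c) (cdom d)) (cdom k)) (zcomp (cdom c) (zcomp (cdom d) (cdom k))))
         (zhcomp c (zhcomp d k))) U"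
      using U n p ract_sec[OF U g m] ract_sec[OF U h n] ract_sec[OF U h ract_sec[OF U g m]]
        ract_mult[OF U h ract_sec[OF U g m] n] ract_comp[OF U m g h] by (simp add: A.m_assoc)
  qed (use cd dk in simp_all)
qed

lemma Z_bicategory: "bicategory Zcat"
proof (unfold_locales, unfold Z_simps)
  fix F H K L :: "('o, 'm, 'e, 'a, 'b, 'g) zarr" and c d k c' d' :: "('o, 'm, 'e, 'a, 'b, 'g) zcell"
    and A :: "('o, 'm, 'e, 'a, 'b, 'g) zobj"
  have u: "group (grp (G1 G) U)" if "U \<in> obs X" for U by (rule grp_group[OF G1 that])
  have one: "\<one>\<^bsub>grp (G1 G) U\<^esub> \<in> sec (G1 G) U" if "U \<in> obs X" for U by (rule one_sec[OF G1 that])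
  have l1: "\<one>\<^bsub>grp (G1 G) U\<^esub> \<otimes>\<^bsub>grp (G1 G) U\<^esub> a = a" "a \<otimes>\<^bsub>grp (G1 G) U\<^esub> \<one>\<^bsub>grp (G1 G) U\<^esub> = a"
    if "U \<in> obs X" "a \<in> sec (G1 G) U" for U a
    using group.is_monoid[OF u[OF that(1)]] monoid.l_one monoid.r_one that(2) by fastforce+
  show "F \<in> Z1 \<Longrightarrow> fst F \<in> Z0" by (rule z_src)
  show "F \<in> Z1 \<Longrightarrow> fst (snd F) \<in> Z0" by (rule z_trg)
  show "c \<in> Z2 \<Longrightarrow> cdom c \<in> Z1" by (rule zc_dom)
  show "c \<in> Z2 \<Longrightarrow> ccod c \<in> Z1" by (rule zc_cod)
  show "c \<in> Z2 \<Longrightarrow> fst (cdom c) = fst (ccod c)" by (rule zc_src[symmetric])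
  show "c \<in> Z2 \<Longrightarrow> fst (snd (cdom c)) = fst (snd (ccod c))" by (rule zc_trg[symmetric])
  show "A \<in> Z0 \<Longrightarrow> zone A \<in> hom1 Zcat A A"
    using z_one_arr[of A] unfolding hom1_def by simp
  show "\<lbrakk>F \<in> Z1; H \<in> Z1; fst (snd F) = fst H\<rbrakk>
      \<Longrightarrow> zcomp F H \<in> hom1 Zcat (fst F) (fst (snd H))"
    using z_comp_arr[of F H] unfolding hom1_def by simp
  show "F \<in> Z1 \<Longrightarrow> ztriv F F \<in> hom2 Zcat F F"
    using z_one2[of F] unfolding hom2_def by simp
  show "\<lbrakk>c \<in> Z2; d \<in> Z2; ccod c = cdom d\<rbrakk>
      \<Longrightarrow> zvcomp c d \<in> hom2 Zcat (cdom c) (ccod d)"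
    using z_vcomp_cell[of c d] unfolding hom2_def by simp
  show "zvcomp (ztriv (cdom c) (cdom c)) c = c" if c: "c \<in> Z2"
    by (rule zcell_eqI[OF z_vcomp_cell[OF z_one2[OF zc_dom[OF c]] c] c]) (simp_all add: l1 zc_sec[OF c])
  show "zvcomp c (ztriv (ccod c) (ccod c)) = c" if c: "c \<in> Z2"
    by (rule zcell_eqI[OF z_vcomp_cell[OF c z_one2[OF zc_cod[OF c]]] c]) (simp_all add: l1 zc_sec[OF c])
  show "zvcomp (zvcomp c d) k = zvcomp c (zvcomp d k)"
    if c: "c \<in> Z2" and d: "d \<in> Z2" and k: "k \<in> Z2"
      and e: "ccod c = cdom d" "ccod d = cdom k"
  proof (rule zcell_eqI[OF z_vcomp_cell[OF z_vcomp_cell[OF c d e(1)] k] z_vcomp_cell[OF c z_vcomp_cell[OF d k e(2)]]])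
    fix U assume U: "U \<in> obs X"
    interpret A: section_group "G1 G" U by (rule section_groupI[OF G1 U])
    show "cellmap (zvcomp (zvcomp c d) k) U = cellmap (zvcomp c (zvcomp d k)) U"
      using U zc_sec[OF c U] zc_sec[OF d U] zc_sec[OF k U] by (simp add: A.m_assoc)
  qed (use e in simp_all)
  show "\<lbrakk>c \<in> Z2; d \<in> Z2; fst (snd (cdom c)) = fst (cdom d)\<rbrakk>
      \<Longrightarrow> zhcomp c d \<in> hom2 Zcat (zcomp (cdom c) (cdom d)) (zcomp (ccod c) (ccod d))"
    using z_hcomp_cell[of c d] unfolding hom2_def by simp
  show "zhcomp (ztriv F F) (ztriv H H) = ztriv (zcomp F H) (zcomp F H)"
    if F: "F \<in> Z1" and H: "H \<in> Z1" and e: "fst (snd F) = fst H"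
    by (rule zcell_eqI[OF z_hcomp_cell[OF z_one2[OF F] z_one2[OF H]] z_one2[OF z_comp_arr[OF F H e]]])
      (use e in \<open>simp_all add: ract_one zg_sec[OF H] l1 one\<close>)
  show "\<lbrakk>c \<in> Z2; c' \<in> Z2; d \<in> Z2; d' \<in> Z2; ccod c = cdom c'; ccod d = cdom d';
      fst (snd (cdom c)) = fst (cdom d)\<rbrakk>
    \<Longrightarrow> zhcomp (zvcomp c c') (zvcomp d d') = zvcomp (zhcomp c d) (zhcomp c' d')"
    by (rule z_interchange)
  show "ztriv (zcomp (zcomp F H) K) (zcomp F (zcomp H K))
      \<in> iso2 Zcat (zcomp (zcomp F H) K) (zcomp F (zcomp H K))"
    if "F \<in> Z1" "H \<in> Z1" "K \<in> Z1" "fst (snd F) = fst H" "fst (snd H) = fst K"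
    by (rule z_iso2[OF z_assoc_cell[OF that]]) simp_all
  show "\<lbrakk>c \<in> Z2; d \<in> Z2; k \<in> Z2; fst (snd (cdom c)) = fst (cdom d);
      fst (snd (cdom d)) = fst (cdom k)\<rbrakk>
    \<Longrightarrow> zvcomp (zhcomp (zhcomp c d) k)
        (ztriv (zcomp (zcomp (ccod c) (ccod d)) (ccod k)) (zcomp (ccod c) (zcomp (ccod d) (ccod k))))
      = zvcomp (ztriv (zcomp (zcomp (cdom c) (cdom d)) (cdom k)) (zcomp (cdom c) (zcomp (cdom d) (cdom k))))
         (zhcomp c (zhcomp d k))"
    by (rule z_assoc_natural)
  show "ztriv (zcomp (zone (fst F)) F) F \<in> iso2 Zcat (zcomp (zone (fst F)) F) F"
    if "F \<in> Z1" by (rule z_iso2[OF z_lunit_cell[OF that]]) simp_all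
  show "ztriv (zcomp F (zone (fst (snd F)))) F \<in> iso2 Zcat (zcomp F (zone (fst (snd F)))) F"
    if "F \<in> Z1" by (rule z_iso2[OF z_runit_cell[OF that]]) simp_all
  show "zvcomp (zhcomp (ztriv (zone (fst (cdom c))) (zone (fst (cdom c)))) c)
        (ztriv (zcomp (zone (fst (ccod c))) (ccod c)) (ccod c))
      = zvcomp (ztriv (zcomp (zone (fst (cdom c))) (cdom c)) (cdom c)) c"
    if c: "c \<in> Z2"
    by (rule zcell_eqI[OF z_vcomp_cell[OF z_hcomp_cell[OF z_one2[OF z_one_arr[OF z_src[OF zc_dom[OF c]]]] c] z_lunit_cell[OF zc_cod[OF c]]]
        z_vcomp_cell[OF z_lunit_cell[OF zc_dom[OF c]] c]])
      (simp_all add: zc_src[OF c] zc_sec[OF c] ract_one zg_sec[OF zc_dom[OF c]] l1)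
  show "zvcomp (zhcomp c (ztriv (zone (fst (snd (cdom c)))) (zone (fst (snd (cdom c))))))
        (ztriv (zcomp (ccod c) (zone (fst (snd (ccod c))))) (ccod c))
      = zvcomp (ztriv (zcomp (cdom c) (zone (fst (snd (cdom c))))) (cdom c)) c"
    if c: "c \<in> Z2"
    by (rule zcell_eqI[OF z_vcomp_cell[OF z_hcomp_cell[OF c z_one2[OF z_one_arr[OF z_trg[OF zc_dom[OF c]]]]] z_runit_cell[OF zc_cod[OF c]]]
        z_vcomp_cell[OF z_runit_cell[OF zc_dom[OF c]] c]])
      (simp_all add: zc_trg[OF c] zc_sec[OF c] ract_id l1)
  show "zvcomp (ztriv (zcomp (zcomp (zcomp F H) K) L) (zcomp (zcomp F H) (zcomp K L)))
        (ztriv (zcomp (zcomp F H) (zcomp K L)) (zcomp F (zcomp H (zcomp K L))))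
      = zvcomp (zhcomp (ztriv (zcomp (zcomp F H) K) (zcomp F (zcomp H K))) (ztriv L L))
         (zvcomp (ztriv (zcomp (zcomp F (zcomp H K)) L) (zcomp F (zcomp (zcomp H K) L)))
           (zhcomp (ztriv F F) (ztriv (zcomp (zcomp H K) L) (zcomp H (zcomp K L)))))"
    if F: "F \<in> Z1" and H: "H \<in> Z1" and K: "K \<in> Z1" and L: "L \<in> Z1"
      and e: "fst (snd F) = fst H" "fst (snd H) = fst K" "fst (snd K) = fst L"
  proof -
    have HK: "zcomp H K \<in> Z1" by (rule z_comp_arr[OF H K e(2)])
    have HKL: "zcomp (zcomp H K) L \<in> Z1" by (rule z_comp_arr[OF HK L]) (use e in simp)
    have r: "ract G U \<one>\<^bsub>grp (G1 G) U\<^esub> (zg L U) = \<one>\<^bsub>grp (G1 G) U\<^esub>"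
      "ract G U \<one>\<^bsub>grp (G1 G) U\<^esub> (zg (zcomp (zcomp H K) L) U) = \<one>\<^bsub>grp (G1 G) U\<^esub>" if U: "U \<in> obs X" for U
      by (rule ract_one[OF U zg_sec[OF L U]], rule ract_one[OF U zg_sec[OF HKL U]])
    show ?thesis by (intro prod_eqI) (use r in \<open>auto simp: l1 one\<close>)
  qed
  show "zvcomp (ztriv (zcomp (zcomp F (zone (fst (snd F)))) H) (zcomp F (zcomp (zone (fst (snd F))) H)))
        (zhcomp (ztriv F F) (ztriv (zcomp (zone (fst H)) H) H))
      = zhcomp (ztriv (zcomp F (zone (fst (snd F)))) F) (ztriv H H)"
    if F: "F \<in> Z1" and H: "H \<in> Z1" and e: "fst (snd F) = fst H"
  proof -
    have OH: "zcomp (zone (fst H)) H \<in> Z1" by (rule z_comp_arr[OF z_one_arr[OF z_src[OF H]] H]) simp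
    have r: "ract G U \<one>\<^bsub>grp (G1 G) U\<^esub> (zg H U) = \<one>\<^bsub>grp (G1 G) U\<^esub>"
      "ract G U \<one>\<^bsub>grp (G1 G) U\<^esub> (zg (zcomp (zone (fst H)) H) U) = \<one>\<^bsub>grp (G1 G) U\<^esub>" if U: "U \<in> obs X" for U
      by (rule ract_one[OF U zg_sec[OF H U]], rule ract_one[OF U zg_sec[OF OH U]])
    show ?thesis by (intro prod_eqI) (use r e in \<open>auto simp: l1 one\<close>)
  qed
qed

lemma Z_locally_groupoidal: "locally_groupoidal Zcat"
  unfolding locally_groupoidal_def by (simp add: z_iso2)

end

section \<open>The comparison\<close>

context gamma_xmod
begin

lemma germ_arr: "germ F U u s \<Longrightarrow> u \<in> sec (w_tor F) U"
    "germ F U u s \<Longrightarrow> local_arrow (fst F) (fst (snd F)) U s (w_phi F U u)"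
    "\<lbrakk>germ F U u s; x \<in> sec (tot (fst F)) U\<rbrakk> \<Longrightarrow> w_t F U x = tw_pt X G (w_tor F) (fst (snd F)) U u (s x)"
  unfolding germ_def by blast+

lemma w_twisted: "F \<in> W1 \<Longrightarrow> twisted X \<Gamma> G (w_tor F) (fst (snd F))"
  by (rule twistedI[OF w_framed w_trg])

text \<open>A germ is the coordinate of \<open>t\<close>, and coordinates are unique.\<close>

lemma germ_unique:
  assumes F: "F \<in> W1" and U: "U \<in> obs X" and s: "germ F U u s" and r: "germ F U u r"
    and x: "x \<in> sec (tot (fst F)) U"
  shows "s x = r x"
proof -
  interpret t: twisted X \<Gamma> G "w_tor F" "fst (snd F)" by (rule w_twisted[OF F])
  show ?thesis
    by (rule t.C.pt_inj[OF U germ_arr(1)[OF s] la_sec[OF germ_arr(2)[OF s] x] la_sec[OF germ_arr(2)[OF r] x]])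
      (use germ_arr(3)[OF s x] germ_arr(3)[OF r x] in simp)
qed

lemma germ_cong:
  assumes F: "F \<in> W1" and U: "U \<in> obs X" and s: "germ F U u s"
    and e: "\<And>x. x \<in> sec (tot (fst F)) U \<Longrightarrow> s x = r x"
  shows "germ F U u r"
  using s e local_arrow_cong[OF w_src[OF F] U e] unfolding germ_def by simp

text \<open>Moving the section of the torsor by \<open>a\<close> conjugates the germ by \<open>a\<close>: this is how 2-arrows of the
  2-groupoid appear inside a single torsor arrow.\<close>

lemma germ_tact:
  assumes F: "F \<in> W1" and U: "U \<in> obs X" and s: "germ F U u s" and a: "a \<in> sec (G1 G) U"
  defines "B \<equiv> fst (snd F)"
  shows "germ F U (tact (w_tor F) U u a) (\<lambda>x. inv\<^bsub>grp (tot B) U\<^esub> (inc B U a) \<otimes>\<^bsub>grp (tot B) U\<^esub> s x \<otimes>\<^bsub>grp (tot B) U\<^esub> inc B U a)"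
    (is "germ F U ?v ?r")
proof -
  interpret t: twisted X \<Gamma> G "w_tor F" B unfolding B_def by (rule w_twisted[OF F])
  interpret E: section_group "tot B" U by (rule section_groupI[OF t.E U])
  note u = germ_arr(1)[OF s]
  have v: "?v \<in> sec (w_tor F) U" by (rule tact_sec[OF w_torsor[OF F] U u a])
  note i = ghom_sec[OF G1 t.E t.i U a]
  obtain r where r: "germ F U ?v r" using ex_germ[OF F U v] by blast
  show ?thesis
  proof (rule germ_cong[OF F U r])
    fix x assume x: "x \<in> sec (tot (fst F)) U"
    have sx: "s x \<in> sec (tot B) U" and rx: "r x \<in> sec (tot B) U"
      using la_sec[OF germ_arr(2)[OF s] x] la_sec[OF germ_arr(2)[OF r] x] unfolding B_def by simp_all
    have rr: "?r x \<in> sec (tot B) U" using i sx by simp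
    have "t.pt U ?v (?r x) = t.pt U u (conj_act B U a (?r x))" by (rule t.C.pt_bal[OF U u a rr])
    also have "conj_act B U a (?r x) = s x" unfolding conj_act_def using i sx by (simp add: E.m_assoc)
    also have "t.pt U u (s x) = t.pt U ?v (r x)"
      using germ_arr(3)[OF s x] germ_arr(3)[OF r x] unfolding B_def by simp
    finally show "r x = ?r x" using t.C.pt_inj[OF U v rr rx] by simp
  qed
qed

abbreviation "I \<equiv> triv_torsor (G1 G)"

lemma mk_map_triv: "mk_map X (G1 G) k = mk_map X I k"
  unfolding mk_map_def by simp

lemma psi_simps [simp]:
  "fst (psi F) = fst F" "fst (snd (psi F)) = fst (snd F)" "w_tor (psi F) = I"
  "w_phi (psi F) = mk_map X I (\<lambda>U a. zg F U \<otimes>\<^bsub>grp (G0 G) U\<^esub> bd G U a)"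
  "w_t (psi F) = mk_map X (tot (fst F)) (\<lambda>U x. tw_pt X G I (fst (snd F)) U \<one>\<^bsub>grp (G1 G) U\<^esub> (zt F U x))"
  unfolding psi_arr_def mk_map_triv by (simp_all add: case_prod_beta w_tor_def w_phi_def w_t_def)

lemma psi_phi: "\<lbrakk>U \<in> obs X; a \<in> sec (G1 G) U\<rbrakk> \<Longrightarrow> w_phi (psi F) U a = zg F U \<otimes>\<^bsub>grp (G0 G) U\<^esub> bd G U a"
  by simp

lemma psi_phi_one:
  assumes F: "F \<in> Z1" and U: "U \<in> obs X"
  shows "w_phi (psi F) U \<one>\<^bsub>grp (G1 G) U\<^esub> = zg F U"
proof -
  interpret K: section_group "G0 G" U by (rule section_groupI[OF G0 U])
  show ?thesis unfolding psi_phi[OF U one_sec[OF G1 U]] bd_one[OF U] using zg_sec[OF F U] by simp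
qed

lemma psi_framed:
  assumes F: "F \<in> Z1"
  shows "framed I (w_phi (psi F))"
  unfolding framed_def psi_simps
proof (intro conjI ballI triv_torsor)
  note g = zg_sec[OF F]
  show "mk_map X I (\<lambda>U a. zg F U \<otimes>\<^bsub>grp (G0 G) U\<^esub> bd G U a) \<in> maps X I (G0 G)"
  proof (rule mapsI[OF _ _ tor_presheaf[OF triv_torsor]])
    fix U a assume U: "U \<in> obs X" and "a \<in> sec I U"
    hence a: "a \<in> sec (G1 G) U" by simp
    show "zg F U \<otimes>\<^bsub>grp (G0 G) U\<^esub> bd G U a \<in> sec (G0 G) U" by (rule mult_sec[OF G0 U g[OF U] bd_sec[OF U a]])
    show "res (G0 G) f (zg F U \<otimes>\<^bsub>grp (G0 G) U\<^esub> bd G U a) = zg F (dm X f) \<otimes>\<^bsub>grp (G0 G) (dm X f)\<^esub> bd G (dm X f) (res I f a)"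
      if f: "f \<in> into X U" for f
      unfolding res_mult[OF G0 f g[OF U] bd_sec[OF U a]] gsec_res[OF zg_gsec[OF F] f] bd_res[OF f a] triv_simps ..
  qed
  fix U u a assume U: "U \<in> obs X" and "u \<in> sec I U" and a: "a \<in> sec (G1 G) U"
  hence u: "u \<in> sec (G1 G) U" by simp
  interpret K: section_group "G0 G" U by (rule section_groupI[OF G0 U])
  show "mk_map X I (\<lambda>U a. zg F U \<otimes>\<^bsub>grp (G0 G) U\<^esub> bd G U a) U (tact I U u a)
      = mk_map X I (\<lambda>U a. zg F U \<otimes>\<^bsub>grp (G0 G) U\<^esub> bd G U a) U u \<otimes>\<^bsub>grp (G0 G) U\<^esub> bd G U a"
    using U u a mult_sec[OF G1 U u a] bd_mult[OF U u a] g[OF U] bd_sec[OF U u] bd_sec[OF U a]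
    by (simp add: K.m_assoc)
qed

text \<open>The formula \<open>x \<mapsto> (1, t x)\<close> exhibits \<open>t\<close> as the germ at
  \<open>1\<close>, and an arrow is recognised by its germs.\<close>

lemma psi:
  assumes F: "F \<in> Z1"
  shows psi_germ: "U \<in> obs X \<Longrightarrow> germ (psi F) U \<one>\<^bsub>grp (G1 G) U\<^esub> (zt F U)"
    and psi_w_arr: "psi F \<in> W1"
proof -
  note A = z_src[OF F] and B = z_trg[OF F]
  interpret t: twisted X \<Gamma> G I "fst (snd F)" by (rule twistedI[OF triv_framed B])
  have o: "\<one>\<^bsub>grp (G1 G) U\<^esub> \<in> sec I U" if "U \<in> obs X" for U using one_sec[OF G1 that] by simp
  show g: "germ (psi F) U \<one>\<^bsub>grp (G1 G) U\<^esub> (zt F U)" if U: "U \<in> obs X" for U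
    unfolding germ_def using o[OF U] z_local[OF F U] psi_phi_one[OF F U] U by simp
  have m: "w_t (psi F) \<in> maps X (tot (fst F)) t.T"
    unfolding psi_simps
  proof (rule mapsI[OF _ _ grp_presheaf[OF tot[OF A]]])
    fix U x assume U: "U \<in> obs X" and x: "x \<in> sec (tot (fst F)) U"
    note tx = maps_sec[OF zt_maps[OF F] U x]
    show "t.pt U \<one>\<^bsub>grp (G1 G) U\<^esub> (zt F U x) \<in> sec t.T U" by (rule t.C.pt_sec[OF U o[OF U] tx])
    show "res t.T f (t.pt U \<one>\<^bsub>grp (G1 G) U\<^esub> (zt F U x))
        = t.pt (dm X f) \<one>\<^bsub>grp (G1 G) (dm X f)\<^esub> (zt F (dm X f) (res (tot (fst F)) f x))" if f: "f \<in> into X U" for f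
      using t.C.pt_res[OF f o[OF U] tx] res_one[OF G1 f] maps_res[OF zt_maps[OF F] f x] by simp
  qed
  show "psi F \<in> W1"
    by (rule w_arrI[OF _ _ _ _ densely_True]) (use A B psi_framed[OF F] m g in auto)
qed

text \<open>On the trivial torsor with \<open>\<phi>(v) = g \<partial>(v)\<close> the Peiffer identity gives
  \<open>v a\<^sup>g\<^sup>\<partial>\<^sup>(\<^sup>v\<^sup>) = a\<^sup>g v\<close>. So \<open>\<Psi>\<close>
  turns the product of two trivial torsors into \<open>(\<alpha> c, \<beta>) = (\<alpha>, c\<^sup>g\<^sup>'
  \<beta>)\<close>, from which the comparison \<open>(\<alpha>, \<beta>) \<mapsto> \<alpha>\<^sup>g\<^sup>'
  \<beta>\<close> is forced by its values \<open>\<beta>\<close> at \<open>(1, \<beta>)\<close>.\<close>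

lemma psi_bit:
  assumes F: "F \<in> Z1" and U: "U \<in> obs X" and a: "a \<in> sec (G1 G) U" and v: "v \<in> sec (G1 G) U"
  shows "bitorsor_act G I (w_phi (psi F)) U a v = ract G U a (zg F U) \<otimes>\<^bsub>grp (G1 G) U\<^esub> v"
proof -
  interpret A: section_group "G1 G" U by (rule section_groupI[OF G1 U])
  note g = zg_sec[OF F U]
  note ag = ract_sec[OF U g a]
  show ?thesis
    unfolding bitorsor_act_def triv_simps psi_phi[OF U v] ract_comp[OF U a g bd_sec[OF U v]] peiffer[OF U ag v]
    using ag v by (simp add: A.m_assoc)
qed

abbreviation "psi2 \<equiv> fce \<Psi>"

lemma Psi_simps [simp]: "fob \<Psi> A = A" "far \<Psi> = psi" "fcomp \<Psi> = psicomp"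
  "funit \<Psi> A = (wone A, psi (zone A), mk_map X I (\<lambda>U a. a))"
  unfolding Psi_def mk_map_triv by simp_all

lemma psi2_simps [simp]: "cdom (psi2 c) = psi (cdom c)" "ccod (psi2 c) = psi (ccod c)"
  "cellmap (psi2 c) = mk_map X I (\<lambda>U a. inv\<^bsub>grp (G1 G) U\<^esub> (cellmap c U) \<otimes>\<^bsub>grp (G1 G) U\<^esub> a)"
  unfolding Psi_def mk_map_triv by (simp_all add: case_prod_beta)

lemma psi2_map: "\<lbrakk>U \<in> obs X; a \<in> sec (G1 G) U\<rbrakk>
    \<Longrightarrow> cellmap (psi2 c) U a = inv\<^bsub>grp (G1 G) U\<^esub> (cellmap c U) \<otimes>\<^bsub>grp (G1 G) U\<^esub> a"
  by simp

lemma cell_tripleI: "(cdom c, ccod c, cellmap c) \<in> W2 \<Longrightarrow> c \<in> W2"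
  by simp

text \<open>Germs are compared at the section \<open>\<mu>\<close> of the trivial torsor: there the germ of the
  source is \<open>t\<close> conjugated by \<open>\<mu>\<close> (\<open>germ_tact\<close>), which is
  \<open>t'\<close>, and \<open>\<mu>\<close> is mapped to \<open>1\<close>, where the germ of the target is
  \<open>t'\<close>.\<close>

lemma psi2_cell:
  assumes c: "c \<in> Z2"
  shows "psi2 c \<in> W2"
proof (rule cell_tripleI, rule w_cell_germI[OF _ _ _ _ _ _ densely_True])
  note F = zc_dom[OF c] and F' = zc_cod[OF c]
  show pF: "cdom (psi2 c) \<in> W1" and "ccod (psi2 c) \<in> W1"
    using psi_w_arr[OF F] psi_w_arr[OF F'] by simp_all
  show "fst (ccod (psi2 c)) = fst (cdom (psi2 c))" "fst (snd (ccod (psi2 c))) = fst (snd (cdom (psi2 c)))"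
    using zc_src[OF c] zc_trg[OF c] by simp_all
  have im: "inv\<^bsub>grp (G1 G) U\<^esub> (cellmap c U) \<in> sec (G1 G) U" if "U \<in> obs X" for U
    by (rule inv_sec[OF G1 that zc_sec[OF c that]])
  have "mk_map X I (\<lambda>U a. inv\<^bsub>grp (G1 G) U\<^esub> (cellmap c U) \<otimes>\<^bsub>grp (G1 G) U\<^esub> a) \<in> maps X I I"
  proof (rule mk_map_maps[OF _ _ triv_torsor])
    fix U a assume U: "U \<in> obs X" and a: "a \<in> sec I U"
    show "inv\<^bsub>grp (G1 G) U\<^esub> (cellmap c U) \<otimes>\<^bsub>grp (G1 G) U\<^esub> a \<in> sec I U"
      using mult_sec[OF G1 U im[OF U]] a by simp
    show "res I f (inv\<^bsub>grp (G1 G) U\<^esub> (cellmap c U) \<otimes>\<^bsub>grp (G1 G) U\<^esub> a)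
        = inv\<^bsub>grp (G1 G) (dm X f)\<^esub> (cellmap c (dm X f)) \<otimes>\<^bsub>grp (G1 G) (dm X f)\<^esub> res I f a" if f: "f \<in> into X U" for f
      using res_mult[OF G1 f im[OF U]] res_inv[OF G1 f zc_sec[OF c U]] gsec_res[OF zc_gsec[OF c] f] a by simp
  qed
  thus "cellmap (psi2 c) \<in> maps X (w_tor (cdom (psi2 c))) (w_tor (ccod (psi2 c)))" by simp
  fix U assume U: "U \<in> obs X"
  interpret A: section_group "G1 G" U by (rule section_groupI[OF G1 U])
  note m = zc_sec[OF c U]
  show "cellmap (psi2 c) U (tact (w_tor (cdom (psi2 c))) U u a) = tact (w_tor (ccod (psi2 c))) U (cellmap (psi2 c) U u) a"
    if "u \<in> sec (w_tor (cdom (psi2 c))) U" "a \<in> sec (G1 G) U" for u a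
    using that U m by (simp add: A.m_assoc)
  have one: "cellmap (psi2 c) U (cellmap c U) = \<one>\<^bsub>grp (G1 G) U\<^esub>" using U m by simp
  show "\<exists>u s. germ (cdom (psi2 c)) U u s \<and> germ (ccod (psi2 c)) U (cellmap (psi2 c) U u) s \<and>
      w_phi (ccod (psi2 c)) U (cellmap (psi2 c) U u) = w_phi (cdom (psi2 c)) U u"
  proof (intro exI conjI)
    have "germ (psi (cdom c)) U (tact I U \<one>\<^bsub>grp (G1 G) U\<^esub> (cellmap c U)) (zt (ccod c) U)"
      by (rule germ_cong[OF psi_w_arr[OF F] U germ_tact[OF psi_w_arr[OF F] U psi_germ[OF F U] m, simplified psi_simps]])
        (use zc_t[OF c U] in simp)
    thus "germ (cdom (psi2 c)) U (cellmap c U) (zt (ccod c) U)" using m by simp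
    show "germ (ccod (psi2 c)) U (cellmap (psi2 c) U (cellmap c U)) (zt (ccod c) U)"
      unfolding one psi2_simps(2) by (rule psi_germ[OF F' U])
    show "w_phi (ccod (psi2 c)) U (cellmap (psi2 c) U (cellmap c U)) = w_phi (cdom (psi2 c)) U (cellmap c U)"
      unfolding one psi2_simps(1,2) psi_phi_one[OF F' U] psi_phi[OF U m] by (rule zc_g[OF c U])
  qed
qed

text \<open>Germs are compared at \<open>(1, 1)\<close>, which the comparison map sends to
  \<open>1\<close>.\<close>

lemma psi_comp:
  assumes F: "F \<in> Z1" and H: "H \<in> Z1" and e: "fst (snd F) = fst H"
  shows psi_comp_dom: "cdom (psicomp F H) = wcomp (psi F) (psi H)" "ccod (psicomp F H) = psi (zcomp F H)"
    and psi_comp_map: "\<lbrakk>U \<in> obs X; a \<in> sec (G1 G) U; v \<in> sec (G1 G) U\<rbrakk>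
      \<Longrightarrow> cellmap (psicomp F H) U (tpw (psi F) (psi H) U a v) = ract G U a (zg H U) \<otimes>\<^bsub>grp (G1 G) U\<^esub> v"
    and psi_comp_cell: "psicomp F H \<in> W2"
proof -
  note pF = psi_w_arr[OF F] and pH = psi_w_arr[OF H] and FH = z_comp_arr[OF F H e]
  have e': "fst (snd (psi F)) = fst (psi H)" using e by simp
  let ?\<phi> = "w_phi (psi H)"
  interpret p: torsor_pair X \<Gamma> G I I ?\<phi> by (unfold_locales) (rule triv_torsor psi_framed[OF H])+
  let ?k = "\<lambda>U a v. ract G U a (zg H U) \<otimes>\<^bsub>grp (G1 G) U\<^esub> v"
  note g = zg_sec[OF H]
  have s: "?k U a v \<in> sec I U" if U: "U \<in> obs X" and a: "a \<in> sec I U" and v: "v \<in> sec I U" for U a v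
    using mult_sec[OF G1 U ract_sec[OF U g[OF U]]] a v by simp
  have r: "res I h (?k U a v) = ?k (dm X h) (res I h a) (res I h v)"
    if U: "U \<in> obs X" and h: "h \<in> into X U" and a: "a \<in> sec I U" and v: "v \<in> sec I U" for U h a v
    using res_mult[OF G1 h ract_sec[OF U g[OF U]]] ract_res[OF h _ g[OF U]] gsec_res[OF zg_gsec[OF H] h] a v by simp
  have b: "?k U (tact I U a c) v = ?k U a (p.b U c v)"
    if U: "U \<in> obs X" and a: "a \<in> sec I U" and v: "v \<in> sec I U" and c: "c \<in> sec (G1 G) U" for U a v c
  proof -
    interpret A: section_group "G1 G" U by (rule section_groupI[OF G1 U])
    have a': "a \<in> sec (G1 G) U" and v': "v \<in> sec (G1 G) U" using a v by simp_all
    note ag = ract_sec[OF U g[OF U] a'] and cg = ract_sec[OF U g[OF U] c]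
    show ?thesis
      unfolding psi_bit[OF H U c v'] triv_simps ract_mult[OF U g[OF U] a' c] by (rule A.m_assoc[OF ag cg v'])
  qed
  note D = p.tdescend_map[OF tor_sheaf[OF triv_torsor], of ?k, OF s r b]
  let ?m = "mk_map X p.R (\<lambda>U. tdescend X G I I ?\<phi> I U (\<lambda>f a v. ?k (dm X f) a v))"
  have w: "psicomp F H = (wcomp (psi F) (psi H), psi (zcomp F H), ?m)"
    unfolding psi_comp_def by (simp add: Let_def)
  show "cdom (psicomp F H) = wcomp (psi F) (psi H)" "ccod (psicomp F H) = psi (zcomp F H)"
    unfolding w by simp_all
  have mm: "?m \<in> maps X p.R I" by (rule D(1))
  have tp: "?m U (p.tp U a v) = ?k U a v" if "U \<in> obs X" "a \<in> sec (G1 G) U" "v \<in> sec (G1 G) U" for U a v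
    by (rule D(2); (assumption | simp add: that))
  show "cellmap (psicomp F H) U (tpw (psi F) (psi H) U a v) = ?k U a v"
    if "U \<in> obs X" "a \<in> sec (G1 G) U" "v \<in> sec (G1 G) U" for U a v
    using tp[OF that] unfolding w by simp
  show "psicomp F H \<in> W2"
    unfolding w
  proof (rule w_cell_germI[OF w_comp_arr[OF pF pH e'] psi_w_arr[OF FH] _ _ _ _ densely_True])
    show "?m \<in> maps X (w_tor (wcomp (psi F) (psi H))) (w_tor (psi (zcomp F H)))" using mm by simp
    have "?m U (tact p.R U y a) = tact I U (?m U y) a"
      if "U \<in> obs X" "y \<in> sec p.R U" "a \<in> sec (G1 G) U" for U y a
    proof (rule p.tact_map_on_tp[OF mm triv_torsor densely_True _ that])
      fix U u v a assume U: "U \<in> obs X" and "u \<in> sec I U" "v \<in> sec I U" and a: "a \<in> sec (G1 G) U"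
      hence u: "u \<in> sec (G1 G) U" and v: "v \<in> sec (G1 G) U" by simp_all
      interpret A: section_group "G1 G" U by (rule section_groupI[OF G1 U])
      show "?m U (p.tp U u (tact I U v a)) = tact I U (?m U (p.tp U u v)) a"
        unfolding triv_simps tp[OF U u mult_sec[OF G1 U v a]] tp[OF U u v]
        by (rule A.m_assoc[OF ract_sec[OF U g[OF U] u] v a, symmetric])
    qed
    thus "?m U (tact (w_tor (wcomp (psi F) (psi H))) U y a) = tact (w_tor (psi (zcomp F H))) U (?m U y) a"
      if "U \<in> obs X" "y \<in> sec (w_tor (wcomp (psi F) (psi H))) U" "a \<in> sec (G1 G) U" for U y a using that by simp
    fix U assume U: "U \<in> obs X"
    note o = one_sec[OF G1 U]
    have oI: "\<one>\<^bsub>grp (G1 G) U\<^esub> \<in> sec I U" using o by simp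
    interpret A: section_group "G1 G" U by (rule section_groupI[OF G1 U])
    have i: "?m U (p.tp U \<one>\<^bsub>grp (G1 G) U\<^esub> \<one>\<^bsub>grp (G1 G) U\<^esub>) = \<one>\<^bsub>grp (G1 G) U\<^esub>"
      unfolding tp[OF U o o] ract_one[OF U g[OF U]] by simp
    show "\<exists>u s. germ (wcomp (psi F) (psi H)) U u s \<and> germ (psi (zcomp F H)) U (?m U u) s \<and>
       w_phi (psi (zcomp F H)) U (?m U u) = w_phi (wcomp (psi F) (psi H)) U u"
    proof (intro exI conjI)
      show "germ (wcomp (psi F) (psi H)) U (p.tp U \<one>\<^bsub>grp (G1 G) U\<^esub> \<one>\<^bsub>grp (G1 G) U\<^esub>) (\<lambda>x. zt H U (zt F U x))"
        using w_comp_germ[OF pF pH e' U psi_germ[OF F U] psi_germ[OF H U]] by simp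
      show "germ (psi (zcomp F H)) U (?m U (p.tp U \<one>\<^bsub>grp (G1 G) U\<^esub> \<one>\<^bsub>grp (G1 G) U\<^esub>)) (\<lambda>x. zt H U (zt F U x))"
        unfolding i by (rule germ_cong[OF psi_w_arr[OF FH] U psi_germ[OF FH U]]) (use U in simp)
      have "w_phi (wcomp (psi F) (psi H)) U (p.tp U \<one>\<^bsub>grp (G1 G) U\<^esub> \<one>\<^bsub>grp (G1 G) U\<^esub>)
          = w_phi (psi F) U \<one>\<^bsub>grp (G1 G) U\<^esub> \<otimes>\<^bsub>grp (G0 G) U\<^esub> w_phi (psi H) U \<one>\<^bsub>grp (G1 G) U\<^esub>"
        unfolding w_comp1_simps psi_simps(3) by (rule p.tprod_map_tp[OF psi_framed[OF F] U oI oI])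
      thus "w_phi (psi (zcomp F H)) U (?m U (p.tp U \<one>\<^bsub>grp (G1 G) U\<^esub> \<one>\<^bsub>grp (G1 G) U\<^esub>))
        = w_phi (wcomp (psi F) (psi H)) U (p.tp U \<one>\<^bsub>grp (G1 G) U\<^esub> \<one>\<^bsub>grp (G1 G) U\<^esub>)"
        unfolding i psi_phi_one[OF F U] psi_phi_one[OF H U] psi_phi_one[OF FH U] using U by simp
    qed
  qed simp_all
qed

lemma psi_unit:
  assumes A: "A \<in> Z0"
  shows "(wone A, psi (zone A), mk_map X I (\<lambda>U a. a)) \<in> W2"
proof (rule w_cell_germI[OF one1_arr[OF A] psi_w_arr[OF z_one_arr[OF A]] _ _ _ _ densely_True])
  note O = z_one_arr[OF A]
  have "mk_map X I (\<lambda>U a. a) \<in> maps X I I" by (rule mk_map_maps[OF _ _ triv_torsor]) simp_all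
  thus "mk_map X I (\<lambda>U a. a) \<in> maps X (w_tor (wone A)) (w_tor (psi (zone A)))" by simp
  fix U assume U: "U \<in> obs X"
  show "mk_map X I (\<lambda>U a. a) U (tact (w_tor (wone A)) U u a)
      = tact (w_tor (psi (zone A))) U (mk_map X I (\<lambda>U a. a) U u) a"
    if "u \<in> sec (w_tor (wone A)) U" "a \<in> sec (G1 G) U" for u a
    using that U mult_sec[OF G1 U] by simp
  note o = one_sec[OF G1 U]
  have i: "mk_map X I (\<lambda>U a. a) U \<one>\<^bsub>grp (G1 G) U\<^esub> = \<one>\<^bsub>grp (G1 G) U\<^esub>" using o U by simp
  show "\<exists>u s. germ (wone A) U u s \<and> germ (psi (zone A)) U (mk_map X I (\<lambda>U a. a) U u) s \<and>
     w_phi (psi (zone A)) U (mk_map X I (\<lambda>U a. a) U u) = w_phi (wone A) U u"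
  proof (intro exI conjI)
    show "germ (wone A) U \<one>\<^bsub>grp (G1 G) U\<^esub> (\<lambda>x. x)" by (rule one1_germ[OF A U])
    show "germ (psi (zone A)) U (mk_map X I (\<lambda>U a. a) U \<one>\<^bsub>grp (G1 G) U\<^esub>) (\<lambda>x. x)"
      unfolding i by (rule germ_cong[OF psi_w_arr[OF O] U psi_germ[OF O U]]) (use U in simp)
    show "w_phi (psi (zone A)) U (mk_map X I (\<lambda>U a. a) U \<one>\<^bsub>grp (G1 G) U\<^esub>) = w_phi (wone A) U \<one>\<^bsub>grp (G1 G) U\<^esub>"
      unfolding i psi_phi_one[OF O U] using U bd_one[OF U] by simp
  qed
qed simp_all

lemma psi_vcomp:
  assumes c: "c \<in> Z2" and d: "d \<in> Z2" and e: "ccod c = cdom d"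
  shows "psi2 (zvcomp c d) = wvcomp (psi2 c) (psi2 d)"
proof (rule cell_eqI[OF psi2_cell[OF z_vcomp_cell[OF c d e]] vcomp_cells[OF psi2_cell[OF c] psi2_cell[OF d]] _ _ densely_True])
  fix U u assume U: "U \<in> obs X" and "u \<in> sec (w_tor (cdom (psi2 (zvcomp c d)))) U"
  hence u: "u \<in> sec (G1 G) U" by simp
  interpret A: section_group "G1 G" U by (rule section_groupI[OF G1 U])
  note m = zc_sec[OF c U] and n = zc_sec[OF d U]
  have "u \<in> sec (w_tor (cdom (psi2 c))) U" using u by simp
  thus "cellmap (psi2 (zvcomp c d)) U u = cellmap (wvcomp (psi2 c) (psi2 d)) U u"
    using U u m n by (simp add: vcomp_map A.inv_mult_group A.m_assoc)
qed (use e in simp_all)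

text \<open>On \<open>(\<alpha>, \<beta>)\<close> the two sides are \<open>(\<mu>\<^sup>-\<^sup>1
  \<alpha>)\<^sup>h\<^sup>' \<mu>'\<^sup>-\<^sup>1 \<beta>\<close> with \<open>h' = g'
  \<partial>(\<mu>')\<close> and \<open>(\<mu>\<^sup>g\<^sup>' \<mu>')\<^sup>-\<^sup>1 \<alpha>\<^sup>g\<^sup>'
  \<beta>\<close>; the Peiffer identity relates them.\<close>

lemma psi_comp_natural:
  assumes c: "c \<in> Z2" and d: "d \<in> Z2" and e: "fst (snd (cdom c)) = fst (cdom d)"
  shows "wvcomp (whcomp (psi2 c) (psi2 d)) (psicomp (ccod c) (ccod d))
    = wvcomp (psicomp (cdom c) (cdom d)) (psi2 (zhcomp c d))"
proof -
  have e': "fst (snd (ccod c)) = fst (ccod d)" using e zc_trg[OF c] zc_src[OF d] by simp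
  have e2: "fst (snd (cdom (psi2 c))) = fst (cdom (psi2 d))" using e by simp
  note F = zc_dom[OF c] and H = zc_dom[OF d] and F' = zc_cod[OF c] and H' = zc_cod[OF d]
  note h = hcomps_cells[OF psi2_cell[OF c] psi2_cell[OF d] e2]
  note q = psi_comp_cell[OF F H e] and q' = psi_comp_cell[OF F' H' e']
  note qd = psi_comp_dom[OF F H e] and qd' = psi_comp_dom[OF F' H' e']
  note zh = z_hcomp_cell[OF c d e]
  have v1: "ccod (whcomp (psi2 c) (psi2 d)) = cdom (psicomp (ccod c) (ccod d))" using qd' by simp
  have v2: "ccod (psicomp (cdom c) (cdom d)) = cdom (psi2 (zhcomp c d))" using qd by simp
  show ?thesis
  proof (rule comp_cell_eqI[OF vcomp_cells[OF h q' v1] vcomp_cells[OF q psi2_cell[OF zh] v2] _ _ _ psi_w_arr[OF F] psi_w_arr[OF H] densely_True])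
    fix U a v assume U: "U \<in> obs X" and a': "a \<in> sec (w_tor (psi (cdom c))) U" and v': "v \<in> sec (w_tor (psi (cdom d))) U"
    have a: "a \<in> sec (G1 G) U" and v: "v \<in> sec (G1 G) U" using a' v' by simp_all
    interpret A: section_group "G1 G" U by (rule section_groupI[OF G1 U])
    let ?x = "tpw (psi (cdom c)) (psi (cdom d)) U a v"
    have x: "?x \<in> sec (w_tor (wcomp (psi (cdom c)) (psi (cdom d)))) U"
      by (rule tpw_sec[OF psi_w_arr[OF F] psi_w_arr[OF H] U a' v'])
    note m = zc_sec[OF c U] and n = zc_sec[OF d U] and g = zg_sec[OF H U]
    note ma = A.m_closed[OF A.inv_closed[OF m] a] and nv = A.m_closed[OF A.inv_closed[OF n] v]
    note mg = ract_sec[OF U g m] and ag = ract_sec[OF U g a]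
    have 1: "cellmap (whcomp (psi2 c) (psi2 d)) U ?x = tpw (psi (ccod c)) (psi (ccod d)) U
        (inv\<^bsub>grp (G1 G) U\<^esub> (cellmap c U) \<otimes>\<^bsub>grp (G1 G) U\<^esub> a) (inv\<^bsub>grp (G1 G) U\<^esub> (cellmap d U) \<otimes>\<^bsub>grp (G1 G) U\<^esub> v)"
      using hcomps_map[OF psi2_cell[OF c] psi2_cell[OF d] e2 U, of a v] a v psi2_map[OF U a, of c] psi2_map[OF U v, of d] by simp
    have "cellmap (wvcomp (whcomp (psi2 c) (psi2 d)) (psicomp (ccod c) (ccod d))) U ?x
        = cellmap (psicomp (ccod c) (ccod d)) U (cellmap (whcomp (psi2 c) (psi2 d)) U ?x)"
      by (rule vcomp_map[OF U]) (use x in simp)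
    also have "\<dots> = ract G U (inv\<^bsub>grp (G1 G) U\<^esub> (cellmap c U) \<otimes>\<^bsub>grp (G1 G) U\<^esub> a) (zg (ccod d) U)
        \<otimes>\<^bsub>grp (G1 G) U\<^esub> (inv\<^bsub>grp (G1 G) U\<^esub> (cellmap d U) \<otimes>\<^bsub>grp (G1 G) U\<^esub> v)"
      unfolding 1 by (rule psi_comp_map[OF F' H' e' U ma nv])
    also have "\<dots> = inv\<^bsub>grp (G1 G) U\<^esub> (ract G U (cellmap c U) (zg (cdom d) U) \<otimes>\<^bsub>grp (G1 G) U\<^esub> cellmap d U)
        \<otimes>\<^bsub>grp (G1 G) U\<^esub> (ract G U a (zg (cdom d) U) \<otimes>\<^bsub>grp (G1 G) U\<^esub> v)"
      unfolding zc_g[OF d U] ract_comp[OF U ma g bd_sec[OF U n]] peiffer[OF U ract_sec[OF U g ma] n]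
      unfolding ract_mult[OF U g A.inv_closed[OF m] a] ract_inv[OF U g m]
      using mg ag n v by (simp add: A.m_assoc A.inv_mult_group)
    also have "\<dots> = cellmap (psi2 (zhcomp c d)) U (cellmap (psicomp (cdom c) (cdom d)) U ?x)"
      unfolding psi_comp_map[OF F H e U a v] psi2_map[OF U A.m_closed[OF ag v]] using U by simp
    also have "\<dots> = cellmap (wvcomp (psicomp (cdom c) (cdom d)) (psi2 (zhcomp c d))) U ?x"
      by (rule vcomp_map[OF U, symmetric]) (use x qd in simp)
    finally show "cellmap (wvcomp (whcomp (psi2 c) (psi2 d)) (psicomp (ccod c) (ccod d))) U ?x
        = cellmap (wvcomp (psicomp (cdom c) (cdom d)) (psi2 (zhcomp c d))) U ?x" .
  qed (use qd qd' in simp_all)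
qed

lemma psi2_triv:
  assumes "U \<in> obs X" "a \<in> sec (G1 G) U"
  shows "cellmap (psi2 (ztriv F H)) U a = a"
proof -
  interpret A: section_group "G1 G" U by (rule section_groupI[OF G1 assms(1)])
  show ?thesis using assms by simp
qed

text \<open>On \<open>((\<alpha>, \<beta>), \<gamma>)\<close> the two sides are \<open>(\<alpha>\<^sup>g\<^sup>'
  \<beta>)\<^sup>h \<gamma>\<close> and \<open>\<alpha>\<^sup>g\<^sup>'\<^sup>h (\<beta>\<^sup>h
  \<gamma>)\<close>, equal because \<open>h\<close> acts by an automorphism.\<close>

lemma psi_comp_assoc:
  assumes F: "F \<in> Z1" and H: "H \<in> Z1" and K: "K \<in> Z1"
    and e: "fst (snd F) = fst H" "fst (snd H) = fst K"
  shows "wvcomp (whcomp (psicomp F H) (wone2 (psi K)))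
      (wvcomp (psicomp (zcomp F H) K)
         (psi2 (ztriv (zcomp (zcomp F H) K) (zcomp F (zcomp H K)))))
    = wvcomp (wassoc (psi F) (psi H) (psi K))
      (wvcomp (whcomp (wone2 (psi F)) (psicomp H K)) (psicomp F (zcomp H K)))"
    (is "wvcomp ?c1 (wvcomp ?c2 ?c3) = wvcomp ?d1 (wvcomp ?d2 ?d3)")
proof -
  note pF = psi_w_arr[OF F] and pH = psi_w_arr[OF H] and pK = psi_w_arr[OF K]
  note FH = z_comp_arr[OF F H e(1)] and HK = z_comp_arr[OF H K e(2)]
  have e1: "fst (snd (zcomp F H)) = fst K" and e2: "fst (snd F) = fst (zcomp H K)" using e by simp_all
  have pe: "fst (snd (psi F)) = fst (psi H)" "fst (snd (psi H)) = fst (psi K)" using e by simp_all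
  note qFH = psi_comp_cell[OF F H e(1)] and dFH = psi_comp_dom[OF F H e(1)]
  note qHK = psi_comp_cell[OF H K e(2)] and dHK = psi_comp_dom[OF H K e(2)]
  note c2 = psi_comp_cell[OF FH K e1] and d2 = psi_comp_dom[OF FH K e1]
  note d3 = psi_comp_cell[OF F HK e2] and dd3 = psi_comp_dom[OF F HK e2]
  note c3 = psi2_cell[OF z_assoc_cell[OF F H K e]]
  note d1 = assoc_cell[OF pF pH pK pe] and dd1 = assoc_dom[OF pF pH pK pe]
  have h1: "fst (snd (cdom (psicomp F H))) = fst (cdom (wone2 (psi K)))" using dFH e by simp
  have h2: "fst (snd (cdom (wone2 (psi F)))) = fst (cdom (psicomp H K))" using dHK e by simp
  note c1 = hcomps_cells[OF qFH one2_cell[OF pK] h1] and dc2 = hcomps_cells[OF one2_cell[OF pF] qHK h2]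
  have v1: "ccod ?c2 = cdom ?c3" using d2 by simp
  have v2: "ccod ?c1 = cdom (wvcomp ?c2 ?c3)" using dFH d2 by simp
  have v3: "ccod ?d2 = cdom ?d3" using dHK dd3 by simp
  have v4: "ccod ?d1 = cdom (wvcomp ?d2 ?d3)" using dHK dd1 by simp
  show ?thesis
  proof (rule comp3_cell_eqI[OF vcomp_cells[OF c1 vcomp_cells[OF c2 c3 v1] v2] vcomp_cells[OF d1 vcomp_cells[OF dc2 d3 v3] v4]
        _ _ _ pF pH pK pe(1) densely_True])
    fix U a b w assume U: "U \<in> obs X" and a': "a \<in> sec (w_tor (psi F)) U" and b': "b \<in> sec (w_tor (psi H)) U"
      and w': "w \<in> sec (w_tor (psi K)) U"
    have a: "a \<in> sec (G1 G) U" and b: "b \<in> sec (G1 G) U" and w: "w \<in> sec (G1 G) U" using a' b' w' by simp_all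
    interpret A: section_group "G1 G" U by (rule section_groupI[OF G1 U])
    note g = zg_sec[OF H U] and k = zg_sec[OF K U]
    let ?ab = "ract G U a (zg H U) \<otimes>\<^bsub>grp (G1 G) U\<^esub> b" and ?bw = "ract G U b (zg K U) \<otimes>\<^bsub>grp (G1 G) U\<^esub> w"
    note ag = ract_sec[OF U g a] and bk = ract_sec[OF U k b]
    have ab: "?ab \<in> sec (G1 G) U" and bw: "?bw \<in> sec (G1 G) U" using ag bk b w by simp_all
    let ?x = "tpw (wcomp (psi F) (psi H)) (psi K) U (tpw (psi F) (psi H) U a b) w"
    note tab = tpw_sec[OF pF pH U a' b'] and tbw = tpw_sec[OF pH pK U b' w']
    have x: "?x \<in> sec (w_tor (wcomp (wcomp (psi F) (psi H)) (psi K))) U"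
      by (rule tpw_sec[OF w_comp_arr[OF pF pH pe(1)] pK U tab w'])
    have 1: "cellmap ?c1 U ?x = tpw (psi (zcomp F H)) (psi K) U ?ab w"
      using hcomps_map[OF qFH one2_cell[OF pK] h1 U, of "tpw (psi F) (psi H) U a b" w] dFH tab w'
        psi_comp_map[OF F H e(1) U a b] one2_map[OF U w'] by simp
    have x1: "cellmap ?c1 U ?x \<in> sec (w_tor (cdom ?c2)) U"
      using cellmap_sec[OF c1 U, of ?x] x dFH d2 by simp
    have kk: "ract G U ?ab (zg K U) \<otimes>\<^bsub>grp (G1 G) U\<^esub> w \<in> sec (G1 G) U" using ract_sec[OF U k ab] w by simp
    have "cellmap (wvcomp ?c1 (wvcomp ?c2 ?c3)) U ?x = cellmap (wvcomp ?c2 ?c3) U (cellmap ?c1 U ?x)"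
      by (rule vcomp_map[OF U]) (use x dFH in simp)
    also have "\<dots> = cellmap ?c3 U (cellmap ?c2 U (cellmap ?c1 U ?x))" by (rule vcomp_map[OF U x1])
    also have "\<dots> = ract G U ?ab (zg K U) \<otimes>\<^bsub>grp (G1 G) U\<^esub> w"
      unfolding 1 psi_comp_map[OF FH K e1 U ab w] by (rule psi2_triv[OF U kk])
    finally have L: "cellmap (wvcomp ?c1 (wvcomp ?c2 ?c3)) U ?x = ract G U ?ab (zg K U) \<otimes>\<^bsub>grp (G1 G) U\<^esub> w" .
    have 2: "cellmap ?d2 U (tpw (psi F) (wcomp (psi H) (psi K)) U a (tpw (psi H) (psi K) U b w))
        = tpw (psi F) (psi (zcomp H K)) U a ?bw"
      using hcomps_map[OF one2_cell[OF pF] qHK h2 U, of a "tpw (psi H) (psi K) U b w"] dHK tbw a'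
        psi_comp_map[OF H K e(2) U b w] one2_map[OF U a'] by simp
    have y: "cellmap ?d1 U ?x \<in> sec (w_tor (cdom ?d2)) U"
      using cellmap_sec[OF d1 U, of ?x] x dd1 dHK by simp
    have "cellmap (wvcomp ?d1 (wvcomp ?d2 ?d3)) U ?x = cellmap (wvcomp ?d2 ?d3) U (cellmap ?d1 U ?x)"
      by (rule vcomp_map[OF U]) (use x dd1 in simp)
    also have "\<dots> = cellmap ?d3 U (cellmap ?d2 U (cellmap ?d1 U ?x))" by (rule vcomp_map[OF U y])
    also have "\<dots> = ract G U a (zg (zcomp H K) U) \<otimes>\<^bsub>grp (G1 G) U\<^esub> ?bw"
      unfolding assoc_map[OF pF pH pK pe U a' b' w'] 2 by (rule psi_comp_map[OF F HK e2 U a bw])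
    also have "\<dots> = ract G U ?ab (zg K U) \<otimes>\<^bsub>grp (G1 G) U\<^esub> w"
      using U ract_comp[OF U a g k] ract_mult[OF U k ag b] ract_sec[OF U k ag] bk w by (simp add: A.m_assoc)
    finally show "cellmap (wvcomp ?c1 (wvcomp ?c2 ?c3)) U ?x = cellmap (wvcomp ?d1 (wvcomp ?d2 ?d3)) U ?x"
      using L by simp
  qed (use dFH d2 dd1 dd3 in simp_all)
qed

text \<open>Both sides are the left action \<open>(\<alpha>, \<beta>) \<mapsto> \<alpha>\<^sup>g \<beta>\<close>
  of \<open>psi_bit\<close>.\<close>

lemma psi_comp_lunit:
  assumes F: "F \<in> Z1"
  shows "wvcomp (whcomp (funit \<Psi> (fst F)) (wone2 (psi F)))
      (wvcomp (psicomp (zone (fst F)) F) (psi2 (ztriv (zcomp (zone (fst F)) F) F)))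
    = wlunit (psi F)"
    (is "wvcomp ?c1 (wvcomp ?c2 ?c3) = ?l")
proof -
  let ?A = "fst F"
  note pF = psi_w_arr[OF F] and A = z_src[OF F]
  note O = z_one_arr[OF A] and wO = one1_arr[OF A]
  have e: "fst (snd (zone ?A)) = ?A" by simp
  have u: "funit \<Psi> ?A \<in> W2" using psi_unit[OF A] by simp
  have h: "fst (snd (cdom (funit \<Psi> ?A))) = fst (cdom (wone2 (psi F)))" by simp
  note c1 = hcomps_cells[OF u one2_cell[OF pF] h]
  note c2 = psi_comp_cell[OF O F e] and d2 = psi_comp_dom[OF O F e]
  note c3 = psi2_cell[OF z_lunit_cell[OF F]]
  have v1: "ccod ?c2 = cdom ?c3" using d2 by simp
  have v2: "ccod ?c1 = cdom (wvcomp ?c2 ?c3)" using d2 by simp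
  have l: "cdom ?l = wcomp (wone ?A) (psi F)" "ccod ?l = psi F" using lunit_dom[OF pF] by simp_all
  show ?thesis
  proof (rule comp_cell_eqI[OF vcomp_cells[OF c1 vcomp_cells[OF c2 c3 v1] v2] lunit_cell[OF pF] _ _ _ wO pF densely_True])
    fix U a v assume U: "U \<in> obs X" and a': "a \<in> sec (w_tor (wone ?A)) U" and v': "v \<in> sec (w_tor (psi F)) U"
    have a: "a \<in> sec (G1 G) U" and v: "v \<in> sec (G1 G) U" using a' v' by simp_all
    let ?x = "tpw (wone ?A) (psi F) U a v"
    have x: "?x \<in> sec (w_tor (wcomp (wone ?A) (psi F))) U" by (rule tpw_sec[OF wO pF U a' v'])
    have 1: "cellmap ?c1 U ?x = tpw (psi (zone ?A)) (psi F) U a v"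
      using hcomps_map[OF u one2_cell[OF pF] h U, of a v] a v one2_map[OF U v'] U by simp
    have x1: "cellmap ?c1 U ?x \<in> sec (w_tor (cdom ?c2)) U" using cellmap_sec[OF c1 U, of ?x] x d2 by simp
    have r: "ract G U a (zg F U) \<otimes>\<^bsub>grp (G1 G) U\<^esub> v \<in> sec (G1 G) U"
      by (rule mult_sec[OF G1 U ract_sec[OF U zg_sec[OF F U] a] v])
    have "cellmap (wvcomp ?c1 (wvcomp ?c2 ?c3)) U ?x = cellmap (wvcomp ?c2 ?c3) U (cellmap ?c1 U ?x)"
      by (rule vcomp_map[OF U]) (use x in simp)
    also have "\<dots> = cellmap ?c3 U (cellmap ?c2 U (cellmap ?c1 U ?x))" by (rule vcomp_map[OF U x1])
    also have "\<dots> = ract G U a (zg F U) \<otimes>\<^bsub>grp (G1 G) U\<^esub> v"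
      unfolding 1 psi_comp_map[OF O F e U a v] by (rule psi2_triv[OF U r])
    also have "\<dots> = cellmap ?l U ?x"
      using lunit_map[OF pF U a v'] psi_bit[OF F U a v] by simp
    finally show "cellmap (wvcomp ?c1 (wvcomp ?c2 ?c3)) U ?x = cellmap ?l U ?x" .
  qed (use l in simp_all)
qed

lemma psi_comp_runit:
  assumes F: "F \<in> Z1"
  shows "wvcomp (whcomp (wone2 (psi F)) (funit \<Psi> (fst (snd F))))
      (wvcomp (psicomp F (zone (fst (snd F)))) (psi2 (ztriv (zcomp F (zone (fst (snd F)))) F)))
    = wrunit (psi F)"
    (is "wvcomp ?c1 (wvcomp ?c2 ?c3) = ?l")
proof -
  let ?B = "fst (snd F)"
  note pF = psi_w_arr[OF F] and B = z_trg[OF F]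
  note O = z_one_arr[OF B] and wO = one1_arr[OF B]
  have e: "fst (snd F) = fst (zone ?B)" by simp
  have u: "funit \<Psi> ?B \<in> W2" using psi_unit[OF B] by simp
  have h: "fst (snd (cdom (wone2 (psi F)))) = fst (cdom (funit \<Psi> ?B))" by simp
  note c1 = hcomps_cells[OF one2_cell[OF pF] u h]
  note c2 = psi_comp_cell[OF F O e] and d2 = psi_comp_dom[OF F O e]
  note c3 = psi2_cell[OF z_runit_cell[OF F]]
  have v1: "ccod ?c2 = cdom ?c3" using d2 by simp
  have v2: "ccod ?c1 = cdom (wvcomp ?c2 ?c3)" using d2 by simp
  have l: "cdom ?l = wcomp (psi F) (wone ?B)" "ccod ?l = psi F" using runit_dom[OF pF] by simp_all
  show ?thesis
  proof (rule comp_cell_eqI[OF vcomp_cells[OF c1 vcomp_cells[OF c2 c3 v1] v2] runit_cell[OF pF] _ _ _ pF wO densely_True])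
    fix U a v assume U: "U \<in> obs X" and a': "a \<in> sec (w_tor (psi F)) U" and v': "v \<in> sec (w_tor (wone ?B)) U"
    have a: "a \<in> sec (G1 G) U" and v: "v \<in> sec (G1 G) U" using a' v' by simp_all
    let ?x = "tpw (psi F) (wone ?B) U a v"
    have x: "?x \<in> sec (w_tor (wcomp (psi F) (wone ?B))) U" by (rule tpw_sec[OF pF wO U a' v'])
    have 1: "cellmap ?c1 U ?x = tpw (psi F) (psi (zone ?B)) U a v"
      using hcomps_map[OF one2_cell[OF pF] u h U, of a v] a v one2_map[OF U a'] U by simp
    have x1: "cellmap ?c1 U ?x \<in> sec (w_tor (cdom ?c2)) U" using cellmap_sec[OF c1 U, of ?x] x d2 by simp
    have k: "ract G U a (zg (zone ?B) U) = a" using U ract_id[OF U a] by simp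
    have "cellmap (wvcomp ?c1 (wvcomp ?c2 ?c3)) U ?x = cellmap (wvcomp ?c2 ?c3) U (cellmap ?c1 U ?x)"
      by (rule vcomp_map[OF U]) (use x in simp)
    also have "\<dots> = cellmap ?c3 U (cellmap ?c2 U (cellmap ?c1 U ?x))" by (rule vcomp_map[OF U x1])
    also have "\<dots> = a \<otimes>\<^bsub>grp (G1 G) U\<^esub> v"
      unfolding 1 psi_comp_map[OF F O e U a v] k by (rule psi2_triv[OF U mult_sec[OF G1 U a v]])
    also have "\<dots> = cellmap ?l U ?x"
      using runit_map[OF pF U a' v] by simp
    finally show "cellmap (wvcomp ?c1 (wvcomp ?c2 ?c3)) U ?x = cellmap ?l U ?x" .
  qed (use l in simp_all)
qed

lemma Psi_bifunctor: "bifunctor Zcat Wcat \<Psi>"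
proof (intro bifunctor.intro Z_bicategory W_bicategory bifunctor_axioms.intro, unfold Z_simps W_simps Psi_simps(1-3))
  fix F H K :: "('o, 'm, 'e, 'a, 'b, 'g) zarr" and c d :: "('o, 'm, 'e, 'a, 'b, 'g) zcell"
    and A :: "('o, 'm, 'e, 'a, 'b, 'g) zobj"
  show "psi F \<in> hom1 Wcat (fst F) (fst (snd F))" if "F \<in> Z1"
    using psi_w_arr[OF that] unfolding hom1_def by simp
  show "psi2 c \<in> hom2 Wcat (psi (cdom c)) (psi (ccod c))" if "c \<in> Z2"
    using psi2_cell[OF that] unfolding hom2_def by simp
  show "psi2 (ztriv F F) = wone2 (psi F)" if F: "F \<in> Z1"
  proof (rule cell_eqI[OF psi2_cell[OF z_one2[OF F]] one2_cell[OF psi_w_arr[OF F]] _ _ densely_True])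
    fix U u assume U: "U \<in> obs X" and "u \<in> sec (w_tor (cdom (psi2 (ztriv F F)))) U"
    hence u: "u \<in> sec (G1 G) U" by simp
    thus "cellmap (psi2 (ztriv F F)) U u = cellmap (wone2 (psi F)) U u"
      unfolding psi2_triv[OF U u] using one2_map[OF U, of u "psi F"] by simp
  qed simp_all
  show "\<lbrakk>c \<in> Z2; d \<in> Z2; ccod c = cdom d\<rbrakk> \<Longrightarrow> psi2 (zvcomp c d) = wvcomp (psi2 c) (psi2 d)"
    by (rule psi_vcomp)
  show "psicomp F H \<in> iso2 Wcat (wcomp (psi F) (psi H)) (psi (zcomp F H))"
    if "F \<in> Z1" "H \<in> Z1" "fst (snd F) = fst H"
    by (rule w_iso2[OF psi_comp_cell[OF that] psi_comp_dom[OF that]])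
  show "\<lbrakk>c \<in> Z2; d \<in> Z2; fst (snd (cdom c)) = fst (cdom d)\<rbrakk>
    \<Longrightarrow> wvcomp (whcomp (psi2 c) (psi2 d)) (psicomp (ccod c) (ccod d))
      = wvcomp (psicomp (cdom c) (cdom d)) (psi2 (zhcomp c d))"
    by (rule psi_comp_natural)
  show "funit \<Psi> A \<in> iso2 Wcat (wone A) (psi (zone A))" if "A \<in> Z0"
    unfolding Psi_simps by (rule w_iso2[OF psi_unit[OF that]]) simp_all
  show "\<lbrakk>F \<in> Z1; H \<in> Z1; K \<in> Z1; fst (snd F) = fst H; fst (snd H) = fst K\<rbrakk>
    \<Longrightarrow> wvcomp (whcomp (psicomp F H) (wone2 (psi K)))
      (wvcomp (psicomp (zcomp F H) K)
         (psi2 (ztriv (zcomp (zcomp F H) K) (zcomp F (zcomp H K)))))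
    = wvcomp (wassoc (psi F) (psi H) (psi K))
      (wvcomp (whcomp (wone2 (psi F)) (psicomp H K)) (psicomp F (zcomp H K)))"
    by (rule psi_comp_assoc)
  show "F \<in> Z1 \<Longrightarrow> wvcomp (whcomp (funit \<Psi> (fst F)) (wone2 (psi F)))
      (wvcomp (psicomp (zone (fst F)) F) (psi2 (ztriv (zcomp (zone (fst F)) F) F)))
    = wlunit (psi F)"
    by (rule psi_comp_lunit)
  show "F \<in> Z1 \<Longrightarrow> wvcomp (whcomp (wone2 (psi F)) (funit \<Psi> (fst (snd F))))
      (wvcomp (psicomp F (zone (fst (snd F)))) (psi2 (ztriv (zcomp F (zone (fst (snd F)))) F)))
    = wrunit (psi F)"
    by (rule psi_comp_runit)
qed

section \<open>Full faithfulness and essential surjectivity\<close>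

text \<open>A 2-arrow between the images of \<open>F\<close> and \<open>H\<close> is an equivariant automorphism of the trivial torsor,
  that is, left multiplication by a global section of \<open>G\<^sub>1\<close>.\<close>

lemma psi2_surj:
  assumes F: "F \<in> Z1" and H: "H \<in> Z1" and e: "fst H = fst F" "fst (snd H) = fst (snd F)"
    and j: "(psi F, psi H, j) \<in> W2"
  shows "\<exists>c\<in>Z2. cdom c = F \<and> ccod c = H \<and> psi2 c = (psi F, psi H, j)"
proof -
  note pH = psi_w_arr[OF H]
  have j_maps: "j \<in> maps X I I" using cell_maps[OF j] by simp
  define b where "b U = j U \<one>\<^bsub>grp (G1 G) U\<^esub>" for U
  have b: "b U \<in> sec (G1 G) U" if U: "U \<in> obs X" for U
    unfolding b_def using maps_sec[OF j_maps U] one_sec[OF G1 U] by simp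
  have b_res: "res (G1 G) f (b U) = b (dm X f)" if f: "f \<in> into X U" for U f
    unfolding b_def using maps_res[OF j_maps f] one_sec[OF G1 into_obs[OF f]] res_one[OF G1 f] by simp
  have j_mult: "j U a = b U \<otimes>\<^bsub>grp (G1 G) U\<^esub> a" if U: "U \<in> obs X" and a: "a \<in> sec (G1 G) U" for U a
  proof -
    interpret A: section_group "G1 G" U by (rule section_groupI[OF G1 U])
    show ?thesis unfolding b_def using cell_tact[OF j U, of "\<one>\<^bsub>grp (G1 G) U\<^esub>" a] a by simp
  qed
  \<comment> \<open>\<open>\<mu>\<close> acts by \<open>\<alpha> \<mapsto> \<mu>\<^sup>-\<^sup>1
    \<alpha>\<close>, so left multiplication by \<open>b\<close> comes from
    \<open>b\<^sup>-\<^sup>1\<close>\<close>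
  let ?m = "\<lambda>U\<in>obs X. inv\<^bsub>grp (G1 G) U\<^esub> (b U)"
  have c: "(F, H, ?m) \<in> Z2"
    unfolding z_cell_iff fst_conv snd_conv
  proof (intro conjI ballI F H e)
    show "?m \<in> gsec X (G1 G)"
    proof (rule gsecI)
      show "inv\<^bsub>grp (G1 G) U\<^esub> (b U) \<in> sec (G1 G) U" if U: "U \<in> obs X" for U by (rule inv_sec[OF G1 U b[OF U]])
      show "res (G1 G) f (inv\<^bsub>grp (G1 G) U\<^esub> (b U)) = inv\<^bsub>grp (G1 G) (dm X f)\<^esub> (b (dm X f))"
        if f: "f \<in> into X U" for U f
        unfolding res_inv[OF G1 f b[OF into_obs[OF f]]] b_res[OF f] ..
    qed
    fix U assume U: "U \<in> obs X"
    note bU = b[OF U] and o = one_sec[OF G1 U]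
    interpret K: section_group "G0 G" U by (rule section_groupI[OF G0 U])
    have "w_phi (psi H) U (b U) = w_phi (psi F) U \<one>\<^bsub>grp (G1 G) U\<^esub>"
      unfolding b_def using cell_phi[OF j U, of "\<one>\<^bsub>grp (G1 G) U\<^esub>"] o by simp
    hence g: "zg F U = zg H U \<otimes>\<^bsub>grp (G0 G) U\<^esub> bd G U (b U)"
      unfolding psi_phi_one[OF F U] psi_phi[OF U bU] by simp
    show "zg F U \<otimes>\<^bsub>grp (G0 G) U\<^esub> bd G U (?m U) = zg H U"
      using U g bd_inv[OF U bU] bd_sec[OF U bU] zg_sec[OF H U] by (simp add: K.m_assoc)
    let ?B = "fst (snd F)"
    note B = z_trg[OF F]
    interpret E: section_group "tot ?B" U by (rule section_groupI[OF tot[OF B] U])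
    interpret A: section_group "G1 G" U by (rule section_groupI[OF G1 U])
    fix x assume x: "x \<in> sec (tot (fst F)) U"
    \<comment> \<open>two descriptions of the germ of the target at \<open>b\<close>: it is transported by
      \<open>j\<close> from the germ of the source at \<open>1\<close>, and it is the germ of the target at
      \<open>1\<close> conjugated by \<open>b\<close>\<close>
    have g1: "germ (psi H) U (b U) (zt F U)" unfolding b_def by (rule cell_germ[OF j U psi_germ[OF F U]])
    have g2: "germ (psi H) U (b U) (\<lambda>x. inv\<^bsub>grp (tot ?B) U\<^esub> (inc ?B U (b U)) \<otimes>\<^bsub>grp (tot ?B) U\<^esub> zt H U x \<otimes>\<^bsub>grp (tot ?B) U\<^esub> inc ?B U (b U))"
      using germ_tact[OF pH U psi_germ[OF H U] bU] bU e by simp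
    have x': "x \<in> sec (tot (fst (psi H))) U" using x e by simp
    have t: "zt F U x = inv\<^bsub>grp (tot ?B) U\<^esub> (inc ?B U (b U)) \<otimes>\<^bsub>grp (tot ?B) U\<^esub> zt H U x \<otimes>\<^bsub>grp (tot ?B) U\<^esub> inc ?B U (b U)"
      by (rule germ_unique[OF pH U g1 g2 x'])
    have tH: "zt H U x \<in> sec (tot ?B) U" using z_zt_sec[OF H e(2) U] x e by simp
    show "zt H U x = inv\<^bsub>grp (tot ?B) U\<^esub> (inc ?B U (?m U)) \<otimes>\<^bsub>grp (tot ?B) U\<^esub> zt F U x \<otimes>\<^bsub>grp (tot ?B) U\<^esub> inc ?B U (?m U)"
      unfolding t using U tH inc_inv[OF B U bU] inc_sec[OF B U bU] by (simp add: E.m_assoc)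
  qed
  have "psi2 (F, H, ?m) = (psi F, psi H, j)"
  proof (rule cell_eqI[OF psi2_cell[OF c] j _ _ densely_True])
    fix U u assume U: "U \<in> obs X" and "u \<in> sec (w_tor (cdom (psi2 (F, H, ?m)))) U"
    hence u: "u \<in> sec (G1 G) U" by simp
    interpret A: section_group "G1 G" U by (rule section_groupI[OF G1 U])
    show "cellmap (psi2 (F, H, ?m)) U u = cellmap (psi F, psi H, j) U u"
      unfolding psi2_map[OF U u] using U b[OF U] j_mult[OF U u] by simp
  qed simp_all
  thus ?thesis using c by (intro bexI[of _ "(F, H, ?m)"]) simp_all
qed

text \<open>The value of \<open>\<alpha> \<mapsto> \<mu>\<^sup>-\<^sup>1 \<alpha>\<close> at \<open>1\<close>
  determines \<open>\<mu>\<close>.\<close>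

lemma psi2_inj:
  assumes c: "c \<in> Z2" and d: "d \<in> Z2" and e: "cdom c = cdom d" "ccod c = ccod d"
    and eq: "psi2 c = psi2 d"
  shows "c = d"
proof (rule zcell_eqI[OF c d e])
  fix U assume U: "U \<in> obs X"
  interpret A: section_group "G1 G" U by (rule section_groupI[OF G1 U])
  note o = one_sec[OF G1 U]
  have "cellmap (psi2 c) U \<one>\<^bsub>grp (G1 G) U\<^esub> = cellmap (psi2 d) U \<one>\<^bsub>grp (G1 G) U\<^esub>" using eq by simp
  hence "inv\<^bsub>grp (G1 G) U\<^esub> (cellmap c U) = inv\<^bsub>grp (G1 G) U\<^esub> (cellmap d U)"
    unfolding psi2_map[OF U o] using zc_sec[OF c U] zc_sec[OF d U] by simp
  hence "inv\<^bsub>grp (G1 G) U\<^esub> (inv\<^bsub>grp (G1 G) U\<^esub> (cellmap c U)) = inv\<^bsub>grp (G1 G) U\<^esub> (inv\<^bsub>grp (G1 G) U\<^esub> (cellmap d U))" by simp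
  thus "cellmap c U = cellmap d U" using zc_sec[OF c U] zc_sec[OF d U] by simp
qed

lemma Psi_fully_faithful: "locally_fully_faithful Zcat Wcat \<Psi>"
  unfolding locally_fully_faithful_def
proof (intro ballI)
  fix A B F H assume "F \<in> hom1 Zcat A B" "H \<in> hom1 Zcat A B"
  hence F: "F \<in> Z1" and H: "H \<in> Z1" and e: "fst H = fst F" "fst (snd H) = fst (snd F)"
    unfolding hom1_def by auto
  show "bij_betw psi2 (hom2 Zcat F H) (hom2 Wcat (far \<Psi> F) (far \<Psi> H))"
  proof (rule bij_betw_imageI)
    show "inj_on psi2 (hom2 Zcat F H)"
    proof (rule inj_onI)
      fix c d assume "c \<in> hom2 Zcat F H" "d \<in> hom2 Zcat F H" and eq: "psi2 c = psi2 d"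
      thus "c = d" unfolding hom2_def by (intro psi2_inj) simp_all
    qed
    show "psi2 ` hom2 Zcat F H = hom2 Wcat (far \<Psi> F) (far \<Psi> H)"
    proof (intro equalityI subsetI)
      fix y assume "y \<in> psi2 ` hom2 Zcat F H"
      then obtain c where "c \<in> Z2" "cdom c = F" "ccod c = H" "y = psi2 c" unfolding hom2_def by auto
      thus "y \<in> hom2 Wcat (far \<Psi> F) (far \<Psi> H)"
        using psi2_cell[of c] unfolding hom2_def by simp
    next
      fix y assume "y \<in> hom2 Wcat (far \<Psi> F) (far \<Psi> H)"
      hence y: "y \<in> W2" "cdom y = psi F" "ccod y = psi H" unfolding hom2_def by auto
      then obtain j where j: "y = (psi F, psi H, j)" by (metis prod.collapse)
      obtain c where "c \<in> Z2" "cdom c = F" "ccod c = H" "psi2 c = y"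
        using psi2_surj[OF F H e, of j] y(1) j by blast
      thus "y \<in> psi2 ` hom2 Zcat F H" unfolding hom2_def by (intro image_eqI[of _ _ c]) simp_all
    qed
  qed
qed

text \<open>A trivialisation of the torsor of an arrow provides compatible sections \<open>u\<^sub>U\<close>; the germs at these
  sections form an arrow given by a global section.\<close>

lemma psi_ess_surj:
  assumes H: "H \<in> W1" and j: "j \<in> torsor_isos X (G1 G) I (w_tor H)"
  shows "\<exists>F\<in>Z1. fst F = fst H \<and> fst (snd F) = fst (snd H) \<and> (psi F, H, j) \<in> W2"
proof -
  let ?A = "fst H" and ?B = "fst (snd H)"
  note A = w_src[OF H] and B = w_trg[OF H]
  note AP = grp_presheaf[OF tot[OF A]]
  interpret t: twisted X \<Gamma> G "w_tor H" ?B by (rule w_twisted[OF H])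
  have jm: "j \<in> maps X I (w_tor H)" and jt: "\<And>U u a. \<lbrakk>U \<in> obs X; u \<in> sec I U; a \<in> sec (G1 G) U\<rbrakk>
      \<Longrightarrow> j U (tact I U u a) = tact (w_tor H) U (j U u) a"
    using j unfolding torsor_isos_def by blast+
  define u where "u U = j U \<one>\<^bsub>grp (G1 G) U\<^esub>" for U
  have u: "u U \<in> sec (w_tor H) U" if U: "U \<in> obs X" for U
    unfolding u_def using maps_sec[OF jm U] one_sec[OF G1 U] by simp
  have u_res: "res (w_tor H) f (u U) = u (dm X f)" if f: "f \<in> into X U" for U f
    unfolding u_def using maps_res[OF jm f] one_sec[OF G1 into_obs[OF f]] res_one[OF G1 f] by simp
  define s where "s U = (SOME s. germ H U (u U) s)" for U
  have s: "germ H U (u U) (s U)" if U: "U \<in> obs X" for U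
    unfolding s_def by (rule someI_ex[OF ex_germ[OF H U u[OF U]]])
  note s_sec = la_sec[OF germ_arr(2)[OF s]]
  let ?t = "mk_map X (tot ?A) s" and ?g = "\<lambda>U\<in>obs X. w_phi H U (u U)"
  have tm: "?t \<in> maps X (tot ?A) (tot ?B)"
  proof (rule mapsI[OF s_sec _ AP])
    fix U f x assume U: "U \<in> obs X" and f: "f \<in> into X U" and x: "x \<in> sec (tot ?A) U"
    note V = dm_into[OF f] and rx = res_sec[OF AP f x]
    note sx = s_sec[OF U x] and srx = s_sec[OF V rx]
    \<comment> \<open>the chosen germs are compatible, as both sides are the coordinate of the same section at
      \<open>u\<close>\<close>
    have "t.pt (dm X f) (u (dm X f)) (res (tot ?B) f (s U x)) = res t.T f (w_t H U x)"
      unfolding germ_arr(3)[OF s[OF U] x] t.C.pt_res[OF f u[OF U] sx] u_res[OF f] ..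
    also have "\<dots> = t.pt (dm X f) (u (dm X f)) (s (dm X f) (res (tot ?A) f x))"
      unfolding maps_res[OF w_maps[OF H] f x] by (rule germ_arr(3)[OF s[OF V] rx])
    finally show "res (tot ?B) f (s U x) = s (dm X f) (res (tot ?A) f x)"
      by (rule t.C.pt_inj[OF V u[OF V] res_sec[OF t.C.FP f sx] srx])
  qed
  have F: "(?A, ?B, ?t, ?g) \<in> Z1"
    unfolding z_arr_iff fst_conv snd_conv
  proof (intro conjI ballI A B tm)
    show "?g \<in> gsec X (G0 G)"
    proof (rule gsecI)
      show "w_phi H U (u U) \<in> sec (G0 G) U" if U: "U \<in> obs X" for U by (rule maps_sec[OF w_phi_maps[OF H] U u[OF U]])
      show "res (G0 G) f (w_phi H U (u U)) = w_phi H (dm X f) (u (dm X f))" if f: "f \<in> into X U" for U f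
        unfolding maps_res[OF w_phi_maps[OF H] f u[OF into_obs[OF f]]] u_res[OF f] ..
    qed
    fix U assume U: "U \<in> obs X"
    show "local_arrow ?A ?B U (?t U) (?g U)"
      using germ_arr(2)[OF s[OF U]] local_arrow_cong[OF A U, of "?t U" "s U"] U by simp
  qed
  let ?F = "(?A, ?B, ?t, ?g)"
  have "(psi ?F, H, j) \<in> W2"
  proof (rule w_cell_germI[OF psi_w_arr[OF F] H _ _ _ _ densely_True])
    show "j \<in> maps X (w_tor (psi ?F)) (w_tor H)" using jm by simp
    show "j U (tact (w_tor (psi ?F)) U v a) = tact (w_tor H) U (j U v) a"
      if "U \<in> obs X" "v \<in> sec (w_tor (psi ?F)) U" "a \<in> sec (G1 G) U" for U v a using jt that by simp
    fix U assume U: "U \<in> obs X"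
    show "\<exists>v r. germ (psi ?F) U v r \<and> germ H U (j U v) r \<and> w_phi H U (j U v) = w_phi (psi ?F) U v"
    proof (intro exI conjI)
      show "germ (psi ?F) U \<one>\<^bsub>grp (G1 G) U\<^esub> (?t U)" using psi_germ[OF F U] by simp
      show "germ H U (j U \<one>\<^bsub>grp (G1 G) U\<^esub>) (?t U)"
        unfolding u_def[symmetric] by (rule germ_cong[OF H U s[OF U]]) (simp add: U)
      show "w_phi H U (j U \<one>\<^bsub>grp (G1 G) U\<^esub>) = w_phi (psi ?F) U \<one>\<^bsub>grp (G1 G) U\<^esub>"
        unfolding psi_phi_one[OF F U] u_def[symmetric] using U by simp
    qed
  qed simp_all
  thus ?thesis using F by (intro bexI[of _ ?F]) simp_all
qed

text \<open>As \<open>\<Psi>\<close> is the identity on objects, surjectivity on objects up to equivalence only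
  needs that the identity arrow is an equivalence; the unit isomorphism shows it to be inverse to
  itself.\<close>

lemma w_equivalent_refl:
  assumes A: "A \<in> Z0"
  shows "equivalent_objects Wcat A A"
proof -
  note O = one1_arr[OF A]
  have "wlunit (wone A) \<in> iso2 Wcat (wcomp (wone A) (wone A)) (wone A)"
    using w_iso2[OF lunit_cell[OF O] lunit_dom[OF O]] by simp
  moreover have "wone A \<in> hom1 Wcat A A" using O unfolding hom1_def by simp
  ultimately show ?thesis unfolding equivalent_objects_def by (intro bexI[of _ "wone A"] conjI) auto
qed

lemma Psi_biequivalence:
  assumes "H1_trivial X (G1 G)"
  shows "biequivalence (Zcat :: (('o, 'm, 'e, 'a, 'b, 'g) zobj, _, _) bicat) Wcat \<Psi>"
  unfolding biequivalence_def
proof (intro conjI Psi_bifunctor Psi_fully_faithful)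
  show "locally_ess_surj (Zcat :: (('o, 'm, 'e, 'a, 'b, 'g) zobj, _, _) bicat) Wcat \<Psi>"
    unfolding locally_ess_surj_def
  proof (intro ballI)
    fix A B :: "('o, 'm, 'e, 'a, 'b, 'g) zobj" and H
    assume "H \<in> hom1 Wcat (fob \<Psi> A) (fob \<Psi> B)"
    hence H: "H \<in> W1" "fst H = A" "fst (snd H) = B" unfolding hom1_def by simp_all
    obtain j where j: "j \<in> torsor_isos X (G1 G) I (w_tor H)"
      using assms w_torsor[OF H(1)] unfolding H1_trivial_def by blast
    obtain F where F: "F \<in> Z1" "fst F = A" "fst (snd F) = B" "(psi F, H, j) \<in> W2"
      using psi_ess_surj[OF H(1) j] H by blast
    have "(psi F, H, j) \<in> iso2 Wcat (far \<Psi> F) H" by (rule w_iso2[OF F(4)]) simp_all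
    moreover have "F \<in> hom1 Zcat A B" using F unfolding hom1_def by simp
    ultimately show "\<exists>f\<in>hom1 Zcat A B. iso2 Wcat (far \<Psi> f) H \<noteq> {}" by blast
  qed
  show "\<forall>B\<in>Ob Wcat. \<exists>A\<in>Ob (Zcat :: (('o, 'm, 'e, 'a, 'b, 'g) zobj, _, _) bicat).
      equivalent_objects Wcat (fob \<Psi> A) B"
    using w_equivalent_refl by auto
qed

text \<open>Over the point the only covering sieve is the maximal one, so having sections over a covering means
  having a section \<open>u\<close>; then \<open>\<alpha> \<mapsto> u \<alpha>\<close> is a
  trivialisation.\<close>

lemma point_H1_trivial:
  assumes "point_site X"
  shows "H1_trivial X (G1 G)"
  unfolding H1_trivial_def
proof (intro allI impI)
  fix P :: "('o, 'm, 'a, 'a) rtorsor" assume P: "is_torsor X (G1 G) P"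
  obtain p i where p: "obs X = {p}" "ars X = {i}" "cov X p = {{i}}"
    using assms unfolding point_site_def by blast
  have pU: "p \<in> obs X" using p by simp
  have idn: "f = idn X p" if "f \<in> into X U" for f U
    using that idn_ars[OF pU] p(2) unfolding into_def by auto
  have "{f \<in> into X p. sec P (dm X f) \<noteq> {}} \<in> cov X p" using tor_dense[OF P] pU unfolding densely_def by blast
  hence "i \<in> {f \<in> into X p. sec P (dm X f) \<noteq> {}}" using p(3) by auto
  moreover have "dm X i = p" using dm_obs[of i] p by auto
  ultimately obtain u where u: "u \<in> sec P p" by auto
  let ?j = "mk_map X I (\<lambda>U a. tact P U u a)"
  have U: "U = p" if "U \<in> obs X" for U using that p by simp
  have "?j \<in> torsor_isos X (G1 G) I P"
  proof (rule torsor_map_bij[OF triv_torsor P])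
    show "?j \<in> maps X I P"
    proof (rule mapsI[OF _ _ tor_presheaf[OF triv_torsor]])
      fix U a assume V: "U \<in> obs X" and "a \<in> sec I U"
      hence a: "a \<in> sec (G1 G) U" by simp
      have uU: "u \<in> sec P U" using u U[OF V] by simp
      show "tact P U u a \<in> sec P U" by (rule tact_sec[OF P V uU a])
      fix f assume f: "f \<in> into X U"
      have "res P f u = u" using idn[OF f] res_idn[OF tor_presheaf[OF P] pU u] by simp
      thus "res P f (tact P U u a) = tact P (dm X f) u (res I f a)" using tact_res[OF P f uU a] by simp
    qed
    fix U v a assume V: "U \<in> obs X" and "v \<in> sec I U" and a: "a \<in> sec (G1 G) U"
    hence v: "v \<in> sec (G1 G) U" by simp
    have uU: "u \<in> sec P U" using u U[OF V] by simp
    show "?j U (tact I U v a) = tact P U (?j U v) a"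
      using V v mult_sec[OF G1 V v a] tact_mult[OF P V uU v a] by simp
  qed
  thus "torsor_isos X (G1 G) I P \<noteq> {}" by blast
qed

end

theorem proposition9p3:
  fixes X :: "('o, 'm) site"
    and \<Gamma> :: "('o, 'm, 'g) gsheaf"
    and G :: "('o, 'm, 'a, 'b, 'g) xmod"
    and Z :: "(('o, 'm, 'e, 'a, 'b, 'g) zobj, ('o, 'm, 'e, 'a, 'b, 'g) zarr,
               ('o, 'm, 'e, 'a, 'b, 'g) zcell) bicat"
    and Z' :: "(('o, 'm, 'e, 'a, 'b, 'g) zobj, ('o, 'm, 'e, 'a, 'b, 'g) warr,
               ('o, 'm, 'e, 'a, 'b, 'g) wcell) bicat"
    and \<Psi> :: "(('o, 'm, 'e, 'a, 'b, 'g) zobj, ('o, 'm, 'e, 'a, 'b, 'g) zarr,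
               ('o, 'm, 'e, 'a, 'b, 'g) zcell, ('o, 'm, 'e, 'a, 'b, 'g) zobj,
               ('o, 'm, 'e, 'a, 'b, 'g) warr, ('o, 'm, 'e, 'a, 'b, 'g) wcell) bifun"
  assumes X: "grothendieck_site X"
    and \<Gamma>: "group_over X \<Gamma>"
    and G: "gamma_crossed_module X \<Gamma> G"
    and Z: "Z = Z_cat X \<Gamma> G"
    and Z': "Z' = W_cat X \<Gamma> G"
    and \<Psi>: "\<Psi> = Psi X \<Gamma> G"
  shows "bifunctor Z Z' \<Psi>
    \<and> Ob Z' = Ob Z \<and> (\<forall>A\<in>Ob Z. fob \<Psi> A = A)
    \<and> locally_groupoidal Z \<and> locally_groupoidal Z'
    \<and> locally_fully_faithful Z Z' \<Psi>
    \<and> (H1_trivial X (G1 G) \<longrightarrow> biequivalence Z Z' \<Psi>)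
    \<and> (point_site X \<longrightarrow> biequivalence Z Z' \<Psi>)"
proof -
  interpret gamma_xmod X \<Gamma> G
    using X \<Gamma> G by (intro gamma_xmod.intro gamma_xmod_axioms.intro)
  show ?thesis
    unfolding Z Z' \<Psi>
  proof (intro conjI ballI impI)
    show "Ob (W_cat X \<Gamma> G) = Ob (Z_cat X \<Gamma> G)" by simp
    show "fob (Psi X \<Gamma> G) A = A" for A by simp
  qed (rule Psi_bifunctor Z_locally_groupoidal W_locally_groupoidal Psi_fully_faithful
      Psi_biequivalence point_H1_trivial; assumption?)+
qed

end
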